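(* Let $\alpha>-1$, and let $x=4(n+c_L)+2\alpha+2(2n)^{1/3}X$ and $y=4(n+c_L)+2\alpha+2(2n)^{1/3}Y$ with $X$, $Y$ and $c_L$ bounded. Then, as $n\to\infty$, $$K_n^{\alpha}(x,y)\,dx=\Big\{K_{\mathrm{Ai}}(X,Y)-2^{\frac23}c_L\,\mathrm{Ai}(X)\mathrm{Ai}(Y)\,n^{-\frac13}+\frac{2^{1/3}}{10}\Big[(X^2+XY+Y^2)\mathrm{Ai}(X)\mathrm{Ai}(Y)-(X+Y)\mathrm{Ai}'(X)\mathrm{Ai}'(Y)$$ $$-(10c_L^2-1)\big(\mathrm{Ai}(X)\mathrm{Ai}'(Y)+\mathrm{Ai}'(X)\mathrm{Ai}(Y)\big)\Big]n^{-\frac23}+O(n^{-1})\,F(X,Y)\Big\}\,dX .$$ The error term $F(X,Y)$ is the kernel of an integral operator on $L^2(J)$ which is trace class for any Borel subset $J$ of the reals which is bounded away from minus infinity.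
   Context: Let $L_n^{\alpha}$ be the Laguerre polynomials (orthogonal with respect to $x^\alpha e^{-x}$ on $(0,\infty)$, standard normalization $L_n^\alpha(0)=\binom{n+\alpha}{n}$) and $\phi_n^{\alpha}(x)=x^{\alpha/2}e^{-x/2}L_n^{\alpha}(x)$. The Laguerre kernel is $$K_n^{\alpha}(x,y)=\sum_{k=0}^{n-1}\frac{\Gamma(k+1)}{\Gamma(\alpha+k+1)}\,\phi_k^{\alpha}(x)\phi_k^{\alpha}(y).$$ $\mathrm{Ai}$ is the Airy function, and the Airy kernel is $$K_{\mathrm{Ai}}(x,y)=\frac{\mathrm{Ai}(x)\mathrm{Ai}'(y)-\mathrm{Ai}(y)\mathrm{Ai}'(x)}{x-y}=\int_0^\infty \mathrm{Ai}(x+z)\mathrm{Ai}(y+z)\,dz.$$ The differentials are related by $dx=2(2n)^{1/3}\,dX$, so the left-hand side means $2(2n)^{1/3}K_n^{\alpha}(x,y)\,dX$. *)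

theory Defs
  imports "HOL-Analysis.Analysis"
begin

section \<open>Laguerre polynomials and the Laguerre kernel\<close>

definition laguerre :: "nat \<Rightarrow> real \<Rightarrow> real \<Rightarrow> real" where
  "laguerre n \<alpha> x =
     (\<Sum>k\<le>n. (- 1) ^ k * ((real n + \<alpha>) gchoose (n - k)) * x ^ k / fact k)"

definition laguerre_fun :: "nat \<Rightarrow> real \<Rightarrow> real \<Rightarrow> real" where
  "laguerre_fun n \<alpha> x = x powr (\<alpha> / 2) * exp (- x / 2) * laguerre n \<alpha> x"

definition laguerre_kernel :: "real \<Rightarrow> nat \<Rightarrow> real \<Rightarrow> real \<Rightarrow> real" where
  "laguerre_kernel \<alpha> n x y =
     (\<Sum>k<n. Gamma (real k + 1) / Gamma (\<alpha> + real k + 1) *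
        laguerre_fun k \<alpha> x * laguerre_fun k \<alpha> y)"

text \<open>
  The explicit sum defining \<^const>\<open>laguerre\<close> has degree \<open>n\<close>. The next two lemmas show that it is
  orthogonal to all polynomials of smaller degree for the weight \<open>x powr \<alpha> * exp (- x)\<close> and has
  the standard normalization at \<open>0\<close>; these properties characterize the Laguerre polynomials.
\<close>

lemma laguerre_at_0: "laguerre n \<alpha> 0 = (real n + \<alpha>) gchoose n"
proof -
  have "laguerre n \<alpha> 0 = (\<Sum>k\<le>n. if k = 0 then (real n + \<alpha>) gchoose n else 0)"
    unfolding laguerre_def by (intro sum.cong) auto
  then show ?thesis by simp
qed

lemma alternating_binomial_sum_pochhammer:
  fixes b :: real
  assumes "m < n"
  shows "(\<Sum>k\<le>n. (- 1) ^ k * real (n choose k) * pochhammer (b + real k) m) = 0"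
  using assms
proof (induction m arbitrary: n b)
  case 0
  then show ?case using choose_alternating_sum[of n, where ?'a = real] by simp
next
  case (Suc m)
  then obtain N where n: "n = Suc N" and "m < N" by (cases n) auto
  define p where "p k = pochhammer (b + real k) (Suc m)" for k
  have diff: "p (Suc k) - p k = real (Suc m) * pochhammer ((b + 1) + real k) m" for k
  proof -
    have "p (Suc k) = pochhammer ((b + 1) + real k) m * (b + 1 + real k + real m)"
      unfolding p_def by (subst pochhammer_Suc) (simp add: algebra_simps)
    moreover have "p k = (b + real k) * pochhammer ((b + 1) + real k) m"
      unfolding p_def by (subst pochhammer_rec) (simp add: algebra_simps)
    ultimately show ?thesis by (simp add: algebra_simps)
  qed
  have "(\<Sum>k\<le>Suc N. (- 1) ^ k * real (Suc N choose k) * p k)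
      = p 0 + (\<Sum>k\<le>N. (- 1) ^ Suc k * real (Suc N choose Suc k) * p (Suc k))"
    by (subst sum.atMost_Suc_shift) simp
  also have "\<dots> = p 0 + (\<Sum>k\<le>N. (- 1) ^ Suc k * real (N choose Suc k) * p (Suc k))
      - (\<Sum>k\<le>N. (- 1) ^ k * real (N choose k) * p (Suc k))"
    by (simp add: algebra_simps sum.distrib sum_negf sum_subtractf)
  also have "p 0 + (\<Sum>k\<le>N. (- 1) ^ Suc k * real (N choose Suc k) * p (Suc k))
      = (\<Sum>k\<le>Suc N. (- 1) ^ k * real (N choose k) * p k)"
    unfolding sum.atMost_Suc_shift[of "\<lambda>k. (- 1) ^ k * real (N choose k) * p k"] by simp
  also have "\<dots> = (\<Sum>k\<le>N. (- 1) ^ k * real (N choose k) * p k)"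
    by simp
  also have "\<dots> - (\<Sum>k\<le>N. (- 1) ^ k * real (N choose k) * p (Suc k))
      = - (\<Sum>k\<le>N. (- 1) ^ k * real (N choose k) * (p (Suc k) - p k))"
    by (simp add: sum_subtractf right_diff_distrib)
  also have "\<dots> = - real (Suc m) *
      (\<Sum>k\<le>N. (- 1) ^ k * real (N choose k) * pochhammer ((b + 1) + real k) m)"
    unfolding diff sum_distrib_left sum_negf[symmetric]
    by (intro sum.cong refl) (simp add: algebra_simps)
  also have "\<dots> = 0" using Suc.IH[OF \<open>m < N\<close>] by simp
  finally show ?case unfolding n p_def .
qed

lemma laguerre_orthogonal:
  assumes "\<alpha> > -1" "m < n"
  shows "((\<lambda>x. x powr \<alpha> * exp (- x) * x ^ m * laguerre n \<alpha> x) has_integral 0) {0<..}"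
proof -
  have pos: "\<alpha> + real j + 1 > 0" for j using assms(1) by linarith
  have moment: "((\<lambda>x. x powr \<alpha> * exp (- x) * x ^ j) has_integral Gamma (\<alpha> + real j + 1)) {0<..}"
    for j
  proof -
    have "((\<lambda>t. t powr (\<alpha> + real j + 1 - 1) / exp t) has_integral Gamma (\<alpha> + real j + 1)) {0..}"
      by (rule Gamma_integral_real[OF pos])
    then have "((\<lambda>t. t powr (\<alpha> + real j) / exp t) has_integral Gamma (\<alpha> + real j + 1)) {0<..}"
      by (subst has_integral_spike_set_eq[of _ "{0..}"])
         (auto intro: negligible_subset[of "{0}"])
    then show ?thesis
      by (rule has_integral_eq[rotated])
         (auto simp: powr_add powr_realpow exp_minus field_simps)
  qed
  define c where "c k = (- 1) ^ k * ((real n + \<alpha>) gchoose (n - k)) / fact k" for k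
  have "((\<lambda>x. \<Sum>k\<le>n. c k * (x powr \<alpha> * exp (- x) * x ^ (m + k)))
      has_integral (\<Sum>k\<le>n. c k * Gamma (\<alpha> + real (m + k) + 1))) {0<..}"
    by (intro has_integral_sum has_integral_mult_right moment) auto
  also have "(\<lambda>x. \<Sum>k\<le>n. c k * (x powr \<alpha> * exp (- x) * x ^ (m + k)))
      = (\<lambda>x. x powr \<alpha> * exp (- x) * x ^ m * laguerre n \<alpha> x)"
    unfolding laguerre_def c_def sum_distrib_left
    by (intro ext sum.cong) (auto simp: power_add)
  also have "(\<Sum>k\<le>n. c k * Gamma (\<alpha> + real (m + k) + 1))
      = (\<Sum>k\<le>n. Gamma (\<alpha> + real n + 1) / fact n *
          ((- 1) ^ k * real (n choose k) * pochhammer (\<alpha> + 1 + real k) m))"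
  proof (intro sum.cong refl)
    fix k assume "k \<in> {..n}"
    then have k: "k \<le> n" by simp
    have nz: "\<alpha> + real k + 1 \<notin> \<int>\<^sub>\<le>\<^sub>0"
      using pos[of k] by (auto elim!: nonpos_Ints_cases)
    have "(real n + \<alpha>) gchoose (n - k) = pochhammer (\<alpha> + real k + 1) (n - k) / fact (n - k)"
      using k by (simp add: gbinomial_pochhammer' of_nat_diff algebra_simps)
    also have "pochhammer (\<alpha> + real k + 1) (n - k) = Gamma (\<alpha> + real n + 1) / Gamma (\<alpha> + real k + 1)"
      using pochhammer_Gamma[OF nz, of "n - k"] k by (simp add: of_nat_diff algebra_simps)
    finally have g: "(real n + \<alpha>) gchoose (n - k)
        = Gamma (\<alpha> + real n + 1) / Gamma (\<alpha> + real k + 1) / fact (n - k)" .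
    have q: "pochhammer (\<alpha> + 1 + real k) m = Gamma (\<alpha> + real (m + k) + 1) / Gamma (\<alpha> + real k + 1)"
      using pochhammer_Gamma[OF nz, of m] by (simp add: algebra_simps)
    have "real (n choose k) = fact n / (fact k * fact (n - k))"
      using binomial_fact[OF k, where ?'a = real] by simp
    then show "c k * Gamma (\<alpha> + real (m + k) + 1) = Gamma (\<alpha> + real n + 1) / fact n *
          ((- 1) ^ k * real (n choose k) * pochhammer (\<alpha> + 1 + real k) m)"
      unfolding c_def g q by (simp add: mult_ac)
  qed
  also have "\<dots> = 0"
    unfolding sum_distrib_left[symmetric]
    using alternating_binomial_sum_pochhammer[OF assms(2), of "\<alpha> + 1"] by simp
  finally show ?thesis .
qed

section \<open>The Airy function and the Airy kernel\<close>

text \<open>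
  The integral over \<open>[0, \<infinity>)\<close> converges only conditionally; the Henstock--Kurzweil integral used here
  is the limit of the integrals over \<open>[0, T]\<close> as \<open>T\<close> tends to infinity.
\<close>

definition airy :: "real \<Rightarrow> real" where
  "airy x = integral {0..} (\<lambda>t. cos (t ^ 3 / 3 + x * t)) / pi"

definition airy_deriv :: "real \<Rightarrow> real" where
  "airy_deriv x = deriv airy x"

text \<open>
  The integral form of the Airy kernel: unlike the difference quotient, it needs no separate
  convention on the diagonal.
\<close>

definition airy_kernel :: "real \<Rightarrow> real \<Rightarrow> real" where
  "airy_kernel x y = integral {0..} (\<lambda>z. airy (x + z) * airy (y + z))"

section \<open>Edge scaling\<close>

definition laguerre_edge :: "real \<Rightarrow> real \<Rightarrow> nat \<Rightarrow> real \<Rightarrow> real" where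
  "laguerre_edge \<alpha> c n X =
     4 * (real n + c) + 2 * \<alpha> + 2 * (2 * real n) powr (1 / 3) * X"

section \<open>Trace class integral operators on \<open>L\<^sup>2\<close>\<close>

text \<open>
  Elements of \<open>L\<^sup>2(M)\<close> are represented by complex functions, to be identified when they agree
  almost everywhere.
\<close>

definition L2 :: "'a measure \<Rightarrow> ('a \<Rightarrow> complex) set" where
  "L2 M = {f \<in> borel_measurable M. integrable M (\<lambda>x. (cmod (f x))\<^sup>2)}"

definition L2_inner :: "'a measure \<Rightarrow> ('a \<Rightarrow> complex) \<Rightarrow> ('a \<Rightarrow> complex) \<Rightarrow> complex" where
  "L2_inner M f g = (\<integral>x. f x * cnj (g x) \<partial>M)"

definition L2_orthonormal :: "'a measure \<Rightarrow> 'i set \<Rightarrow> ('i \<Rightarrow> 'a \<Rightarrow> complex) \<Rightarrow> bool" where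
  "L2_orthonormal M I u \<longleftrightarrow>
     (\<forall>i\<in>I. u i \<in> L2 M) \<and>
     (\<forall>i\<in>I. \<forall>j\<in>I. L2_inner M (u i) (u j) = (if i = j then 1 else 0))"

definition kernel_operator ::
    "'a measure \<Rightarrow> ('a \<Rightarrow> 'a \<Rightarrow> complex) \<Rightarrow> ('a \<Rightarrow> complex) \<Rightarrow> 'a \<Rightarrow> complex" where
  "kernel_operator M K f x = (\<integral>y. K x y * f y \<partial>M)"

definition L2_kernel :: "'a measure \<Rightarrow> ('a \<Rightarrow> 'a \<Rightarrow> complex) \<Rightarrow> bool" where
  "L2_kernel M K \<longleftrightarrow>
     case_prod K \<in> borel_measurable (M \<Otimes>\<^sub>M M) \<and>
     (\<forall>f\<in>L2 M. (AE x in M. integrable M (\<lambda>y. K x y * f y)) \<and> kernel_operator M K f \<in> L2 M)"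

text \<open>
  An operator \<open>T\<close> is trace class if its singular values \<open>\<sigma>\<^sub>k\<close> are summable, where the singular values
  are the coefficients of a canonical (Schmidt) expansion \<open>T f = (\<Sum>k. \<sigma>\<^sub>k \<langle>f, u\<^sub>k\<rangle> v\<^sub>k)\<close>, convergent in
  \<open>L\<^sup>2\<close>, with orthonormal systems \<open>u\<close> and \<open>v\<close>. The index set \<open>I\<close> allows for operators of finite rank.
\<close>

definition trace_class_kernel :: "'a measure \<Rightarrow> ('a \<Rightarrow> 'a \<Rightarrow> complex) \<Rightarrow> bool" where
  "trace_class_kernel M K \<longleftrightarrow>
     L2_kernel M K \<and>
     (\<exists>(I :: nat set) \<sigma> u v.
        (\<forall>k\<in>I. 0 < \<sigma> k) \<and> \<sigma> summable_on I \<and>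
        L2_orthonormal M I u \<and> L2_orthonormal M I v \<and>
        (\<forall>f\<in>L2 M.
           (\<lambda>N. \<integral>x. (cmod (kernel_operator M K f x -
               (\<Sum>k\<in>I \<inter> {..<N}. complex_of_real (\<sigma> k) * L2_inner M f (u k) * v k x)))\<^sup>2 \<partial>M)
             \<longlonglongrightarrow> 0))"

end

theory Submission
  imports Defs "HOL-Complex_Analysis.Complex_Analysis" "HOL-Real_Asymp.Real_Asymp" "HOL-Probability.Probability"
    "HOL-Library.Diagonal_Subsequence"
begin

section \<open>Hilbert space preliminaries over the reals\<close>

section \<open>Real square integrable functions\<close>

text \<open>The remainder \<open>F\<close> is defined as n times the difference between the scaled
  Laguerre kernel and the truncated expansion. The displayed identity then only compares constants,
  and two facts remain: \<open>F\<close> stays bounded for bounded parameters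
  (\<open>edge_expansion_bound\<close>), and it is a trace class kernel on every Borel set bounded
  below (\<open>edge_kernels_combination\<close>).

  For the bound put b = (2n)^(1/3) and \<nu> = n + (\<alpha>+1)/2. By Christoffel-Darboux the kernel
  is a Wronskian-like expression in u(x) = x^((\<alpha>+1)/2) e^(-x/2) L_n(x), divided by x - y,
  plus lower order terms (\<open>laguerre_kernel_off_diagonal\<close>). The function u satisfies u''
  = (1/4 - \<nu>/x + (\<alpha>^2-1)/(4x^2)) u. With x = 4\<nu> + 2b\<xi> this turns into w'' =
  (\<xi> - \<xi>^2/b^2 + O(b^(-3))) w, a perturbed Airy equation with approximate solution Ai +
  \<open>airy_corr\<close> / b^2. A Gronwall estimate makes this rigorous
  (\<open>wave_expansion\<close>), provided that w(0) and w'(0) are known up to O(1/n).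

  These initial data belong to the single point x = 4\<nu>. There a contour integral for L_n has the
  phase \<nu> (2 tanh(w/2) - w), whose saddle at w = 0 is cubic. The expansion along the ray of
  argument 2\<pi>/3 (\<open>laplace_expansion\<close>) produces Ai(0) and Ai'(0), and a quotient of
  Gamma functions controls the prefactor (\<open>wave_initial\<close>).

  All errors are bounded together with their Lipschitz constants, so that the division by \<xi> -
  \<eta> costs nothing; the diagonal follows by continuity (\<open>kernel_expansion\<close>). This
  is the expansion for the centring c = 1/2. Any other c translates both variables by (2c-1)/b, and
  Taylor's formula along the diagonal direction, based on d/dt K(X+t,Y+t) = -Ai(X+t) Ai(Y+t) for the
  Airy kernel K, gives the stated coefficients (\<open>kernel_approx_shift\<close>).

  For the trace class property, the Laguerre kernel and the correction terms are finite sums of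
  products f(X) g(Y), and the Airy kernel is a superposition of the rank one kernels Ai(X+z) Ai(Y+z)
  over z > 0. For all of these the sums of |<K e_i, e_i>| over orthonormal families are bounded
  (\<open>nuclear\<close>). A symmetric kernel with this property is diagonalised by removing one
  extremal eigenfunction after another; the bound makes the eigenvalues summable, which yields the
  Schmidt expansion (\<open>nuclear_trace_class\<close>).\<close>

definition rL2 :: "'a measure \<Rightarrow> ('a \<Rightarrow> real) set" where
  "rL2 M = {f \<in> borel_measurable M. integrable M (\<lambda>x. (f x)\<^sup>2)}"

text \<open>The kernels in question are real and symmetric, so their spectral theory is done over
  the reals. Complex functions enter only in \<open>nuclear_trace_class\<close>, through real and
  imaginary parts.\<close>

definition ip :: "'a measure \<Rightarrow> ('a \<Rightarrow> real) \<Rightarrow> ('a \<Rightarrow> real) \<Rightarrow> real" where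
  "ip M f g = (\<integral>x. f x * g x \<partial>M)"

lemma rL2_measurable: "f \<in> rL2 M \<Longrightarrow> f \<in> borel_measurable M"
  by (simp add: rL2_def)

lemma rL2_square_integrable: "f \<in> rL2 M \<Longrightarrow> integrable M (\<lambda>x. (f x)\<^sup>2)"
  by (simp add: rL2_def)

lemma rL2_integrable_mult:
  assumes "f \<in> rL2 M" "g \<in> rL2 M"
  shows "integrable M (\<lambda>x. f x * g x)"
proof (rule Bochner_Integration.integrable_bound)
  show "integrable M (\<lambda>x. (f x)\<^sup>2 + (g x)\<^sup>2)"
    using assms by (intro Bochner_Integration.integrable_add rL2_square_integrable)
  show "(\<lambda>x. f x * g x) \<in> borel_measurable M"
    using assms[THEN rL2_measurable] by measurable
  have "\<bar>a * b\<bar> \<le> a\<^sup>2 + b\<^sup>2" for a b :: real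
  proof -
    have "2 * (\<bar>a\<bar> * \<bar>b\<bar>) \<le> \<bar>a\<bar>\<^sup>2 + \<bar>b\<bar>\<^sup>2"
      using sum_squares_bound[of "\<bar>a\<bar>" "\<bar>b\<bar>"] by (simp add: mult_ac)
    moreover have "0 \<le> \<bar>a\<bar> * \<bar>b\<bar>" by simp
    ultimately show ?thesis unfolding abs_mult power2_abs by linarith
  qed
  then show "AE x in M. norm (f x * g x) \<le> norm ((f x)\<^sup>2 + (g x)\<^sup>2)"
    by (simp add: abs_le_iff)
qed

lemma rL2_scale: "f \<in> rL2 M \<Longrightarrow> (\<lambda>x. c * f x) \<in> rL2 M"
  unfolding rL2_def by (auto simp: power_mult_distrib)

lemma rL2_add:
  assumes "f \<in> rL2 M" "g \<in> rL2 M"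
  shows "(\<lambda>x. f x + g x) \<in> rL2 M"
proof -
  have "integrable M (\<lambda>x. (f x)\<^sup>2 + (g x)\<^sup>2 + 2 * (f x * g x))"
    using assms by (intro Bochner_Integration.integrable_add rL2_square_integrable
        integrable_mult_right rL2_integrable_mult)
  then have "integrable M (\<lambda>x. (f x + g x)\<^sup>2)"
    by (simp add: power2_sum algebra_simps)
  then show ?thesis using assms by (auto simp: rL2_def)
qed

lemma rL2_diff: "f \<in> rL2 M \<Longrightarrow> g \<in> rL2 M \<Longrightarrow> (\<lambda>x. f x - g x) \<in> rL2 M"
  using rL2_add[of f M "\<lambda>x. - 1 * g x"] rL2_scale[of g M "-1"] by simp

lemma rL2_zero: "(\<lambda>x. 0) \<in> rL2 M"
  by (simp add: rL2_def)

lemma rL2_sum: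
  assumes "\<And>i. i \<in> I \<Longrightarrow> f i \<in> rL2 M"
  shows "(\<lambda>x. \<Sum>i\<in>I. f i x) \<in> rL2 M"
  using assms by (induction I rule: infinite_finite_induct) (auto intro: rL2_zero rL2_add)

lemma rL2_bound:
  assumes "w \<in> rL2 M" "f \<in> borel_measurable M" "\<And>x. x \<in> space M \<Longrightarrow> \<bar>f x\<bar> \<le> c * w x"
  shows "f \<in> rL2 M"
proof -
  have "integrable M (\<lambda>x. (f x)\<^sup>2)"
  proof (rule Bochner_Integration.integrable_bound)
    show "integrable M (\<lambda>x. (c * w x)\<^sup>2)"
      using rL2_scale[OF assms(1)] by (rule rL2_square_integrable)
    show "(\<lambda>x. (f x)\<^sup>2) \<in> borel_measurable M" using assms(2) by measurable
    show "AE x in M. norm ((f x)\<^sup>2) \<le> norm ((c * w x)\<^sup>2)"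
    proof (rule AE_I2)
      fix x assume "x \<in> space M"
      then have "\<bar>f x\<bar> \<le> \<bar>c * w x\<bar>" using assms(3) by force
      then have "(f x)\<^sup>2 \<le> (c * w x)\<^sup>2" by (simp add: abs_le_square_iff)
      then show "norm ((f x)\<^sup>2) \<le> norm ((c * w x)\<^sup>2)" by simp
    qed
  qed
  then show ?thesis using assms(2) by (simp add: rL2_def)
qed

lemma ip_commute: "ip M f g = ip M g f"
  by (simp add: ip_def mult.commute)

lemma ip_scale_left: "ip M (\<lambda>x. c * f x) g = c * ip M f g"
  by (simp add: ip_def mult.assoc)

lemma ip_scale_right: "ip M f (\<lambda>x. c * g x) = c * ip M f g"
  using ip_scale_left[of M c g f] by (simp add: ip_commute)

lemma ip_add_left:
  "f \<in> rL2 M \<Longrightarrow> g \<in> rL2 M \<Longrightarrow> h \<in> rL2 M \<Longrightarrow> ip M (\<lambda>x. f x + g x) h = ip M f h + ip M g h"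
  by (simp add: ip_def distrib_right rL2_integrable_mult)

lemma ip_add_right:
  "f \<in> rL2 M \<Longrightarrow> g \<in> rL2 M \<Longrightarrow> h \<in> rL2 M \<Longrightarrow> ip M h (\<lambda>x. f x + g x) = ip M h f + ip M h g"
  by (simp add: ip_def distrib_left rL2_integrable_mult)

lemma ip_diff_left:
  "f \<in> rL2 M \<Longrightarrow> g \<in> rL2 M \<Longrightarrow> h \<in> rL2 M \<Longrightarrow> ip M (\<lambda>x. f x - g x) h = ip M f h - ip M g h"
  by (simp add: ip_def left_diff_distrib rL2_integrable_mult)

lemma ip_diff_right:
  "f \<in> rL2 M \<Longrightarrow> g \<in> rL2 M \<Longrightarrow> h \<in> rL2 M \<Longrightarrow> ip M h (\<lambda>x. f x - g x) = ip M h f - ip M h g"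
  by (simp add: ip_def right_diff_distrib rL2_integrable_mult)

lemma ip_sum_left:
  assumes "\<And>i. i \<in> I \<Longrightarrow> f i \<in> rL2 M" "h \<in> rL2 M"
  shows "ip M (\<lambda>x. \<Sum>i\<in>I. f i x) h = (\<Sum>i\<in>I. ip M (f i) h)"
  using assms unfolding ip_def sum_distrib_right
  by (intro Bochner_Integration.integral_sum) (auto intro: rL2_integrable_mult)

lemma ip_nonneg: "0 \<le> ip M f f"
  unfolding ip_def by (intro Bochner_Integration.integral_nonneg) auto

lemma ip_diff_diff:
  assumes "f \<in> rL2 M" "g \<in> rL2 M"
  shows "ip M (\<lambda>x. f x - g x) (\<lambda>x. f x - g x) = ip M f f - 2 * ip M f g + ip M g g"
  using assms by (simp add: ip_diff_left ip_diff_right rL2_diff ip_commute[of M g f])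

lemma ip_cong: "(\<And>x. x \<in> space M \<Longrightarrow> f x = f' x) \<Longrightarrow> (\<And>x. x \<in> space M \<Longrightarrow> g x = g' x) \<Longrightarrow>
    ip M f g = ip M f' g'"
  unfolding ip_def by (intro Bochner_Integration.integral_cong) auto

lemma ip_Cauchy_Schwarz_square:
  assumes "f \<in> rL2 M" "g \<in> rL2 M"
  shows "(ip M f g)\<^sup>2 \<le> ip M f f * ip M g g"
proof -
  have q: "0 \<le> ip M f f - 2 * (t * ip M f g) + t\<^sup>2 * ip M g g" for t
    using ip_nonneg[of M "\<lambda>x. f x - t * g x"] ip_diff_diff[OF assms(1) rL2_scale[OF assms(2)], of t]
    by (simp add: ip_scale_left ip_scale_right power2_eq_square mult_ac)
  show ?thesis
  proof (cases "ip M g g = 0")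
    case True
    have "ip M f g = 0"
    proof (rule ccontr)
      assume "ip M f g \<noteq> 0"
      \<comment> \<open>The quadratic form in t has degenerated to an affine function; at this t its
        value is -1.\<close>
      then show False
        using q[of "(ip M f f + 1) / (2 * ip M f g)"] True ip_nonneg[of M f] by simp
    qed
    then show ?thesis using True by simp
  next
    case False
    then have "ip M g g > 0" using ip_nonneg[of M g] by simp
    moreover have "0 \<le> ip M f f - (ip M f g)\<^sup>2 / ip M g g"
      using q[of "ip M f g / ip M g g"] False by (simp add: power2_eq_square field_simps)
    ultimately show ?thesis by (simp add: field_simps)
  qed
qed

lemma ip_Cauchy_Schwarz:
  assumes "f \<in> rL2 M" "g \<in> rL2 M"
  shows "\<bar>ip M f g\<bar> \<le> sqrt (ip M f f) * sqrt (ip M g g)"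
  using real_sqrt_le_mono[OF ip_Cauchy_Schwarz_square[OF assms]] by (simp add: real_sqrt_mult)

definition orthonormal_family :: "'a measure \<Rightarrow> nat set \<Rightarrow> (nat \<Rightarrow> 'a \<Rightarrow> real) \<Rightarrow> bool" where
  "orthonormal_family M I e \<longleftrightarrow> (\<forall>i\<in>I. e i \<in> rL2 M) \<and>
     (\<forall>i\<in>I. \<forall>j\<in>I. ip M (e i) (e j) = (if i = j then 1 else 0))"

text \<open>With \<open>g\<close> the projection of \<open>f\<close> onto the span of the family,
  the squared distance from \<open>f\<close> to \<open>g\<close> is \<open>ip M f f\<close> minus
  the sum.\<close>

lemma Bessel_inequality:
  assumes I: "finite I" and e: "orthonormal_family M I e" and f: "f \<in> rL2 M"
  shows "(\<Sum>i\<in>I. (ip M f (e i))\<^sup>2) \<le> ip M f f"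
proof -
  define c where "c i = ip M f (e i)" for i
  define g where "g = (\<lambda>x. \<Sum>i\<in>I. c i * e i x)"
  have eL: "\<And>i. i \<in> I \<Longrightarrow> e i \<in> rL2 M" using e by (simp add: orthonormal_family_def)
  have gL: "g \<in> rL2 M" unfolding g_def by (intro rL2_sum rL2_scale eL)
  have ge: "ip M g h = (\<Sum>i\<in>I. c i * ip M (e i) h)" if "h \<in> rL2 M" for h
    unfolding g_def using that eL by (subst ip_sum_left) (auto intro: rL2_scale simp: ip_scale_left)
  have gei: "ip M g (e j) = c j" if "j \<in> I" for j
  proof -
    have "ip M g (e j) = (\<Sum>i\<in>I. if i = j then c i else 0)"
      unfolding ge[OF eL[OF that]] using e that
      by (intro sum.cong) (auto simp: orthonormal_family_def)
    then show ?thesis using I that by simp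
  qed
  have "ip M g f = (\<Sum>i\<in>I. (c i)\<^sup>2)"
    unfolding ge[OF f] by (simp add: c_def power2_eq_square ip_commute)
  moreover have "ip M g g = (\<Sum>i\<in>I. (c i)\<^sup>2)"
    unfolding ge[OF gL] by (intro sum.cong) (auto simp: power2_eq_square ip_commute[of M _ g] gei)
  ultimately have "0 \<le> ip M f f - (\<Sum>i\<in>I. (c i)\<^sup>2)"
    using ip_nonneg[of M "\<lambda>x. f x - g x"] ip_diff_diff[OF f gL] by (simp add: ip_commute[of M f g])
  then show ?thesis by (simp add: c_def)
qed

section \<open>Compactness of dominated kernels and existence of an extremal eigenfunction\<close>

section \<open>Integral operators with dominated kernels\<close>

definition kop :: "'a measure \<Rightarrow> ('a \<Rightarrow> 'a \<Rightarrow> real) \<Rightarrow> ('a \<Rightarrow> real) \<Rightarrow> 'a \<Rightarrow> real" where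
  "kop M K f x = (\<integral>y. K x y * f y \<partial>M)"

text \<open>The weight \<open>w\<close> will dominate every kernel, through c w(x) w(y). The
  sequences \<open>q x\<close> in the countable set \<open>D\<close> stand in for a topology:
  continuity of a kernel will only mean convergence along \<open>q x\<close>, and countability of
  \<open>D\<close> is what a diagonal argument asks for.\<close>

locale dominated_kernels = sigma_finite_measure M for M :: "'a measure" +
  fixes w :: "'a \<Rightarrow> real" and q :: "'a \<Rightarrow> nat \<Rightarrow> 'a" and D :: "'a set" and W :: real
  assumes w_L2: "w \<in> rL2 M" and w_nonneg: "\<And>x. 0 \<le> w x" and w_le: "\<And>x. x \<in> space M \<Longrightarrow> w x \<le> W"
    and D: "countable D" "D \<subseteq> space M" and qD: "\<And>x j. x \<in> space M \<Longrightarrow> q x j \<in> D"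
begin

text \<open>Domination gives pointwise bounds for the images of the operator, and convergence along
  \<open>q\<close> makes these images determined by their values on \<open>D\<close>. Together they
  replace the usual theory of compact operators.\<close>

definition good :: "('a \<Rightarrow> 'a \<Rightarrow> real) \<Rightarrow> bool" where
  "good K \<longleftrightarrow> case_prod K \<in> borel_measurable (M \<Otimes>\<^sub>M M) \<and>
     (\<exists>c\<ge>0. \<forall>x\<in>space M. \<forall>y\<in>space M. \<bar>K x y\<bar> \<le> c * w x * w y) \<and>
     (\<forall>x\<in>space M. \<forall>y\<in>space M. (\<lambda>j. K (q x j) y) \<longlonglongrightarrow> K x y)"

definition symmetric :: "('a \<Rightarrow> 'a \<Rightarrow> real) \<Rightarrow> bool" where
  "symmetric K \<longleftrightarrow> (\<forall>x\<in>space M. \<forall>y\<in>space M. K x y = K y x)"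

lemma w_meas [measurable]: "w \<in> borel_measurable M"
  using w_L2 by (rule rL2_measurable)

lemma q_space: "x \<in> space M \<Longrightarrow> q x j \<in> space M"
  using qD D by blast

lemma good_section_measurable:
  assumes "good K" "x \<in> space M"
  shows "K x \<in> borel_measurable M"
proof -
  have "(\<lambda>y. case_prod K (x, y)) \<in> borel_measurable M"
    using assms by (intro measurable_compose[OF measurable_Pair1']) (auto simp: good_def)
  then show ?thesis by simp
qed

lemma good_section_L2:
  assumes "good K" "x \<in> space M"
  shows "K x \<in> rL2 M"
proof -
  obtain c where "\<And>y. y \<in> space M \<Longrightarrow> \<bar>K x y\<bar> \<le> c * w x * w y"
    using assms unfolding good_def by blast
  then show ?thesis
    by (intro rL2_bound[OF w_L2 good_section_measurable[OF assms], of "c * w x"])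
qed

lemma kop_eq_ip: "kop M K f x = ip M (K x) f"
  by (simp add: kop_def ip_def)

lemma kop_scale: "kop M K (\<lambda>x. c * f x) x = c * kop M K f x"
  by (simp add: kop_eq_ip ip_scale_right)

lemma kop_add: "good K \<Longrightarrow> f \<in> rL2 M \<Longrightarrow> g \<in> rL2 M \<Longrightarrow> x \<in> space M \<Longrightarrow>
   kop M K (\<lambda>x. f x + g x) x = kop M K f x + kop M K g x"
  by (simp add: kop_eq_ip ip_add_right good_section_L2)

lemma kop_diff: "good K \<Longrightarrow> f \<in> rL2 M \<Longrightarrow> g \<in> rL2 M \<Longrightarrow> x \<in> space M \<Longrightarrow>
   kop M K (\<lambda>x. f x - g x) x = kop M K f x - kop M K g x"
  by (simp add: kop_eq_ip ip_diff_right good_section_L2)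

text \<open>Cauchy-Schwarz on the section \<open>K x\<close>. The estimate is pointwise with
  majorant \<open>w\<close>, which is what later applications of dominated convergence use.\<close>

lemma kop_bound:
  assumes "good K"
  obtains c where "c \<ge> 0"
    "\<And>x f. x \<in> space M \<Longrightarrow> f \<in> rL2 M \<Longrightarrow> \<bar>kop M K f x\<bar> \<le> c * w x * sqrt (ip M f f)"
proof -
  obtain c where c: "c \<ge> 0" "\<And>x y. x \<in> space M \<Longrightarrow> y \<in> space M \<Longrightarrow> \<bar>K x y\<bar> \<le> c * w x * w y"
    using assms unfolding good_def by blast
  have "\<bar>kop M K f x\<bar> \<le> (c * sqrt (ip M w w)) * w x * sqrt (ip M f f)"
    if x: "x \<in> space M" and f: "f \<in> rL2 M" for x f
  proof -
    have "ip M (K x) (K x) \<le> ip M (\<lambda>y. (c * w x) * w y) (\<lambda>y. (c * w x) * w y)"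
      unfolding ip_def
    proof (rule integral_mono)
      show "integrable M (\<lambda>y. K x y * K x y)"
        using good_section_L2[OF assms x] by (intro rL2_integrable_mult)
      show "integrable M (\<lambda>y. c * w x * w y * (c * w x * w y))"
        using rL2_scale[OF w_L2, of "c * w x"] by (intro rL2_integrable_mult)
      fix y assume "y \<in> space M"
      then have "\<bar>K x y\<bar> \<le> \<bar>c * w x * w y\<bar>" using c(2)[OF x, of y] by simp
      then show "K x y * K x y \<le> c * w x * w y * (c * w x * w y)"
        by (simp add: abs_le_square_iff power2_eq_square)
    qed
    also have "\<dots> = (c * w x)\<^sup>2 * ip M w w"
      by (simp only: ip_scale_left ip_scale_right) (simp add: power2_eq_square)
    finally have "sqrt (ip M (K x) (K x)) \<le> sqrt ((c * w x)\<^sup>2 * ip M w w)"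
      by (rule real_sqrt_le_mono)
    also have "\<dots> = c * w x * sqrt (ip M w w)"
      using c(1) w_nonneg[of x] by (simp add: real_sqrt_mult)
    finally have "\<bar>kop M K f x\<bar> \<le> c * w x * sqrt (ip M w w) * sqrt (ip M f f)"
      unfolding kop_eq_ip using ip_Cauchy_Schwarz[OF good_section_L2[OF assms x] f]
      by (meson ip_nonneg mult_right_mono order_trans real_sqrt_ge_zero)
    then show ?thesis by (simp add: mult_ac)
  qed
  moreover have "c * sqrt (ip M w w) \<ge> 0" using c(1) by (simp add: ip_nonneg)
  ultimately show ?thesis using that by blast
qed

lemma kop_measurable:
  assumes "good K" "f \<in> rL2 M"
  shows "kop M K f \<in> borel_measurable M"
proof -
  have [measurable]: "case_prod K \<in> borel_measurable (M \<Otimes>\<^sub>M M)" "f \<in> borel_measurable M"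
    using assms by (auto simp: good_def rL2_def)
  have "(\<lambda>(x, y). K x y * f y) \<in> borel_measurable (M \<Otimes>\<^sub>M M)"
    by measurable
  then show ?thesis
    unfolding kop_def by (rule borel_measurable_lebesgue_integral)
qed

lemma kop_L2:
  assumes "good K" "f \<in> rL2 M"
  shows "kop M K f \<in> rL2 M"
proof -
  obtain c where "c \<ge> 0" and
    c: "\<And>x f. x \<in> space M \<Longrightarrow> f \<in> rL2 M \<Longrightarrow> \<bar>kop M K f x\<bar> \<le> c * w x * sqrt (ip M f f)"
    by (rule kop_bound[OF assms(1)]) (rule that)
  show ?thesis
    by (rule rL2_bound[OF w_L2 kop_measurable[OF assms], of "c * sqrt (ip M f f)"])
       (metis c[OF _ assms(2)] mult.assoc mult.commute)
qed

text \<open>Fubini, with the product of w |g| and w |f| as integrable majorant.\<close>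

lemma kop_symmetric:
  assumes K: "good K" "symmetric K" and f: "f \<in> rL2 M" and g: "g \<in> rL2 M"
  shows "ip M (kop M K f) g = ip M f (kop M K g)"
proof -
  interpret P: pair_sigma_finite M M ..
  obtain c where c: "\<And>x y. x \<in> space M \<Longrightarrow> y \<in> space M \<Longrightarrow> \<bar>K x y\<bar> \<le> c * w x * w y"
    using K unfolding good_def by blast
  have [measurable]: "case_prod K \<in> borel_measurable (M \<Otimes>\<^sub>M M)" "f \<in> borel_measurable M"
    "g \<in> borel_measurable M" using K f g by (auto simp: good_def rL2_def)
  define h where "h = (\<lambda>x y. K x y * f y * g x)"
  have hm: "case_prod h \<in> borel_measurable (M \<Otimes>\<^sub>M M)" unfolding h_def by measurable
  have wf: "integrable M (\<lambda>y. w y * \<bar>f y\<bar>)" "integrable M (\<lambda>y. w y * \<bar>g y\<bar>)"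
    using integrable_norm[OF rL2_integrable_mult[OF w_L2 f]]
      integrable_norm[OF rL2_integrable_mult[OF w_L2 g]]
    by (simp_all add: abs_mult w_nonneg)
  have hint: "integrable (M \<Otimes>\<^sub>M M) (case_prod h)"
  proof (rule Bochner_Integration.integrable_bound)
    show "integrable (M \<Otimes>\<^sub>M M) (\<lambda>(x, y). c * (w x * \<bar>g x\<bar>) * (w y * \<bar>f y\<bar>))"
    proof (rule P.Fubini_integrable)
      show "(\<lambda>(x, y). c * (w x * \<bar>g x\<bar>) * (w y * \<bar>f y\<bar>)) \<in> borel_measurable (M \<Otimes>\<^sub>M M)"
        by measurable
      have "(\<integral>y. norm (case (x, y) of (x, y) \<Rightarrow> c * (w x * \<bar>g x\<bar>) * (w y * \<bar>f y\<bar>)) \<partial>M)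
          = (w x * \<bar>g x\<bar>) * (\<bar>c\<bar> * (\<integral>y. w y * \<bar>f y\<bar> \<partial>M))" for x
        by (simp add: abs_mult w_nonneg mult.assoc)
      then show "integrable M (\<lambda>x. \<integral>y. norm (case (x, y) of (x, y) \<Rightarrow>
          c * (w x * \<bar>g x\<bar>) * (w y * \<bar>f y\<bar>)) \<partial>M)"
        using wf(2) by simp
      show "AE x in M. integrable M (\<lambda>y. case (x, y) of (x, y) \<Rightarrow> c * (w x * \<bar>g x\<bar>) * (w y * \<bar>f y\<bar>))"
        using wf(1) by (intro AE_I2) simp
    qed
    show "AE z in M \<Otimes>\<^sub>M M. norm (case_prod h z)
        \<le> norm (case z of (x, y) \<Rightarrow> c * (w x * \<bar>g x\<bar>) * (w y * \<bar>f y\<bar>))"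
    proof (rule AE_I2, clarsimp simp: space_pair_measure)
      fix x y assume xy: "x \<in> space M" "y \<in> space M"
      have "\<bar>K x y\<bar> * (\<bar>f y\<bar> * \<bar>g x\<bar>) \<le> \<bar>c * w x * w y\<bar> * (\<bar>f y\<bar> * \<bar>g x\<bar>)"
        using c[OF xy] by (intro mult_right_mono) auto
      then show "\<bar>h x y\<bar> \<le> \<bar>c * (w x * \<bar>g x\<bar>) * (w y * \<bar>f y\<bar>)\<bar>"
        by (simp add: h_def abs_mult mult_ac)
    qed
  qed (rule hm)
  have "ip M (kop M K f) g = (\<integral>x. \<integral>y. h x y \<partial>M \<partial>M)"
    unfolding ip_def kop_def h_def by simp
  also have "\<dots> = (\<integral>y. \<integral>x. h x y \<partial>M \<partial>M)"
    using P.integral_fst[OF hint] P.integral_snd[OF hint] by simp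
  also have "\<dots> = (\<integral>y. f y * kop M K g y \<partial>M)"
  proof (rule Bochner_Integration.integral_cong[OF refl])
    fix y assume y: "y \<in> space M"
    have "(\<integral>x. h x y \<partial>M) = (\<integral>x. f y * (K y x * g x) \<partial>M)"
      using K(2) y by (intro Bochner_Integration.integral_cong) (auto simp: h_def symmetric_def)
    then show "(\<integral>x. h x y \<partial>M) = f y * kop M K g y" by (simp add: kop_def)
  qed
  finally show ?thesis by (simp add: ip_def)
qed

text \<open>Dominated convergence. This plays the role of equicontinuity: it carries convergence on
  \<open>D\<close> to all points, uniformly over the unit ball.\<close>

lemma section_distance_tendsto_0:
  assumes K: "good K" and x: "x \<in> space M"
  shows "(\<lambda>j. ip M (\<lambda>y. K (q x j) y - K x y) (\<lambda>y. K (q x j) y - K x y)) \<longlonglongrightarrow> 0"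
proof -
  obtain c where c0: "c \<ge> 0" and
    c: "\<And>x y. x \<in> space M \<Longrightarrow> y \<in> space M \<Longrightarrow> \<bar>K x y\<bar> \<le> c * w x * w y"
    using K unfolding good_def by blast
  \<comment> \<open>The majorant has to be independent of j, so the factor w(q x j) is replaced by
    its bound \<open>W\<close>.\<close>
  have c': "\<bar>K x y\<bar> \<le> c * W * w y" if "x \<in> space M" "y \<in> space M" for x y
  proof -
    have "c * w x * w y \<le> c * W * w y"
      using w_le[OF that(1)] c0 w_nonneg by (intro mult_right_mono mult_left_mono) auto
    then show ?thesis using c[OF that] by linarith
  qed
  have "(\<lambda>j. \<integral>y. (K (q x j) y - K x y)\<^sup>2 \<partial>M) \<longlonglongrightarrow> (\<integral>y. 0 \<partial>M)"
  proof (rule integral_dominated_convergence)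
    show "(\<lambda>y. (K (q x j) y - K x y)\<^sup>2) \<in> borel_measurable M" for j
      using good_section_measurable[OF K x] good_section_measurable[OF K q_space[OF x]] by measurable
    show "integrable M (\<lambda>y. (2 * c * W * w y)\<^sup>2)"
      using rL2_square_integrable[OF rL2_scale[OF w_L2, of "2 * c * W"]] by simp
    show "AE y in M. (\<lambda>j. (K (q x j) y - K x y)\<^sup>2) \<longlonglongrightarrow> 0"
    proof (rule AE_I2)
      fix y assume "y \<in> space M"
      then have "(\<lambda>j. (K (q x j) y - K x y)\<^sup>2) \<longlonglongrightarrow> (K x y - K x y)\<^sup>2"
        using K x unfolding good_def by (intro tendsto_intros) auto
      then show "(\<lambda>j. (K (q x j) y - K x y)\<^sup>2) \<longlonglongrightarrow> 0" by simp
    qed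
    show "AE y in M. norm ((K (q x j) y - K x y)\<^sup>2) \<le> (2 * c * W * w y)\<^sup>2" for j
    proof (rule AE_I2)
      fix y assume "y \<in> space M"
      then have "\<bar>K (q x j) y - K x y\<bar> \<le> 2 * c * W * w y"
        using c'[OF x, of y] c'[OF q_space[OF x], of y j] by linarith
      then have "\<bar>K (q x j) y - K x y\<bar> \<le> \<bar>2 * c * W * w y\<bar>" by linarith
      then show "norm ((K (q x j) y - K x y)\<^sup>2) \<le> (2 * c * W * w y)\<^sup>2"
        by (simp add: abs_le_square_iff)
    qed
  qed auto
  then show ?thesis by (simp add: ip_def power2_eq_square)
qed

lemma kop_q_tendsto:
  assumes K: "good K" and x: "x \<in> space M" and f: "f \<in> rL2 M"
  shows "(\<lambda>j. kop M K f (q x j)) \<longlonglongrightarrow> kop M K f x"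
proof -
  have "(\<lambda>j. kop M K f (q x j) - kop M K f x) \<longlonglongrightarrow> 0"
  proof (rule Lim_null_comparison)
    show "\<forall>\<^sub>F j in sequentially. norm (kop M K f (q x j) - kop M K f x)
       \<le> sqrt (ip M (\<lambda>y. K (q x j) y - K x y) (\<lambda>y. K (q x j) y - K x y)) * sqrt (ip M f f)"
    proof (intro always_eventually allI)
      fix j
      have L: "K (q x j) \<in> rL2 M" "K x \<in> rL2 M"
        using good_section_L2[OF K] x q_space[OF x] by auto
      have "kop M K f (q x j) - kop M K f x = ip M (\<lambda>y. K (q x j) y - K x y) f"
        unfolding kop_eq_ip using L f by (simp add: ip_diff_left)
      then show "norm (kop M K f (q x j) - kop M K f x)
         \<le> sqrt (ip M (\<lambda>y. K (q x j) y - K x y) (\<lambda>y. K (q x j) y - K x y)) * sqrt (ip M f f)"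
        using ip_Cauchy_Schwarz[OF rL2_diff[OF L] f] by simp
    qed
    show "(\<lambda>j. sqrt (ip M (\<lambda>y. K (q x j) y - K x y) (\<lambda>y. K (q x j) y - K x y)) * sqrt (ip M f f)) \<longlonglongrightarrow> 0"
      using tendsto_mult[OF tendsto_real_sqrt[OF section_distance_tendsto_0[OF K x]] tendsto_const, of "sqrt (ip M f f)"]
      by simp
  qed
  then show ?thesis by (simp add: LIM_zero_iff)
qed

end

context dominated_kernels
begin

text \<open>An Arzela-Ascoli argument: a diagonal subsequence converges at every point of
  \<open>D\<close>, and the L2 distance of sections extends the Cauchy property to every x.\<close>

lemma convergent_subsequence:
  assumes K: "good K" and f: "\<And>n. f n \<in> rL2 M" and f1: "\<And>n. ip M (f n) (f n) \<le> 1"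
  obtains r :: "nat \<Rightarrow> nat" and g where "strict_mono r"
    "\<And>x. x \<in> space M \<Longrightarrow> (\<lambda>n. kop M K (f (r n)) x) \<longlonglongrightarrow> g x"
proof (cases "space M = {}")
  case True
  then show ?thesis using that[of id] by (auto simp: strict_mono_def)
next
  case False
  then obtain x0 where "x0 \<in> space M" by auto
  then have Dne: "D \<noteq> {}" using qD by blast
  obtain c where c0: "c \<ge> 0" and
    c: "\<And>x f. x \<in> space M \<Longrightarrow> f \<in> rL2 M \<Longrightarrow> \<bar>kop M K f x\<bar> \<le> c * w x * sqrt (ip M f f)"
    by (rule kop_bound[OF K]) (rule that)
  have cf: "\<bar>kop M K (f n) x\<bar> \<le> c * w x" if "x \<in> space M" for n x
  proof -
    have "c * w x * sqrt (ip M (f n) (f n)) \<le> c * w x * 1"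
      using f1[of n] c0 w_nonneg[of x] by (intro mult_left_mono) auto
    then show ?thesis using c[OF that f[of n]] by linarith
  qed
  define d where "d k = from_nat_into D k" for k
  have dD: "d k \<in> space M" for k
    using from_nat_into[OF Dne] D(2) by (auto simp: d_def)
  let ?P = "\<lambda>k s. convergent (\<lambda>n. kop M K (f (s n)) (d k))"
  interpret S: subseqs ?P
  proof
    fix k :: nat and s :: "nat \<Rightarrow> nat" assume "strict_mono s"
    have "bounded {- (c * w (d k))..c * w (d k)}" by simp
    moreover have "\<And>n. kop M K (f (s n)) (d k) \<in> {- (c * w (d k))..c * w (d k)}"
      using cf[OF dD[of k]] by (simp add: abs_le_iff minus_le_iff)
    ultimately have "\<exists>l s'. strict_mono s' \<and> ((\<lambda>n. kop M K (f (s n)) (d k)) \<circ> s') \<longlonglongrightarrow> l"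
      using compact_Icc compact_imp_seq_compact seq_compactE by metis
    then show "\<exists>r'. strict_mono r' \<and> ?P k (s \<circ> r')"
      by (auto simp: convergent_def comp_def)
  qed
  define r where "r = S.diagseq"
  have rmono: "strict_mono r" unfolding r_def by (rule S.subseq_diagseq)
  have convd: "?P k r" for k
  proof -
    have "?P k (r \<circ> ((+) (Suc k)))"
      unfolding r_def
    proof (rule S.diagseq_holds)
      fix r' s :: "nat \<Rightarrow> nat" and k assume "strict_mono r'" "?P k s"
      then show "?P k (s \<circ> r')"
        using convergent_subseq_convergent[of "\<lambda>n. kop M K (f (s n)) (d k)" r'] by (simp add: o_def)
    qed
    then have "convergent (\<lambda>n. kop M K (f (r (n + Suc k))) (d k))"
      by (simp add: o_def add.commute)
    then show ?thesis
      using convergent_ignore_initial_segment[of "\<lambda>n. kop M K (f (r n)) (d k)" "Suc k"] by simp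
  qed
  have conv: "convergent (\<lambda>n. kop M K (f (r n)) x)" if x: "x \<in> space M" for x
  proof (rule Cauchy_convergent, rule metric_CauchyI)
    fix e :: real assume e: "e > 0"
    let ?\<eta> = "\<lambda>j. sqrt (ip M (\<lambda>y. K (q x j) y - K x y) (\<lambda>y. K (q x j) y - K x y))"
    have "?\<eta> \<longlonglongrightarrow> 0"
      using tendsto_real_sqrt[OF section_distance_tendsto_0[OF K x]] by simp
    then have "\<forall>\<^sub>F j in sequentially. ?\<eta> j < e / 3"
      using e by (intro order_tendstoD(2)) auto
    then obtain j where j: "?\<eta> j < e / 3"
      using eventually_happens'[OF sequentially_bot] by blast
    have L: "K (q x j) \<in> rL2 M" "K x \<in> rL2 M"
      using good_section_L2[OF K] x q_space[OF x] by auto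
    \<comment> \<open>The choice of j does not depend on n, because all \<open>f n\<close> lie in
      the unit ball.\<close>
    have close: "\<bar>kop M K (f n) (q x j) - kop M K (f n) x\<bar> < e / 3" for n
    proof -
      have "kop M K (f n) (q x j) - kop M K (f n) x = ip M (\<lambda>y. K (q x j) y - K x y) (f n)"
        unfolding kop_eq_ip using L f by (simp add: ip_diff_left)
      then have "\<bar>kop M K (f n) (q x j) - kop M K (f n) x\<bar> \<le> ?\<eta> j * sqrt (ip M (f n) (f n))"
        using ip_Cauchy_Schwarz[OF rL2_diff[OF L] f] by simp
      also have "\<dots> \<le> ?\<eta> j * 1"
        using f1[of n] by (intro mult_left_mono) (auto simp: ip_nonneg)
      finally show ?thesis using j by simp
    qed
    obtain k where k: "d k = q x j"
      using from_nat_into_surj[OF D(1) qD[OF x]] unfolding d_def by blast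
    have "Cauchy (\<lambda>n. kop M K (f (r n)) (q x j))"
      using convd[of k] unfolding k by (rule convergent_Cauchy)
    from metric_CauchyD[OF this, of "e / 3"] obtain N where N: "\<And>m n. m \<ge> N \<Longrightarrow> n \<ge> N \<Longrightarrow>
        dist (kop M K (f (r m)) (q x j)) (kop M K (f (r n)) (q x j)) < e / 3"
      using e by auto
    have "dist (kop M K (f (r m)) x) (kop M K (f (r n)) x) < e" if "m \<ge> N" "n \<ge> N" for m n
      using N[OF that] close[of "r m"] close[of "r n"] unfolding dist_real_def by linarith
    then show "\<exists>N. \<forall>m\<ge>N. \<forall>n\<ge>N. dist (kop M K (f (r m)) x) (kop M K (f (r n)) x) < e"
      by blast
  qed
  show ?thesis
    using that[OF rmono, of "\<lambda>x. lim (\<lambda>n. kop M K (f (r n)) x)"] conv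
    by (simp add: convergent_LIMSEQ_iff)
qed

text \<open>Common domination by \<open>w\<close> lets pointwise convergence pass through the
  operator, so the limit function obtained from a subsequence can be fed back into it.\<close>

lemma kop_tendsto:
  assumes K: "good K" and h: "\<And>n. h n \<in> borel_measurable M"
    and hc: "\<And>n x. x \<in> space M \<Longrightarrow> \<bar>h n x\<bar> \<le> c * w x"
    and hg: "\<And>x. x \<in> space M \<Longrightarrow> (\<lambda>n. h n x) \<longlonglongrightarrow> g x" and x: "x \<in> space M"
  shows "(\<lambda>n. kop M K (h n) x) \<longlonglongrightarrow> kop M K g x"
proof -
  have gm: "g \<in> borel_measurable M" by (rule borel_measurable_LIMSEQ_real[OF hg h])
  have Kw: "integrable M (\<lambda>y. \<bar>K x y\<bar> * (\<bar>c\<bar> * w y))"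
    using integrable_norm[OF rL2_integrable_mult[OF good_section_L2[OF K x] rL2_scale[OF w_L2, of "\<bar>c\<bar>"]]]
    by (simp add: abs_mult w_nonneg)
  show ?thesis
    unfolding kop_def
  proof (rule integral_dominated_convergence[OF _ _ Kw])
    show "(\<lambda>y. K x y * g y) \<in> borel_measurable M" "(\<lambda>y. K x y * h n y) \<in> borel_measurable M" for n
      using gm h good_section_measurable[OF K x] by measurable
    show "AE y in M. (\<lambda>n. K x y * h n y) \<longlonglongrightarrow> K x y * g y"
      by (intro AE_I2 tendsto_intros hg)
    show "AE y in M. norm (K x y * h n y) \<le> \<bar>K x y\<bar> * (\<bar>c\<bar> * w y)" for n
    proof (rule AE_I2)
      fix y assume "y \<in> space M"
      then have "\<bar>h n y\<bar> \<le> \<bar>c\<bar> * w y" using hc[of y n] w_nonneg[of y]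
        by (meson abs_ge_self mult_right_mono order_trans)
      then show "norm (K x y * h n y) \<le> \<bar>K x y\<bar> * (\<bar>c\<bar> * w y)"
        by (simp add: abs_mult mult_left_mono)
    qed
  qed
qed

text \<open>
  If \<open>\<parallel>f n\<parallel> \<le> 1\<close> and \<open>\<parallel>T f n\<parallel> \<rightarrow> s = \<parallel>T\<parallel>\<close>, then \<open>\<parallel>T\<^sup>2 f n - s\<^sup>2 f n\<parallel> \<rightarrow> 0\<close>, so the limit \<open>g\<close> of a
  subsequence of \<open>T f n\<close> satisfies \<open>T\<^sup>2 g = s\<^sup>2 g\<close> and either \<open>T g + s g\<close> or \<open>g\<close> is an eigenfunction.
\<close>
lemma extremal_eigenfunction:
  assumes K: "good K" "symmetric K"
  obtains l e where "e \<in> rL2 M" "\<And>x. x \<in> space M \<Longrightarrow> kop M K e x = l * e x"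
    "l \<noteq> 0 \<Longrightarrow> ip M e e = 1" "l = 0 \<Longrightarrow> e = (\<lambda>x. 0)"
    "\<And>f. f \<in> rL2 M \<Longrightarrow> ip M (kop M K f) (kop M K f) \<le> l\<^sup>2 * ip M f f"
proof -
  note finish = that
  let ?T = "kop M K"
  \<comment> \<open>The supremum \<open>S\<close> of this set is the square of the operator
    norm.\<close>
  define A where "A = {ip M (?T f) (?T f) |f. f \<in> rL2 M \<and> ip M f f \<le> 1}"
  define S where "S = Sup A"
  obtain c where c0: "c \<ge> 0" and
    c: "\<And>x f. x \<in> space M \<Longrightarrow> f \<in> rL2 M \<Longrightarrow> \<bar>?T f x\<bar> \<le> c * w x * sqrt (ip M f f)"
    by (rule kop_bound[OF K(1)]) (rule that)
  have cf: "\<bar>?T f x\<bar> \<le> c * w x" if "x \<in> space M" "f \<in> rL2 M" "ip M f f \<le> 1" for f x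
  proof -
    have "c * w x * sqrt (ip M f f) \<le> c * w x * 1"
      using that c0 w_nonneg[of x] by (intro mult_left_mono) auto
    then show ?thesis using c[OF that(1,2)] by linarith
  qed
  have TL: "?T f \<in> rL2 M" if "f \<in> rL2 M" for f using kop_L2[OF K(1) that] .
  have Abd: "bdd_above A"
  proof (rule bdd_aboveI)
    fix a assume "a \<in> A"
    then obtain f where f: "a = ip M (?T f) (?T f)" "f \<in> rL2 M" "ip M f f \<le> 1" by (auto simp: A_def)
    have "a \<le> ip M (\<lambda>x. c * w x) (\<lambda>x. c * w x)"
      unfolding f ip_def
    proof (rule integral_mono)
      show "integrable M (\<lambda>x. ?T f x * ?T f x)" using TL[OF f(2)] by (intro rL2_integrable_mult)
      show "integrable M (\<lambda>x. c * w x * (c * w x))" using rL2_scale[OF w_L2] by (intro rL2_integrable_mult)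
      fix x assume "x \<in> space M"
      then have "\<bar>?T f x\<bar> \<le> \<bar>c * w x\<bar>" using cf f by force
      then show "?T f x * ?T f x \<le> c * w x * (c * w x)"
        by (simp add: abs_le_square_iff power2_eq_square)
    qed
    then show "a \<le> ip M (\<lambda>x. c * w x) (\<lambda>x. c * w x)" .
  qed
  have T0: "?T (\<lambda>x. 0) = (\<lambda>x. 0)" by (rule ext) (simp add: kop_def)
  have A0: "0 \<in> A"
    unfolding A_def using rL2_zero[of M] T0 by (auto intro!: exI[of _ "\<lambda>x. 0"] simp: ip_def)
  have S0: "S \<ge> 0" unfolding S_def using cSup_upper[OF A0 Abd] .
  have Sle: "ip M (?T f) (?T f) \<le> S" if "f \<in> rL2 M" "ip M f f \<le> 1" for f
    unfolding S_def using that by (intro cSup_upper[OF _ Abd]) (auto simp: A_def)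
  have Sbound: "ip M (?T f) (?T f) \<le> S * ip M f f" if f: "f \<in> rL2 M" for f
  proof (cases "ip M f f = 0")
    case True
    have "ip M (?T f) (?T f) = ip M (\<lambda>x. 0) (\<lambda>x. 0)"
      using c[OF _ f] True by (intro ip_cong) auto
    then show ?thesis using True by (simp add: ip_def)
  next
    case False
    then have p: "ip M f f > 0" using ip_nonneg[of M f] by simp
    define a where "a = 1 / sqrt (ip M f f)"
    have a2: "a * a = 1 / ip M f f" using p by (simp add: a_def)
    have e: "kop M K (\<lambda>x. a * f x) = (\<lambda>x. a * ?T f x)" by (rule ext) (rule kop_scale)
    have "ip M (\<lambda>x. a * f x) (\<lambda>x. a * f x) \<le> 1"
      using a2 p by (simp add: ip_scale_left ip_scale_right flip: mult.assoc)
    then have "ip M (\<lambda>x. a * ?T f x) (\<lambda>x. a * ?T f x) \<le> S"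
      using Sle[OF rL2_scale[OF f, of a]] unfolding e by blast
    then have "(a * a) * ip M (?T f) (?T f) \<le> S"
      by (simp add: ip_scale_left ip_scale_right mult.assoc)
    then show ?thesis using p unfolding a2 by (simp add: field_simps)
  qed
  show ?thesis
  proof (cases "S = 0")
    case True
    \<comment> \<open>The operator vanishes; the value 0 with the zero function is the convention
      for this case.\<close>
    show ?thesis
    proof (rule finish[of "\<lambda>x. 0" 0])
      show "(\<lambda>x. 0) \<in> rL2 M" by (rule rL2_zero)
      show "kop M K (\<lambda>x. 0) x = 0 * 0" for x by (simp add: kop_def)
      show "ip M (?T f) (?T f) \<le> 0\<^sup>2 * ip M f f" if "f \<in> rL2 M" for f
        using Sbound[OF that] unfolding True by simp
    qed simp_all
  next
    case False
    then have S: "S > 0" using S0 by simp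
    have "\<exists>f. f \<in> rL2 M \<and> ip M f f \<le> 1 \<and> S - 1 / real (Suc n) < ip M (?T f) (?T f)" for n
    proof -
      have "\<exists>a\<in>A. S - 1 / real (Suc n) < a"
        using less_cSupD[of A "S - 1 / real (Suc n)"] A0 unfolding S_def by fastforce
      then show ?thesis unfolding A_def by blast
    qed
    then obtain f where f: "\<And>n. f n \<in> rL2 M" "\<And>n. ip M (f n) (f n) \<le> 1"
      "\<And>n. S - 1 / real (Suc n) < ip M (?T (f n)) (?T (f n))" by metis
    obtain r g where r: "strict_mono r" and
      g: "\<And>x. x \<in> space M \<Longrightarrow> (\<lambda>n. ?T (f (r n)) x) \<longlonglongrightarrow> g x"
      by (rule convergent_subsequence[OF K(1) f(1,2)]) (rule that)
    define h where "h n = ?T (f (r n))" for n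
    have hL: "h n \<in> rL2 M" for n unfolding h_def by (intro TL f)
    have hm: "h n \<in> borel_measurable M" for n using hL by (rule rL2_measurable)
    have hg: "(\<lambda>n. h n x) \<longlonglongrightarrow> g x" if "x \<in> space M" for x using g[OF that] by (simp add: h_def)
    have hc: "\<bar>h n x\<bar> \<le> c * w x" if "x \<in> space M" for n x unfolding h_def by (intro cf that f)
    have gm: "g \<in> borel_measurable M" by (rule borel_measurable_LIMSEQ_real[OF hg hm])
    have gc: "\<bar>g x\<bar> \<le> c * w x" if "x \<in> space M" for x
      using hc[OF that] by (intro LIMSEQ_le_const2[OF tendsto_rabs[OF hg[OF that]]]) auto
    have gL: "g \<in> rL2 M" by (rule rL2_bound[OF w_L2 gm gc])
    have hS: "(\<lambda>n. ip M (h n) (h n)) \<longlonglongrightarrow> S"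
    proof -
      have "(\<lambda>n. ip M (?T (f n)) (?T (f n))) \<longlonglongrightarrow> S"
      proof (rule tendsto_sandwich)
        show "\<forall>\<^sub>F n in sequentially. S - 1 / real (Suc n) \<le> ip M (?T (f n)) (?T (f n))"
          using f(3) by (intro always_eventually allI less_imp_le)
        show "\<forall>\<^sub>F n in sequentially. ip M (?T (f n)) (?T (f n)) \<le> S"
          using Sle f by (intro always_eventually) auto
        show "(\<lambda>n. S - 1 / real (Suc n)) \<longlonglongrightarrow> S" by real_asymp
      qed auto
      then show ?thesis unfolding h_def using LIMSEQ_subseq_LIMSEQ[OF _ r] by (simp add: o_def)
    qed
    have gg: "ip M g g = S"
    proof (rule LIMSEQ_unique[OF _ hS])
      show "(\<lambda>n. ip M (h n) (h n)) \<longlonglongrightarrow> ip M g g"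
        unfolding ip_def
      proof (rule integral_dominated_convergence)
        show "(\<lambda>x. g x * g x) \<in> borel_measurable M" using gm by measurable
        show "(\<lambda>x. h n x * h n x) \<in> borel_measurable M" for n using hm[of n] by measurable
        show "integrable M (\<lambda>x. (c * w x) * (c * w x))"
          using rL2_scale[OF w_L2] by (intro rL2_integrable_mult)
        show "AE x in M. (\<lambda>n. h n x * h n x) \<longlonglongrightarrow> g x * g x"
          by (intro AE_I2 tendsto_mult hg)
        show "AE x in M. norm (h n x * h n x) \<le> c * w x * (c * w x)" for n
          unfolding real_norm_def abs_mult by (intro AE_I2 mult_mono' hc abs_ge_zero)
      qed
    qed
    define d where "d n = (\<lambda>x. ?T (h n) x - S * f (r n) x)" for n
    have dL: "d n \<in> rL2 M" for n unfolding d_def by (intro rL2_diff rL2_scale TL hL f)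
    \<comment> \<open>Expand the square: symmetry turns the cross term into S times the squared norm
      of \<open>h n\<close>, and the norm of \<open>?T (h n)\<close> is estimated by
      \<open>Sbound\<close>.\<close>
    have dd: "ip M (d n) (d n) \<le> S * (S - ip M (h n) (h n))" for n
    proof -
      have sym: "ip M (?T (h n)) (f (r n)) = ip M (h n) (h n)"
        using kop_symmetric[OF K hL[of n] f(1)[of "r n"]] by (simp add: h_def)
      have "ip M (d n) (d n) = ip M (?T (h n)) (?T (h n)) - 2 * (S * ip M (h n) (h n))
          + S\<^sup>2 * ip M (f (r n)) (f (r n))"
        unfolding d_def ip_diff_diff[OF TL[OF hL] rL2_scale[OF f(1)]]
        by (simp add: ip_scale_left ip_scale_right sym power2_eq_square)
      also have "\<dots> \<le> S * ip M (h n) (h n) - 2 * (S * ip M (h n) (h n)) + S\<^sup>2 * 1"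
        using Sbound[OF hL[of n]] f(2)[of "r n"] by (intro add_mono mult_left_mono diff_right_mono) auto
      finally show ?thesis by (simp add: power2_eq_square algebra_simps)
    qed
    have ddlim: "(\<lambda>n. ip M (d n) (d n)) \<longlonglongrightarrow> 0"
    proof (rule tendsto_sandwich[OF _ _ tendsto_const])
      show "(\<lambda>n. S * (S - ip M (h n) (h n))) \<longlonglongrightarrow> 0"
        using tendsto_mult[OF tendsto_const tendsto_diff[OF tendsto_const hS], of S S] by simp
    qed (auto simp: dd ip_nonneg)
    have TTg: "?T (?T g) x = S * g x" if x: "x \<in> space M" for x
    proof -
      have Thg: "(\<lambda>n. ?T (h n) y) \<longlonglongrightarrow> ?T g y" if "y \<in> space M" for y
        by (rule kop_tendsto[OF K(1) hm hc hg that])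
      have Thc: "\<bar>?T (h n) y\<bar> \<le> c * sqrt S * w y" if "y \<in> space M" for n y
      proof -
        have "ip M (h n) (h n) \<le> S" unfolding h_def by (intro Sle f)
        then have "c * w y * sqrt (ip M (h n) (h n)) \<le> c * w y * sqrt S"
          using c0 w_nonneg[of y] by (intro mult_left_mono) auto
        then show ?thesis using c[OF that hL[of n]] by (simp add: mult_ac)
      qed
      have 1: "(\<lambda>n. ?T (?T (h n)) x) \<longlonglongrightarrow> ?T (?T g) x"
        by (rule kop_tendsto[OF K(1) rL2_measurable[OF TL[OF hL]] Thc Thg x])
      have "(\<lambda>n. ?T (d n) x) \<longlonglongrightarrow> 0"
      proof (rule Lim_null_comparison)
        show "\<forall>\<^sub>F n in sequentially. norm (?T (d n) x) \<le> c * w x * sqrt (ip M (d n) (d n))"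
          using c[OF x dL] by (intro always_eventually) simp
        show "(\<lambda>n. c * w x * sqrt (ip M (d n) (d n))) \<longlonglongrightarrow> 0"
          using tendsto_mult[OF tendsto_const tendsto_real_sqrt[OF ddlim], of "c * w x"] by simp
      qed
      moreover have "?T (d n) x = ?T (?T (h n)) x - S * h n x" for n
        unfolding d_def kop_diff[OF K(1) TL[OF hL] rL2_scale[OF f(1)] x] kop_scale
        by (simp add: h_def)
      ultimately have "(\<lambda>n. ?T (?T (h n)) x - S * h n x) \<longlonglongrightarrow> 0" by simp
      moreover have "(\<lambda>n. ?T (?T (h n)) x - S * h n x) \<longlonglongrightarrow> ?T (?T g) x - S * g x"
        by (intro tendsto_intros 1 hg x)
      ultimately show ?thesis using LIMSEQ_unique by fastforce
    qed
    define s where "s = sqrt S"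
    have s: "s > 0" "s * s = S" "s\<^sup>2 = S" using S by (auto simp: s_def)
    \<comment> \<open>Since s^2 = S, the operator factorises as (T - s)(T + s) g = 0; hence
      \<open>e0\<close> is an eigenfunction for s unless it vanishes.\<close>
    define e0 where "e0 = (\<lambda>x. ?T g x + s * g x)"
    have e0L: "e0 \<in> rL2 M" unfolding e0_def by (intro rL2_add rL2_scale TL gL)
    have Te0: "?T e0 x = s * e0 x" if "x \<in> space M" for x
      unfolding e0_def kop_add[OF K(1) TL[OF gL] rL2_scale[OF gL] that] kop_scale TTg[OF that]
      by (simp add: s(2)[symmetric] algebra_simps)
    have normalise: thesis if e: "e \<in> rL2 M" "\<And>x. x \<in> space M \<Longrightarrow> ?T e x = l * e x" "ip M e e > 0"
      and l: "l\<^sup>2 = S" for e l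
    proof -
      define a where "a = 1 / sqrt (ip M e e)"
      have "a * a = 1 / ip M e e" using e(3) by (simp add: a_def)
      then have "ip M (\<lambda>x. a * e x) (\<lambda>x. a * e x) = 1"
        using e(3) by (simp add: ip_scale_left ip_scale_right flip: mult.assoc)
      moreover have "l \<noteq> 0" using l S by auto
      ultimately show thesis
        using finish[OF rL2_scale[OF e(1), of a], of l] e(2) Sbound l by (simp add: kop_scale)
    qed
    show ?thesis
    proof (cases "ip M e0 e0 = 0")
      case False
      then show ?thesis
        using normalise[OF e0L Te0 _ s(3)] ip_nonneg[of M e0] by fastforce
    next
      case True
      \<comment> \<open>The bound of \<open>kop_bound\<close> is pointwise, so zero norm forces
        \<open>?T e0\<close> to vanish at every point, and \<open>g\<close> itself is an
        eigenfunction for -s.\<close>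
      have "?T e0 x = 0" if "x \<in> space M" for x using c[OF that e0L] True by simp
      then have "e0 x = 0" if "x \<in> space M" for x using Te0[OF that] s(1) that by simp
      then have "?T g x = (- s) * g x" if "x \<in> space M" for x
        using that unfolding e0_def by fastforce
      then show ?thesis using normalise[OF gL, of "- s"] gg S s(3) by simp
    qed
  qed
qed

end

section \<open>Nuclear kernels, deflation and the Schmidt expansion\<close>

context dominated_kernels
begin

lemma good_add:
  assumes "good K" "good L"
  shows "good (\<lambda>x y. K x y + L x y)"
  unfolding good_def
proof (intro conjI ballI)
  have [measurable]: "case_prod K \<in> borel_measurable (M \<Otimes>\<^sub>M M)"
    "case_prod L \<in> borel_measurable (M \<Otimes>\<^sub>M M)" using assms by (auto simp: good_def)
  show "(\<lambda>(x, y). K x y + L x y) \<in> borel_measurable (M \<Otimes>\<^sub>M M)" by measurable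
  obtain c where c: "c \<ge> 0" "\<And>x y. x \<in> space M \<Longrightarrow> y \<in> space M \<Longrightarrow> \<bar>K x y\<bar> \<le> c * w x * w y"
    using assms(1) unfolding good_def by blast
  obtain d where d: "d \<ge> 0" "\<And>x y. x \<in> space M \<Longrightarrow> y \<in> space M \<Longrightarrow> \<bar>L x y\<bar> \<le> d * w x * w y"
    using assms(2) unfolding good_def by blast
  have "\<bar>K x y + L x y\<bar> \<le> (c + d) * w x * w y" if "x \<in> space M" "y \<in> space M" for x y
    using c(2)[OF that] d(2)[OF that] unfolding distrib_right by linarith
  then show "\<exists>c\<ge>0. \<forall>x\<in>space M. \<forall>y\<in>space M. \<bar>K x y + L x y\<bar> \<le> c * w x * w y"
    using c(1) d(1) by (intro exI[of _ "c + d"]) auto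
  show "(\<lambda>j. K (q x j) y + L (q x j) y) \<longlonglongrightarrow> K x y + L x y" if "x \<in> space M" "y \<in> space M" for x y
    using assms that unfolding good_def by (intro tendsto_add) auto
qed

lemma good_scale:
  assumes "good K"
  shows "good (\<lambda>x y. a * K x y)"
  unfolding good_def
proof (intro conjI ballI)
  have [measurable]: "case_prod K \<in> borel_measurable (M \<Otimes>\<^sub>M M)" using assms by (auto simp: good_def)
  show "(\<lambda>(x, y). a * K x y) \<in> borel_measurable (M \<Otimes>\<^sub>M M)" by measurable
  obtain c where c: "c \<ge> 0" "\<And>x y. x \<in> space M \<Longrightarrow> y \<in> space M \<Longrightarrow> \<bar>K x y\<bar> \<le> c * w x * w y"
    using assms unfolding good_def by blast
  have "\<bar>a * K x y\<bar> \<le> (\<bar>a\<bar> * c) * w x * w y" if "x \<in> space M" "y \<in> space M" for x y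
    using mult_left_mono[OF c(2)[OF that], of "\<bar>a\<bar>"] by (simp add: abs_mult mult_ac)
  then show "\<exists>c\<ge>0. \<forall>x\<in>space M. \<forall>y\<in>space M. \<bar>a * K x y\<bar> \<le> c * w x * w y"
    using c(1) by (intro exI[of _ "\<bar>a\<bar> * c"]) auto
  show "(\<lambda>j. a * K (q x j) y) \<longlonglongrightarrow> a * K x y" if "x \<in> space M" "y \<in> space M" for x y
    using assms that unfolding good_def by (intro tendsto_mult tendsto_const) auto
qed

text \<open>The one variable counterpart of \<open>good\<close>: products of two admissible
  functions are good kernels.\<close>

definition admissible :: "('a \<Rightarrow> real) \<Rightarrow> bool" where
  "admissible f \<longleftrightarrow> f \<in> borel_measurable M \<and> (\<exists>c. \<forall>x\<in>space M. \<bar>f x\<bar> \<le> c * w x) \<and>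
     (\<forall>x\<in>space M. (\<lambda>j. f (q x j)) \<longlonglongrightarrow> f x)"

lemma admissible_L2: "admissible f \<Longrightarrow> f \<in> rL2 M"
  unfolding admissible_def using rL2_bound[OF w_L2] by blast

lemma good_tensor:
  assumes "admissible f" "admissible g"
  shows "good (\<lambda>x y. f x * g y)"
  unfolding good_def
proof (intro conjI ballI)
  have [measurable]: "f \<in> borel_measurable M" "g \<in> borel_measurable M"
    using assms by (auto simp: admissible_def)
  show "(\<lambda>(x, y). f x * g y) \<in> borel_measurable (M \<Otimes>\<^sub>M M)" by measurable
  obtain c where c: "\<And>x. x \<in> space M \<Longrightarrow> \<bar>f x\<bar> \<le> c * w x"
    using assms(1) unfolding admissible_def by blast
  obtain d where d: "\<And>x. x \<in> space M \<Longrightarrow> \<bar>g x\<bar> \<le> d * w x"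
    using assms(2) unfolding admissible_def by blast
  have "\<bar>f x * g y\<bar> \<le> \<bar>c * d\<bar> * w x * w y" if "x \<in> space M" "y \<in> space M" for x y
  proof -
    have "\<bar>f x\<bar> \<le> \<bar>c\<bar> * w x" "\<bar>g y\<bar> \<le> \<bar>d\<bar> * w y"
      using c[OF that(1)] d[OF that(2)] w_nonneg
      by (meson abs_ge_self mult_right_mono order_trans)+
    then have "\<bar>f x\<bar> * \<bar>g y\<bar> \<le> (\<bar>c\<bar> * w x) * (\<bar>d\<bar> * w y)" by (intro mult_mono') auto
    then show ?thesis by (simp add: abs_mult mult_ac)
  qed
  then show "\<exists>c\<ge>0. \<forall>x\<in>space M. \<forall>y\<in>space M. \<bar>f x * g y\<bar> \<le> c * w x * w y"
    by (intro exI[of _ "\<bar>c * d\<bar>"]) auto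
  show "(\<lambda>j. f (q x j) * g y) \<longlonglongrightarrow> f x * g y" if "x \<in> space M" "y \<in> space M" for x y
    using assms that unfolding admissible_def by (intro tendsto_mult tendsto_const) auto
qed

text \<open>An eigenfunction with l nonzero is T e / l and so inherits the bound and the continuity
  that every image has. Subtracting its rank one kernel therefore stays within the good
  kernels.\<close>

lemma eigenfunction_admissible:
  assumes K: "good K" and e: "e \<in> rL2 M" "\<And>x. x \<in> space M \<Longrightarrow> kop M K e x = l * e x" "l \<noteq> 0"
  shows "admissible e"
  unfolding admissible_def
proof (intro conjI ballI)
  have ex: "e x = kop M K e x / l" if "x \<in> space M" for x using e(2)[OF that] e(3) by simp
  show "e \<in> borel_measurable M" using e(1) by (rule rL2_measurable)
  obtain c where "c \<ge> 0" and
    c: "\<And>x f. x \<in> space M \<Longrightarrow> f \<in> rL2 M \<Longrightarrow> \<bar>kop M K f x\<bar> \<le> c * w x * sqrt (ip M f f)"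
    by (rule kop_bound[OF K]) (rule that)
  have "\<bar>e x\<bar> \<le> (c * sqrt (ip M e e) / \<bar>l\<bar>) * w x" if "x \<in> space M" for x
    unfolding ex[OF that] using c[OF that e(1)] e(3) by (simp add: field_simps)
  then show "\<exists>c. \<forall>x\<in>space M. \<bar>e x\<bar> \<le> c * w x" by blast
  fix x assume x: "x \<in> space M"
  have "(\<lambda>j. kop M K e (q x j) / l) \<longlonglongrightarrow> kop M K e x / l"
    using e(3) by (intro tendsto_divide kop_q_tendsto K x e(1) tendsto_const)
  then show "(\<lambda>j. e (q x j)) \<longlonglongrightarrow> e x" using ex q_space[OF x] x by simp
qed

lemma admissible_zero: "admissible (\<lambda>x. 0)"
  by (auto simp: admissible_def intro!: exI[of _ 0])

lemma kop_add_kernel: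
  "good K \<Longrightarrow> good L \<Longrightarrow> f \<in> rL2 M \<Longrightarrow> x \<in> space M \<Longrightarrow>
    kop M (\<lambda>x y. K x y + L x y) f x = kop M K f x + kop M L f x"
  by (simp add: kop_eq_ip ip_add_left good_section_L2)

lemma kop_scale_kernel: "kop M (\<lambda>x y. a * K x y) f x = a * kop M K f x"
  unfolding kop_eq_ip by (rule ip_scale_left)

lemma kop_tensor: "kop M (\<lambda>x y. f x * g y) h x = ip M g h * f x"
  unfolding kop_eq_ip by (simp add: ip_scale_left)

text \<open>This form of the trace norm bound is visibly stable under sums and multiples, and
  evaluated on eigenfunctions it bounds the sum of the moduli of the eigenvalues.\<close>

definition nuclear :: "('a \<Rightarrow> 'a \<Rightarrow> real) \<Rightarrow> bool" where
  "nuclear K \<longleftrightarrow> good K \<and> (\<exists>C. \<forall>I e. finite I \<and> orthonormal_family M I e \<longrightarrow>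
      (\<Sum>i\<in>I. \<bar>ip M (kop M K (e i)) (e i)\<bar>) \<le> C)"

lemma nuclear_add:
  assumes "nuclear K" "nuclear L"
  shows "nuclear (\<lambda>x y. K x y + L x y)"
proof -
  have g: "good K" "good L" using assms by (auto simp: nuclear_def)
  obtain C where
    C: "\<And>I e. finite I \<Longrightarrow> orthonormal_family M I e \<Longrightarrow> (\<Sum>i\<in>I. \<bar>ip M (kop M K (e i)) (e i)\<bar>) \<le> C"
    using assms(1) unfolding nuclear_def by metis
  obtain E where
    E: "\<And>I e. finite I \<Longrightarrow> orthonormal_family M I e \<Longrightarrow> (\<Sum>i\<in>I. \<bar>ip M (kop M L (e i)) (e i)\<bar>) \<le> E"
    using assms(2) unfolding nuclear_def by metis
  have "(\<Sum>i\<in>I. \<bar>ip M (kop M (\<lambda>x y. K x y + L x y) (e i)) (e i)\<bar>) \<le> C + E"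
    if I: "finite I" and e: "orthonormal_family M I e" for I e
  proof -
    have "(\<Sum>i\<in>I. \<bar>ip M (kop M (\<lambda>x y. K x y + L x y) (e i)) (e i)\<bar>)
       \<le> (\<Sum>i\<in>I. \<bar>ip M (kop M K (e i)) (e i)\<bar> + \<bar>ip M (kop M L (e i)) (e i)\<bar>)"
    proof (rule sum_mono)
      fix i assume "i \<in> I"
      then have ei: "e i \<in> rL2 M" using e by (simp add: orthonormal_family_def)
      have "ip M (kop M (\<lambda>x y. K x y + L x y) (e i)) (e i)
          = ip M (\<lambda>x. kop M K (e i) x + kop M L (e i) x) (e i)"
        using kop_add_kernel[OF g ei] by (intro ip_cong) auto
      also have "\<dots> = ip M (kop M K (e i)) (e i) + ip M (kop M L (e i)) (e i)"
        by (intro ip_add_left kop_L2 g ei)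
      finally show "\<bar>ip M (kop M (\<lambda>x y. K x y + L x y) (e i)) (e i)\<bar>
         \<le> \<bar>ip M (kop M K (e i)) (e i)\<bar> + \<bar>ip M (kop M L (e i)) (e i)\<bar>" by simp
    qed
    also have "\<dots> \<le> C + E" using C[OF I e] E[OF I e] by (simp add: sum.distrib)
    finally show ?thesis .
  qed
  then show ?thesis using good_add[OF g] unfolding nuclear_def by blast
qed

lemma nuclear_scale:
  assumes "nuclear K"
  shows "nuclear (\<lambda>x y. a * K x y)"
proof -
  obtain C where
    C: "\<And>I e. finite I \<Longrightarrow> orthonormal_family M I e \<Longrightarrow> (\<Sum>i\<in>I. \<bar>ip M (kop M K (e i)) (e i)\<bar>) \<le> C"
    using assms unfolding nuclear_def by metis
  have k: "kop M (\<lambda>x y. a * K x y) f = (\<lambda>x. a * kop M K f x)" for f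
    by (rule ext) (rule kop_scale_kernel)
  have "(\<Sum>i\<in>I. \<bar>ip M (kop M (\<lambda>x y. a * K x y) (e i)) (e i)\<bar>) \<le> \<bar>a\<bar> * C"
    if "finite I" "orthonormal_family M I e" for I e
    using mult_left_mono[OF C[OF that], of "\<bar>a\<bar>"]
    by (simp add: k ip_scale_left abs_mult sum_distrib_left)
  then show ?thesis using assms good_scale unfolding nuclear_def by blast
qed

text \<open>The diagonal entries are products of the coefficients of f and g;
  \<open>|ab| <= a^2 + b^2\<close> reduces their sum to Bessel's inequality for f and for g.\<close>

lemma nuclear_tensor:
  assumes f: "admissible f" and g: "admissible g"
  shows "nuclear (\<lambda>x y. f x * g y)"
proof -
  have fL: "f \<in> rL2 M" and gL: "g \<in> rL2 M" using f g by (auto intro: admissible_L2)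
  have "(\<Sum>i\<in>I. \<bar>ip M (kop M (\<lambda>x y. f x * g y) (e i)) (e i)\<bar>) \<le> ip M f f + ip M g g"
    if I: "finite I" and e: "orthonormal_family M I e" for I e
  proof -
    have k: "kop M (\<lambda>x y. f x * g y) h = (\<lambda>x. ip M g h * f x)" for h
      by (rule ext) (rule kop_tensor)
    have ab: "\<bar>a * b\<bar> \<le> a\<^sup>2 + b\<^sup>2" for a b :: real
    proof -
      have "2 * (\<bar>a\<bar> * \<bar>b\<bar>) \<le> \<bar>a\<bar>\<^sup>2 + \<bar>b\<bar>\<^sup>2"
        using sum_squares_bound[of "\<bar>a\<bar>" "\<bar>b\<bar>"] by (simp add: mult_ac)
      moreover have "0 \<le> \<bar>a\<bar> * \<bar>b\<bar>" by simp
      ultimately show ?thesis unfolding abs_mult power2_abs by linarith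
    qed
    have "(\<Sum>i\<in>I. \<bar>ip M (kop M (\<lambda>x y. f x * g y) (e i)) (e i)\<bar>)
        \<le> (\<Sum>i\<in>I. (ip M g (e i))\<^sup>2 + (ip M f (e i))\<^sup>2)"
      unfolding k ip_scale_left by (intro sum_mono ab)
    also have "\<dots> \<le> ip M f f + ip M g g"
      using Bessel_inequality[OF I e fL] Bessel_inequality[OF I e gL] by (simp add: sum.distrib)
    finally show ?thesis .
  qed
  then show ?thesis using good_tensor[OF f g] unfolding nuclear_def by blast
qed

lemma nuclear_sum:
  assumes "finite A" "\<And>i. i \<in> A \<Longrightarrow> nuclear (K i)"
  shows "nuclear (\<lambda>x y. \<Sum>i\<in>A. K i x y)"
  using assms
proof (induction A rule: finite_induct)
  case empty
  then show ?case using nuclear_scale[OF nuclear_tensor[OF admissible_zero admissible_zero], of 0] by simp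
next
  case (insert a A)
  then show ?case using nuclear_add[of "K a" "\<lambda>x y. \<Sum>i\<in>A. K i x y"] by simp
qed

text \<open>The last clause says that |l| dominates the operator norm. The pair of 0 and the zero
  function stands for a vanishing operator, so that deflation never has to stop.\<close>

definition eigenpair :: "('a \<Rightarrow> 'a \<Rightarrow> real) \<Rightarrow> real \<times> ('a \<Rightarrow> real) \<Rightarrow> bool" where
  "eigenpair K p \<longleftrightarrow> (case p of (l, e) \<Rightarrow> e \<in> rL2 M \<and> (\<forall>x\<in>space M. kop M K e x = l * e x) \<and>
     (l \<noteq> 0 \<longrightarrow> ip M e e = 1) \<and> (l = 0 \<longrightarrow> e = (\<lambda>x. 0)) \<and>
     (\<forall>f\<in>rL2 M. ip M (kop M K f) (kop M K f) \<le> l\<^sup>2 * ip M f f))"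

definition pick :: "('a \<Rightarrow> 'a \<Rightarrow> real) \<Rightarrow> real \<times> ('a \<Rightarrow> real)" where
  "pick K = (SOME p. eigenpair K p)"

lemma eigenpair_pick:
  assumes "good K" "symmetric K"
  shows "eigenpair K (pick K)"
proof -
  obtain l e where "e \<in> rL2 M" "\<And>x. x \<in> space M \<Longrightarrow> kop M K e x = l * e x"
    "l \<noteq> 0 \<Longrightarrow> ip M e e = 1" "l = 0 \<Longrightarrow> e = (\<lambda>x. 0)"
    "\<And>f. f \<in> rL2 M \<Longrightarrow> ip M (kop M K f) (kop M K f) \<le> l\<^sup>2 * ip M f f"
    by (rule extremal_eigenfunction[OF assms]) (rule that)
  then have "eigenpair K (l, e)" unfolding eigenpair_def prod.case by blast
  then show ?thesis unfolding pick_def by (rule someI)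
qed

text \<open>Each stage removes the rank one part of an extremal eigenpair; the operator norm of
  stage n is then controlled by the n-th eigenvalue.\<close>

primrec deflate :: "('a \<Rightarrow> 'a \<Rightarrow> real) \<Rightarrow> nat \<Rightarrow> 'a \<Rightarrow> 'a \<Rightarrow> real" where
  "deflate K 0 = K"
| "deflate K (Suc n) = (\<lambda>x y. deflate K n x y +
     (- fst (pick (deflate K n))) * (snd (pick (deflate K n)) x * snd (pick (deflate K n)) y))"

definition eval_seq where "eval_seq K n = fst (pick (deflate K n))"
definition evec_seq where "evec_seq K n = snd (pick (deflate K n))"

context
  fixes K assumes K: "good K" "symmetric K"
begin

lemma deflate_good: "good (deflate K n) \<and> symmetric (deflate K n)"
proof (induction n)
  case 0
  then show ?case using K by simp
next
  case (Suc n)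
  let ?p = "pick (deflate K n)"
  have p: "eigenpair (deflate K n) ?p" using Suc eigenpair_pick by blast
  have "admissible (snd ?p)"
  proof (cases "fst ?p = 0")
    case True
    then show ?thesis using p admissible_zero by (auto simp: eigenpair_def split_beta)
  next
    case False
    then show ?thesis using p Suc eigenfunction_admissible[of "deflate K n" "snd ?p" "fst ?p"]
      by (auto simp: eigenpair_def split_beta)
  qed
  then show ?case
    using Suc unfolding deflate.simps
    by (intro conjI good_add good_scale good_tensor) (auto simp: symmetric_def)
qed

lemma eval_seq_eigenpair: "eigenpair (deflate K n) (eval_seq K n, evec_seq K n)"
  using eigenpair_pick deflate_good by (simp add: eval_seq_def evec_seq_def)

lemma evec_L2: "evec_seq K n \<in> rL2 M"
  using eval_seq_eigenpair[of n] by (simp add: eigenpair_def)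

lemma evec_admissible: "admissible (evec_seq K n)"
proof (cases "eval_seq K n = 0")
  case True
  then show ?thesis using eval_seq_eigenpair[of n] admissible_zero by (auto simp: eigenpair_def)
next
  case False
  then show ?thesis
    using eval_seq_eigenpair[of n] deflate_good[of n]
      eigenfunction_admissible[of "deflate K n" "evec_seq K n" "eval_seq K n"]
    by (auto simp: eigenpair_def)
qed

lemma kop_deflate_Suc:
  assumes "f \<in> rL2 M" "x \<in> space M"
  shows "kop M (deflate K (Suc n)) f x
     = kop M (deflate K n) f x - eval_seq K n * ip M f (evec_seq K n) * evec_seq K n x"
proof -
  have d: "deflate K (Suc n)
      = (\<lambda>x y. deflate K n x y + - eval_seq K n * (evec_seq K n x * evec_seq K n y))"
    by (simp add: eval_seq_def evec_seq_def)
  have "kop M (deflate K (Suc n)) f x = kop M (deflate K n) f x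
      + kop M (\<lambda>x y. - eval_seq K n * (evec_seq K n x * evec_seq K n y)) f x"
    unfolding d using deflate_good[of n] assms
    by (intro kop_add_kernel good_scale good_tensor evec_admissible) auto
  then show ?thesis unfolding kop_scale_kernel kop_tensor by (simp add: ip_commute)
qed

lemma kop_deflate:
  assumes "f \<in> rL2 M" "x \<in> space M"
  shows "kop M (deflate K n) f x
     = kop M K f x - (\<Sum>k<n. eval_seq K k * ip M f (evec_seq K k) * evec_seq K k x)"
  by (induction n) (use assms kop_deflate_Suc in \<open>auto simp del: deflate.simps(2)\<close>)

text \<open>The eigenfunction just removed is sent to 0 because it has norm 1. For an earlier one,
  symmetry gives l <e_n, e_k> = <e_n, T_n e_k> = 0, so the new rank one term does not act on
  it.\<close>

lemma deflate_annihilates: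
  "k < n \<Longrightarrow> x \<in> space M \<Longrightarrow> kop M (deflate K n) (evec_seq K k) x = 0"
proof (induction n arbitrary: x)
  case (Suc n)
  have ep: "\<And>x. x \<in> space M \<Longrightarrow> kop M (deflate K n) (evec_seq K n) x = eval_seq K n * evec_seq K n x"
    "eval_seq K n \<noteq> 0 \<Longrightarrow> ip M (evec_seq K n) (evec_seq K n) = 1"
    using eval_seq_eigenpair[of n] by (auto simp: eigenpair_def)
  show ?case
  proof (cases "k = n")
    case True
    then show ?thesis
      using ep Suc.prems unfolding True kop_deflate_Suc[OF evec_L2 Suc.prems(2)] by auto
  next
    case False
    then have k: "k < n" using Suc.prems by simp
    have "eval_seq K n * ip M (evec_seq K n) (evec_seq K k)
        = ip M (kop M (deflate K n) (evec_seq K n)) (evec_seq K k)"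
      unfolding ip_scale_left[symmetric] by (rule ip_cong) (use ep in auto)
    also have "\<dots> = ip M (evec_seq K n) (kop M (deflate K n) (evec_seq K k))"
      using deflate_good[of n] by (intro kop_symmetric evec_L2) auto
    also have "\<dots> = ip M (evec_seq K n) (\<lambda>x. 0)"
      by (rule ip_cong) (use Suc.IH[OF k] in auto)
    finally have "eval_seq K n * ip M (evec_seq K k) (evec_seq K n) = 0"
      by (simp add: ip_def mult.commute)
    then show ?thesis
      unfolding kop_deflate_Suc[OF evec_L2 Suc.prems(2)] Suc.IH[OF k Suc.prems(2)] by simp
  qed
qed simp

lemma evec_orthogonal_less:
  assumes k: "k < n"
  shows "ip M (evec_seq K k) (evec_seq K n) = 0"
proof (cases "eval_seq K n = 0")
  case True
  then show ?thesis using eval_seq_eigenpair[of n] by (simp add: eigenpair_def ip_def)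
next
  case False
  have "eval_seq K n * ip M (evec_seq K n) (evec_seq K k)
      = ip M (kop M (deflate K n) (evec_seq K n)) (evec_seq K k)"
    unfolding ip_scale_left[symmetric] by (rule ip_cong)
      (use eval_seq_eigenpair[of n] in \<open>auto simp: eigenpair_def\<close>)
  also have "\<dots> = ip M (evec_seq K n) (kop M (deflate K n) (evec_seq K k))"
    using deflate_good[of n] by (intro kop_symmetric evec_L2) auto
  also have "\<dots> = ip M (evec_seq K n) (\<lambda>x. 0)"
    by (rule ip_cong) (use deflate_annihilates[OF k] in auto)
  finally show ?thesis using False by (simp add: ip_def mult.commute)
qed

lemma evec_orthogonal: "k \<noteq> n \<Longrightarrow> ip M (evec_seq K k) (evec_seq K n) = 0"
  using evec_orthogonal_less[of k n] evec_orthogonal_less[of n k]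
  by (cases "k < n") (auto simp: ip_commute)

lemma evec_normalised: "eval_seq K k \<noteq> 0 \<Longrightarrow> ip M (evec_seq K k) (evec_seq K k) = 1"
  using eval_seq_eigenpair[of k] by (simp add: eigenpair_def)

text \<open>By orthogonality the removed terms do not see the n-th eigenfunction, so eigenfunctions
  of the deflated kernels are eigenfunctions of \<open>K\<close> itself.\<close>

lemma kop_evec:
  assumes "x \<in> space M"
  shows "kop M K (evec_seq K n) x = eval_seq K n * evec_seq K n x"
proof -
  have "(\<Sum>k<n. eval_seq K k * ip M (evec_seq K n) (evec_seq K k) * evec_seq K k x) = 0"
    by (intro sum.neutral ballI) (simp add: evec_orthogonal)
  then show ?thesis
    using kop_deflate[OF evec_L2 assms, of n n] eval_seq_eigenpair[of n] assms
    by (simp add: eigenpair_def)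
qed

lemma evec_orthonormal: "orthonormal_family M {k. eval_seq K k \<noteq> 0} (evec_seq K)"
  using evec_orthogonal evec_normalised evec_L2 by (auto simp: orthonormal_family_def)

text \<open>The bound in \<open>nuclear\<close> is applied to the eigenfunctions with nonzero
  eigenvalue, whose diagonal entries are the eigenvalues.\<close>

lemma eval_summable:
  assumes "nuclear K"
  shows "summable (\<lambda>k. \<bar>eval_seq K k\<bar>)"
proof -
  obtain C where
    C: "\<And>I e. finite I \<Longrightarrow> orthonormal_family M I e \<Longrightarrow> (\<Sum>i\<in>I. \<bar>ip M (kop M K (e i)) (e i)\<bar>) \<le> C"
    using assms unfolding nuclear_def by metis
  show ?thesis
  proof (rule bounded_imp_summable)
    fix n
    let ?I = "{k\<in>{..n}. eval_seq K k \<noteq> 0}"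
    have "(\<Sum>k\<le>n. \<bar>eval_seq K k\<bar>) = (\<Sum>k\<in>?I. \<bar>eval_seq K k\<bar>)"
      by (rule sum.mono_neutral_right) auto
    also have "\<dots> = (\<Sum>k\<in>?I. \<bar>ip M (kop M K (evec_seq K k)) (evec_seq K k)\<bar>)"
    proof (rule sum.cong[OF refl])
      fix k assume "k \<in> ?I"
      then have "ip M (\<lambda>x. eval_seq K k * evec_seq K k x) (evec_seq K k) = eval_seq K k"
        by (simp add: ip_scale_left evec_normalised)
      moreover have "ip M (kop M K (evec_seq K k)) (evec_seq K k)
          = ip M (\<lambda>x. eval_seq K k * evec_seq K k x) (evec_seq K k)"
        by (rule ip_cong) (auto simp: kop_evec)
      ultimately show "\<bar>eval_seq K k\<bar> = \<bar>ip M (kop M K (evec_seq K k)) (evec_seq K k)\<bar>" by simp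
    qed
    also have "\<dots> \<le> C"
      using evec_orthonormal by (intro C) (auto simp: orthonormal_family_def)
    finally show "(\<Sum>k\<le>n. \<bar>eval_seq K k\<bar>) \<le> C" .
  qed simp
qed

end

text \<open>
  The deflated kernels have operator norm \<open>\<bar>eval_seq K N\<bar>\<close>, which tends to \<open>0\<close> because the
  eigenvalues are summable; this gives the convergence of the Schmidt expansion.
\<close>
theorem nuclear_trace_class:
  assumes "nuclear K" and sym: "symmetric K"
  shows "trace_class_kernel M (\<lambda>x y. complex_of_real (K x y))"
proof -
  let ?KC = "\<lambda>x y. complex_of_real (K x y)"
  have K: "good K" using assms by (simp add: nuclear_def)
  define ev where "ev = eval_seq K"
  define e where "e = evec_seq K"
  have eL: "e k \<in> rL2 M" for k unfolding e_def by (rule evec_L2[OF K sym])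
  have [measurable]: "e k \<in> borel_measurable M" for k using eL by (rule rL2_measurable)
  define I where "I = {k. ev k \<noteq> 0}"
  have L2_split: "(\<lambda>x. Re (f x)) \<in> rL2 M" "(\<lambda>x. Im (f x)) \<in> rL2 M" if f: "f \<in> L2 M" for f
  proof -
    have [measurable]: "f \<in> borel_measurable M" and i: "integrable M (\<lambda>x. (cmod (f x))\<^sup>2)"
      using f by (auto simp: L2_def)
    have "integrable M (\<lambda>x. (Re (f x))\<^sup>2)" "integrable M (\<lambda>x. (Im (f x))\<^sup>2)"
      by (rule Bochner_Integration.integrable_bound[OF i]; simp add: cmod_power2)+
    then show "(\<lambda>x. Re (f x)) \<in> rL2 M" "(\<lambda>x. Im (f x)) \<in> rL2 M" by (auto simp: rL2_def)
  qed
  have mult_int: "integrable M (\<lambda>x. complex_of_real (g x) * f x)"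
    "(\<integral>x. complex_of_real (g x) * f x \<partial>M) = Complex (ip M g (\<lambda>x. Re (f x))) (ip M g (\<lambda>x. Im (f x)))"
    if f: "f \<in> L2 M" and g: "g \<in> rL2 M" for f g
  proof -
    have i: "integrable M (\<lambda>x. g x * Re (f x))" "integrable M (\<lambda>x. g x * Im (f x))"
      using L2_split[OF f] g by (auto intro: rL2_integrable_mult)
    have eq: "(\<lambda>x. complex_of_real (g x) * f x)
      = (\<lambda>x. complex_of_real (g x * Re (f x)) + \<i> * complex_of_real (g x * Im (f x)))"
      by (rule ext) (simp add: complex_eq_iff)
    show "integrable M (\<lambda>x. complex_of_real (g x) * f x)"
      unfolding eq by (intro Bochner_Integration.integrable_add integrable_mult_right integrable_of_real i)
    show "(\<integral>x. complex_of_real (g x) * f x \<partial>M) = Complex (ip M g (\<lambda>x. Re (f x))) (ip M g (\<lambda>x. Im (f x)))"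
      unfolding eq
      by (subst Bochner_Integration.integral_add)
        (use i in \<open>auto simp: ip_def Complex_eq intro!: integrable_of_real integrable_mult_right
            simp del: of_real_mult\<close>)
  qed
  have kopC: "kernel_operator M ?KC f x = Complex (kop M K (\<lambda>x. Re (f x)) x) (kop M K (\<lambda>x. Im (f x)) x)"
    if "f \<in> L2 M" "x \<in> space M" for f x
    unfolding kernel_operator_def mult_int(2)[OF that(1) good_section_L2[OF K that(2)]] kop_eq_ip ..
  have innC: "L2_inner M f (\<lambda>x. complex_of_real (g x))
      = Complex (ip M (\<lambda>x. Re (f x)) g) (ip M (\<lambda>x. Im (f x)) g)" if "f \<in> L2 M" "g \<in> rL2 M" for f g
    using mult_int(2)[OF that] by (simp add: L2_inner_def mult.commute ip_commute)
  have of_real_L2: "(\<lambda>x. complex_of_real (g x)) \<in> L2 M" if "g \<in> rL2 M" for g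
    using that by (auto simp: L2_def rL2_def)
  have L2k: "L2_kernel M ?KC"
    unfolding L2_kernel_def
  proof (intro conjI ballI)
    have [measurable]: "case_prod K \<in> borel_measurable (M \<Otimes>\<^sub>M M)" using K by (auto simp: good_def)
    have "(\<lambda>z. complex_of_real (case_prod K z)) \<in> borel_measurable (M \<Otimes>\<^sub>M M)" by measurable
    then show "(\<lambda>(x, y). complex_of_real (K x y)) \<in> borel_measurable (M \<Otimes>\<^sub>M M)"
      by (simp add: split_beta)
    fix f assume f: "f \<in> L2 M"
    show "AE x in M. integrable M (\<lambda>y. complex_of_real (K x y) * f y)"
      using mult_int(1)[OF f good_section_L2[OF K]] by (intro AE_I2)
    let ?g = "\<lambda>x. Complex (kop M K (\<lambda>x. Re (f x)) x) (kop M K (\<lambda>x. Im (f x)) x)"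
    have T: "kop M K (\<lambda>x. Re (f x)) \<in> rL2 M" "kop M K (\<lambda>x. Im (f x)) \<in> rL2 M"
      using L2_split[OF f] by (auto intro: kop_L2 K)
    have "?g \<in> borel_measurable M"
      using T[THEN rL2_measurable] unfolding Complex_eq by measurable
    moreover have "integrable M (\<lambda>x. (cmod (?g x))\<^sup>2)"
      unfolding cmod_power2 complex.sel
      by (intro Bochner_Integration.integrable_add rL2_square_integrable T)
    moreover have "kernel_operator M ?KC f \<in> borel_measurable M \<longleftrightarrow> ?g \<in> borel_measurable M"
      by (intro measurable_cong kopC f)
    moreover have "integrable M (\<lambda>x. (cmod (kernel_operator M ?KC f x))\<^sup>2)
        \<longleftrightarrow> integrable M (\<lambda>x. (cmod (?g x))\<^sup>2)"
      by (intro Bochner_Integration.integrable_cong refl) (simp add: kopC[OF f])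
    ultimately show "kernel_operator M ?KC f \<in> L2 M" by (simp add: L2_def)
  qed
  have ortho: "ip M (e i) (e j) = (if i = j then 1 else 0)" if "i \<in> I" "j \<in> I" for i j
    using evec_orthonormal[OF K sym] that by (simp add: orthonormal_family_def I_def ev_def e_def)
  \<comment> \<open>Singular values must be positive, so the sign of each eigenvalue is moved into
    the second orthonormal system.\<close>
  let ?u = "\<lambda>k x. complex_of_real (e k x)" and ?v = "\<lambda>k x. complex_of_real (sgn (ev k) * e k x)"
  have ev_sum: "summable (\<lambda>k. \<bar>ev k\<bar>)" unfolding ev_def by (rule eval_summable[OF K sym assms(1)])
  have "(\<lambda>k. \<bar>ev k\<bar>) summable_on I"
  proof (rule summable_on_subset_banach)
    show "(\<lambda>k. \<bar>ev k\<bar>) summable_on UNIV"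
      using ev_sum by (intro norm_summable_imp_summable_on) simp
  qed simp
  moreover have "\<forall>k\<in>I. 0 < \<bar>ev k\<bar>" by (simp add: I_def)
  moreover have "L2_orthonormal M I ?u"
    unfolding L2_orthonormal_def
  proof (intro conjI ballI)
    show "?u i \<in> L2 M" for i by (rule of_real_L2[OF eL])
    fix i j assume ij: "i \<in> I" "j \<in> I"
    show "L2_inner M (?u i) (?u j) = (if i = j then 1 else 0)"
      using ortho[OF ij] by (simp add: innC[OF of_real_L2[OF eL] eL] ip_def complex_eq_iff)
  qed
  moreover have "L2_orthonormal M I ?v"
    unfolding L2_orthonormal_def
  proof (intro conjI ballI)
    have vL: "(\<lambda>x. sgn (ev i) * e i x) \<in> rL2 M" for i by (rule rL2_scale[OF eL])
    show "?v i \<in> L2 M" for i by (rule of_real_L2[OF vL])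
    fix i j assume ij: "i \<in> I" "j \<in> I"
    have "ip M (\<lambda>x. sgn (ev i) * e i x) (\<lambda>x. sgn (ev j) * e j x) = (if i = j then 1 else 0)"
      using ij by (auto simp: ip_scale_left ip_scale_right ortho I_def sgn_if)
    then show "L2_inner M (?v i) (?v j) = (if i = j then 1 else 0)"
      unfolding innC[OF of_real_L2[OF vL] vL] by (simp add: ip_def complex_eq_iff)
  qed
  moreover have "(\<lambda>N. \<integral>x. (cmod (kernel_operator M ?KC f x -
      (\<Sum>k\<in>I \<inter> {..<N}. complex_of_real \<bar>ev k\<bar> * L2_inner M f (?u k) * ?v k x)))\<^sup>2 \<partial>M) \<longlonglongrightarrow> 0"
    if f: "f \<in> L2 M" for f
  proof -
    define f1 f2 where "f1 = (\<lambda>x. Re (f x))" and "f2 = (\<lambda>x. Im (f x))"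
    have fL: "f1 \<in> rL2 M" "f2 \<in> rL2 M" using L2_split[OF f] by (auto simp: f1_def f2_def)
    let ?T = "\<lambda>N. kop M (deflate K N)"
    have TL: "?T N f1 \<in> rL2 M" "?T N f2 \<in> rL2 M" for N
      using deflate_good[OF K sym, of N] fL by (auto intro: kop_L2)
    \<comment> \<open>The remainder after N terms of the expansion is exactly the N times deflated
      operator, applied to real and imaginary part.\<close>
    have diff: "kernel_operator M ?KC f x -
      (\<Sum>k\<in>I \<inter> {..<N}. complex_of_real \<bar>ev k\<bar> * L2_inner M f (?u k) * ?v k x)
      = Complex (?T N f1 x) (?T N f2 x)" if x: "x \<in> space M" for N x
    proof -
      have "(\<Sum>k\<in>I \<inter> {..<N}. complex_of_real \<bar>ev k\<bar> * L2_inner M f (?u k) * ?v k x)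
          = (\<Sum>k\<in>I \<inter> {..<N}. Complex (ev k * ip M f1 (e k) * e k x) (ev k * ip M f2 (e k) * e k x))"
      proof (rule sum.cong[OF refl])
        fix k
        have "\<bar>ev k\<bar> * sgn (ev k) = ev k" by (simp add: abs_mult_sgn)
        then have s: "complex_of_real \<bar>ev k\<bar> * complex_of_real (sgn (ev k)) = complex_of_real (ev k)"
          by (metis of_real_mult)
        have "complex_of_real \<bar>ev k\<bar> * L2_inner M f (?u k) * ?v k x
            = (complex_of_real \<bar>ev k\<bar> * complex_of_real (sgn (ev k))) * L2_inner M f (?u k) * complex_of_real (e k x)"
          by (simp add: mult_ac)
        then show "complex_of_real \<bar>ev k\<bar> * L2_inner M f (?u k) * ?v k x
            = Complex (ev k * ip M f1 (e k) * e k x) (ev k * ip M f2 (e k) * e k x)"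
          unfolding s innC[OF f eL] f1_def f2_def by (simp add: complex_eq_iff)
      qed
      also have "\<dots> = (\<Sum>k<N. Complex (ev k * ip M f1 (e k) * e k x) (ev k * ip M f2 (e k) * e k x))"
        by (rule sum.mono_neutral_left) (auto simp: I_def complex_eq_iff)
      finally show ?thesis
        unfolding kopC[OF f x] kop_deflate[OF K sym fL(1) x] kop_deflate[OF K sym fL(2) x]
        by (simp add: complex_eq_iff f1_def f2_def ev_def e_def)
    qed
    have bnd: "ip M (?T N g) (?T N g) \<le> (ev N)\<^sup>2 * ip M g g" if "g \<in> rL2 M" for g N
      using eval_seq_eigenpair[OF K sym, of N] that by (simp add: eigenpair_def ev_def)
    have "(\<integral>x. (cmod (kernel_operator M ?KC f x -
      (\<Sum>k\<in>I \<inter> {..<N}. complex_of_real \<bar>ev k\<bar> * L2_inner M f (?u k) * ?v k x)))\<^sup>2 \<partial>M)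
      = ip M (?T N f1) (?T N f1) + ip M (?T N f2) (?T N f2)" for N
    proof -
      have "(\<integral>x. (cmod (kernel_operator M ?KC f x -
        (\<Sum>k\<in>I \<inter> {..<N}. complex_of_real \<bar>ev k\<bar> * L2_inner M f (?u k) * ?v k x)))\<^sup>2 \<partial>M)
        = (\<integral>x. ?T N f1 x * ?T N f1 x + ?T N f2 x * ?T N f2 x \<partial>M)"
        by (rule Bochner_Integration.integral_cong[OF refl])
          (simp only: diff cmod_power2 complex.sel, simp only: power2_eq_square)
      also have "\<dots> = ip M (?T N f1) (?T N f1) + ip M (?T N f2) (?T N f2)"
        unfolding ip_def by (intro Bochner_Integration.integral_add rL2_integrable_mult TL)
      finally show ?thesis .
    qed
    moreover have "(\<lambda>N. ip M (?T N f1) (?T N f1) + ip M (?T N f2) (?T N f2)) \<longlonglongrightarrow> 0"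
    proof (rule tendsto_sandwich[OF _ _ tendsto_const])
      show "\<forall>\<^sub>F N in sequentially. 0 \<le> ip M (?T N f1) (?T N f1) + ip M (?T N f2) (?T N f2)"
        by (intro always_eventually allI add_nonneg_nonneg ip_nonneg)
      show "\<forall>\<^sub>F N in sequentially. ip M (?T N f1) (?T N f1) + ip M (?T N f2) (?T N f2)
          \<le> \<bar>ev N\<bar>\<^sup>2 * (ip M f1 f1 + ip M f2 f2)"
        unfolding distrib_left power2_abs by (intro always_eventually allI add_mono bnd fL)
      show "(\<lambda>N. \<bar>ev N\<bar>\<^sup>2 * (ip M f1 f1 + ip M f2 f2)) \<longlonglongrightarrow> 0"
        using tendsto_mult[OF tendsto_power[OF summable_LIMSEQ_zero[OF ev_sum]] tendsto_const, of 2 "ip M f1 f1 + ip M f2 f2"]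
        by simp
    qed
    ultimately show ?thesis by simp
  qed
  ultimately show ?thesis
    unfolding trace_class_kernel_def using L2k
    by (intro conjI exI[of _ I] exI[of _ "\<lambda>k. \<bar>ev k\<bar>"] exI[of _ ?u] exI[of _ ?v]) auto
qed

end

section \<open>Half-line integrals with cubic exponential decay\<close>

section \<open>Integrals over the half line\<close>

lemma set_integrable_Ici_bound:
  fixes f :: "real \<Rightarrow> 'a::{banach, second_countable_topology}"
  assumes "set_integrable lborel {a..} g" "continuous_on {a..} f"
    "\<And>t. t \<ge> a \<Longrightarrow> norm (f t) \<le> (g t :: real)"
  shows "set_integrable lborel {a..} f"
proof (rule set_integrable_bound[OF assms(1)])
  show "set_borel_measurable lborel {a..} f"
    unfolding set_borel_measurable_def
    using borel_measurable_continuous_on_indicator[OF _ assms(2)] by simp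
  show "AE t in lborel. t \<in> {a..} \<longrightarrow> norm (f t) \<le> norm (g t)"
    using assms(3) by (intro AE_I2) fastforce
qed

lemma norm_set_integral_Ici_le:
  fixes f :: "real \<Rightarrow> 'a::{banach, second_countable_topology}"
  assumes "set_integrable lborel {a..} g" "set_integrable lborel {a..} f"
    "\<And>t. t \<ge> a \<Longrightarrow> norm (f t) \<le> (g t :: real)"
  shows "norm (LINT t:{a..}|lborel. f t) \<le> (LINT t:{a..}|lborel. g t)"
proof -
  have "norm (LINT t:{a..}|lborel. f t) \<le> (LINT t:{a..}|lborel. norm (f t))"
    by (rule set_integral_norm_bound[OF assms(2)])
  also have "\<dots> \<le> (LINT t:{a..}|lborel. g t)"
    by (intro set_integral_mono set_integrable_norm assms) (use assms(3) in auto)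
  finally show ?thesis .
qed

lemma set_integral_Ici_scale:
  fixes f :: "real \<Rightarrow> 'a::{banach, second_countable_topology}"
  assumes "c > 0"
  shows "(LINT t:{0..}|lborel. f (c * t)) = (1 / c) *\<^sub>R (LINT t:{0..}|lborel. f t)"
proof -
  have "(LINT t:{0..}|lborel. f t) = \<bar>c\<bar> *\<^sub>R (\<integral>t. indicator {0..} (0 + c * t) *\<^sub>R f (0 + c * t) \<partial>lborel)"
    unfolding set_lebesgue_integral_def using assms by (intro lborel_integral_real_affine) simp
  also have "(\<lambda>t. indicator {0..} (0 + c * t) *\<^sub>R f (0 + c * t)) = (\<lambda>t. indicator {0..} t *\<^sub>R f (c * t))"
    using assms by (auto simp: fun_eq_iff indicator_def zero_le_mult_iff)
  finally show ?thesis using assms by (simp add: set_lebesgue_integral_def)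
qed

lemma set_integrable_Ici_scale:
  fixes f :: "real \<Rightarrow> 'a::{banach, second_countable_topology}"
  assumes "c > 0" "set_integrable lborel {0..} f"
  shows "set_integrable lborel {0..} (\<lambda>t. f (c * t))"
proof -
  have "integrable lborel (\<lambda>t. indicator {0..} (0 + c * t) *\<^sub>R f (0 + c * t))"
    using assms unfolding set_integrable_def by (intro lborel_integrable_real_affine) auto
  also have "(\<lambda>t. indicator {0..} (0 + c * t) *\<^sub>R f (0 + c * t)) = (\<lambda>t. indicator {0..} t *\<^sub>R f (c * t))"
    using assms by (auto simp: fun_eq_iff indicator_def zero_le_mult_iff)
  finally show ?thesis by (simp add: set_integrable_def)
qed

lemma set_integral_FTC_Ici:
  fixes F :: "real \<Rightarrow> 'a::euclidean_space"
  assumes "\<And>t. t \<ge> a \<Longrightarrow> (F has_vector_derivative f t) (at t)" "continuous_on {a..} f"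
    "set_integrable lborel {a..} f" "(F \<longlongrightarrow> L) at_top"
  shows "(LINT t:{a..}|lborel. f t) = L - F a"
proof (rule tendsto_unique[OF trivial_limit_at_top_linorder])
  show "((\<lambda>b. LINT t:{a..b}|lborel. f t) \<longlongrightarrow> (LINT t:{a..}|lborel. f t)) at_top"
    by (rule tendsto_set_lebesgue_integral_at_top) (use assms in auto)
  show "((\<lambda>b. LINT t:{a..b}|lborel. f t) \<longlongrightarrow> L - F a) at_top"
  proof (rule Lim_transform_eventually)
    show "((\<lambda>b. F b - F a) \<longlongrightarrow> L - F a) at_top" by (intro tendsto_intros assms)
    show "\<forall>\<^sub>F b in at_top. F b - F a = (LINT t:{a..b}|lborel. f t)"
      using eventually_ge_at_top[of a]
    proof eventually_elim
      case (elim b)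
      have "(f has_integral (F b - F a)) {a..b}"
        using elim assms(1) by (intro fundamental_theorem_of_calculus)
          (auto intro: has_vector_derivative_at_within)
      moreover have "set_integrable lborel {a..b} f"
        by (rule set_integrable_subset[OF assms(3)]) auto
      ultimately show ?case using set_borel_integral_eq_integral(2) integral_unique by metis
    qed
  qed
qed

lemma set_integrable_power_exp:
  assumes "(\<kappa>::real) > 0"
  shows "set_integrable lborel {0..} (\<lambda>t. t ^ k * exp (- \<kappa> * t))"
    "(LINT t:{0..}|lborel. t ^ k * exp (- \<kappa> * t)) = fact k / \<kappa> ^ Suc k"
proof -
  have 1: "has_bochner_integral lborel (\<lambda>x. x ^ k * exp (-x) * indicator {0..} x) (fact k :: real)"
    by (rule has_bochner_integral_I0i_power_exp_m')
  have i: "set_integrable lborel {0..} (\<lambda>t::real. t ^ k * exp (- t))"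
    using integrable.intros[OF 1]
    by (simp add: set_integrable_def mult.commute)
  have v: "(LINT t:{0..}|lborel. t ^ k * exp (- t)) = (fact k :: real)"
    using has_bochner_integral_integral_eq[OF 1] by (simp add: set_lebesgue_integral_def mult.commute)
  have eq: "t ^ k * exp (- \<kappa> * t) = (1 / \<kappa> ^ k) * ((\<kappa> * t) ^ k * exp (- (\<kappa> * t)))" for t
    using assms by (simp add: power_mult_distrib)
  show "set_integrable lborel {0..} (\<lambda>t. t ^ k * exp (- \<kappa> * t))"
    unfolding eq using set_integrable_Ici_scale[OF assms i] by (intro set_integrable_mult_right) simp
  show "(LINT t:{0..}|lborel. t ^ k * exp (- \<kappa> * t)) = fact k / \<kappa> ^ Suc k"
    unfolding eq using set_integral_Ici_scale[OF assms, of "\<lambda>t. t ^ k * exp (- t)"] v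
    by (simp add: set_integral_mult_right)
qed

text \<open>The number sqrt((b+1)/\<kappa>) is the point from which \<kappa> t^3 exceeds (b+1) t;
  before it, (b+1) t is bounded by its value there.\<close>

lemma cubic_exponent_bound:
  fixes \<kappa> b t :: real
  assumes "\<kappa> > 0" "t \<ge> 0" "b \<ge> 0"
  shows "b * t - \<kappa> * t ^ 3 \<le> (b + 1) * sqrt ((b + 1) / \<kappa>) - t"
proof -
  let ?m = "sqrt ((b + 1) / \<kappa>)"
  have m: "?m \<ge> 0" "\<kappa> * ?m\<^sup>2 = b + 1" using assms by auto
  show ?thesis
  proof (cases "t \<le> ?m")
    case True
    then have "(b + 1) * t \<le> (b + 1) * ?m" using assms by (intro mult_left_mono) auto
    moreover have "0 \<le> \<kappa> * t ^ 3" using assms by simp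
    ultimately show ?thesis by (simp add: algebra_simps)
  next
    case False
    then have "?m\<^sup>2 \<le> t\<^sup>2" using m(1) by (intro power_mono) auto
    from mult_left_mono[OF this, of \<kappa>] have "\<kappa> * ?m\<^sup>2 \<le> \<kappa> * t\<^sup>2" using assms by simp
    from mult_right_mono[OF this assms(2)] have "\<kappa> * ?m\<^sup>2 * t \<le> \<kappa> * t\<^sup>2 * t" .
    then have "(b + 1) * t \<le> \<kappa> * t ^ 3" unfolding m(2) by (simp add: power2_eq_square power3_eq_cube mult_ac)
    moreover have "0 \<le> (b + 1) * ?m" using assms m by simp
    ultimately show ?thesis by (simp add: algebra_simps)
  qed
qed

lemma set_integrable_power_exp_cube:
  fixes \<kappa> b :: real
  assumes "\<kappa> > 0"
  shows "set_integrable lborel {0..} (\<lambda>t. t ^ k * exp (b * t - \<kappa> * t ^ 3))"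
proof (rule set_integrable_Ici_bound)
  let ?C = "exp ((\<bar>b\<bar> + 1) * sqrt ((\<bar>b\<bar> + 1) / \<kappa>))"
  show "set_integrable lborel {0..} (\<lambda>t. ?C * (t ^ k * exp (- 1 * t)))"
    using set_integrable_power_exp[of 1 k] by (intro set_integrable_mult_right) simp
  show "continuous_on {0..} (\<lambda>t. t ^ k * exp (b * t - \<kappa> * t ^ 3))" by (intro continuous_intros)
  fix t :: real assume t: "t \<ge> 0"
  have "b * t - \<kappa> * t ^ 3 \<le> \<bar>b\<bar> * t - \<kappa> * t ^ 3" using t by (simp add: mult_right_mono)
  also have "\<dots> \<le> (\<bar>b\<bar> + 1) * sqrt ((\<bar>b\<bar> + 1) / \<kappa>) - t"
    by (rule cubic_exponent_bound[OF assms t]) simp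
  finally have "exp (b * t - \<kappa> * t ^ 3) \<le> ?C * exp (- 1 * t)" by (simp flip: exp_add)
  then have "t ^ k * exp (b * t - \<kappa> * t ^ 3) \<le> t ^ k * (?C * exp (- 1 * t))"
    using t by (intro mult_left_mono) auto
  then show "norm (t ^ k * exp (b * t - \<kappa> * t ^ 3)) \<le> ?C * (t ^ k * exp (- 1 * t))"
    using t by (simp add: mult_ac)
qed

text \<open>These moments are Gamma values in disguise. Only their ratios in steps of 3 are used,
  since both the Airy values at 0 and the saddle point expansion are expressed by them.\<close>

definition cubic_moment :: "nat \<Rightarrow> real" where
  "cubic_moment k = (LINT t:{0..}|lborel. t ^ k * exp (- (t ^ 3) / 3))"

lemma cubic_moment_integrable: "set_integrable lborel {0..} (\<lambda>t::real. t ^ k * exp (- (t ^ 3) / 3))"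
  using set_integrable_power_exp_cube[of "1/3" k 0] by simp

lemma exp_cube_tendsto_0: "((\<lambda>t::real. t ^ k * exp (- (t ^ 3) / 3)) \<longlongrightarrow> 0) at_top"
proof -
  have "((\<lambda>t::real. exp (4/3) * (t ^ k / exp t)) \<longlongrightarrow> 0) at_top"
    using tendsto_mult[OF tendsto_const tendsto_power_div_exp_0[of k], of "exp (4/3)"] by simp
  moreover have "\<forall>\<^sub>F t in at_top. norm (t ^ k * exp (- (t ^ 3) / 3)) \<le> exp (4/3) * (t ^ k / exp t)"
    using eventually_ge_at_top[of 2]
  proof eventually_elim
    case (elim t)
    have "t * 2\<^sup>2 \<le> t * t\<^sup>2" using elim by (intro mult_left_mono power_mono) auto
    then have "4 * t \<le> t ^ 3" by (simp add: power3_eq_cube power2_eq_square mult_ac)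
    then have "- (t ^ 3) / 3 \<le> 4/3 - t" using elim by linarith
    then have "exp (- (t ^ 3) / 3) \<le> exp (4/3) * exp (- t)" by (simp flip: exp_add)
    then have "t ^ k * exp (- (t ^ 3) / 3) \<le> t ^ k * (exp (4/3) * exp (- t))"
      using elim by (intro mult_left_mono) auto
    then show ?case using elim by (simp add: exp_minus field_simps)
  qed
  ultimately show ?thesis by (rule Lim_null_comparison[rotated])
qed

text \<open>Integrate the derivative of -(t^(k+1) exp(-t^3/3)) over the half-line; both boundary
  values vanish.\<close>

lemma cubic_moment_rec: "cubic_moment (k + 3) = (real k + 1) * cubic_moment k"
proof -
  let ?F = "\<lambda>t::real. - (t ^ (k + 1) * exp (- (t ^ 3) / 3))"
  let ?f = "\<lambda>t::real. t ^ (k + 3) * exp (- (t ^ 3) / 3) - (real k + 1) * (t ^ k * exp (- (t ^ 3) / 3))"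
  have i: "set_integrable lborel {0..} (\<lambda>t::real. (real k + 1) * (t ^ k * exp (- (t ^ 3) / 3)))"
    using cubic_moment_integrable[of k] by (intro set_integrable_mult_right) simp
  have "(LINT t:{0..}|lborel. ?f t) = 0 - ?F 0"
  proof (rule set_integral_FTC_Ici)
    fix t :: real
    have 1: "((\<lambda>t. t ^ (k + 1)) has_real_derivative (real k + 1) * t ^ k) (at t)"
      using DERIV_pow[of "k + 1" t UNIV] by (simp add: add.commute)
    have 2: "((\<lambda>t. exp (- (t ^ 3) / 3)) has_real_derivative exp (- (t ^ 3) / 3) * (- t\<^sup>2)) (at t)"
      by (auto intro!: derivative_eq_intros)
    have "(?F has_real_derivative ?f t) (at t)"
      using DERIV_minus[OF DERIV_mult[OF 1 2]]
      by (simp add: algebra_simps power_add power2_eq_square power3_eq_cube)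
    then show "(?F has_vector_derivative ?f t) (at t)" by (simp add: has_real_derivative_iff_has_vector_derivative)
    show "continuous_on {0..} ?f" by (intro continuous_intros) auto
    show "set_integrable lborel {0..} ?f" using cubic_moment_integrable i by (rule set_integral_diff)
    show "(?F \<longlongrightarrow> 0) at_top" using tendsto_minus[OF exp_cube_tendsto_0[of "k + 1"]] by simp
  qed
  moreover have "(LINT t:{0..}|lborel. ?f t) = cubic_moment (k + 3) - (real k + 1) * cubic_moment k"
    unfolding cubic_moment_def using cubic_moment_integrable[of "k+3"] i
    by (subst set_integral_diff) (auto simp: set_integral_mult_right)
  ultimately show ?thesis by simp
qed

lemma cubic_moment_scale:
  assumes "\<delta> > 0"
  shows "(LINT t:{0..}|lborel. t ^ k * exp (- ((t / \<delta>) ^ 3) / 3)) = \<delta> ^ Suc k * cubic_moment k"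
    and "set_integrable lborel {0..} (\<lambda>t. t ^ k * exp (- ((t / \<delta>) ^ 3) / 3))"
proof -
  have eq: "t ^ k * exp (- ((t / \<delta>) ^ 3) / 3) = \<delta> ^ k * ((1 / \<delta> * t) ^ k * exp (- ((1 / \<delta> * t) ^ 3) / 3))" for t
    using assms by (simp add: power_divide)
  have d: "1 / \<delta> > 0" using assms by simp
  show "(LINT t:{0..}|lborel. t ^ k * exp (- ((t / \<delta>) ^ 3) / 3)) = \<delta> ^ Suc k * cubic_moment k"
    unfolding eq set_integral_mult_right cubic_moment_def
    using set_integral_Ici_scale[OF d, of "\<lambda>t. t ^ k * exp (- (t ^ 3) / 3)"] by simp
  show "set_integrable lborel {0..} (\<lambda>t. t ^ k * exp (- ((t / \<delta>) ^ 3) / 3))"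
    unfolding eq
    using set_integrable_Ici_scale[OF d cubic_moment_integrable[of k]] by (intro set_integrable_mult_right) simp
qed

text \<open>The integral defining \<open>airy\<close> converges only conditionally, so it has to be
  reached as a limit of integrals over [0,T].\<close>

lemma has_integral_Ici_limit:
  fixes f :: "real \<Rightarrow> real"
  assumes cont: "continuous_on {0..} f" and lim: "((\<lambda>T. integral {0..T} f) \<longlongrightarrow> L) at_top"
  shows "(f has_integral L) {0..}"
  unfolding has_integral_alt'
proof (intro conjI allI impI)
  fix a b :: real
  have "f integrable_on {max 0 a..b}"
    by (intro integrable_continuous_real continuous_on_subset[OF cont]) auto
  moreover have "{0..} \<inter> cbox a b = {max 0 a..b}" by auto
  ultimately show "(\<lambda>x. if x \<in> {0..} then f x else 0) integrable_on cbox a b"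
    using integrable_restrict_Int[of "{0..}" f "cbox a b"] by simp
next
  fix e :: real assume "e > 0"
  then obtain N where N: "\<And>T. T \<ge> N \<Longrightarrow> dist (integral {0..T} f) L < e"
    using lim unfolding tendsto_iff eventually_at_top_linorder by blast
  show "\<exists>B>0. \<forall>a b. ball 0 B \<subseteq> cbox a b \<longrightarrow>
      norm (integral (cbox a b) (\<lambda>x. if x \<in> {0..} then f x else 0) - L) < e"
  proof (intro exI[of _ "max 1 N"] conjI allI impI)
    fix a b :: real assume "ball 0 (max 1 N) \<subseteq> cbox a b"
    then have "{- max 1 N<..<max 1 N} \<subseteq> {a..b}" by (simp add: ball_eq_greaterThanLessThan)
    then have ab: "a \<le> - max 1 N" "max 1 N \<le> b"
      by (subst (asm) greaterThanLessThan_subseteq_atLeastAtMost_iff; simp)+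
    then have "cbox a b \<inter> {0..} = {0..b}" by auto
    then have "integral (cbox a b) (\<lambda>x. if x \<in> {0..} then f x else 0) = integral {0..b} f"
      using integral_restrict_Int[of "cbox a b" "{0..}" f] ab by (simp add: Int_commute)
    then show "norm (integral (cbox a b) (\<lambda>x. if x \<in> {0..} then f x else 0) - L) < e"
      using N[of b] ab by (simp add: dist_norm)
  qed simp
qed

lemma integral_Ici_FTC:
  fixes F :: "real \<Rightarrow> real"
  assumes "\<And>t. t \<ge> 0 \<Longrightarrow> (F has_real_derivative f t) (at t)" "continuous_on {0..} f" "(F \<longlongrightarrow> L) at_top"
  shows "(f has_integral (L - F 0)) {0..}"
proof (rule has_integral_Ici_limit[OF assms(2)])
  show "((\<lambda>T. integral {0..T} f) \<longlongrightarrow> L - F 0) at_top"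
  proof (rule Lim_transform_eventually)
    show "((\<lambda>T. F T - F 0) \<longlongrightarrow> L - F 0) at_top" by (intro tendsto_intros assms)
    show "\<forall>\<^sub>F T in at_top. F T - F 0 = integral {0..T} f"
      using eventually_ge_at_top[of 0]
    proof eventually_elim
      case (elim T)
      have "(f has_integral (F T - F 0)) {0..T}"
        using elim assms(1) by (intro fundamental_theorem_of_calculus)
          (auto intro: has_field_derivative_at_within simp flip: has_real_derivative_iff_has_vector_derivative)
      then show ?case by (simp add: integral_unique)
    qed
  qed
qed

section \<open>The Airy function on a rotated ray; derivatives, differential equation and
  decay\<close>

section \<open>The Airy function as an absolutely convergent integral\<close>

text \<open>\<open>\<omega>\<close> = exp(i \<pi>/6) is the direction in which i z^3/3 becomes
  -r^3/3, and \<open>\<zeta>\<close> = i \<open>\<omega>\<close> = exp(2 \<pi> i/3) is the factor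
  that then multiplies x r. The same \<open>\<zeta>\<close> will be the steepest descent direction
  for the Laguerre integral.\<close>

definition \<omega> :: complex where "\<omega> = Complex (sqrt 3 / 2) (1 / 2)"
definition \<zeta> :: complex where "\<zeta> = Complex (- 1 / 2) (sqrt 3 / 2)"

lemma Re_\<omega>: "Re \<omega> = sqrt 3 / 2" and Im_\<omega>: "Im \<omega> = 1 / 2"
  and Re_\<zeta>: "Re \<zeta> = - 1 / 2" and Im_\<zeta>: "Im \<zeta> = sqrt 3 / 2"
  by (simp_all add: \<omega>_def \<zeta>_def)

lemma norm_\<omega>: "cmod \<omega> = 1" and norm_\<zeta>: "cmod \<zeta> = 1"
  by (simp_all add: cmod_def Re_\<omega> Im_\<omega> Re_\<zeta> Im_\<zeta> power_divide)

lemma i_\<omega>: "\<i> * \<omega> = \<zeta>" and \<zeta>_squared: "\<zeta>\<^sup>2 = Complex (- 1 / 2) (- sqrt 3 / 2)"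
  by (simp_all add: complex_eq_iff Re_\<omega> Im_\<omega> Re_\<zeta> Im_\<zeta> power2_eq_square)

lemma \<zeta>_cubed: "\<zeta> ^ 3 = 1"
proof -
  have "\<zeta> ^ 3 = \<zeta> * \<zeta>\<^sup>2" by (simp add: power3_eq_cube power2_eq_square)
  then show ?thesis by (simp add: \<zeta>_squared complex_eq_iff Re_\<zeta> Im_\<zeta>)
qed

lemma \<omega>_\<zeta>_squared: "\<omega> * \<zeta>\<^sup>2 = - \<i>"
  by (simp add: \<zeta>_squared complex_eq_iff Re_\<omega> Im_\<omega>)

lemma \<omega>_cubed: "\<omega> ^ 3 = \<i>"
proof -
  have 2: "\<omega>\<^sup>2 = Complex (1 / 2) (sqrt 3 / 2)"
    by (simp add: complex_eq_iff Re_\<omega> Im_\<omega> power2_eq_square)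
  have "\<omega> * \<omega>\<^sup>2 = \<i>" unfolding 2 by (simp add: complex_eq_iff Re_\<omega> Im_\<omega>)
  then show ?thesis by (simp add: power3_eq_cube power2_eq_square mult.assoc)
qed

lemma cmod_exp_le_quadratic:
  fixes z :: complex
  shows "cmod (exp z - 1 - z) \<le> (cmod z)\<^sup>2 * exp (cmod z)"
  using Taylor_exp_field[of z 1] by (simp add: power2_eq_square algebra_simps)

text \<open>Converts a quadratic remainder obtained under the integral sign into a
  derivative.\<close>

lemma has_vector_derivative_quadratic:
  fixes f :: "real \<Rightarrow> 'a::real_normed_vector"
  assumes "\<And>h. \<bar>h\<bar> \<le> 1 \<Longrightarrow> norm (f (x + h) - f x - h *\<^sub>R D) \<le> C * h\<^sup>2"
  shows "(f has_vector_derivative D) (at x)"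
  unfolding has_vector_derivative_def has_derivative_at2
proof (intro conjI)
  have C: "0 \<le> C" using order_trans[OF norm_ge_zero assms[of 1]] by simp
  have "((\<lambda>y. norm ((1 / norm (y - x)) *\<^sub>R (f y - (f x + (y - x) *\<^sub>R D)))) \<longlongrightarrow> 0) (at x)"
  proof (rule tendsto_sandwich[OF _ _ tendsto_const])
    show "\<forall>\<^sub>F y in at x. norm ((1 / norm (y - x)) *\<^sub>R (f y - (f x + (y - x) *\<^sub>R D))) \<le> C * \<bar>y - x\<bar>"
      unfolding eventually_at
    proof (intro exI[of _ 1] conjI ballI impI)
      fix y assume y: "y \<noteq> x \<and> dist y x < 1"
      have "norm (f y - (f x + (y - x) *\<^sub>R D)) \<le> C * (y - x)\<^sup>2"
        using assms[of "y - x"] y by (simp add: dist_real_def algebra_simps)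
      then have "norm (f y - (f x + (y - x) *\<^sub>R D)) / \<bar>y - x\<bar> \<le> C * (y - x)\<^sup>2 / \<bar>y - x\<bar>"
        by (rule divide_right_mono) simp
      also have "C * (y - x)\<^sup>2 / \<bar>y - x\<bar> = C * \<bar>y - x\<bar>"
        using y by (simp add: power2_eq_square divide_simps abs_if algebra_simps)
      finally show "norm ((1 / norm (y - x)) *\<^sub>R (f y - (f x + (y - x) *\<^sub>R D))) \<le> C * \<bar>y - x\<bar>"
        unfolding norm_scaleR real_norm_def by (simp only: abs_divide abs_one abs_idempotent times_divide_eq_left mult_1)
    qed simp
    show "((\<lambda>y. C * \<bar>y - x\<bar>) \<longlongrightarrow> 0) (at x)"
      by (auto intro!: tendsto_eq_intros)
  qed auto
  then show "((\<lambda>y. (1 / norm (y - x)) *\<^sub>R (f y - (f x + (y - x) *\<^sub>R D))) \<longlongrightarrow> 0) (at x)"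
    by (rule tendsto_norm_zero_cancel)
qed (intro bounded_linear_scaleR_left)

text \<open>This is exp(i (z^3/3 + x z)) on the ray z = \<open>\<omega>\<close> t, with the power
  t^k that k differentiations in x bring down.\<close>

definition airy_integrand :: "real \<Rightarrow> nat \<Rightarrow> real \<Rightarrow> complex" where
  "airy_integrand x k t = complex_of_real (t ^ k) * exp (of_real (- (t ^ 3) / 3) + of_real (x * t) * \<zeta>)"

definition airy_moment :: "nat \<Rightarrow> real \<Rightarrow> complex" where
  "airy_moment k x = (LINT t:{0..}|lborel. airy_integrand x k t)"

text \<open>\<open>Ai k\<close> is the k-th derivative of the Airy function: every differentiation
  contributes a factor \<open>\<zeta>\<close> t.\<close>

definition Ai :: "nat \<Rightarrow> real \<Rightarrow> real" where
  "Ai k x = Re (\<omega> * \<zeta> ^ k * airy_moment k x) / pi"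

lemma norm_airy_integrand:
  assumes "t \<ge> 0"
  shows "cmod (airy_integrand x k t) = t ^ k * exp ((- x / 2) * t - (1 / 3) * t ^ 3)"
  using assms by (simp add: airy_integrand_def norm_mult Re_\<zeta> norm_power algebra_simps)

lemma airy_integrand_continuous: "continuous_on A (airy_integrand x k)"
  unfolding airy_integrand_def by (intro continuous_intros) simp

lemma airy_integrand_integrable: "set_integrable lborel {0..} (airy_integrand x k)"
proof (rule set_integrable_Ici_bound)
  show "set_integrable lborel {0..} (\<lambda>t. t ^ k * exp ((- x / 2) * t - (1 / 3) * t ^ 3))"
    by (rule set_integrable_power_exp_cube) simp
  show "cmod (airy_integrand x k t) \<le> t ^ k * exp ((- x / 2) * t - (1 / 3) * t ^ 3)" if "t \<ge> 0" for t
    using norm_airy_integrand[OF that] by simp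
qed (rule airy_integrand_continuous)

text \<open>Expand exp(h t \<open>\<zeta>\<close>) to first order; the quadratic remainder carries
  t^(k+2) and at most linear exponential growth, which the cubic decay integrates.\<close>

lemma airy_moment_derivative:
  "(airy_moment k has_vector_derivative \<zeta> * airy_moment (Suc k) x) (at x)"
proof (rule has_vector_derivative_quadratic)
  let ?B = "\<lambda>t::real. t ^ (k + 2) * exp ((\<bar>x\<bar> + 1) * t - (1 / 3) * t ^ 3)"
  let ?C = "LINT t:{0..}|lborel. ?B t"
  fix h :: real assume h: "\<bar>h\<bar> \<le> 1"
  let ?R = "\<lambda>t. airy_integrand (x + h) k t - airy_integrand x k t - of_real h * (\<zeta> * airy_integrand x (Suc k) t)"
  have iS: "set_integrable lborel {0..} (\<lambda>t. of_real h * (\<zeta> * airy_integrand x (Suc k) t))"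
    using airy_integrand_integrable[of x "Suc k"] by (intro set_integrable_mult_right) simp
  have iR: "set_integrable lborel {0..} ?R"
    using airy_integrand_integrable iS by (intro set_integral_diff(1))
  have iB: "set_integrable lborel {0..} (\<lambda>t. h\<^sup>2 * ?B t)"
    using set_integrable_power_exp_cube[of "1/3" "k+2" "\<bar>x\<bar> + 1"] by (intro set_integrable_mult_right) simp
  have "airy_moment k (x + h) - airy_moment k x - h *\<^sub>R (\<zeta> * airy_moment (Suc k) x)
      = (LINT t:{0..}|lborel. ?R t)"
    unfolding airy_moment_def
    using airy_integrand_integrable iS
    by (simp add: set_integral_diff set_integral_mult_right scaleR_conv_of_real)
  also have "norm \<dots> \<le> (LINT t:{0..}|lborel. h\<^sup>2 * ?B t)"
  proof (rule norm_set_integral_Ici_le[OF iB iR])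
    fix t :: real assume t: "t \<ge> 0"
    define z where "z = of_real (h * t) * \<zeta>"
    have nz: "cmod z = \<bar>h\<bar> * t" using t by (simp add: z_def norm_mult abs_mult norm_\<zeta>)
    have "complex_of_real (- (t ^ 3) / 3) + of_real ((x + h) * t) * \<zeta>
        = (of_real (- (t ^ 3) / 3) + of_real (x * t) * \<zeta>) + z"
      by (simp add: z_def algebra_simps)
    then have "airy_integrand (x + h) k t = airy_integrand x k t * exp z"
      unfolding airy_integrand_def by (simp only: exp_add mult.assoc)
    moreover have "of_real h * (\<zeta> * airy_integrand x (Suc k) t) = airy_integrand x k t * z"
      by (simp add: airy_integrand_def z_def)
    ultimately have "?R t = airy_integrand x k t * (exp z - 1 - z)" by (simp add: algebra_simps)
    then have "cmod (?R t) \<le> cmod (airy_integrand x k t) * ((\<bar>h\<bar> * t)\<^sup>2 * exp (\<bar>h\<bar> * t))"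
      using cmod_exp_le_quadratic[of z] by (simp add: norm_mult nz mult_left_mono)
    also have "\<dots> = h\<^sup>2 * (t ^ (k + 2) * (exp ((- x / 2) * t - (1 / 3) * t ^ 3) * exp (\<bar>h\<bar> * t)))"
      unfolding norm_airy_integrand[OF t] by (simp add: power_mult_distrib power_add power2_eq_square mult_ac)
    also have "\<dots> \<le> h\<^sup>2 * (t ^ (k + 2) * exp ((\<bar>x\<bar> + 1) * t - (1 / 3) * t ^ 3))"
    proof (intro mult_left_mono)
      have "- (x * t) \<le> \<bar>x\<bar> * t" using t by (metis abs_ge_minus_self minus_mult_left mult_right_mono)
      then have "- (x * t / 2) \<le> \<bar>x\<bar> * t" using t by (smt (verit) field_sum_of_halves mult_nonneg_nonneg abs_ge_zero)
      moreover have "\<bar>h\<bar> * t \<le> 1 * t" using h t by (intro mult_right_mono) auto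
      ultimately show "exp ((- x / 2) * t - (1 / 3) * t ^ 3) * exp (\<bar>h\<bar> * t) \<le> exp ((\<bar>x\<bar> + 1) * t - (1 / 3) * t ^ 3)"
        by (simp add: algebra_simps flip: exp_add)
    qed (use t in auto)
    finally show "norm (?R t) \<le> h\<^sup>2 * ?B t" .
  qed
  also have "\<dots> = ?C * h\<^sup>2" by (simp add: set_integral_mult_right)
  finally show "norm (airy_moment k (x + h) - airy_moment k x - h *\<^sub>R (\<zeta> * airy_moment (Suc k) x)) \<le> ?C * h\<^sup>2" .
qed

lemma Ai_derivative: "(Ai k has_real_derivative Ai (Suc k) x) (at x)"
proof -
  have "((\<lambda>x. Re (\<omega> * \<zeta> ^ k * airy_moment k x) / pi) has_vector_derivative
      Re (\<omega> * \<zeta> ^ k * (\<zeta> * airy_moment (Suc k) x)) / pi) (at x)"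
    by (intro has_vector_derivative_divide bounded_linear.has_vector_derivative[OF bounded_linear_Re] has_vector_derivative_mult_right airy_moment_derivative)
  then show ?thesis
    unfolding has_real_derivative_iff_has_vector_derivative Ai_def[abs_def] by (simp add: mult_ac)
qed

lemma Ai_continuous: "continuous_on A (Ai k)"
  using Ai_derivative by (meson DERIV_continuous continuous_at_imp_continuous_on)

text \<open>The integrand is the total derivative of the exponential, whose boundary value at 0
  supplies the summand 1.\<close>

lemma airy_moment_2: "airy_moment 2 x = of_real x * \<zeta> * airy_moment 0 x + 1"
proof -
  let ?F = "\<lambda>t. exp (complex_of_real (- (t ^ 3) / 3) + of_real (x * t) * \<zeta>)"
  let ?f = "\<lambda>t. of_real x * \<zeta> * airy_integrand x 0 t - airy_integrand x 2 t"
  have i: "set_integrable lborel {0..} (\<lambda>t. of_real x * \<zeta> * airy_integrand x 0 t)"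
    using airy_integrand_integrable[of x 0] by (intro set_integrable_mult_right) simp
  have "(LINT t:{0..}|lborel. ?f t) = 0 - ?F 0"
  proof (rule set_integral_FTC_Ici)
    fix t :: real
    have "((\<lambda>z. exp (- (z ^ 3) / 3 + of_real x * z * \<zeta>)) has_field_derivative
        exp (- (of_real t ^ 3) / 3 + of_real x * of_real t * \<zeta>) * (- (of_real t)\<^sup>2 + of_real x * \<zeta>)) (at (of_real t))"
      by (auto intro!: derivative_eq_intros)
    from has_vector_derivative_real_field[OF this]
    show "(?F has_vector_derivative ?f t) (at t)"
      by (simp add: airy_integrand_def algebra_simps)
    show "continuous_on {0..} ?f" by (intro continuous_intros airy_integrand_continuous)
    show "set_integrable lborel {0..} ?f"
      by (intro set_integral_diff(1) i airy_integrand_integrable)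
    show "(?F \<longlongrightarrow> 0) at_top"
    proof (rule tendsto_norm_zero_cancel)
      have "((\<lambda>t::real. exp (- (x * t / 2) - t ^ 3 / 3)) \<longlongrightarrow> 0) at_top" by real_asymp
      then show "((\<lambda>t. cmod (?F t)) \<longlongrightarrow> 0) at_top" by (simp add: Re_\<zeta>)
    qed
  qed
  moreover have "(LINT t:{0..}|lborel. ?f t) = of_real x * \<zeta> * airy_moment 0 x - airy_moment 2 x"
    unfolding airy_moment_def using i airy_integrand_integrable[of x 2]
    by (simp add: set_integral_diff set_integral_mult_right)
  ultimately show ?thesis by (simp add: algebra_simps)
qed

text \<open>The Airy equation. The boundary term of \<open>airy_moment_2\<close> is multiplied by
  \<open>\<omega> * \<zeta>\<^sup>2\<close> = -i and so disappears from the real part.\<close>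

lemma Ai_2: "Ai 2 x = x * Ai 0 x"
proof -
  have "\<omega> * \<zeta>\<^sup>2 * airy_moment 2 x = \<zeta> ^ 3 * (of_real x * (\<omega> * airy_moment 0 x)) + \<omega> * \<zeta>\<^sup>2"
    unfolding airy_moment_2 by (simp add: algebra_simps power2_eq_square power3_eq_cube)
  then show ?thesis
    unfolding Ai_def \<zeta>_cubed \<omega>_\<zeta>_squared by simp
qed

lemma Ai_3: "Ai 3 x = Ai 0 x + x * Ai 1 x"
proof -
  have "((\<lambda>x. x * Ai 0 x) has_real_derivative Ai 0 x + x * Ai 1 x) (at x)"
    using DERIV_mult[OF DERIV_ident Ai_derivative[of 0 x]] by (simp add: mult.commute)
  then show ?thesis
    using Ai_derivative[of 2 x] DERIV_unique unfolding Ai_2[abs_def] by (metis eval_nat_numeral(3))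
qed

text \<open>For positive x the factor exp(-x t/2) alone makes the integral converge. The resulting
  algebraic decay, improved through the Airy equation, is all that the trace class argument
  requires.\<close>

lemma Ai_decay:
  assumes "x > 0"
  shows "\<bar>Ai k x\<bar> \<le> fact k * 2 ^ Suc k / x ^ Suc k"
proof -
  have "cmod (airy_moment k x) \<le> (LINT t:{0..}|lborel. t ^ k * exp (- (x / 2) * t))"
    unfolding airy_moment_def
  proof (rule norm_set_integral_Ici_le)
    show "set_integrable lborel {0..} (\<lambda>t. t ^ k * exp (- (x / 2) * t))"
      using assms by (intro set_integrable_power_exp) simp
    show "norm (airy_integrand x k t) \<le> t ^ k * exp (- (x / 2) * t)" if "t \<ge> 0" for t
      unfolding norm_airy_integrand[OF that] using that by (intro mult_left_mono) auto
  qed (rule airy_integrand_integrable)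
  also have "\<dots> = fact k / (x / 2) ^ Suc k"
    using assms by (intro set_integrable_power_exp(2)) simp
  finally have 1: "cmod (airy_moment k x) \<le> fact k * 2 ^ Suc k / x ^ Suc k"
    by (simp add: power_divide)
  have "\<bar>Re (\<omega> * \<zeta> ^ k * airy_moment k x)\<bar> \<le> cmod (\<omega> * \<zeta> ^ k * airy_moment k x)"
    by (rule abs_Re_le_cmod)
  also have "\<dots> = cmod (airy_moment k x)" by (simp add: norm_mult norm_power norm_\<omega> norm_\<zeta>)
  finally have "\<bar>Ai k x\<bar> \<le> cmod (airy_moment k x) / pi"
    by (simp add: Ai_def divide_right_mono)
  also have "\<dots> \<le> cmod (airy_moment k x) / 1" using pi_ge_two by (intro divide_left_mono) auto
  finally show ?thesis using 1 by simp
qed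

text \<open>
  The Cauchy theorem on the triangle with vertices \<open>0\<close>, \<open>T\<close> and \<open>T + i T / \<surd>3\<close> rotates the ray of
  integration to the direction \<open>\<omega>\<close>.
\<close>
lemma airy_partial_integral_tendsto:
  "((\<lambda>T. integral {0..T} (\<lambda>t. cos (t ^ 3 / 3 + x * t))) \<longlongrightarrow> pi * Ai 0 x) at_top"
proof -
  define f where "f = (\<lambda>z::complex. exp (\<i> * z ^ 3 / 3 + \<i> * of_real x * z))"
  have f_hol: "f holomorphic_on A" for A unfolding f_def by (intro holomorphic_intros) auto
  have f_cont: "continuous_on A f" for A by (rule holomorphic_on_imp_continuous_on[OF f_hol])
  \<comment> \<open>The hypotenuse of the triangle has length 2 T / sqrt 3 for horizontal leg
    T.\<close>
  define c where "c = 2 / sqrt 3"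
  have c: "c > 0" by (simp add: c_def)
  define P where "P T = complex_of_real (c * T) * \<omega>" for T
  have P: "P T = Complex T (T / sqrt 3)" for T
    by (simp add: P_def c_def complex_eq_iff Re_\<omega> Im_\<omega> field_simps)
  have norm_side: "cmod (f (Complex T v)) = exp (- (T\<^sup>2 * v) + v ^ 3 / 3 - x * v)" for T v
    by (simp add: f_def power3_eq_cube power2_eq_square field_simps)
  define side where "side T = contour_integral (linepath (of_real T) (P T)) f" for T
  have split: "complex_of_real (integral {0..T} (\<lambda>t. cos (t ^ 3 / 3 + x * t)))
      = of_real (Re (\<omega> * (LINT t:{0..c * T}|lborel. airy_integrand x 0 t) - side T))" if T: "T > 0" for T
  proof -
    have ci: "f contour_integrable_on linepath a b" for a b
      by (intro contour_integrable_continuous_linepath f_cont)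
    have "contour_integral (linepath 0 (of_real T) +++ linepath (of_real T) (P T) +++ linepath (P T) 0) f = 0"
      by (intro contour_integral_unique Cauchy_theorem_triangle f_hol)
    then have sum0: "contour_integral (linepath 0 (of_real T)) f + side T + contour_integral (linepath (P T) 0) f = 0"
      by (simp add: ci side_def contour_integrable_joinI add.assoc)
    have "contour_integral (linepath 0 (of_real T)) f = integral {0..T} (\<lambda>t. f (of_real t))"
      using contour_integral_linepath_Reals_eq[of 0 "of_real T" f] T by simp
    have "((\<lambda>t. f (linepath 0 (P T) t) * (P T - 0)) has_integral contour_integral (linepath 0 (P T)) f) {0..1}"
      using has_contour_integral_integral[OF ci] by (simp only: has_contour_integral_linepath)
    moreover have "f (linepath 0 (P T) t) * (P T - 0) = (c * T) *\<^sub>R (\<omega> * airy_integrand x 0 (c * T * t))" for t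
    proof -
      have l: "linepath 0 (P T) t = of_real (c * T * t) * \<omega>"
        by (simp add: linepath_def P_def scaleR_conv_of_real)
      have 3: "\<i> * (of_real r * \<omega>) ^ 3 / 3 = of_real (- (r ^ 3) / 3)" for r
        by (simp add: power_mult_distrib \<omega>_cubed mult.left_commute[of \<i>])
      have 1: "\<i> * of_real x * (of_real r * \<omega>) = of_real (x * r) * \<zeta>" for r
        by (simp flip: i_\<omega>)
      show ?thesis unfolding l f_def 3 1 by (simp add: airy_integrand_def P_def scaleR_conv_of_real)
    qed
    ultimately have "((\<lambda>t. (c * T) *\<^sub>R (\<omega> * airy_integrand x 0 (c * T * t))) has_integral
        contour_integral (linepath 0 (P T)) f) {0..1}" by simp
    moreover have "((\<lambda>t. (c * T) *\<^sub>R (\<omega> * airy_integrand x 0 (c * T * t))) has_integral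
        (\<omega> * (LINT t:{0..c * T}|lborel. airy_integrand x 0 t))) {0..1}"
    proof -
      have s: "set_integrable lborel {0..c * T} (airy_integrand x 0)"
        by (rule set_integrable_subset[OF airy_integrand_integrable]) auto
      have "((\<lambda>t. \<omega> * airy_integrand x 0 t) has_integral \<omega> * (LINT t:{0..c * T}|lborel. airy_integrand x 0 t)) {0..c * T}"
        unfolding set_borel_integral_eq_integral(2)[OF s]
        by (intro has_integral_mult_right integrable_integral set_borel_integral_eq_integral(1) s)
      then have "((\<lambda>t. \<omega> * airy_integrand x 0 (c * T * t)) has_integral
          (1 / (c * T)) *\<^sub>R (\<omega> * (LINT t:{0..c * T}|lborel. airy_integrand x 0 t))) ((\<lambda>t. t / (c * T)) ` {0..c * T})"
        using has_integral_stretch_real[of "\<lambda>t. \<omega> * airy_integrand x 0 t" _ 0 "c * T" "c * T"] T c by simp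
      moreover have "(\<lambda>t. t / (c * T)) ` {0..c * T} = {0..1}"
        using T c by (simp add: image_divide_atLeastAtMost)
      ultimately have "((\<lambda>t. \<omega> * airy_integrand x 0 (c * T * t)) has_integral
          (1 / (c * T)) *\<^sub>R (\<omega> * (LINT t:{0..c * T}|lborel. airy_integrand x 0 t))) {0..1}" by simp
      from has_integral_cmul[OF this, of "c * T"] show ?thesis using T c by simp
    qed
    ultimately have "contour_integral (linepath 0 (P T)) f = \<omega> * (LINT t:{0..c * T}|lborel. airy_integrand x 0 t)"
      by (rule has_integral_unique)
    moreover have "contour_integral (linepath (P T) 0) f = - contour_integral (linepath 0 (P T)) f"
      by (metis contour_integral_reversepath reversepath_linepath valid_path_linepath)
    ultimately have "contour_integral (linepath 0 (of_real T)) f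
        = \<omega> * (LINT t:{0..c * T}|lborel. airy_integrand x 0 t) - side T"
      using sum0 by algebra
    moreover have "contour_integral (linepath 0 (of_real T)) f = integral {0..T} (\<lambda>t. f (of_real t))"
      by fact
    moreover have "Re (integral {0..T} (\<lambda>t. f (of_real t))) = integral {0..T} (\<lambda>t. Re (f (of_real t)))"
    proof -
      have "(\<lambda>t. f (of_real t)) integrable_on {0..T}"
        unfolding f_def by (intro integrable_continuous_real continuous_intros) auto
      from has_integral_linear[OF integrable_integral[OF this] bounded_linear_Re]
      show ?thesis by (simp add: integral_unique o_def)
    qed
    moreover have "Re (f (of_real t)) = cos (t ^ 3 / 3 + x * t)" for t
    proof -
      have "\<i> * complex_of_real t ^ 3 / 3 + \<i> * of_real x * of_real t = \<i> * of_real (t ^ 3 / 3 + x * t)"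
        by (simp add: algebra_simps)
      then show ?thesis unfolding f_def by (simp only: exp_eq_polar) (simp add: Re_exp)
    qed
    ultimately show ?thesis by simp
  qed
  have side_bound: "cmod (side T) \<le> 2 / T\<^sup>2" if T: "T \<ge> 1" "T\<^sup>2 \<ge> 3 * \<bar>x\<bar>" for T
  proof -
    have eq: "side T = integral {0..1} (\<lambda>t. f (linepath (of_real T) (P T) t) * (P T - of_real T))"
      unfolding side_def contour_integral_integral by simp
    have l: "linepath (of_real T) (P T) t = Complex T (T / sqrt 3 * t)" for t
      by (simp add: linepath_def P complex_eq_iff algebra_simps)
    let ?a = "T\<^sup>2 / 2 * (T / sqrt 3)"
    have a: "?a > 0" using T by simp
    have "norm (side T) \<le> integral {0..1} (\<lambda>t. T / sqrt 3 * exp (- (?a * t)))"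
      unfolding eq
    proof (rule integral_norm_bound_integral)
      show "(\<lambda>t. f (linepath (of_real T) (P T) t) * (P T - of_real T)) integrable_on {0..1}"
        by (intro integrable_continuous_real continuous_intros continuous_on_compose2[OF f_cont]) auto
      show "(\<lambda>t. T / sqrt 3 * exp (- (?a * t))) integrable_on {0..1}"
        by (intro integrable_continuous_real continuous_intros)
      fix t :: real assume t: "t \<in> {0..1}"
      let ?v = "T / sqrt 3 * t"
      have v: "0 \<le> ?v" using T t by simp
      \<comment> \<open>On the vertical side v^2/3 <= T^2/9 and |x| <= T^2/3, so the exponent is at
        most -v T^2/2; integrating this exponential gives the bound 2/T^2.\<close>
      have "?v\<^sup>2 \<le> T\<^sup>2 / 3"
      proof -
        have "?v\<^sup>2 = T\<^sup>2 / 3 * t\<^sup>2" by (simp add: power_mult_distrib power_divide)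
        also have "\<dots> \<le> T\<^sup>2 / 3 * 1" using t by (intro mult_left_mono) (auto simp: power_le_one)
        finally show ?thesis by simp
      qed
      then have "- T\<^sup>2 + ?v\<^sup>2 / 3 - x \<le> - (T\<^sup>2 / 2)" using T by linarith
      note le = mult_left_mono[OF this v]
      have "- (T\<^sup>2 * v) + v ^ 3 / 3 - x * v = v * (- T\<^sup>2 + v\<^sup>2 / 3 - x)" for v
        by (simp add: algebra_simps power2_eq_square power3_eq_cube)
      moreover have "- (?a * t) = ?v * - (T\<^sup>2 / 2)" by (simp add: mult_ac)
      ultimately have "- (T\<^sup>2 * ?v) + ?v ^ 3 / 3 - x * ?v \<le> - (?a * t)"
        using le by metis
      then have "cmod (f (linepath (of_real T) (P T) t)) \<le> exp (- (?a * t))"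
        unfolding l norm_side by simp
      moreover have "cmod (P T - of_real T) = T / sqrt 3"
      proof -
        have "P T - of_real T = of_real (T / sqrt 3) * \<i>" by (simp add: P complex_eq_iff)
        then show ?thesis using T by (simp add: norm_mult norm_divide)
      qed
      ultimately show "norm (f (linepath (of_real T) (P T) t) * (P T - of_real T)) \<le> T / sqrt 3 * exp (- (?a * t))"
        by (metis mult.commute mult_right_mono norm_ge_zero norm_mult)
    qed
    also have "\<dots> = T / sqrt 3 * ((1 - exp (- ?a)) / ?a)"
    proof -
      have "integral {0..1} (\<lambda>t. k * exp (- (a * t))) = k * ((1 - exp (- a)) / a)" if "a > 0" for a k :: real
      proof -
        have "((\<lambda>t. k * exp (- (a * t))) has_integral
            (k * (- exp (- (a * 1)) / a) - k * (- exp (- (a * 0)) / a))) {0..1}"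
          using that by (intro fundamental_theorem_of_calculus)
            (auto intro!: derivative_eq_intros simp flip: has_real_derivative_iff_has_vector_derivative)
        then have "integral {0..1} (\<lambda>t. k * exp (- (a * t)))
            = k * (- exp (- (a * 1)) / a) - k * (- exp (- (a * 0)) / a)"
          by (rule integral_unique)
        also have "\<dots> = k * ((1 - exp (- a)) / a)" by (simp add: diff_divide_distrib right_diff_distrib)
        finally show ?thesis .
      qed
      from this[OF a] show ?thesis .
    qed
    also have "\<dots> \<le> T / sqrt 3 * (1 / ?a)"
      using a T by (intro mult_left_mono divide_right_mono) auto
    also have "\<dots> = 2 / T\<^sup>2" using T by (simp add: field_simps)
    finally show ?thesis .
  qed
  have "(side \<longlongrightarrow> 0) at_top"
  proof (rule Lim_null_comparison)
    have "\<forall>\<^sub>F T in at_top. T\<^sup>2 \<ge> 3 * \<bar>x\<bar>" by real_asymp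
    then show "\<forall>\<^sub>F T in at_top. norm (side T) \<le> 2 / T\<^sup>2"
      using eventually_ge_at_top[of 1] by eventually_elim (rule side_bound)
    show "((\<lambda>T::real. 2 / T\<^sup>2) \<longlongrightarrow> 0) at_top" by real_asymp
  qed
  moreover have "((\<lambda>T. LINT t:{0..c * T}|lborel. airy_integrand x 0 t) \<longlongrightarrow> airy_moment 0 x) at_top"
  proof -
    have "filterlim (\<lambda>T. c * T) at_top at_top" using c by real_asymp
    from filterlim_compose[OF tendsto_set_lebesgue_integral_at_top[OF _ airy_integrand_integrable] this]
    show ?thesis by (simp add: airy_moment_def)
  qed
  ultimately have lim: "((\<lambda>T. Re (\<omega> * (LINT t:{0..c * T}|lborel. airy_integrand x 0 t) - side T)) \<longlongrightarrow>
      Re (\<omega> * airy_moment 0 x - 0)) at_top"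
    by (intro tendsto_intros)
  have ev: "\<forall>\<^sub>F T in at_top. Re (\<omega> * (LINT t:{0..c * T}|lborel. airy_integrand x 0 t) - side T)
      = integral {0..T} (\<lambda>t. cos (t ^ 3 / 3 + x * t))"
    using eventually_gt_at_top[of 0]
  proof eventually_elim
    case (elim T)
    then show ?case using split[of T] by (simp only: of_real_eq_iff)
  qed
  have "Re (\<omega> * airy_moment 0 x - 0) = pi * Ai 0 x" by (simp add: Ai_def)
  from Lim_transform_eventually[OF lim ev, unfolded this] show ?thesis .
qed

lemma airy_eq_Ai: "airy = Ai 0"
proof
  fix x
  have "((\<lambda>t. cos (t ^ 3 / 3 + x * t)) has_integral pi * Ai 0 x) {0..}"
    by (intro has_integral_Ici_limit airy_partial_integral_tendsto continuous_intros) auto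
  then show "airy x = Ai 0 x" by (simp add: airy_def integral_unique)
qed

lemma airy_deriv_eq_Ai: "airy_deriv = Ai 1"
proof
  fix x
  show "airy_deriv x = Ai 1 x"
    unfolding airy_deriv_def airy_eq_Ai using DERIV_imp_deriv[OF Ai_derivative[of 0 x]] by simp
qed

lemma Ai_0_derivative: "(Ai 0 has_real_derivative Ai 1 x) (at x)"
  using Ai_derivative[of 0 x] by simp

lemma Ai_1_derivative: "(Ai 1 has_real_derivative x * Ai 0 x) (at x)"
  using Ai_derivative[of 1 x] Ai_2[of x] by (simp add: numeral_2_eq_2)

section \<open>Closed forms of the Airy kernel and its nuclearity on half-lines\<close>

section \<open>The Airy kernel\<close>

lemma Ai_tendsto_0: "(Ai k \<longlongrightarrow> 0) at_top"
proof (rule Lim_null_comparison)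
  show "\<forall>\<^sub>F x in at_top. norm (Ai k x) \<le> fact k * 2 ^ Suc k / x ^ Suc k"
    using eventually_gt_at_top[of 0] by eventually_elim (use Ai_decay in simp)
  have "((\<lambda>x::real. fact k * 2 ^ Suc k * (1 / x) ^ Suc k) \<longlongrightarrow> fact k * 2 ^ Suc k * 0 ^ Suc k) at_top"
    by (intro tendsto_intros tendsto_divide_0[OF tendsto_const] filterlim_at_top_imp_at_infinity filterlim_ident)
  then show "((\<lambda>x::real. fact k * 2 ^ Suc k / x ^ Suc k) \<longlongrightarrow> 0) at_top"
    by (simp add: power_divide)
qed

lemma Ai_shift_tendsto_0: "((\<lambda>z. Ai k (X + z)) \<longlongrightarrow> 0) at_top"
proof -
  have "filterlim (\<lambda>z. X + z) at_top at_top" by real_asymp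
  then show ?thesis by (rule filterlim_compose[OF Ai_tendsto_0])
qed

lemma Ai_shift_derivative: "((\<lambda>z. Ai 0 (X + z)) has_real_derivative Ai 1 (X + z)) (at z)"
  "((\<lambda>z. Ai 1 (X + z)) has_real_derivative (X + z) * Ai 0 (X + z)) (at z)"
proof -
  show "((\<lambda>z. Ai 0 (X + z)) has_real_derivative Ai 1 (X + z)) (at z)"
    using DERIV_shift[of "Ai 0" "Ai 1 (z + X)" z X, THEN iffD1, OF Ai_0_derivative]
    by (simp only: add.commute[of X])
  show "((\<lambda>z. Ai 1 (X + z)) has_real_derivative (X + z) * Ai 0 (X + z)) (at z)"
    using DERIV_shift[of "Ai 1" "(z + X) * Ai 0 (z + X)" z X, THEN iffD1, OF Ai_1_derivative]
    by (simp only: add.commute[of X])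
qed

lemma Ai_shift_continuous: "continuous_on A (\<lambda>z. Ai k (X + z))"
  by (rule continuous_on_compose2[OF Ai_continuous[of UNIV]]) (auto intro: continuous_intros)

text \<open>By the Airy equation the z-derivative of Ai(X+z) Ai'(Y+z) - Ai'(X+z) Ai(Y+z) is (Y - X)
  Ai(X+z) Ai(Y+z), and the expression vanishes at infinity.\<close>

lemma airy_kernel_off_diagonal:
  assumes "X \<noteq> Y"
  shows "airy_kernel X Y = (Ai 0 X * Ai 1 Y - Ai 1 X * Ai 0 Y) / (X - Y)"
proof -
  let ?F = "\<lambda>z. (Ai 0 (X + z) * Ai 1 (Y + z) - Ai 1 (X + z) * Ai 0 (Y + z)) / (Y - X)"
  have "((\<lambda>z. Ai 0 (X + z) * Ai 0 (Y + z)) has_integral 0 - ?F 0) {0..}"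
  proof (rule integral_Ici_FTC)
    show "(?F has_real_derivative Ai 0 (X + z) * Ai 0 (Y + z)) (at z)" for z
    proof -
      have "((\<lambda>z. Ai 0 (X + z) * Ai 1 (Y + z) - Ai 1 (X + z) * Ai 0 (Y + z))
          has_real_derivative (Y - X) * (Ai 0 (X + z) * Ai 0 (Y + z))) (at z)"
        by (rule derivative_eq_intros Ai_shift_derivative refl)+ (simp add: algebra_simps)
      from DERIV_cdivide[OF this, of "Y - X"] show ?thesis using assms by simp
    qed
    have "(?F \<longlongrightarrow> (0 * 0 - 0 * 0) / (Y - X)) at_top"
      using assms by (intro tendsto_intros Ai_shift_tendsto_0) auto
    then show "(?F \<longlongrightarrow> 0) at_top" by simp
  qed (intro continuous_intros Ai_shift_continuous)
  then have "airy_kernel X Y = - ?F 0" unfolding airy_kernel_def airy_eq_Ai by (simp add: integral_unique)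
  then show ?thesis using assms by (simp add: field_simps)
qed

text \<open>The antiderivative of Ai(X+z)^2 is (X+z) Ai(X+z)^2 - Ai'(X+z)^2.\<close>

lemma airy_kernel_diagonal: "airy_kernel X X = (Ai 1 X)\<^sup>2 - X * (Ai 0 X)\<^sup>2"
proof -
  let ?F = "\<lambda>z. (X + z) * (Ai 0 (X + z) * Ai 0 (X + z)) - Ai 1 (X + z) * Ai 1 (X + z)"
  have "((\<lambda>z. Ai 0 (X + z) * Ai 0 (X + z)) has_integral 0 - ?F 0) {0..}"
  proof (rule integral_Ici_FTC)
    show "(?F has_real_derivative Ai 0 (X + z) * Ai 0 (X + z)) (at z)" for z
      by (rule derivative_eq_intros Ai_shift_derivative refl)+ (simp add: algebra_simps)
    \<comment> \<open>The unbounded factor X + z is absorbed by writing (X+z) Ai(X+z) as the second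
      derivative, which tends to 0.\<close>
    have "((\<lambda>z. Ai 2 (X + z) * Ai 0 (X + z) - Ai 1 (X + z) * Ai 1 (X + z)) \<longlongrightarrow> 0 * 0 - 0 * 0) at_top"
      by (intro tendsto_intros Ai_shift_tendsto_0)
    then show "(?F \<longlongrightarrow> 0) at_top" by (simp add: Ai_2 mult.assoc)
  qed (intro continuous_intros Ai_shift_continuous)
  then show ?thesis
    unfolding airy_kernel_def airy_eq_Ai by (simp add: integral_unique power2_eq_square)
qed

text \<open>Compactness of [B, max B 1] is combined with the decay beyond 1. The variable 1 + x - B
  is at least 1 on the half-line, whatever the sign of B.\<close>

lemma decay_bound_half_line:
  fixes f :: "real \<Rightarrow> real"
  assumes "continuous_on UNIV f" "\<And>x. x \<ge> 1 \<Longrightarrow> \<bar>f x\<bar> \<le> C / x ^ 4"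
  obtains E where "E \<ge> 0" "\<And>x. x \<ge> B \<Longrightarrow> \<bar>f x\<bar> \<le> E / (1 + x - B) ^ 4"
proof -
  have "compact (f ` {B..max B 1})"
    using assms(1) by (intro compact_continuous_image) (auto intro: continuous_on_subset)
  then have "bounded (f ` {B..max B 1})" by (rule compact_imp_bounded)
  then obtain C1 where "\<forall>y\<in>f ` {B..max B 1}. norm y \<le> C1"
    unfolding bounded_iff by blast
  then have C1: "\<bar>f x\<bar> \<le> C1" if "x \<in> {B..max B 1}" for x using that by auto
  have "C1 \<ge> 0" using C1[of B] by (meson abs_ge_zero atLeastAtMost_iff max.cobounded1 order_refl order_trans)
  have "C \<ge> 0" using order_trans[OF abs_ge_zero assms(2)[of 1]] by simp
  let ?m = "1 + max B 1 - B" and ?k = "2 + \<bar>B\<bar>"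
  have "\<bar>f x\<bar> \<le> (C1 * ?m ^ 4 + C * ?k ^ 4) / (1 + x - B) ^ 4" if x: "x \<ge> B" for x
  proof (cases "x \<le> max B 1")
    case True
    have p: "1 + x - B > 0" using x by simp
    have "(1 + x - B) ^ 4 \<le> ?m ^ 4" using True x by (intro power_mono) auto
    then have "C1 * (1 + x - B) ^ 4 \<le> C1 * ?m ^ 4 + C * ?k ^ 4"
      using \<open>C1 \<ge> 0\<close> \<open>C \<ge> 0\<close> by (simp add: add_increasing2 mult_left_mono)
    moreover have "\<bar>f x\<bar> * (1 + x - B) ^ 4 \<le> C1 * (1 + x - B) ^ 4"
      using C1[of x] True x p by (intro mult_right_mono) auto
    ultimately show ?thesis unfolding pos_le_divide_eq[OF zero_less_power[OF p]] by linarith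
  next
    case False
    then have x1: "x \<ge> 1" by simp
    have p: "1 + x - B > 0" using x by simp
    have "1 + x - B \<le> ?k * x"
    proof -
      have "\<bar>B\<bar> * 1 \<le> \<bar>B\<bar> * x" using x1 by (intro mult_left_mono) auto
      then have "2 * x + \<bar>B\<bar> * x \<ge> 1 + x - B" using x1 by linarith
      then show ?thesis by (simp add: distrib_right)
    qed
    then have "(1 + x - B) ^ 4 \<le> (?k * x) ^ 4" using p by (intro power_mono) auto
    then have "C * (1 + x - B) ^ 4 \<le> C * ?k ^ 4 * x ^ 4"
      using \<open>C \<ge> 0\<close> by (simp add: power_mult_distrib mult.assoc mult_left_mono)
    then have "C / x ^ 4 * (1 + x - B) ^ 4 \<le> C * ?k ^ 4" using x1 by (simp add: field_simps)
    moreover have "\<bar>f x\<bar> * (1 + x - B) ^ 4 \<le> C / x ^ 4 * (1 + x - B) ^ 4"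
      using assms(2)[OF x1] p by (intro mult_right_mono) auto
    moreover have "C1 * ?m ^ 4 \<ge> 0" using \<open>C1 \<ge> 0\<close> by simp
    ultimately show ?thesis unfolding pos_le_divide_eq[OF zero_less_power[OF p]] by linarith
  qed
  moreover have "C1 * ?m ^ 4 + C * ?k ^ 4 \<ge> 0" using \<open>C1 \<ge> 0\<close> \<open>C \<ge> 0\<close> by simp
  ultimately show ?thesis using that by blast
qed

text \<open>Ai = Ai''/x gains one power over the general decay estimate.\<close>

lemma Ai_0_decay4: "x \<ge> 1 \<Longrightarrow> \<bar>Ai 0 x\<bar> \<le> 16 / x ^ 4"
  using Ai_decay[of x 2] unfolding Ai_2 by (simp add: abs_mult field_simps power_Suc numeral_eq_Suc)

text \<open>The differentiated Airy equation gives x Ai'(x) = Ai'''(x) - Ai(x), both of order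
  x^(-4); the factor x on the left is merely bounded below by 1.\<close>

lemma Ai_1_decay4:
  assumes "x \<ge> 1"
  shows "\<bar>Ai 1 x\<bar> \<le> 112 / x ^ 4"
proof -
  have "\<bar>Ai 1 x\<bar> \<le> x * \<bar>Ai 1 x\<bar>" using assms by (simp add: mult_le_cancel_right1)
  also have "\<dots> = \<bar>Ai 3 x - Ai 0 x\<bar>" using assms by (simp add: Ai_3 abs_mult)
  also have "\<dots> \<le> \<bar>Ai 3 x\<bar> + \<bar>Ai 0 x\<bar>" by simp
  also have "\<dots> \<le> 96 / x ^ 4 + 16 / x ^ 4"
    using Ai_decay[of x 3] Ai_0_decay4[OF assms] assms by (intro add_mono) (auto simp: numeral_eq_Suc fact_Suc)
  finally show ?thesis by (simp flip: add_divide_distrib)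
qed

lemma (in pair_sigma_finite) integrable_tensor:
  fixes u :: "'a \<Rightarrow> real" and v :: "'b \<Rightarrow> real"
  assumes "integrable M1 u" "integrable M2 v"
  shows "integrable (M1 \<Otimes>\<^sub>M M2) (\<lambda>(x, y). u x * v y)"
proof (rule Fubini_integrable)
  have [measurable]: "u \<in> borel_measurable M1" "v \<in> borel_measurable M2" using assms by auto
  show "(\<lambda>(x, y). u x * v y) \<in> borel_measurable (M1 \<Otimes>\<^sub>M M2)" by measurable
  have "(\<integral>y. norm (case (x, y) of (x, y) \<Rightarrow> u x * v y) \<partial>M2) = \<bar>u x\<bar> * (\<integral>y. \<bar>v y\<bar> \<partial>M2)" for x
    by (simp add: abs_mult)
  then show "integrable M1 (\<lambda>x. \<integral>y. norm (case (x, y) of (x, y) \<Rightarrow> u x * v y) \<partial>M2)"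
    using assms(1) by simp
  show "AE x in M1. integrable M2 (\<lambda>y. case (x, y) of (x, y) \<Rightarrow> u x * v y)"
    using assms(2) by (intro AE_I2) simp
qed

lemma (in pair_sigma_finite) Fubini_dominated:
  fixes f :: "'a \<Rightarrow> 'b \<Rightarrow> real"
  assumes "case_prod f \<in> borel_measurable (M1 \<Otimes>\<^sub>M M2)" "integrable M1 u" "integrable M2 v"
    "\<And>x y. x \<in> space M1 \<Longrightarrow> y \<in> space M2 \<Longrightarrow> \<bar>f x y\<bar> \<le> u x * v y"
  shows "(\<integral>x. (\<integral>y. f x y \<partial>M2) \<partial>M1) = (\<integral>y. (\<integral>x. f x y \<partial>M1) \<partial>M2)"
proof -
  have "integrable (M1 \<Otimes>\<^sub>M M2) (case_prod f)"
  proof (rule Bochner_Integration.integrable_bound[OF integrable_tensor[OF assms(2,3)] assms(1)])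
    show "AE z in M1 \<Otimes>\<^sub>M M2. norm (case_prod f z) \<le> norm (case z of (x, y) \<Rightarrow> u x * v y)"
      using assms(4) by (intro AE_I2) (force simp: space_pair_measure)
  qed
  then show ?thesis using integral_fst integral_snd by metis
qed

context dominated_kernels
begin

text \<open>
  A kernel of the form \<open>\<integral> a z x a z y dz\<close> is a continuous superposition of rank one kernels; by
  Bessel's inequality its diagonal sums are at most \<open>\<integral> \<parallel>a z\<parallel>\<^sup>2 dz\<close>.
\<close>
lemma nuclear_superposition:
  fixes N :: "'b measure" and a :: "'b \<Rightarrow> 'a \<Rightarrow> real" and b :: "'b \<Rightarrow> real"
  assumes "sigma_finite_measure N" and K: "good K"
    and a [measurable]: "case_prod a \<in> borel_measurable (N \<Otimes>\<^sub>M M)"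
    and b: "integrable N b" "integrable N (\<lambda>z. (b z)\<^sup>2)" "\<And>z. 0 \<le> b z"
    and ab: "\<And>z x. z \<in> space N \<Longrightarrow> x \<in> space M \<Longrightarrow> \<bar>a z x\<bar> \<le> b z * w x"
    and Ka: "\<And>x y. x \<in> space M \<Longrightarrow> y \<in> space M \<Longrightarrow> K x y = (\<integral>z. a z x * a z y \<partial>N)"
  shows "nuclear K"
proof -
  interpret N: sigma_finite_measure N by fact
  interpret P: pair_sigma_finite N M ..
  have am: "a z \<in> borel_measurable M" if "z \<in> space N" for z
    using that by measurable
  have aL: "a z \<in> rL2 M" if "z \<in> space N" for z
    using ab[OF that] by (intro rL2_bound[OF w_L2 am[OF that]]) 
  have aw: "ip M (a z) (a z) \<le> (b z)\<^sup>2 * ip M w w" if z: "z \<in> space N" for z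
  proof -
    have "ip M (a z) (a z) \<le> ip M (\<lambda>x. b z * w x) (\<lambda>x. b z * w x)"
      unfolding ip_def
    proof (rule integral_mono)
      show "integrable M (\<lambda>x. a z x * a z x)" by (intro rL2_integrable_mult aL z)
      show "integrable M (\<lambda>x. b z * w x * (b z * w x))" by (intro rL2_integrable_mult rL2_scale w_L2)
      fix x assume "x \<in> space M"
      then have "\<bar>a z x\<bar> \<le> \<bar>b z * w x\<bar>" using ab[OF z] by force
      then show "a z x * a z x \<le> b z * w x * (b z * w x)"
        by (simp add: abs_le_square_iff power2_eq_square)
    qed
    then show ?thesis by (simp add: ip_scale_left ip_scale_right power2_eq_square mult.assoc)
  qed
  \<comment> \<open>Two applications of Fubini turn the quadratic form into an integral of squares.
    It is nonnegative, so no absolute values survive in the diagonal sums.\<close>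
  have quad: "ip M (kop M K h) h = (\<integral>z. (ip M (a z) h)\<^sup>2 \<partial>N)"
    and quad_int: "integrable N (\<lambda>z. (ip M (a z) h)\<^sup>2)" if h: "h \<in> rL2 M" for h
  proof -
    have [measurable]: "h \<in> borel_measurable M" using h by (rule rL2_measurable)
    have wh: "integrable M (\<lambda>y. w y * \<bar>h y\<bar>)"
      using integrable_norm[OF rL2_integrable_mult[OF w_L2 h]] by (simp add: abs_mult w_nonneg)
    define g where "g z = ip M (a z) h" for z
    have gm [measurable]: "g \<in> borel_measurable N"
    proof -
      have "(\<lambda>(z, y). a z y * h y) \<in> borel_measurable (N \<Otimes>\<^sub>M M)" by measurable
      then show ?thesis unfolding g_def ip_def by (rule borel_measurable_lebesgue_integral)
    qed
    define G where "G = sqrt (ip M w w) * sqrt (ip M h h)"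
    have G0: "G \<ge> 0" by (simp add: G_def ip_nonneg)
    have gb: "\<bar>g z\<bar> \<le> b z * G" if z: "z \<in> space N" for z
    proof -
      have "\<bar>g z\<bar> \<le> sqrt (ip M (a z) (a z)) * sqrt (ip M h h)"
        unfolding g_def by (rule ip_Cauchy_Schwarz[OF aL[OF z] h])
      also have "\<dots> \<le> sqrt ((b z)\<^sup>2 * ip M w w) * sqrt (ip M h h)"
        using aw[OF z] by (intro mult_right_mono real_sqrt_le_mono) (auto simp: ip_nonneg)
      also have "\<dots> = b z * G" using b(3)[of z] by (simp add: G_def real_sqrt_mult)
      finally show ?thesis .
    qed
    have kK: "kop M K h x = (\<integral>z. a z x * g z \<partial>N)" if x: "x \<in> space M" for x
    proof -
      have ax [measurable]: "(\<lambda>z. a z x) \<in> borel_measurable N" using x by measurable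
      have "kop M K h x = (\<integral>y. (\<integral>z. a z x * a z y * h y \<partial>N) \<partial>M)"
        unfolding kop_def by (intro Bochner_Integration.integral_cong refl) (simp add: Ka x)
      also have "\<dots> = (\<integral>z. (\<integral>y. a z x * a z y * h y \<partial>M) \<partial>N)"
      proof (rule P.Fubini_dominated[symmetric])
        show "(\<lambda>(z, y). a z x * a z y * h y) \<in> borel_measurable (N \<Otimes>\<^sub>M M)" by measurable
        show "integrable N (\<lambda>z. w x * (b z)\<^sup>2)" using b(2) by simp
        show "integrable M (\<lambda>y. w y * \<bar>h y\<bar>)" by (rule wh)
        fix z y assume zy: "z \<in> space N" "y \<in> space M"
        have "\<bar>a z x\<bar> * \<bar>a z y\<bar> * \<bar>h y\<bar> \<le> (b z * w x) * (b z * w y) * \<bar>h y\<bar>"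
          using ab[OF zy(1)] x zy(2) b(3)[of z] w_nonneg by (intro mult_right_mono mult_mono) auto
        then show "\<bar>a z x * a z y * h y\<bar> \<le> w x * (b z)\<^sup>2 * (w y * \<bar>h y\<bar>)"
          by (simp add: abs_mult power2_eq_square mult_ac)
      qed
      also have "\<dots> = (\<integral>z. a z x * g z \<partial>N)"
        by (simp add: g_def ip_def mult.assoc)
      finally show ?thesis .
    qed
    have "ip M (kop M K h) h = (\<integral>x. (\<integral>z. a z x * g z * h x \<partial>N) \<partial>M)"
      unfolding ip_def by (intro Bochner_Integration.integral_cong refl) (simp add: kK)
    also have "\<dots> = (\<integral>z. (\<integral>x. a z x * g z * h x \<partial>M) \<partial>N)"
    proof (rule P.Fubini_dominated[symmetric])
      show "(\<lambda>(z, x). a z x * g z * h x) \<in> borel_measurable (N \<Otimes>\<^sub>M M)" by measurable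
      show "integrable N (\<lambda>z. G * (b z)\<^sup>2)" using b(2) by simp
      show "integrable M (\<lambda>x. w x * \<bar>h x\<bar>)" by (rule wh)
      fix z x assume zx: "z \<in> space N" "x \<in> space M"
      have "\<bar>a z x\<bar> * \<bar>g z\<bar> * \<bar>h x\<bar> \<le> (b z * w x) * (b z * G) * \<bar>h x\<bar>"
        using ab[OF zx] gb[OF zx(1)] b(3)[of z] w_nonneg[of x] G0 by (intro mult_right_mono mult_mono) auto
      then show "\<bar>a z x * g z * h x\<bar> \<le> G * (b z)\<^sup>2 * (w x * \<bar>h x\<bar>)"
        by (simp add: abs_mult power2_eq_square mult_ac)
    qed
    also have "\<dots> = (\<integral>z. (g z)\<^sup>2 \<partial>N)"
    proof (intro Bochner_Integration.integral_cong refl)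
      fix z
      have "(\<integral>x. a z x * g z * h x \<partial>M) = (\<integral>x. g z * (a z x * h x) \<partial>M)" by (simp add: mult_ac)
      then show "(\<integral>x. a z x * g z * h x \<partial>M) = (g z)\<^sup>2" by (simp add: g_def ip_def power2_eq_square)
    qed
    finally show "ip M (kop M K h) h = (\<integral>z. (ip M (a z) h)\<^sup>2 \<partial>N)" by (simp add: g_def)
    have "integrable N (\<lambda>z. (g z)\<^sup>2)"
    proof (rule Bochner_Integration.integrable_bound)
      show "integrable N (\<lambda>z. (b z)\<^sup>2 * G\<^sup>2)" using b(2) by simp
      show "AE z in N. norm ((g z)\<^sup>2) \<le> norm ((b z)\<^sup>2 * G\<^sup>2)"
      proof (rule AE_I2)
        fix z assume "z \<in> space N"
        then have "\<bar>g z\<bar> \<le> \<bar>b z * G\<bar>" using gb by force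
        then have "(g z)\<^sup>2 \<le> (b z * G)\<^sup>2" by (simp only: abs_le_square_iff)
        then show "norm ((g z)\<^sup>2) \<le> norm ((b z)\<^sup>2 * G\<^sup>2)" by (simp add: power_mult_distrib)
      qed
    qed measurable
    then show "integrable N (\<lambda>z. (ip M (a z) h)\<^sup>2)" by (simp add: g_def)
  qed
  have "(\<Sum>i\<in>I. \<bar>ip M (kop M K (e i)) (e i)\<bar>) \<le> (\<integral>z. (b z)\<^sup>2 \<partial>N) * ip M w w"
    if I: "finite I" and e: "orthonormal_family M I e" for I e
  proof -
    have eL: "\<And>i. i \<in> I \<Longrightarrow> e i \<in> rL2 M" using e by (simp add: orthonormal_family_def)
    have "(\<Sum>i\<in>I. \<bar>ip M (kop M K (e i)) (e i)\<bar>) = (\<Sum>i\<in>I. \<integral>z. (ip M (a z) (e i))\<^sup>2 \<partial>N)"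
      by (intro sum.cong refl) (simp add: quad eL)
    also have "\<dots> = (\<integral>z. (\<Sum>i\<in>I. (ip M (a z) (e i))\<^sup>2) \<partial>N)"
      by (rule Bochner_Integration.integral_sum[symmetric]) (intro quad_int eL)
    also have "\<dots> \<le> (\<integral>z. (b z)\<^sup>2 * ip M w w \<partial>N)"
    proof (rule integral_mono)
      show "integrable N (\<lambda>z. \<Sum>i\<in>I. (ip M (a z) (e i))\<^sup>2)"
        by (intro Bochner_Integration.integrable_sum quad_int eL)
      show "integrable N (\<lambda>z. (b z)\<^sup>2 * ip M w w)" using b(2) by simp
      show "(\<Sum>i\<in>I. (ip M (a z) (e i))\<^sup>2) \<le> (b z)\<^sup>2 * ip M w w" if z: "z \<in> space N" for z
        using Bessel_inequality[OF I e aL[OF z]] aw[OF z] by linarith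
    qed
    finally show ?thesis by simp
  qed
  then show ?thesis using K unfolding nuclear_def by blast
qed

end

text \<open>The exponent 2 is half of the available decay x^(-4): it leaves room for the weight in a
  second variable, and the weight is integrable, square integrable and bounded by 1.\<close>

definition edge_weight :: "real \<Rightarrow> real \<Rightarrow> real" where
  "edge_weight B x = (if x \<ge> B then 1 / (1 + x - B)\<^sup>2 else 0)"

lemma edge_weight_nonneg: "0 \<le> edge_weight B x"
  by (simp add: edge_weight_def)

lemma edge_weight_le_1: "edge_weight B x \<le> 1"
proof (cases "x \<ge> B")
  case True
  then have "1 \<le> (1 + x - B)\<^sup>2" using power_mono[of 1 "1 + x - B" 2] by simp
  then show ?thesis by (simp add: edge_weight_def divide_le_eq_1)
qed (simp add: edge_weight_def)

lemma edge_weight_measurable [measurable]: "edge_weight B \<in> borel_measurable borel"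
  unfolding edge_weight_def[abs_def] by measurable

lemma edge_weight_integrable: "integrable lborel (edge_weight B)"
proof -
  have "(\<integral>\<^sup>+x. ennreal (1 / (1 + x - B)\<^sup>2) * indicator {B..} x \<partial>lborel) = ennreal (0 - (- 1 / (1 + B - B)))"
  proof (rule nn_integral_FTC_atLeast[where F = "\<lambda>x. - 1 / (1 + x - B)" and T = 0])
    show "((\<lambda>x. - 1 / (1 + x - B)) \<longlongrightarrow> 0) at_top" by real_asymp
    fix x assume "B \<le> x"
    then show "((\<lambda>x. - 1 / (1 + x - B)) has_real_derivative 1 / (1 + x - B)\<^sup>2) (at x)"
      by (auto intro!: derivative_eq_intros simp: power2_eq_square)
  qed auto
  moreover have "(\<integral>\<^sup>+x. ennreal (edge_weight B x) \<partial>lborel)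
      = (\<integral>\<^sup>+x. ennreal (1 / (1 + x - B)\<^sup>2) * indicator {B..} x \<partial>lborel)"
    by (intro nn_integral_cong) (auto simp: edge_weight_def indicator_def)
  ultimately show ?thesis
    by (intro integrableI_nonneg) (auto simp: edge_weight_nonneg)
qed

lemma edge_weight_square_integrable: "integrable lborel (\<lambda>x. (edge_weight B x)\<^sup>2)"
proof (rule Bochner_Integration.integrable_bound[OF edge_weight_integrable])
  have "(edge_weight B x)\<^sup>2 \<le> edge_weight B x" for x
    using edge_weight_nonneg[of B x] edge_weight_le_1[of B x]
    by (simp add: power2_eq_square mult_left_le)
  then show "AE x in lborel. norm ((edge_weight B x)\<^sup>2) \<le> norm (edge_weight B x)"
    by (simp add: edge_weight_nonneg)
qed measurable

lemma integrable_restrict_lborel: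
  fixes f :: "real \<Rightarrow> real"
  assumes "J \<in> sets borel" "integrable lborel f"
  shows "integrable (restrict_space lborel J) f"
  using assms integrable_mult_indicator[of J lborel f] by (subst integrable_restrict_space) auto

lemma measurable_restrict_lborel:
  "f \<in> borel_measurable borel \<Longrightarrow> f \<in> borel_measurable (restrict_space lborel J)"
  by (rule measurable_restrict_space1) simp

text \<open>The fourth power of 1 + (x+z) - B dominates (1+z)^2 (1+x-B)^2, which separates the
  variables.\<close>

lemma Ai_0_shift_bound:
  obtains E where "E \<ge> 0"
    "\<And>x z. x \<ge> B \<Longrightarrow> z \<ge> 0 \<Longrightarrow> \<bar>Ai 0 (x + z)\<bar> \<le> E * edge_weight 0 z * edge_weight B x"
proof -
  obtain E where E: "E \<ge> 0" "\<And>x. x \<ge> B \<Longrightarrow> \<bar>Ai 0 x\<bar> \<le> E / (1 + x - B) ^ 4"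
    by (rule decay_bound_half_line[of "Ai 0" 16 B, OF Ai_continuous Ai_0_decay4]) (assumption, rule that)
  have "\<bar>Ai 0 (x + z)\<bar> \<le> E * edge_weight 0 z * edge_weight B x" if "x \<ge> B" "z \<ge> 0" for x z
  proof -
    let ?s = "1 + (x + z) - B"
    have "(1 + z)\<^sup>2 * (1 + x - B)\<^sup>2 \<le> ?s\<^sup>2 * ?s\<^sup>2"
      using that by (intro mult_mono power_mono) auto
    also have "\<dots> = ?s ^ 4" by (simp flip: power_add)
    finally have "E / ?s ^ 4 \<le> E / ((1 + z)\<^sup>2 * (1 + x - B)\<^sup>2)"
      using that E(1) by (intro divide_left_mono) auto
    then show ?thesis using E(2)[of "x + z"] that by (simp add: edge_weight_def)
  qed
  then show ?thesis using that E(1) by blast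
qed

text \<open>On a set J bounded below by B, take for \<open>D\<close> a countable dense subset and
  for \<open>q x\<close> a sequence in it converging to x. Continuous functions dominated by the
  weight become admissible, and the Airy kernel is a superposition of the functions Ai(x+z).\<close>

lemma edge_kernels:
  assumes J: "J \<in> sets borel" "\<And>x. x \<in> J \<Longrightarrow> B \<le> x"
  obtains q :: "real \<Rightarrow> nat \<Rightarrow> real" and D where
    "dominated_kernels (restrict_space lborel J) (edge_weight B) q D 1"
    "\<And>f c. continuous_on J f \<Longrightarrow> (\<And>x. x \<in> J \<Longrightarrow> \<bar>f x\<bar> \<le> c * edge_weight B x) \<Longrightarrow>
       dominated_kernels.admissible (restrict_space lborel J) (edge_weight B) q f"
    "dominated_kernels.nuclear (restrict_space lborel J) (edge_weight B) q airy_kernel"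
proof -
  let ?M = "restrict_space lborel J" and ?w = "edge_weight B"
  have sp: "space ?M = J" by (simp add: space_restrict_space)
  obtain D where dense: "countable D" "D \<subseteq> J" "J \<subseteq> closure D" using separable by blast
  have "\<exists>s. (\<forall>j. s j \<in> D) \<and> s \<longlonglongrightarrow> x" if "x \<in> J" for x
    using that dense(3) closure_sequential by blast
  then obtain q where q: "\<And>x j. x \<in> J \<Longrightarrow> q x j \<in> D" "\<And>x. x \<in> J \<Longrightarrow> q x \<longlonglongrightarrow> x"
    by metis
  have wm: "?w \<in> borel_measurable ?M" by (intro measurable_restrict_lborel edge_weight_measurable)
  have "sigma_finite_measure ?M"
    using J(1) by (intro sigma_finite_measure_restrict_space sigma_finite_lborel) simp
  then interpret dominated_kernels ?M ?w q D 1
  proof (intro dominated_kernels.intro dominated_kernels_axioms.intro)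
    show "?w \<in> rL2 ?M"
      unfolding rL2_def using wm J(1) edge_weight_square_integrable by (auto intro: integrable_restrict_lborel)
  qed (use dense q edge_weight_nonneg edge_weight_le_1 in \<open>auto simp: sp\<close>)
  have adm: "admissible f" if f: "continuous_on J f" "\<And>x. x \<in> J \<Longrightarrow> \<bar>f x\<bar> \<le> c * ?w x" for f c
    unfolding admissible_def sp
  proof (intro conjI ballI)
    have "f \<in> borel_measurable (restrict_space borel J)"
      using f(1) by (rule borel_measurable_continuous_on_restrict)
    then show "f \<in> borel_measurable ?M"
      by (simp cong: measurable_cong_sets add: sets_restrict_space)
    show "\<exists>c. \<forall>x\<in>J. \<bar>f x\<bar> \<le> c * ?w x" using f(2) by blast
    fix x assume x: "x \<in> J"
    have "\<forall>\<^sub>F j in sequentially. q x j \<in> J"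
      using q(1)[OF x] dense(2) by (intro always_eventually) blast
    then show "(\<lambda>j. f (q x j)) \<longlonglongrightarrow> f x"
      by (rule continuous_on_tendsto_compose[OF f(1) q(2)[OF x] x])
  qed
  obtain E where E: "E \<ge> 0"
    "\<And>x z. x \<ge> B \<Longrightarrow> z \<ge> 0 \<Longrightarrow> \<bar>Ai 0 (x + z)\<bar> \<le> E * edge_weight 0 z * ?w x"
    by (rule Ai_0_shift_bound) (rule that)
  let ?N = "restrict_space lborel {0::real..}" and ?b = "\<lambda>z. E * edge_weight 0 z"
  have b: "integrable ?N ?b" "integrable ?N (\<lambda>z. (?b z)\<^sup>2)"
    using edge_weight_integrable[of 0] edge_weight_square_integrable[of 0]
    by (auto intro!: integrable_restrict_lborel simp: power_mult_distrib)
  have Aim [measurable]: "Ai k \<in> borel_measurable borel" for k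
    by (intro borel_measurable_continuous_onI Ai_continuous)
  have bw: "\<bar>Ai 0 (x + z) * Ai 0 (y + z)\<bar> \<le> (?b z)\<^sup>2 * (?w x * ?w y)"
    if "x \<ge> B" "y \<ge> B" "z \<ge> 0" for x y z
  proof -
    have "\<bar>Ai 0 (x + z)\<bar> * \<bar>Ai 0 (y + z)\<bar> \<le> (?b z * ?w x) * (?b z * ?w y)"
      using E that by (intro mult_mono') auto
    then show ?thesis by (simp add: abs_mult power2_eq_square mult_ac)
  qed
  have int: "integrable ?N (\<lambda>z. Ai 0 (x + z) * Ai 0 (y + z))" if "x \<ge> B" "y \<ge> B" for x y
  proof (rule Bochner_Integration.integrable_bound)
    show "integrable ?N (\<lambda>z. (?b z)\<^sup>2 * (?w x * ?w y))" using b(2) by simp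
    show "(\<lambda>z. Ai 0 (x + z) * Ai 0 (y + z)) \<in> borel_measurable ?N"
      by (intro measurable_restrict_lborel) measurable
    show "AE z in ?N. norm (Ai 0 (x + z) * Ai 0 (y + z)) \<le> norm ((?b z)\<^sup>2 * (?w x * ?w y))"
      using bw[OF that] by (intro AE_I2) (force simp: space_restrict_space)
  qed
  have Keq: "airy_kernel x y = (\<integral>z. Ai 0 (x + z) * Ai 0 (y + z) \<partial>?N)" if "x \<ge> B" "y \<ge> B" for x y
  proof -
    have "set_integrable lborel {0..} (\<lambda>z. Ai 0 (x + z) * Ai 0 (y + z))"
      using int[OF that] unfolding set_integrable_def by (subst (asm) integrable_restrict_space) auto
    from set_borel_integral_eq_integral(2)[OF this]
    show ?thesis
      unfolding airy_kernel_def airy_eq_Ai set_lebesgue_integral_def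
      by (subst integral_restrict_space) auto
  qed
  have good: "good airy_kernel"
    unfolding good_def sp
  proof (intro conjI ballI)
    define i where "i = (\<lambda>x::real. x)"
    have [measurable]: "i \<in> borel_measurable ?M" "Ai k \<in> borel_measurable ?M" for k
      unfolding i_def by (intro measurable_restrict_lborel; measurable)+
    \<comment> \<open>Joint measurability is read off from the closed forms on and off the
      diagonal.\<close>
    have "(\<lambda>(x, y). if i x = i y then (Ai 1 x)\<^sup>2 - i x * (Ai 0 x)\<^sup>2
        else (Ai 0 x * Ai 1 y - Ai 1 x * Ai 0 y) / (i x - i y)) \<in> borel_measurable (?M \<Otimes>\<^sub>M ?M)"
      by measurable
    also have "(\<lambda>(x, y). if i x = i y then (Ai 1 x)\<^sup>2 - i x * (Ai 0 x)\<^sup>2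
        else (Ai 0 x * Ai 1 y - Ai 1 x * Ai 0 y) / (i x - i y)) = case_prod airy_kernel"
      by (auto simp: fun_eq_iff i_def airy_kernel_diagonal airy_kernel_off_diagonal)
    finally show "case_prod airy_kernel \<in> borel_measurable (?M \<Otimes>\<^sub>M ?M)" .
    let ?c = "\<integral>z. (?b z)\<^sup>2 \<partial>?N"
    have "\<bar>airy_kernel x y\<bar> \<le> ?c * ?w x * ?w y" if "x \<in> J" "y \<in> J" for x y
    proof -
      have xy: "x \<ge> B" "y \<ge> B" using that J(2) by auto
      have "norm (airy_kernel x y) \<le> (\<integral>z. norm (Ai 0 (x + z) * Ai 0 (y + z)) \<partial>?N)"
        unfolding Keq[OF xy] by (rule integral_norm_bound)
      also have "\<dots> \<le> (\<integral>z. (?b z)\<^sup>2 * (?w x * ?w y) \<partial>?N)"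
        using int[OF xy] b(2) bw[OF xy] by (intro integral_mono integrable_norm) (auto simp: space_restrict_space)
      also have "\<dots> = ?c * ?w x * ?w y" by (simp add: mult.assoc)
      finally show ?thesis by simp
    qed
    then show "\<exists>c\<ge>0. \<forall>x\<in>J. \<forall>y\<in>J. \<bar>airy_kernel x y\<bar> \<le> c * ?w x * ?w y"
      by (intro exI[of _ ?c]) (auto intro!: Bochner_Integration.integral_nonneg)
    fix x y assume xy: "x \<in> J" "y \<in> J"
    have ge: "x \<ge> B" "y \<ge> B" "q x j \<ge> B" for j using xy J(2) q(1)[OF xy(1)] dense(2) by auto
    have wq: "?w x \<le> 1" for x by (rule edge_weight_le_1)
    have "(\<lambda>j. \<integral>z. Ai 0 (q x j + z) * Ai 0 (y + z) \<partial>?N) \<longlonglongrightarrow> (\<integral>z. Ai 0 (x + z) * Ai 0 (y + z) \<partial>?N)"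
    proof (rule integral_dominated_convergence)
      show "integrable ?N (\<lambda>z. (?b z)\<^sup>2)" by (rule b(2))
      show "(\<lambda>z. Ai 0 (x + z) * Ai 0 (y + z)) \<in> borel_measurable ?N"
        "(\<lambda>z. Ai 0 (q x j + z) * Ai 0 (y + z)) \<in> borel_measurable ?N" for j
        by (intro measurable_restrict_lborel; measurable)+
      show "AE z in ?N. (\<lambda>j. Ai 0 (q x j + z) * Ai 0 (y + z)) \<longlonglongrightarrow> Ai 0 (x + z) * Ai 0 (y + z)"
      proof (rule AE_I2)
        fix z
        have "(\<lambda>j. q x j + z) \<longlonglongrightarrow> x + z" by (intro tendsto_intros q xy)
        then have "(\<lambda>j. Ai 0 (q x j + z)) \<longlonglongrightarrow> Ai 0 (x + z)"
          using continuous_on_tendsto_compose[OF Ai_continuous[of UNIV 0]] by auto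
        then show "(\<lambda>j. Ai 0 (q x j + z) * Ai 0 (y + z)) \<longlonglongrightarrow> Ai 0 (x + z) * Ai 0 (y + z)"
          by (intro tendsto_intros)
      qed
      show "AE z in ?N. norm (Ai 0 (q x j + z) * Ai 0 (y + z)) \<le> (?b z)\<^sup>2" for j
      proof (rule AE_I2)
        fix z assume "z \<in> space ?N"
        then have "\<bar>Ai 0 (q x j + z) * Ai 0 (y + z)\<bar> \<le> (?b z)\<^sup>2 * (?w (q x j) * ?w y)"
          using ge by (intro bw) (auto simp: space_restrict_space)
        also have "\<dots> \<le> (?b z)\<^sup>2 * 1"
          using wq[of "q x j"] wq[of y] edge_weight_nonneg by (intro mult_left_mono mult_le_one) auto
        finally show "norm (Ai 0 (q x j + z) * Ai 0 (y + z)) \<le> (?b z)\<^sup>2" by simp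
      qed
    qed
    then show "(\<lambda>j. airy_kernel (q x j) y) \<longlonglongrightarrow> airy_kernel x y"
      unfolding Keq[OF ge(1,2)] Keq[OF ge(3) ge(2)] .
  qed
  have "nuclear airy_kernel"
  proof (rule nuclear_superposition[of ?N _ "\<lambda>z x. Ai 0 (x + z)" ?b])
    show "sigma_finite_measure ?N"
      by (intro sigma_finite_measure_restrict_space sigma_finite_lborel) simp
    define i where "i = (\<lambda>x::real. x)"
    have [measurable]: "i \<in> borel_measurable ?M" "i \<in> borel_measurable ?N"
      unfolding i_def by (intro measurable_restrict_lborel; measurable)+
    have "(\<lambda>(z, x). Ai 0 (i x + i z)) \<in> borel_measurable (?N \<Otimes>\<^sub>M ?M)" by measurable
    then show "(\<lambda>(z, x). Ai 0 (x + z)) \<in> borel_measurable (?N \<Otimes>\<^sub>M ?M)" by (simp add: i_def)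
    show "0 \<le> ?b z" for z using E(1) edge_weight_nonneg by simp
    show "\<bar>Ai 0 (x + z)\<bar> \<le> ?b z * ?w x" if "z \<in> space ?N" "x \<in> space ?M" for z x
      using that E(2) J(2) by (simp add: space_restrict_space)
    show "airy_kernel x y = (\<integral>z. Ai 0 (x + z) * Ai 0 (y + z) \<partial>?N)" if "x \<in> space ?M" "y \<in> space ?M" for x y
      using that J(2) by (intro Keq) (auto simp: sp)
  qed (use good b in auto)
  from that[OF dominated_kernels_axioms adm this] show ?thesis .
qed

section \<open>Algebraic identities for Laguerre polynomials and the normal form of their
  equation\<close>

section \<open>Laguerre polynomials\<close>

text \<open>Extended by zero beyond the degree, so that polynomials of neighbouring degrees can be
  summed over one range.\<close>

definition laguerre_coeff :: "nat \<Rightarrow> real \<Rightarrow> nat \<Rightarrow> real" where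
  "laguerre_coeff n \<alpha> k = (if k \<le> n then (- 1) ^ k * ((real n + \<alpha>) gchoose (n - k)) / fact k else 0)"

lemma laguerre_eq_sum:
  assumes "n \<le> N"
  shows "laguerre n \<alpha> x = (\<Sum>k\<le>N. laguerre_coeff n \<alpha> k * x ^ k)"
proof -
  have "(\<Sum>k\<le>N. laguerre_coeff n \<alpha> k * x ^ k) = (\<Sum>k\<le>n. laguerre_coeff n \<alpha> k * x ^ k)"
    using assms by (intro sum.mono_neutral_right) (auto simp: laguerre_coeff_def)
  also have "\<dots> = laguerre n \<alpha> x"
    unfolding laguerre_def by (intro sum.cong) (auto simp: laguerre_coeff_def)
  finally show ?thesis by simp
qed

definition laguerre_deriv :: "nat \<Rightarrow> real \<Rightarrow> real \<Rightarrow> real" where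
  "laguerre_deriv n \<alpha> x = (\<Sum>k\<le>n. laguerre_coeff n \<alpha> k * (real k * x ^ (k - 1)))"

lemma laguerre_has_derivative: "(laguerre n \<alpha> has_real_derivative laguerre_deriv n \<alpha> x) (at x)"
proof -
  have "((\<lambda>x. \<Sum>k\<le>n. laguerre_coeff n \<alpha> k * x ^ k) has_real_derivative laguerre_deriv n \<alpha> x) (at x)"
    unfolding laguerre_deriv_def by (intro DERIV_sum DERIV_cmult) (auto intro!: derivative_eq_intros)
  moreover have "laguerre n \<alpha> = (\<lambda>x. \<Sum>k\<le>n. laguerre_coeff n \<alpha> k * x ^ k)"
    by (rule ext) (rule laguerre_eq_sum[OF order_refl])
  ultimately show ?thesis by simp
qed

lemma cancel_fact_Suc: "real (Suc k) * (c / fact (Suc k)) = c / fact k"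
  by (simp add: fact_Suc del: of_nat_Suc)

lemma laguerre_deriv_has_derivative: "\<exists>D. (laguerre_deriv n \<alpha> has_real_derivative D) (at x)"
  unfolding laguerre_deriv_def[abs_def]
  by (rule exI[of _ "\<Sum>k\<le>n. laguerre_coeff n \<alpha> k * (real k * (real (k - 1) * x ^ (k - 1 - Suc 0)))"],
      intro DERIV_sum DERIV_cmult DERIV_pow)

text \<open>Makes the contour integral, with \<alpha> raised by one, available for the
  derivative.\<close>

lemma laguerre_deriv_eq: "laguerre_deriv (Suc n) \<alpha> x = - laguerre n (\<alpha> + 1) x"
proof -
  have "laguerre_deriv (Suc n) \<alpha> x = (\<Sum>k\<le>n. laguerre_coeff (Suc n) \<alpha> (Suc k) * (real (Suc k) * x ^ k))"
    unfolding laguerre_deriv_def by (subst sum.atMost_Suc_shift) simp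
  also have "\<dots> = (\<Sum>k\<le>n. - (laguerre_coeff n (\<alpha> + 1) k * x ^ k))"
  proof (rule sum.cong[OF refl])
    fix k assume k: "k \<in> {..n}"
    have a: "real (Suc n) + \<alpha> = real n + (\<alpha> + 1)" by simp
    have "laguerre_coeff (Suc n) \<alpha> (Suc k) * real (Suc k) = - laguerre_coeff n (\<alpha> + 1) k"
      using k cancel_fact_Suc[of k "(- 1) ^ Suc k * ((real n + (\<alpha> + 1)) gchoose (n - k))"]
      unfolding laguerre_coeff_def a by (simp add: mult.commute del: fact_Suc of_nat_Suc)
    then show "laguerre_coeff (Suc n) \<alpha> (Suc k) * (real (Suc k) * x ^ k) = - (laguerre_coeff n (\<alpha> + 1) k * x ^ k)"
      by (metis mult.assoc mult_minus_left)
  qed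
  also have "\<dots> = - laguerre n (\<alpha> + 1) x" by (simp add: sum_negf laguerre_eq_sum[of n n])
  finally show ?thesis .
qed

lemma x_laguerre_deriv: "x * laguerre_deriv n \<alpha> x = (\<Sum>k\<le>n. real k * laguerre_coeff n \<alpha> k * x ^ k)"
proof -
  have "x * (c * (real k * x ^ (k - 1))) = real k * c * x ^ k" for k c
    by (cases k) simp_all
  then show ?thesis unfolding laguerre_deriv_def sum_distrib_left by (intro sum.cong refl)
qed

text \<open>Comparison of coefficients; the absorption identity of binomial coefficients relates the
  two degrees.\<close>

lemma laguerre_ladder_down:
  "x * laguerre_deriv (Suc n) \<alpha> x
     = real (Suc n) * laguerre (Suc n) \<alpha> x - (real (Suc n) + \<alpha>) * laguerre n \<alpha> x"
proof -
  have "real k * laguerre_coeff (Suc n) \<alpha> k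
      = real (Suc n) * laguerre_coeff (Suc n) \<alpha> k - (real (Suc n) + \<alpha>) * laguerre_coeff n \<alpha> k"
    if "k \<le> Suc n" for k
  proof (cases "k = Suc n")
    case True
    then show ?thesis by (simp add: laguerre_coeff_def)
  next
    case False
    then have "k \<le> n" using that by simp
    then obtain j where j: "n = k + j" using le_Suc_ex by blast
    have "(real (Suc n) + \<alpha>) * ((real n + \<alpha>) gchoose j) = real (Suc j) * ((real (Suc n) + \<alpha>) gchoose (Suc j))"
      using gbinomial_absorption[of j "real (Suc n) + \<alpha>"] by (simp add: algebra_simps)
    then show ?thesis
      using j by (simp add: laguerre_coeff_def Suc_diff_le field_simps)
  qed
  then have "(\<Sum>k\<le>Suc n. real k * laguerre_coeff (Suc n) \<alpha> k * x ^ k)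
     = (\<Sum>k\<le>Suc n. (real (Suc n) * laguerre_coeff (Suc n) \<alpha> k - (real (Suc n) + \<alpha>) * laguerre_coeff n \<alpha> k) * x ^ k)"
    by (intro sum.cong) auto
  then show ?thesis
    unfolding x_laguerre_deriv laguerre_eq_sum[of "Suc n" "Suc n", OF order_refl] laguerre_eq_sum[of n "Suc n", OF le_SucI[OF order_refl]]
    by (simp add: left_diff_distrib sum_subtractf sum_distrib_left mult.assoc del: sum.atMost_Suc)
qed

text \<open>Comparison of coefficients again, now with x L_n contributing the shifted sequence
  \<open>?s\<close>; Pascal's rule and the product rule \<open>gbinomial_mult_1\<close> settle each
  coefficient.\<close>

lemma laguerre_ladder_up:
  "x * laguerre_deriv n \<alpha> x
     = real (Suc n) * laguerre (Suc n) \<alpha> x - (real (Suc n) + \<alpha> - x) * laguerre n \<alpha> x"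
proof -
  let ?s = "\<lambda>k. case k of 0 \<Rightarrow> 0 | Suc j \<Rightarrow> laguerre_coeff n \<alpha> j"
  have coeff: "real k * laguerre_coeff n \<alpha> k
      = real (Suc n) * laguerre_coeff (Suc n) \<alpha> k - (real (Suc n) + \<alpha>) * laguerre_coeff n \<alpha> k + ?s k"
    if k: "k \<le> Suc n" for k
  proof (cases "k = Suc n")
    case True
    then show ?thesis
      using cancel_fact_Suc[of n "(- 1) ^ Suc n"] by (simp add: laguerre_coeff_def del: fact_Suc of_nat_Suc)
  next
    case False
    then have kn: "k \<le> n" using k by simp
    then obtain j where j: "n = k + j" using le_Suc_ex[of k n] by auto
    let ?g = "\<lambda>j. (real n + \<alpha>) gchoose j"
    have g1: "(real (Suc n) + \<alpha>) gchoose (Suc j) = ?g j + ?g (Suc j)"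
      using gbinomial_Suc_Suc[of "real n + \<alpha>" j] by (simp add: algebra_simps)
    have g2: "(real n + \<alpha>) * ?g j = real j * ?g j + real (Suc j) * ?g (Suc j)"
      by (rule gbinomial_mult_1)
    show ?thesis
    proof (cases k)
      case 0
      then have n: "n = j" using j by simp
      show ?thesis
        using g1 g2 unfolding 0 by (simp add: laguerre_coeff_def n algebra_simps)
    next
      case (Suc i)
      have sc: "real k * ?g j = real (Suc n) * (?g j + ?g (Suc j)) - (real (Suc n) + \<alpha>) * ?g j - real k * ?g (Suc j)"
        using g2 j by (simp add: algebra_simps)
      have "?s k = (- 1) ^ i * ?g (Suc j) / fact i"
        using Suc j by (simp add: laguerre_coeff_def Suc_diff_le)
      also have "\<dots> = real (Suc i) * ((- 1) ^ i * ?g (Suc j) / fact (Suc i))"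
        by (rule cancel_fact_Suc[symmetric])
      also have "\<dots> = - ((- 1) ^ k / fact k) * (real k * ?g (Suc j))"
        unfolding Suc by (simp add: mult_ac del: fact_Suc of_nat_Suc)
      finally have "?s k = - ((- 1) ^ k / fact k) * (real k * ?g (Suc j))" .
      moreover have "laguerre_coeff (Suc n) \<alpha> k = ((- 1) ^ k / fact k) * (?g j + ?g (Suc j))"
        using j g1 by (simp add: laguerre_coeff_def Suc_diff_le)
      moreover have "laguerre_coeff n \<alpha> k = ((- 1) ^ k / fact k) * ?g j"
        using j by (simp add: laguerre_coeff_def)
      ultimately show ?thesis
        using sc by algebra
    qed
  qed
  have shift: "x * laguerre n \<alpha> x = (\<Sum>k\<le>Suc n. ?s k * x ^ k)"
    unfolding laguerre_eq_sum[of n n, OF order_refl] sum_distrib_left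
    by (subst sum.atMost_Suc_shift) (simp add: mult_ac)
  have "x * laguerre_deriv n \<alpha> x = (\<Sum>k\<le>Suc n. real k * laguerre_coeff n \<alpha> k * x ^ k)"
    unfolding x_laguerre_deriv by (simp add: laguerre_coeff_def)
  also have "\<dots> = (\<Sum>k\<le>Suc n. (real (Suc n) * laguerre_coeff (Suc n) \<alpha> k
      - (real (Suc n) + \<alpha>) * laguerre_coeff n \<alpha> k + ?s k) * x ^ k)"
    using coeff by (intro sum.cong) auto
  also have "\<dots> = real (Suc n) * (\<Sum>k\<le>Suc n. laguerre_coeff (Suc n) \<alpha> k * x ^ k)
      - (real (Suc n) + \<alpha>) * (\<Sum>k\<le>Suc n. laguerre_coeff n \<alpha> k * x ^ k) + (\<Sum>k\<le>Suc n. ?s k * x ^ k)"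
    by (simp add: left_diff_distrib distrib_right sum_subtractf sum.distrib sum_distrib_left mult.assoc del: sum.atMost_Suc)
  also have "\<dots> = real (Suc n) * laguerre (Suc n) \<alpha> x - (real (Suc n) + \<alpha>) * laguerre n \<alpha> x + x * laguerre n \<alpha> x"
    unfolding shift[symmetric] laguerre_eq_sum[of "Suc n" "Suc n", OF order_refl, symmetric]
      laguerre_eq_sum[of n "Suc n", OF le_SucI[OF order_refl], symmetric] ..
  finally show ?thesis by (simp add: left_diff_distrib)
qed

text \<open>The two ladder relations express the same x L_(n+1)' in terms of neighbouring
  polynomials.\<close>

lemma laguerre_three_term:
  "real (Suc (Suc n)) * laguerre (Suc (Suc n)) \<alpha> x
     = (2 * real (Suc n) + 1 + \<alpha> - x) * laguerre (Suc n) \<alpha> x - (real (Suc n) + \<alpha>) * laguerre n \<alpha> x"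
  using laguerre_ladder_up[of x "Suc n" \<alpha>] laguerre_ladder_down[of x n \<alpha>] by (simp add: algebra_simps)

lemma laguerre_0: "laguerre 0 \<alpha> x = 1" by (simp add: laguerre_def)

lemma laguerre_1: "laguerre (Suc 0) \<alpha> x = 1 + \<alpha> - x"
  by (simp add: laguerre_def)

text \<open>Differentiate the downward relation and eliminate the lower polynomial and its
  derivative by both ladders; this gives x times the equation, and x is cancelled.\<close>

lemma laguerre_ode:
  assumes "x \<noteq> 0" "(laguerre_deriv n \<alpha> has_real_derivative D) (at x)"
  shows "x * D + (\<alpha> + 1 - x) * laguerre_deriv n \<alpha> x + real n * laguerre n \<alpha> x = 0"
proof (cases n)
  case 0
  then have "laguerre_deriv n \<alpha> = (\<lambda>x. 0)" by (simp add: laguerre_deriv_def fun_eq_iff)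
  then show ?thesis using assms(2) 0 DERIV_unique[OF assms(2)] DERIV_const[of 0 "at x"] by simp
next
  case (Suc m)
  have "((\<lambda>x. x * laguerre_deriv n \<alpha> x) has_real_derivative laguerre_deriv n \<alpha> x + x * D) (at x)"
    using DERIV_mult[OF DERIV_ident assms(2)] by (simp add: algebra_simps)
  moreover have "((\<lambda>x. x * laguerre_deriv n \<alpha> x) has_real_derivative
     real n * laguerre_deriv n \<alpha> x - (real n + \<alpha>) * laguerre_deriv m \<alpha> x) (at x)"
    unfolding Suc laguerre_ladder_down by (intro DERIV_diff DERIV_cmult laguerre_has_derivative)
  ultimately have 1: "laguerre_deriv n \<alpha> x + x * D = real n * laguerre_deriv n \<alpha> x - (real n + \<alpha>) * laguerre_deriv m \<alpha> x"
    by (rule DERIV_unique)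
  have 2: "x * laguerre_deriv m \<alpha> x = real n * laguerre n \<alpha> x - (real n + \<alpha> - x) * laguerre m \<alpha> x"
    unfolding Suc by (rule laguerre_ladder_up)
  have 3: "x * laguerre_deriv n \<alpha> x = real n * laguerre n \<alpha> x - (real n + \<alpha>) * laguerre m \<alpha> x"
    unfolding Suc by (rule laguerre_ladder_down)
  have "x * (x * D + (\<alpha> + 1 - x) * laguerre_deriv n \<alpha> x + real n * laguerre n \<alpha> x) = 0"
    using 1 2 3 by algebra
  then show ?thesis using assms(1) by simp
qed

text \<open>Induction: the weights satisfy c_(N+1) (N+1+\<alpha>) = c_N (N+1), and with this the
  three-term recurrence absorbs the new summand.\<close>

lemma laguerre_Christoffel_Darboux:
  assumes "\<alpha> > -1"
  shows "(x - y) * (\<Sum>k<Suc n. Gamma (real k + 1) / Gamma (\<alpha> + real k + 1) * laguerre k \<alpha> x * laguerre k \<alpha> y)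
    = Gamma (real (Suc n) + 1) / Gamma (\<alpha> + real (Suc n) + 1) * ((real (Suc n) + \<alpha>) *
       (laguerre n \<alpha> x * laguerre (Suc n) \<alpha> y - laguerre (Suc n) \<alpha> x * laguerre n \<alpha> y))"
proof (induction n)
  case 0
  have "Gamma (\<alpha> + 1 + 1) = (\<alpha> + 1) * Gamma (\<alpha> + 1)" using assms by (intro Gamma_plus1) (auto elim!: nonpos_Ints_cases)
  moreover have "Gamma (\<alpha> + 1) > 0" using assms by (intro Gamma_real_pos) simp
  moreover have "Gamma (2::real) = 1" using Gamma_fact[of 1, where 'a = real] by simp
  ultimately have r: "Gamma (real (Suc 0) + 1) / Gamma (\<alpha> + real (Suc 0) + 1) * (real (Suc 0) + \<alpha>) = 1 / Gamma (\<alpha> + 1)"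
    using assms by (simp add: add.commute)
  have "(x - y) * (\<Sum>k<Suc 0. Gamma (real k + 1) / Gamma (\<alpha> + real k + 1) * laguerre k \<alpha> x * laguerre k \<alpha> y)
      = 1 / Gamma (\<alpha> + 1) * (laguerre 0 \<alpha> x * laguerre (Suc 0) \<alpha> y - laguerre (Suc 0) \<alpha> x * laguerre 0 \<alpha> y)"
    by (simp add: laguerre_0 laguerre_1)
  then show ?case unfolding r[symmetric] by (simp only: mult.assoc)
next
  case (Suc n)
  let ?L = "\<lambda>k z. laguerre k \<alpha> z" and ?N = "Suc n"
  let ?c = "Gamma (real ?N + 1) / Gamma (\<alpha> + real ?N + 1)"
  let ?d = "Gamma (real (Suc ?N) + 1) / Gamma (\<alpha> + real (Suc ?N) + 1)"
  have p: "Gamma (\<alpha> + real ?N + 1) > 0" "\<alpha> + real ?N + 1 > 0" using assms by (auto intro!: Gamma_real_pos)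
  have nz': "real ?N + 1 \<notin> \<int>\<^sub>\<le>\<^sub>0" by (auto elim!: nonpos_Ints_cases)
  have nz: "\<alpha> + real ?N + 1 \<notin> \<int>\<^sub>\<le>\<^sub>0" using p(2) by (auto elim!: nonpos_Ints_cases)
  have "Gamma (\<alpha> + real (Suc ?N) + 1) = (\<alpha> + real ?N + 1) * Gamma (\<alpha> + real ?N + 1)"
    using Gamma_plus1[OF nz] by (simp add: algebra_simps)
  moreover have "Gamma (real (Suc ?N) + 1) = (real ?N + 1) * Gamma (real ?N + 1)"
    using Gamma_plus1[OF nz'] by (simp add: algebra_simps)
  moreover have "real (Suc ?N) + \<alpha> = \<alpha> + real ?N + 1" by simp
  moreover have "(m * B) / (b * A) * b = B / A * m" if "b > 0" for m A B b :: real
    using that by simp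
  ultimately have d: "?d * (real (Suc ?N) + \<alpha>) = ?c * (real ?N + 1)"
    using p(2) by presburger
  have tx: "(real ?N + 1) * ?L (Suc ?N) z = (2 * real ?N + 1 + \<alpha> - z) * ?L ?N z - (real ?N + \<alpha>) * ?L n z" for z
    using laguerre_three_term[of n \<alpha> z] by (simp add: algebra_simps)
  have "(x - y) * (\<Sum>k<Suc ?N. Gamma (real k + 1) / Gamma (\<alpha> + real k + 1) * ?L k x * ?L k y)
      = ?c * ((real ?N + \<alpha>) * (?L n x * ?L ?N y - ?L ?N x * ?L n y)) + (x - y) * (?c * ?L ?N x * ?L ?N y)"
    unfolding sum.lessThan_Suc[of _ ?N] distrib_left Suc.IH ..
  also have "\<dots> = ?c * ((real ?N + 1) * (?L ?N x * ?L (Suc ?N) y - ?L (Suc ?N) x * ?L ?N y))"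
  proof -
    have "(real ?N + 1) * (?L ?N x * ?L (Suc ?N) y - ?L (Suc ?N) x * ?L ?N y)
        = (real ?N + \<alpha>) * (?L n x * ?L ?N y - ?L ?N x * ?L n y) + (x - y) * (?L ?N x * ?L ?N y)"
      using tx[of x] tx[of y] by algebra
    then show ?thesis by (simp only: distrib_left mult_ac)
  qed
  also have "\<dots> = ?d * ((real (Suc ?N) + \<alpha>) * (?L ?N x * ?L (Suc ?N) y - ?L (Suc ?N) x * ?L ?N y))"
    using d by (metis mult.assoc)
  finally show ?case .
qed

text \<open>The lower polynomial is traded for a derivative, so that only one function and its
  differential equation need to be analysed.\<close>

lemma laguerre_Christoffel_Darboux_deriv:
  assumes "\<alpha> > -1" "n \<ge> 1"
  shows "(x - y) * (\<Sum>k<n. Gamma (real k + 1) / Gamma (\<alpha> + real k + 1) * laguerre k \<alpha> x * laguerre k \<alpha> y)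
    = Gamma (real n + 1) / Gamma (\<alpha> + real n + 1) *
       (y * laguerre n \<alpha> x * laguerre_deriv n \<alpha> y - x * laguerre_deriv n \<alpha> x * laguerre n \<alpha> y)"
proof -
  obtain m where n: "n = Suc m" using assms(2) by (cases n) auto
  have "(real n + \<alpha>) * (laguerre m \<alpha> x * laguerre n \<alpha> y - laguerre n \<alpha> x * laguerre m \<alpha> y)
    = y * laguerre n \<alpha> x * laguerre_deriv n \<alpha> y - x * laguerre_deriv n \<alpha> x * laguerre n \<alpha> y"
    using laguerre_ladder_down[of x m \<alpha>] laguerre_ladder_down[of y m \<alpha>] unfolding n by algebra
  then show ?thesis using laguerre_Christoffel_Darboux[OF assms(1), of x y m] unfolding n by simp
qed

text \<open>This is sqrt x times the weighted polynomial. The exponent (\<alpha>+1)/2 removes the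
  first order term from the differential equation.\<close>

definition laguerre_u :: "nat \<Rightarrow> real \<Rightarrow> real \<Rightarrow> real" where
  "laguerre_u n \<alpha> x = x powr ((\<alpha> + 1) / 2) * exp (- x / 2) * laguerre n \<alpha> x"

definition laguerre_u' :: "nat \<Rightarrow> real \<Rightarrow> real \<Rightarrow> real" where
  "laguerre_u' n \<alpha> x = x powr ((\<alpha> + 1) / 2) * exp (- x / 2) *
     (((\<alpha> + 1) / (2 * x) - 1 / 2) * laguerre n \<alpha> x + laguerre_deriv n \<alpha> x)"

lemma laguerre_weight_derivative:
  assumes "(x::real) > 0"
  shows "((\<lambda>x. x powr b * exp (- x / 2)) has_real_derivative x powr b * exp (- x / 2) * (b / x - 1 / 2)) (at x)"
proof -
  have "x powr (b - 1) = x powr b / x" using assms by (simp add: powr_diff)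
  then show ?thesis
    using assms by (auto intro!: derivative_eq_intros simp: field_simps)
qed

lemma laguerre_u_derivative:
  assumes "x > 0"
  shows "(laguerre_u n \<alpha> has_real_derivative laguerre_u' n \<alpha> x) (at x)"
  using DERIV_mult[OF laguerre_weight_derivative[OF assms, of "(\<alpha> + 1) / 2"] laguerre_has_derivative[of n \<alpha> x]]
  unfolding laguerre_u_def[abs_def] laguerre_u'_def by (simp add: algebra_simps)

text \<open>The Liouville normal form. Up to the term with \<alpha>^2 - 1, its coefficient changes
  sign at x = 4 (n + (\<alpha>+1)/2), the turning point.\<close>

lemma laguerre_u'_derivative:
  assumes "x > 0"
  shows "(laguerre_u' n \<alpha> has_real_derivative
     (1 / 4 - (real n + (\<alpha> + 1) / 2) / x + (\<alpha>\<^sup>2 - 1) / (4 * x\<^sup>2)) * laguerre_u n \<alpha> x) (at x)"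
proof -
  obtain D where D: "(laguerre_deriv n \<alpha> has_real_derivative D) (at x)"
    using laguerre_deriv_has_derivative by blast
  let ?L = "laguerre n \<alpha> x" and ?L1 = "laguerre_deriv n \<alpha> x"
  let ?p = "x powr ((\<alpha> + 1) / 2) * exp (- x / 2)"
  let ?a = "(\<alpha> + 1) / (2 * x) - 1 / 2"
  have xD: "x * D = - ((\<alpha> + 1 - x) * ?L1 + real n * ?L)"
    using laguerre_ode[OF _ D] assms by simp
  have "((\<lambda>x. ((\<alpha> + 1) / (2 * x) - 1 / 2) * laguerre n \<alpha> x + laguerre_deriv n \<alpha> x) has_real_derivative
      - ((\<alpha> + 1) / (2 * x\<^sup>2)) * ?L + ?a * ?L1 + D) (at x)"
  proof -
    have "((\<lambda>x. (\<alpha> + 1) / (2 * x) - 1 / 2) has_real_derivative - ((\<alpha> + 1) / (2 * x\<^sup>2))) (at x)"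
      using assms by (auto intro!: derivative_eq_intros simp: power2_eq_square field_simps)
    from DERIV_add[OF DERIV_mult[OF this laguerre_has_derivative[of n \<alpha> x]] D]
    show ?thesis by (simp add: algebra_simps)
  qed
  note d = DERIV_mult[OF laguerre_weight_derivative[OF assms, of "(\<alpha> + 1) / 2"] this]
  have "D = - ((\<alpha> + 1 - x) * ?L1 + real n * ?L) / x" using xD assms by (simp add: field_simps)
  then have "?a * (?a * ?L + ?L1) + (- ((\<alpha> + 1) / (2 * x\<^sup>2)) * ?L + ?a * ?L1 + D)
      = (1 / 4 - (real n + (\<alpha> + 1) / 2) / x + (\<alpha>\<^sup>2 - 1) / (4 * x\<^sup>2)) * ?L"
  proof -
    define r where "r = 1 / x"
    have xr: "c / (2 * x) = c / 2 * r" "c / x = c * r" "c / (2 * x\<^sup>2) = c / 2 * r * r" "c / (4 * x\<^sup>2) = c / 4 * r * r" for c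
      by (simp_all add: r_def power2_eq_square)
    have "- ((\<alpha> + 1 - x) * ?L1 + real n * ?L) / x = - ((\<alpha> + 1) * r - 1) * ?L1 - real n * r * ?L"
      using assms by (simp add: r_def field_simps)
    then have D': "D = - ((\<alpha> + 1) * r - 1) * ?L1 - real n * r * ?L" using \<open>D = _\<close> by simp
    show ?thesis unfolding xr D' by (simp add: field_simps power2_eq_square)
  qed
  moreover have "p * a * S + T * p = R * (p * L)" if "a * S + T = R * L" for p a S T R L :: real
    using that by algebra
  moreover have "(\<alpha> + 1) / 2 / x = (\<alpha> + 1) / (2 * x)" by simp
  ultimately have "?p * ((\<alpha> + 1) / 2 / x - 1 / 2) * (?a * ?L + ?L1) + (- ((\<alpha> + 1) / (2 * x\<^sup>2)) * ?L + ?a * ?L1 + D) * ?p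
      = (1 / 4 - (real n + (\<alpha> + 1) / 2) / x + (\<alpha>\<^sup>2 - 1) / (4 * x\<^sup>2)) * laguerre_u n \<alpha> x"
    unfolding laguerre_u_def by presburger
  then show ?thesis using d unfolding laguerre_u'_def[abs_def] by simp
qed

text \<open>Christoffel-Darboux rewritten in u and u'. The square roots come from u = sqrt x times
  the weighted polynomial and the last term from differentiating e^(-x/2); the contributions of the
  power of x cancel.\<close>

lemma laguerre_kernel_off_diagonal:
  assumes "\<alpha> > -1" "n \<ge> 1" and x: "x > 0" and y: "y > 0"
  shows "(x - y) * laguerre_kernel \<alpha> n x y = Gamma (real n + 1) / Gamma (\<alpha> + real n + 1) *
    (sqrt (y / x) * laguerre_u n \<alpha> x * laguerre_u' n \<alpha> y - sqrt (x / y) * laguerre_u' n \<alpha> x * laguerre_u n \<alpha> y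
     - (x - y) / 2 * laguerre_u n \<alpha> x * laguerre_u n \<alpha> y / sqrt (x * y))"
proof -
  let ?p = "\<lambda>x. x powr (\<alpha> / 2) * exp (- x / 2)"
  let ?L = "laguerre n \<alpha>" and ?L1 = "laguerre_deriv n \<alpha>"
  have half: "z powr ((\<alpha> + 1) / 2) = z powr (\<alpha> / 2) * sqrt z" if "z > 0" for z
    using that by (simp add: powr_half_sqrt[symmetric] add_divide_distrib flip: powr_add)
  have K: "laguerre_kernel \<alpha> n x y = ?p x * ?p y *
      (\<Sum>k<n. Gamma (real k + 1) / Gamma (\<alpha> + real k + 1) * laguerre k \<alpha> x * laguerre k \<alpha> y)"
    unfolding laguerre_kernel_def laguerre_fun_def sum_distrib_left by (intro sum.cong) (auto simp: mult_ac)
  have u: "laguerre_u n \<alpha> z = ?p z * sqrt z * ?L z" if "z > 0" for z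
    using that by (simp add: laguerre_u_def half mult_ac)
  have u': "laguerre_u' n \<alpha> z = ?p z * sqrt z * (((\<alpha> + 1) / (2 * z) - 1 / 2) * ?L z + ?L1 z)" if "z > 0" for z
    using that by (simp add: laguerre_u'_def half mult_ac)
  define s t where "s = sqrt x" and "t = sqrt y"
  have st: "s > 0" "t > 0" "x = s * s" "y = t * t" using x y by (auto simp: s_def t_def)
  have "sqrt (y / x) = t / s" "sqrt (x / y) = s / t" "sqrt (x * y) = s * t"
    by (auto simp: s_def t_def real_sqrt_divide real_sqrt_mult)
  moreover have "t / s * (s * ?L x) * (t * (((\<alpha> + 1) / (2 * y) - 1 / 2) * ?L y + ?L1 y))
     - s / t * (s * (((\<alpha> + 1) / (2 * x) - 1 / 2) * ?L x + ?L1 x)) * (t * ?L y)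
     - (x - y) / 2 * (s * ?L x) * (t * ?L y) / (s * t)
     = y * ?L x * ?L1 y - x * ?L1 x * ?L y"
    using st(1,2) unfolding st(3,4) by (simp add: field_simps)
  ultimately have "sqrt (y / x) * laguerre_u n \<alpha> x * laguerre_u' n \<alpha> y - sqrt (x / y) * laguerre_u' n \<alpha> x * laguerre_u n \<alpha> y
     - (x - y) / 2 * laguerre_u n \<alpha> x * laguerre_u n \<alpha> y / sqrt (x * y)
     = ?p x * ?p y * (y * ?L x * ?L1 y - x * ?L1 x * ?L y)"
    unfolding u[OF x] u[OF y] u'[OF x] u'[OF y] s_def[symmetric] t_def[symmetric] by algebra
  then show ?thesis
    unfolding K using laguerre_Christoffel_Darboux_deriv[OF assms(1,2), of x y] by algebra
qed

section \<open>Generating function and contour integral\<close>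

section \<open>A contour integral for the Laguerre polynomials\<close>

text \<open>The generating function (1-t)^(-\<alpha>-1) exp(-x t/(1-t)), with the power written
  through the principal logarithm.\<close>

definition laguerre_gen :: "real \<Rightarrow> real \<Rightarrow> complex \<Rightarrow> complex" where
  "laguerre_gen \<alpha> x t = exp (- of_real x * t / (1 - t)) * exp (- of_real (\<alpha> + 1) * Ln (1 - t))"

lemma laguerre_gen_derivative:
  assumes "cmod t < 1"
  shows "(laguerre_gen \<alpha> x has_field_derivative
    (of_real (\<alpha> + 1) / (1 - t) - of_real x / (1 - t)\<^sup>2) * laguerre_gen \<alpha> x t) (at t)"
proof -
  have "Re t < 1" using assms complex_Re_le_cmod[of t] by linarith
  then have nz: "1 - t \<noteq> 0" and ln: "1 - t \<notin> \<real>\<^sub>\<le>\<^sub>0"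
    by (auto simp: complex_nonpos_Reals_iff)
  have 1: "((\<lambda>t. - of_real x * t / (1 - t)) has_field_derivative - of_real x / (1 - t)\<^sup>2) (at t)"
    using nz by (auto intro!: derivative_eq_intros simp: power2_eq_square field_simps)
  have 2: "((\<lambda>t. - of_real (\<alpha> + 1) * Ln (1 - t)) has_field_derivative of_real (\<alpha> + 1) / (1 - t)) (at t)"
    using nz ln by (auto intro!: derivative_eq_intros simp: field_simps)
  show ?thesis
    unfolding laguerre_gen_def[abs_def]
    using DERIV_mult[OF DERIV_fun_exp[OF 1] DERIV_fun_exp[OF 2]] by (simp add: algebra_simps)
qed

lemma laguerre_gen_holomorphic: "laguerre_gen \<alpha> x holomorphic_on ball 0 1"
  using laguerre_gen_derivative by (auto simp: holomorphic_on_open intro!: exI)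

text \<open>The first order differential equation in t translates into the three-term recurrence for
  the Taylor coefficients, with the right initial values.\<close>

lemma laguerre_gen_coeff:
  "(deriv ^^ n) (laguerre_gen \<alpha> x) 0 / fact n = complex_of_real (laguerre n \<alpha> x)"
proof -
  let ?f = "laguerre_gen \<alpha> x"
  define F where "F = fps_expansion ?f 0"
  have F: "?f has_fps_expansion F"
    unfolding F_def by (rule has_fps_expansion_fps_expansion[OF open_ball _ laguerre_gen_holomorphic]) simp
  define a z where "a = complex_of_real (\<alpha> + 1)" and "z = complex_of_real x"
  have L: "(\<lambda>t. (1 - t) * ((1 - t) * deriv ?f t)) has_fps_expansion (1 - fps_X) * ((1 - fps_X) * fps_deriv F)"
    by (intro fps_expansion_intros F)
  have R: "(\<lambda>t. a * ((1 - t) * ?f t) - z * ?f t) has_fps_expansion fps_const a * ((1 - fps_X) * F) - fps_const z * F"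
    by (intro fps_expansion_intros F)
  have "\<forall>\<^sub>F t in nhds 0. t \<in> ball (0::complex) 1" by (rule eventually_nhds_in_open) auto
  then have "\<forall>\<^sub>F t in nhds 0. (1 - t) * ((1 - t) * deriv ?f t) = a * ((1 - t) * ?f t) - z * ?f t"
  proof eventually_elim
    case (elim t)
    then have t: "cmod t < 1" by simp
    then have nz: "1 - t \<noteq> 0" by auto
    have "deriv ?f t = (a / (1 - t) - z / (1 - t)\<^sup>2) * ?f t"
      using DERIV_imp_deriv[OF laguerre_gen_derivative[OF t]] by (simp add: a_def z_def)
    then have "(1 - t) * ((1 - t) * deriv ?f t) = ((1 - t) * ((1 - t) * (a / (1 - t) - z / (1 - t)\<^sup>2))) * ?f t"
      by (simp only: mult.assoc)
    also have "(1 - t) * ((1 - t) * (a / (1 - t) - z / (1 - t)\<^sup>2)) = a * (1 - t) - z"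
    proof -
      have "s * (s * (a / s - z / s\<^sup>2)) = a * s - z" if "s \<noteq> 0" for s
        using that by (simp add: power2_eq_square field_simps)
      from this[OF nz] show ?thesis .
    qed
    finally show ?case by (simp add: algebra_simps)
  qed
  then have eq: "(1 - fps_X) * ((1 - fps_X) * fps_deriv F) = fps_const a * ((1 - fps_X) * F) - fps_const z * F"
    by (intro fps_expansion_unique_complex[OF _ R]) (rule iffD1[OF has_fps_expansion_cong[OF _ refl] L])
  let ?D = "fps_deriv F"
  have eq': "?D - fps_X * ?D - (fps_X * ?D - fps_X * (fps_X * ?D))
      = fps_const a * F - fps_const a * (fps_X * F) - fps_const z * F"
    using eq by (simp only: left_diff_distrib right_diff_distrib mult_1)
  \<comment> \<open>The coefficient of t^(n+1) in the differential equation, multiplied out.\<close>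
  have rec: "of_nat (Suc (Suc n)) * F $ Suc (Suc n) - 2 * (of_nat (Suc n) * F $ Suc n) + of_nat n * F $ n
      = a * (F $ Suc n - F $ n) - z * F $ Suc n" for n
    using arg_cong[OF eq', of "\<lambda>G. fps_nth G (Suc n)"] by (cases n; simp; simp add: algebra_simps)
  have rec0: "F $ 1 = (a - z) * F $ 0"
    using arg_cong[OF eq', of "\<lambda>G. fps_nth G 0"] by (simp; simp add: algebra_simps)
  have F0: "F $ 0 = 1"
    using fps_nth_fps_expansion[OF F, of 0] by (simp add: laguerre_gen_def)
  have "F $ n = complex_of_real (laguerre n \<alpha> x) \<and> F $ Suc n = complex_of_real (laguerre (Suc n) \<alpha> x)" for n
  proof (induction n)
    case 0
    then show ?case using F0 rec0 by (simp add: laguerre_0 laguerre_1 a_def z_def)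
  next
    case (Suc n)
    have "of_nat (Suc (Suc n)) * F $ Suc (Suc n)
        = (2 * of_nat (Suc n) + a - z) * F $ Suc n - (of_nat n + a) * F $ n"
      using rec[of n] by (simp add: algebra_simps)
    also have "\<dots> = complex_of_real ((2 * real (Suc n) + 1 + \<alpha> - x) * laguerre (Suc n) \<alpha> x
        - (real (Suc n) + \<alpha>) * laguerre n \<alpha> x)"
      using Suc.IH by (simp add: a_def z_def algebra_simps)
    also have "\<dots> = of_nat (Suc (Suc n)) * complex_of_real (laguerre (Suc (Suc n)) \<alpha> x)"
      unfolding laguerre_three_term[symmetric] by simp
    finally show ?case using Suc.IH by (simp only: mult_left_cancel[OF of_nat_neq_0])
  qed
  then show ?thesis using fps_nth_fps_expansion[OF F, of n] by simp
qed

text \<open>The substitution t = -exp w in Cauchy's formula, with the factor e^(-x/2) drawn in: -x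
  t/(1-t) - x/2 becomes (x/2) tanh(w/2), an odd function of w.\<close>

definition laguerre_integrand :: "nat \<Rightarrow> real \<Rightarrow> real \<Rightarrow> complex \<Rightarrow> complex" where
  "laguerre_integrand n \<alpha> x w = exp (of_real (x / 2) * ((exp w - 1) / (exp w + 1)) - of_nat n * w)
     * exp (- of_real (\<alpha> + 1) * Ln (1 + exp w))"

text \<open>Chosen so that the end of the ray in direction \<open>\<zeta>\<close> has imaginary part
  \<pi>.\<close>

definition ray_length :: real where "ray_length = 2 * pi / sqrt 3"

lemma ray_length_pos: "ray_length > 0" by (simp add: ray_length_def)

text \<open>In this region exp w lies in the open unit disc or equals 1, so the logarithm of 1 + exp
  w stays off its cut.\<close>

lemma Re_one_plus_exp_pos:
  assumes "Re w < 0 \<or> w = 0"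
  shows "Re (1 + exp w) > 0"
proof (cases "w = 0")
  case False
  then have "cmod (exp w) < 1" using assms by simp
  then have "\<bar>Re (exp w)\<bar> < 1" using abs_Re_le_cmod[of "exp w"] by linarith
  then show ?thesis unfolding plus_complex.sel one_complex.sel by linarith
qed simp

lemma one_plus_exp_nonzero:
  assumes "Re w < 0 \<or> w = 0"
  shows "1 + exp w \<noteq> 0" "exp w + 1 \<noteq> 0" "1 + exp w \<notin> \<real>\<^sub>\<le>\<^sub>0"
proof -
  note p = Re_one_plus_exp_pos[OF assms]
  show nz: "1 + exp w \<noteq> 0" using p by (metis less_irrefl zero_complex.sel(1))
  then show "exp w + 1 \<noteq> 0" by (simp only: add.commute not_False_eq_True)
  show "1 + exp w \<notin> \<real>\<^sub>\<le>\<^sub>0" using p by (simp add: complex_nonpos_Reals_iff)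
qed

lemma laguerre_integrand_holomorphic:
  "laguerre_integrand n \<alpha> x holomorphic_on {w. Re w < 0 \<or> w = 0}"
proof -
  let ?S = "{w. 0 < Re (1 + exp w)}"
  have "laguerre_integrand n \<alpha> x holomorphic_on ?S"
    unfolding laguerre_integrand_def
    by (intro holomorphic_intros) (auto simp: complex_nonpos_Reals_iff add.commute complex_eq_iff)
  then show ?thesis
    by (rule holomorphic_on_subset) (use Re_one_plus_exp_pos in blast)
qed

lemma laguerre_integrand_cnj:
  assumes "Re w < 0 \<or> w = 0"
  shows "laguerre_integrand n \<alpha> x (cnj w) = cnj (laguerre_integrand n \<alpha> x w)"
  using cnj_Ln[OF one_plus_exp_nonzero(3)[OF assms]]
  by (simp add: laguerre_integrand_def exp_cnj)

text \<open>Under t = -exp w a circle becomes a vertical segment between conjugate points. The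
  triangle with third vertex 0 replaces it by two rays issuing from the saddle at 0; they are
  conjugate, so their difference is 2i times an imaginary part.\<close>

theorem laguerre_contour_integral:
  "(- 1) ^ n * exp (- x / 2) * laguerre n \<alpha> x
     = Im (\<zeta> * (LINT r:{0..ray_length}|lborel. laguerre_integrand n \<alpha> x (of_real r * \<zeta>))) / pi"
proof -
  let ?G = "laguerre_integrand n \<alpha> x" and ?f = "laguerre_gen \<alpha> x"
  define z0 where "z0 = of_real ray_length * \<zeta>"
  define a where "a = - pi / sqrt 3"
  have "sqrt 3 * sqrt 3 = (3::real)" by simp
  then have z0: "z0 = Complex a pi"
    by (simp add: z0_def complex_eq_iff Re_\<zeta> Im_\<zeta> ray_length_def a_def)
  have a: "a < 0" by (simp add: a_def)
  \<comment> \<open>With this radius the circle |t| = \<rho> is the image of the segment from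
    \<open>cnj z0\<close> to \<open>z0\<close>.\<close>
  define \<rho> where "\<rho> = exp a"
  have \<rho>: "0 < \<rho>" "\<rho> < 1" using a by (auto simp: \<rho>_def)
  have "((\<lambda>u. ?f u / (u - 0) ^ Suc n) has_contour_integral
      (2 * pi * \<i>) / fact n * (deriv ^^ n) ?f 0) (circlepath 0 \<rho>)"
  proof (rule Cauchy_has_contour_integral_higher_derivative_circlepath)
    show "continuous_on (cball 0 \<rho>) ?f"
      by (rule continuous_on_subset[OF holomorphic_on_imp_continuous_on[OF laguerre_gen_holomorphic]]) (use \<rho> in auto)
    show "?f holomorphic_on ball 0 \<rho>"
      by (rule holomorphic_on_subset[OF laguerre_gen_holomorphic]) (use \<rho> in auto)
  qed (use \<rho> in auto)
  then have I1: "((\<lambda>\<theta>. ?f (circlepath 0 \<rho> \<theta>) / circlepath 0 \<rho> \<theta> ^ Suc n *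
      vector_derivative (circlepath 0 \<rho>) (at \<theta> within {0..1})) has_integral
      2 * pi * \<i> * of_real (laguerre n \<alpha> x)) {0..1}"
    unfolding has_contour_integral_def using laguerre_gen_coeff[of n \<alpha> x] by (simp add: field_simps)
  have Gline: "?G (linepath (cnj z0) z0 \<theta>) * (z0 - cnj z0)
      = of_real ((- 1) ^ n * exp (- x / 2)) * (?f (circlepath 0 \<rho> \<theta>) / circlepath 0 \<rho> \<theta> ^ Suc n *
      vector_derivative (circlepath 0 \<rho>) (at \<theta> within {0..1}))" if \<theta>: "\<theta> \<in> {0..1}" for \<theta>
  proof -
    define t where "t = circlepath 0 \<rho> \<theta>"
    define w where "w = linepath (cnj z0) z0 \<theta>"
    have t: "t = of_real \<rho> * exp (2 * of_real pi * \<i> * of_real \<theta>)" by (simp add: t_def circlepath)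
    have t0: "t \<noteq> 0" and t1: "cmod t < 1" using \<rho> by (simp_all add: t norm_mult)
    then have nz: "1 - t \<noteq> 0" by auto
    have "w = of_real a - of_real pi * \<i> + 2 * of_real pi * \<i> * of_real \<theta>"
      by (simp add: w_def linepath_def z0 complex_eq_iff algebra_simps)
    then have ew: "exp w = - t"
      by (simp add: exp_add exp_diff t \<rho>_def exp_of_real exp_pi_i)
    have vd: "vector_derivative (circlepath 0 \<rho>) (at \<theta> within {0..1}) = 2 * of_real pi * \<i> * t"
      using vector_derivative_circlepath01[of \<theta> 0 \<rho>] \<theta> by (simp add: t)
    have dz: "z0 - cnj z0 = 2 * of_real pi * \<i>" by (simp add: z0 complex_eq_iff)
    have e1: "of_real (x / 2) * ((exp w - 1) / (exp w + 1)) = of_real (- x / 2) + (- of_real x * t / (1 - t))"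
      using nz unfolding ew by (simp add: field_simps)
    have "?G w = exp (of_real (- x / 2)) * ?f t * exp (- (of_nat n * w))"
      unfolding laguerre_integrand_def laguerre_gen_def e1 unfolding ew by (simp only: diff_conv_add_uminus exp_add mult_ac)
    also have "exp (- (of_nat n * w)) = (- 1) ^ n / t ^ n"
    proof -
      have "exp (of_nat n * w) = (- 1) ^ n * t ^ n"
        by (simp only: exp_of_nat_mult ew power_minus[of t])
      moreover have "inverse ((- 1) ^ n * t ^ n) = (- 1) ^ n / t ^ n"
        by (simp add: divide_inverse flip: power_inverse)
      ultimately show ?thesis by (simp add: exp_minus)
    qed
    also have "exp (complex_of_real (- x / 2)) = of_real (exp (- x / 2))" by (rule exp_of_real)
    finally have Gw: "?G w = of_real (exp (- x / 2)) * ?f t * ((- 1) ^ n / t ^ n)" .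
    show ?thesis
      unfolding t_def[symmetric] w_def[symmetric] Gw vd dz using t0 by (simp add: field_simps)
  qed
  have I2: "((\<lambda>\<theta>. ?G (linepath (cnj z0) z0 \<theta>) * (z0 - cnj z0)) has_integral
      of_real ((- 1) ^ n * exp (- x / 2)) * (2 * pi * \<i> * of_real (laguerre n \<alpha> x))) {0..1}"
    by (rule has_integral_eq[OF Gline[symmetric] has_integral_mult_right[OF I1]])
  then have line: "contour_integral (linepath (cnj z0) z0) ?G
      = of_real ((- 1) ^ n * exp (- x / 2)) * (2 * pi * \<i> * of_real (laguerre n \<alpha> x))"
    by (intro contour_integral_unique) (simp add: has_contour_integral_linepath)
  \<comment> \<open>The triangle meets the imaginary axis only at its vertex 0, which is exactly the
    region of holomorphy established above.\<close>
  have hull: "convex hull {cnj z0, z0, 0} \<subseteq> {w. Re w < 0 \<or> w = 0}"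
  proof
    fix w assume "w \<in> convex hull {cnj z0, z0, 0}"
    then obtain u v s where uv: "u \<ge> 0" "v \<ge> 0" "s \<ge> 0" "u + v + s = 1"
      "w = u *\<^sub>R cnj z0 + v *\<^sub>R z0 + s *\<^sub>R 0"
      unfolding convex_hull_3 by blast
    have Re: "Re w = (u + v) * a" unfolding uv(5) by (simp add: z0 algebra_simps)
    show "w \<in> {w. Re w < 0 \<or> w = 0}"
    proof (cases "u + v = 0")
      case True
      then have "u = 0" "v = 0" using uv by auto
      then show ?thesis using uv(5) by simp
    next
      case False
      then show ?thesis using Re a uv(1,2) by (simp add: mult_pos_neg)
    qed
  qed
  have hol: "?G holomorphic_on convex hull {cnj z0, z0, 0}"
    by (rule holomorphic_on_subset[OF laguerre_integrand_holomorphic hull])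
  have cont: "continuous_on (convex hull {cnj z0, z0, 0}) ?G"
    by (rule holomorphic_on_imp_continuous_on[OF hol])
  have ci: "?G contour_integrable_on linepath p q" if "p \<in> {cnj z0, z0, 0}" "q \<in> {cnj z0, z0, 0}" for p q
  proof (intro contour_integrable_continuous_linepath continuous_on_subset[OF cont])
    show "closed_segment p q \<subseteq> convex hull {cnj z0, z0, 0}"
      unfolding segment_convex_hull using that by (intro hull_mono) auto
  qed
  have "contour_integral (linepath (cnj z0) z0 +++ linepath z0 0 +++ linepath 0 (cnj z0)) ?G = 0"
    by (intro contour_integral_unique Cauchy_theorem_triangle hol)
  then have sum0: "contour_integral (linepath (cnj z0) z0) ?G + contour_integral (linepath z0 0) ?G
      + contour_integral (linepath 0 (cnj z0)) ?G = 0"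
    by (simp add: ci contour_integrable_joinI add.assoc)
  let ?A = "\<zeta> * (LINT r:{0..ray_length}|lborel. ?G (of_real r * \<zeta>))"
  have seg: "Re (of_real r * \<zeta>) < 0 \<or> of_real r * \<zeta> = 0" if "r \<ge> 0" for r :: real
    using that by (cases "r = 0") (auto simp: Re_\<zeta>)
  have A: "((\<lambda>\<theta>. ?G (linepath 0 z0 \<theta>) * z0) has_integral ?A) {0..1}"
  proof -
    have c: "continuous_on {0..ray_length} (\<lambda>r. ?G (of_real r * \<zeta>))"
      by (rule continuous_on_compose2[OF holomorphic_on_imp_continuous_on[OF laguerre_integrand_holomorphic]])
        (auto intro!: continuous_intros simp: Re_\<zeta>)
    have s: "set_integrable lborel {0..ray_length} (\<lambda>r. ?G (of_real r * \<zeta>))"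
      by (rule borel_integrable_atLeastAtMost'[OF c])
    have "((\<lambda>r. \<zeta> * ?G (of_real r * \<zeta>)) has_integral ?A) {0..ray_length}"
      unfolding set_borel_integral_eq_integral(2)[OF s]
      by (intro has_integral_mult_right integrable_integral set_borel_integral_eq_integral(1) s)
    then have "((\<lambda>\<theta>. \<zeta> * ?G (of_real (ray_length * \<theta>) * \<zeta>)) has_integral (1 / ray_length) *\<^sub>R ?A)
        ((\<lambda>t. t / ray_length) ` {0..ray_length})"
      using has_integral_stretch_real[of "\<lambda>r. \<zeta> * ?G (of_real r * \<zeta>)" ?A 0 ray_length ray_length] ray_length_pos by simp
    moreover have "(\<lambda>t. t / ray_length) ` {0..ray_length} = {0..1}"
      using ray_length_pos by (simp add: image_divide_atLeastAtMost)
    ultimately have "((\<lambda>\<theta>. \<zeta> * ?G (of_real (ray_length * \<theta>) * \<zeta>)) has_integral (1 / ray_length) *\<^sub>R ?A) {0..1}"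
      by simp
    from has_integral_cmul[OF this, of ray_length]
    have "((\<lambda>\<theta>. ray_length *\<^sub>R (\<zeta> * ?G (of_real (ray_length * \<theta>) * \<zeta>))) has_integral ?A) {0..1}"
      using ray_length_pos by simp
    moreover have "ray_length *\<^sub>R (\<zeta> * ?G (of_real (ray_length * \<theta>) * \<zeta>)) = ?G (linepath 0 z0 \<theta>) * z0" for \<theta>
      by (simp add: linepath_def z0_def scaleR_conv_of_real mult_ac)
    ultimately show ?thesis by simp
  qed
  then have up: "contour_integral (linepath 0 z0) ?G = ?A"
    by (intro contour_integral_unique) (simp add: has_contour_integral_linepath)
  have down: "contour_integral (linepath 0 (cnj z0)) ?G = cnj ?A"
  proof (rule contour_integral_unique)
    have "((\<lambda>\<theta>. cnj (?G (linepath 0 z0 \<theta>) * z0)) has_integral cnj ?A) {0..1}"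
      using has_integral_linear[OF A bounded_linear_cnj] by (simp add: o_def)
    moreover have "cnj (?G (linepath 0 z0 \<theta>) * z0) = ?G (linepath 0 (cnj z0) \<theta>) * (cnj z0 - 0)" if "\<theta> \<in> {0..1}" for \<theta>
    proof -
      have l: "linepath 0 z0 \<theta> = of_real (ray_length * \<theta>) * \<zeta>"
        by (simp add: linepath_def z0_def scaleR_conv_of_real)
      have "linepath 0 (cnj z0) \<theta> = cnj (linepath 0 z0 \<theta>)" by (simp add: linepath_def)
      moreover have "Re (linepath 0 z0 \<theta>) < 0 \<or> linepath 0 z0 \<theta> = 0"
        unfolding l using that ray_length_pos by (intro seg) simp
      ultimately have "?G (linepath 0 (cnj z0) \<theta>) = cnj (?G (linepath 0 z0 \<theta>))"
        by (metis laguerre_integrand_cnj)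
      then show ?thesis by simp
    qed
    ultimately show "(?G has_contour_integral cnj ?A) (linepath 0 (cnj z0))"
      unfolding has_contour_integral_linepath by (rule has_integral_eq[rotated])
  qed
  have rev: "contour_integral (linepath z0 0) ?G = - contour_integral (linepath 0 z0) ?G"
    by (metis contour_integral_reversepath reversepath_linepath valid_path_linepath)
  have "contour_integral (linepath (cnj z0) z0) ?G = ?A - cnj ?A"
    using sum0 unfolding rev up down by algebra
  also have "\<dots> = 2 * \<i> * of_real (Im ?A)" by (simp add: complex_eq_iff)
  finally have "of_real ((- 1) ^ n * exp (- x / 2)) * (2 * pi * \<i> * of_real (laguerre n \<alpha> x)) = 2 * \<i> * of_real (Im ?A)"
    unfolding line .
  then have "Im (of_real ((- 1) ^ n * exp (- x / 2)) * (2 * pi * \<i> * of_real (laguerre n \<alpha> x))) = Im (2 * \<i> * of_real (Im ?A))"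
    by (rule arg_cong)
  moreover have "complex_of_real ((- 1) ^ n * exp (- x / 2)) * (2 * pi * \<i> * of_real (laguerre n \<alpha> x))
      = \<i> * of_real (2 * pi * ((- 1) ^ n * exp (- x / 2) * laguerre n \<alpha> x))" by simp
  ultimately show ?thesis
    by (simp only: Im_i_times Re_complex_of_real) (simp add: field_simps)
qed

section \<open>Steepest descent for the Laguerre integral at the turning point\<close>

section \<open>The cubic saddle point at the turning point\<close>

text \<open>This is 2 tanh(w/2) - w = -w^3/12 + w^5/120 - ...: for x = 4\<nu> the linear terms
  cancel and the saddle is cubic.\<close>

definition saddle_phase :: "complex \<Rightarrow> complex" where
  "saddle_phase w = 2 * ((exp w - 1) / (exp w + 1)) - w"

text \<open>This is (2 cosh(w/2))^(-\<beta>), an even function.\<close>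

definition saddle_amp :: "real \<Rightarrow> complex \<Rightarrow> complex" where
  "saddle_amp \<beta> w = exp (of_real (\<beta> / 2) * w - of_real \<beta> * Ln (1 + exp w))"

lemma laguerre_integrand_saddle:
  "laguerre_integrand n \<alpha> (4 * (real n + (\<alpha> + 1) / 2)) w
     = exp (of_real (real n + (\<alpha> + 1) / 2) * saddle_phase w) * saddle_amp (\<alpha> + 1) w"
proof -
  have gen: "of_real (4 * (real n + (\<alpha> + 1) / 2) / 2) * q - of_nat n * w + - of_real (\<alpha> + 1) * l
      = of_real (real n + (\<alpha> + 1) / 2) * (2 * q - w) + (of_real ((\<alpha> + 1) / 2) * w - of_real (\<alpha> + 1) * l)"
    for q l :: complex
    by (simp add: field_simps)
  show ?thesis
    unfolding laguerre_integrand_def saddle_phase_def saddle_amp_def exp_add[symmetric]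
    by (rule arg_cong[where f = exp, OF gen])
qed

lemma ray_left: "r \<ge> 0 \<Longrightarrow> Re (of_real r * \<zeta>) < 0 \<or> of_real r * \<zeta> = 0" for r :: real
  by (cases "r = 0") (auto simp: Re_\<zeta>)

lemma norm_ray: "r \<ge> 0 \<Longrightarrow> cmod (of_real r * \<zeta>) = r" for r :: real
  by (simp add: norm_mult norm_\<zeta>)

lemma ray_cubed: "(of_real r * \<zeta>) ^ 3 = of_real (r ^ 3)" for r :: real
  by (simp add: power_mult_distrib \<zeta>_cubed)

lemma bounded_on_ray:
  fixes f :: "real \<Rightarrow> 'a::real_normed_vector"
  assumes "continuous_on {0..ray_length} f"
  obtains B where "B \<ge> 0" "\<And>r. 0 \<le> r \<Longrightarrow> r \<le> ray_length \<Longrightarrow> norm (f r) \<le> B"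
proof -
  have "bounded (f ` {0..ray_length})"
    by (intro compact_imp_bounded compact_continuous_image assms) simp
  then obtain B where B: "\<forall>y\<in>f ` {0..ray_length}. norm y \<le> B" unfolding bounded_iff by blast
  have "norm (f r) \<le> max B 0" if "0 \<le> r" "r \<le> ray_length" for r
    using B that by (auto simp: le_max_iff_disj)
  then show ?thesis using that[of "max B 0"] by simp
qed

lemma ray_continuous_exp: "continuous_on A (\<lambda>r. exp (of_real r * \<zeta>))"
  by (intro continuous_intros)

lemma saddle_phase_continuous: "continuous_on {0..ray_length} (\<lambda>r. saddle_phase (of_real r * \<zeta>))"
  unfolding saddle_phase_def
  by (intro continuous_intros) (use one_plus_exp_nonzero(2)[OF ray_left] in auto)

lemma saddle_amp_continuous: "continuous_on {0..ray_length} (\<lambda>r. saddle_amp \<beta> (of_real r * \<zeta>))"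
  unfolding saddle_amp_def
  by (intro continuous_intros) (use one_plus_exp_nonzero(3)[OF ray_left] in auto)

text \<open>Multiply by exp w + 1, replace exp by its Taylor polynomial of degree 6 and check a
  polynomial identity; the denominator is bounded away from 0 on the compact ray.\<close>

lemma saddle_phase_expansion:
  obtains C where "C \<ge> 0"
    "\<And>r. 0 \<le> r \<Longrightarrow> r \<le> ray_length \<Longrightarrow>
      cmod (saddle_phase (of_real r * \<zeta>) - (- ((of_real r * \<zeta>) ^ 3) / 12 + (of_real r * \<zeta>) ^ 5 / 120)) \<le> C * r ^ 7"
proof -
  let ?w = "\<lambda>r. of_real r * \<zeta>"
  obtain r0 where r0: "r0 \<in> {0..ray_length}"
    "\<And>r. r \<in> {0..ray_length} \<Longrightarrow> cmod (exp (?w r0) + 1) \<le> cmod (exp (?w r) + 1)"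
  proof -
    have "continuous_on {0..ray_length} (\<lambda>r. cmod (exp (?w r) + 1))" by (intro continuous_intros)
    moreover have "{0..ray_length} \<noteq> {}" using ray_length_pos by simp
    ultimately show ?thesis using continuous_attains_inf[OF compact_Icc] that by blast
  qed
  define m where "m = cmod (exp (?w r0) + 1)"
  have m: "m > 0" using one_plus_exp_nonzero(2)[OF ray_left] r0(1) by (simp add: m_def)
  \<comment> \<open>\<open>q\<close> is the cofactor of w^7 in 2 (T - 1) - p (T + 1), where
    \<open>T\<close> is the Taylor polynomial of exp and \<open>p\<close> the truncated series of 2
    tanh(w/2).\<close>
  define q where "q w = - (1 / 480 + w / 1440 + w ^ 2 / 4320 + w ^ 3 / 14400 + w ^ 4 / 86400)" for w :: complex
  define p where "p w = w - w ^ 3 / 12 + w ^ 5 / 120" for w :: complex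
  define T where "T w = 1 + w + w ^ 2 / 2 + w ^ 3 / 6 + w ^ 4 / 24 + w ^ 5 / 120 + w ^ 6 / 720" for w :: complex
  obtain Bq where Bq: "Bq \<ge> 0" "\<And>r. 0 \<le> r \<Longrightarrow> r \<le> ray_length \<Longrightarrow> cmod (q (?w r)) \<le> Bq"
    by (rule bounded_on_ray[of "\<lambda>r. q (?w r)"]) (auto simp: q_def intro!: continuous_intros that)
  obtain Bp where Bp: "Bp \<ge> 0" "\<And>r. 0 \<le> r \<Longrightarrow> r \<le> ray_length \<Longrightarrow> cmod (2 - p (?w r)) \<le> Bp"
    by (rule bounded_on_ray[of "\<lambda>r. 2 - p (?w r)"]) (auto simp: p_def intro!: continuous_intros that)
  have alg: "2 * (T w - 1) - p w * (T w + 1) = w ^ 7 * q w" for w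
  proof -
    have "720 * T w = 720 + 720 * w + 360 * w ^ 2 + 120 * w ^ 3 + 30 * w ^ 4 + 6 * w ^ 5 + w ^ 6"
      by (simp add: T_def)
    moreover have "120 * p w = 120 * w - 10 * w ^ 3 + w ^ 5" by (simp add: p_def)
    moreover have "86400 * q w = - (180 + 60 * w + 20 * w ^ 2 + 6 * w ^ 3 + w ^ 4)" by (simp add: q_def)
    ultimately have "86400 * (2 * (T w - 1) - p w * (T w + 1)) = 86400 * (w ^ 7 * q w)" by algebra
    then show ?thesis by (metis mult_cancel_left zero_neq_numeral)
  qed
  let ?C = "(Bq + exp ray_length / 720 * Bp) / m"
  have "cmod (saddle_phase (?w r) - (- (?w r ^ 3) / 12 + ?w r ^ 5 / 120)) \<le> ?C * r ^ 7"
    if r: "0 \<le> r" "r \<le> ray_length" for r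
  proof -
    let ?W = "?w r"
    let ?e = "saddle_phase ?W - (- (?W ^ 3) / 12 + ?W ^ 5 / 120)"
    have nz: "exp ?W + 1 \<noteq> 0" using one_plus_exp_nonzero(2)[OF ray_left[OF r(1)]] .
    have T: "(\<Sum>i\<le>6. ?W ^ i / fact i) = T ?W"
      by (simp add: T_def numeral_eq_Suc fact_Suc)
    have rem: "cmod (exp ?W - T ?W) \<le> exp ray_length / 720 * r ^ 7"
    proof -
      have "cmod (exp ?W - T ?W) \<le> exp (cmod ?W) * cmod ?W ^ 7 / fact 6"
        using Taylor_exp_field[of ?W 6] unfolding T by simp
      also have "\<dots> = exp r / 720 * r ^ 7" unfolding norm_ray[OF r(1)] by (simp add: fact_numeral)
      also have "\<dots> \<le> exp ray_length / 720 * r ^ 7"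
        using r by (intro mult_right_mono divide_right_mono) auto
      finally show ?thesis .
    qed
    have "?e = 2 * ((exp ?W - 1) / (exp ?W + 1)) - p ?W" by (simp add: saddle_phase_def p_def)
    moreover have "(2 * (a / b) - c) * b = 2 * a - c * b" if "b \<noteq> 0" for a b c :: complex
      using that by (simp add: left_diff_distrib)
    ultimately have "?e * (exp ?W + 1) = 2 * (exp ?W - 1) - p ?W * (exp ?W + 1)"
      using nz by presburger
    also have "\<dots> = (2 * (T ?W - 1) - p ?W * (T ?W + 1)) + (exp ?W - T ?W) * (2 - p ?W)"
      by (simp add: algebra_simps)
    finally have "cmod (?e * (exp ?W + 1)) \<le> cmod (?W ^ 7 * q ?W) + cmod ((exp ?W - T ?W) * (2 - p ?W))"
      unfolding alg by (simp add: norm_triangle_ineq)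
    also have "\<dots> \<le> r ^ 7 * Bq + (exp ray_length / 720 * r ^ 7) * Bp"
      unfolding norm_mult[of "?W ^ 7"] norm_mult[of "exp ?W - T ?W"] norm_power[of ?W] norm_ray[OF r(1)]
      using r by (intro add_mono mult_mono Bq Bp rem) auto
    also have "\<dots> = (Bq + exp ray_length / 720 * Bp) * r ^ 7" by (simp add: algebra_simps)
    finally have 1: "cmod ?e * cmod (exp ?W + 1) \<le> (Bq + exp ray_length / 720 * Bp) * r ^ 7"
      by (simp add: norm_mult)
    have "cmod ?e * m \<le> cmod ?e * cmod (exp ?W + 1)"
      using r0(2)[of r] r by (intro mult_left_mono) (auto simp: m_def)
    then have "cmod ?e * m \<le> (Bq + exp ray_length / 720 * Bp) * r ^ 7" using 1 by linarith
    then have "cmod ?e \<le> (Bq + exp ray_length / 720 * Bp) * r ^ 7 / m"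
      using m by (simp only: pos_le_divide_eq)
    then show ?thesis by simp
  qed
  moreover have "?C \<ge> 0" using Bq Bp m by simp
  ultimately show ?thesis using that by blast
qed

text \<open>With s = r/2 this is the negativity of the real part of the phase on the ray, cleared of
  denominators. For s <= 1 Taylor bounds suffice; beyond, the cosine is negative and only an
  inequality for exp(2s) is left.\<close>

lemma hyperbolic_trig_inequality:
  fixes s :: real
  assumes "0 < s" "s \<le> pi / sqrt 3"
  shows "s * (exp (- s) + 2 * cos (sqrt 3 * s) + exp s) < 2 * (exp s - exp (- s))"
proof (cases "s \<le> 1")
  case True
  let ?a = "1 + s + s\<^sup>2 / 2"
  have 1: "?a \<le> exp s" using assms by (intro exp_lower_Taylor_quadratic) simp
  have 2: "exp s \<le> 1 + s + s\<^sup>2" using assms True by (intro exp_bound) auto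
  have 3: "exp (- s) \<le> 1 - s + s\<^sup>2 / 2"
  proof -
    have "0 < ?a" using assms by (simp add: add_pos_nonneg)
    have "exp (- s) = 1 / exp s" by (simp add: exp_minus field_simps)
    also have "\<dots> \<le> 1 / ?a" using 1 \<open>0 < ?a\<close> by (intro divide_left_mono) auto
    also have "\<dots> \<le> 1 - s + s\<^sup>2 / 2"
    proof -
      have "(1 - s + s\<^sup>2 / 2) * ?a = 1 + s ^ 4 / 4"
        by (simp add: algebra_simps power2_eq_square power4_eq_xxxx)
      then have "1 \<le> (1 - s + s\<^sup>2 / 2) * ?a" by simp
      then show ?thesis using \<open>0 < ?a\<close> by (simp only: pos_divide_le_eq)
    qed
    finally show ?thesis .
  qed
  have 4: "cos (sqrt 3 * s) \<le> 1 - 3 * s\<^sup>2 / 2 + 9 * s ^ 4 / 24"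
  proof -
    obtain t where t: "cos (sqrt 3 * s) = (\<Sum>m<4. cos_coeff m * (sqrt 3 * s) ^ m)
        + (cos (t + 1/2 * real 4 * pi) / fact 4) * (sqrt 3 * s) ^ 4"
      using Maclaurin_cos_expansion[of "sqrt 3 * s" 4] by blast
    have p2: "(sqrt 3 * s)\<^sup>2 = 3 * s\<^sup>2" by (simp add: power_mult_distrib)
    have p4: "(sqrt 3 * s) ^ 4 = 9 * s ^ 4"
    proof -
      have "(sqrt 3 * s) ^ 4 = ((sqrt 3 * s)\<^sup>2)\<^sup>2" by (simp flip: power_mult)
      then show ?thesis unfolding p2 by (simp add: power_mult_distrib flip: power_mult)
    qed
    have "(\<Sum>m<4. cos_coeff m * (sqrt 3 * s) ^ m) = 1 - (sqrt 3 * s)\<^sup>2 / 2"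
    proof -
      have "(\<Sum>m<4. f m) = f 0 + f 1 + f 2 + f 3" for f :: "nat \<Rightarrow> real" by (simp add: numeral_eq_Suc)
      moreover have "cos_coeff 0 = 1" "cos_coeff 1 = 0" "cos_coeff 2 = - 1 / 2" "cos_coeff 3 = 0"
        by (simp_all add: cos_coeff_def fact_numeral)
      ultimately show ?thesis by simp
    qed
    moreover have "cos (t + 1/2 * real 4 * pi) * s ^ 4 \<le> 1 * s ^ 4" by (intro mult_right_mono) auto
    ultimately show ?thesis using t unfolding p2 p4 by (simp add: fact_numeral)
  qed
  have "s ^ 4 < 2 * s\<^sup>2"
  proof -
    have "s\<^sup>2 * s\<^sup>2 \<le> s\<^sup>2 * 1" using True assms by (intro mult_left_mono) (auto simp: power_le_one)
    moreover have "0 < s\<^sup>2" using assms by simp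
    ultimately show ?thesis by (simp add: power4_eq_xxxx power2_eq_square)
  qed
  then have "exp (- s) + 2 * cos (sqrt 3 * s) + exp s < 4"
    using 2 3 4 by linarith
  then have "s * (exp (- s) + 2 * cos (sqrt 3 * s) + exp s) < s * 4"
    using assms by (intro mult_strict_left_mono) auto
  moreover have "s * 4 \<le> 2 * (exp s - exp (- s))" using 1 3 by simp
  ultimately show ?thesis by linarith
next
  case False
  have s3: "1.73 \<le> sqrt 3" by (rule real_le_rsqrt) (simp add: power2_eq_square)
  have "pi < 3.1416" using pi_approx by simp
  then have "pi / sqrt 3 \<le> 3.1416 / 1.73" using s3 by (intro frac_le) auto
  then have s2: "s \<le> 1.82" using assms by simp
  \<comment> \<open>For s > 1 the argument sqrt 3 s lies between \<pi>/2 and \<pi>.\<close>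
  have "cos (sqrt 3 * s) \<le> cos (pi / 2)"
  proof (rule cos_monotone_0_pi_le)
    show "sqrt 3 * s \<le> pi" using assms by (simp add: field_simps)
    have "pi / 2 \<le> 1.73 * 1" using \<open>pi < 3.1416\<close> by simp
    also have "\<dots> \<le> sqrt 3 * s" using s3 False by (intro mult_mono) auto
    finally show "pi / 2 \<le> sqrt 3 * s" .
  qed simp
  then have c: "cos (sqrt 3 * s) \<le> 0" by simp
  \<comment> \<open>1.48 = 1 + 0.4 + 0.4^2/2; its powers bound exp(2s) from below on three
    subintervals.\<close>
  have e4: "1.48 \<le> exp (0.4 :: real)" using exp_lower_Taylor_quadratic[of "0.4"] by (simp add: power2_eq_square)
  have pw: "1.48 ^ k \<le> exp (2 * s)" if "0.4 * real k \<le> 2 * s" for k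
  proof -
    have "1.48 ^ k \<le> exp (0.4 :: real) ^ k" using e4 by (intro power_mono) auto
    also have "\<dots> = exp (real k * 0.4)" by (rule exp_of_nat_mult[symmetric])
    also have "\<dots> \<le> exp (2 * s)" using that by simp
    finally show ?thesis .
  qed
  have "2 + s < exp (2 * s) * (2 - s)"
  proof -
    consider "s \<le> 1.2" | "1.2 \<le> s" "s \<le> 1.6" | "1.6 \<le> s" by linarith
    then show ?thesis
    proof cases
      case 1
      have "7 * 0.8 \<le> exp (2 * s) * (2 - s)"
        using pw[of 5] False 1 by (intro mult_mono) (auto simp: power_numeral_reduce)
      then show ?thesis using 1 by simp
    next
      case 2
      have "10 * 0.4 \<le> exp (2 * s) * (2 - s)"
        using pw[of 6] 2 by (intro mult_mono) (auto simp: power_numeral_reduce)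
      then show ?thesis using 2 by simp
    next
      case 3
      have "22 * 0.18 \<le> exp (2 * s) * (2 - s)"
        using pw[of 8] 3 s2 by (intro mult_mono) (auto simp: power_numeral_reduce)
      then show ?thesis using s2 by simp
    qed
  qed
  then have "exp (- s) * (2 + s) < exp (- s) * (exp (2 * s) * (2 - s))"
    by (intro mult_strict_left_mono) auto
  also have "exp (- s) * (exp (2 * s) * (2 - s)) = exp s * (2 - s)"
    by (simp add: mult.assoc[symmetric] flip: exp_add)
  finally have "s * (exp (- s) + exp s) < 2 * (exp s - exp (- s))" by (simp add: algebra_simps)
  moreover have "s * cos (sqrt 3 * s) \<le> 0" using c False by (simp add: mult_nonneg_nonpos)
  ultimately show ?thesis by (simp add: algebra_simps)
qed

lemma saddle_phase_negative:
  assumes "0 < r" "r \<le> ray_length"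
  shows "Re (saddle_phase (of_real r * \<zeta>)) < 0"
proof -
  define s where "s = r / 2"
  have s: "0 < s" "s \<le> pi / sqrt 3" using assms by (simp_all add: s_def ray_length_def mult.commute)
  define c v where "c = exp (- s)" and "v = sqrt 3 * s"
  have w: "of_real r * \<zeta> = Complex (- s) v"
    by (simp add: complex_eq_iff Re_\<zeta> Im_\<zeta> s_def v_def)
  have E: "Re (exp (Complex (- s) v)) = c * cos v" "Im (exp (Complex (- s) v)) = c * sin v"
    by (simp_all add: Re_exp Im_exp c_def)
  have c: "c > 0" "c * exp s = 1" by (simp_all add: c_def flip: exp_add)
  let ?d = "c\<^sup>2 + 2 * c * cos v + 1"
  have d1: "(c * cos v + 1)\<^sup>2 + (c * sin v)\<^sup>2 = ?d"
    using sin_cos_squared_add[of v] by algebra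
  have d0: "?d > 0"
  proof -
    have "exp (Complex (- s) v) + 1 \<noteq> 0"
      using one_plus_exp_nonzero(2)[OF ray_left[of r]] assms unfolding w by simp
    then have "c * cos v + 1 \<noteq> 0 \<or> c * sin v \<noteq> 0" using E by (auto simp: complex_eq_iff)
    then show ?thesis unfolding d1[symmetric] by (metis sum_power2_gt_zero_iff)
  qed
  have num: "(c * cos v - 1) * (c * cos v + 1) + c * sin v * (c * sin v) = c\<^sup>2 - 1"
    using sin_cos_squared_add[of v] by algebra
  have "Re ((exp (Complex (- s) v) - 1) / (exp (Complex (- s) v) + 1)) = (c\<^sup>2 - 1) / ?d"
    using num d1 by (simp add: Re_divide E)
  moreover have "Re (2 * z - Complex (- s) v) = 2 * Re z + s" for z by simp
  ultimately have phase: "Re (saddle_phase (of_real r * \<zeta>)) = 2 * ((c\<^sup>2 - 1) / ?d) + s"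
    unfolding w saddle_phase_def by presburger
  have "s * (exp (- s) + 2 * cos v + exp s) < 2 * (exp s - exp (- s))"
    unfolding v_def by (rule hyperbolic_trig_inequality[OF s])
  then have "c * (s * (exp (- s) + 2 * cos v + exp s)) < c * (2 * (exp s - exp (- s)))"
    using c by (intro mult_strict_left_mono)
  moreover have "c * (s * (c + 2 * cos v + exp s)) = s * ?d" "c * (2 * (exp s - c)) = 2 * (1 - c\<^sup>2)"
    using c(2) by algebra+
  ultimately have "s * ?d < 2 * (1 - c\<^sup>2)"
    unfolding c_def[symmetric] by simp
  then have "s < 2 * (1 - c\<^sup>2) / ?d" using d0 by (simp only: pos_less_divide_eq)
  moreover have "2 * (1 - c\<^sup>2) / ?d = - (2 * ((c\<^sup>2 - 1) / ?d))" by (simp add: diff_divide_distrib)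
  ultimately show ?thesis unfolding phase by linarith
qed

text \<open>Near 0 the leading term -r^3/12 dominates with half of it to spare; on the remaining
  compact part the continuous negative function is bounded away from 0. The smaller of the two rates
  is \<open>\<kappa>\<close>.\<close>

lemma saddle_phase_decay:
  obtains \<kappa> where "\<kappa> > 0" "\<kappa> \<le> 1 / 24"
    "\<And>r. 0 \<le> r \<Longrightarrow> r \<le> ray_length \<Longrightarrow> Re (saddle_phase (of_real r * \<zeta>)) \<le> - \<kappa> * r ^ 3"
proof -
  let ?w = "\<lambda>r. of_real r * \<zeta>" and ?R = ray_length
  obtain C where C: "C \<ge> 0"
    "\<And>r. 0 \<le> r \<Longrightarrow> r \<le> ?R \<Longrightarrow> cmod (saddle_phase (?w r) - (- (?w r ^ 3) / 12 + ?w r ^ 5 / 120)) \<le> C * r ^ 7"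
    by (rule saddle_phase_expansion) (rule that)
  \<comment> \<open>Below \<open>r1\<close> the fifth and seventh order terms together are at most
    r^3/24.\<close>
  define r1 where "r1 = min 1 (1 / (24 * (1 / 120 + C)))"
  have r1: "r1 > 0" "r1 \<le> 1" "r1 \<le> 1 / (24 * (1 / 120 + C))" using C(1) by (auto simp: r1_def)
  have small: "Re (saddle_phase (?w r)) \<le> - (1 / 24) * r ^ 3" if r: "0 \<le> r" "r \<le> ?R" "r \<le> r1" for r
  proof -
    let ?e = "saddle_phase (?w r) - (- (?w r ^ 3) / 12 + ?w r ^ 5 / 120)"
    have "Re (saddle_phase (?w r)) = - (r ^ 3) / 12 + Re (?w r ^ 5) / 120 + Re ?e"
      unfolding ray_cubed by simp
    moreover have "Re (?w r ^ 5) \<le> r ^ 5"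
      using complex_Re_le_cmod[of "?w r ^ 5"] by (simp only: norm_power norm_ray[OF r(1)])
    moreover have "Re ?e \<le> C * r ^ 7" using C(2)[OF r(1,2)] complex_Re_le_cmod[of ?e] by linarith
    moreover have "r ^ 5 / 120 + C * r ^ 7 \<le> (1 / 24) * r ^ 3"
    proof -
      have 2: "r * r \<le> r * 1" using r r1 by (intro mult_left_mono) auto
      then have "r * r \<le> 1" using r r1 by linarith
      then have "r * r * (r * r) \<le> 1 * (r * 1)" using 2 r r1 by (intro mult_mono) auto
      with 2 have "r * r / 120 + C * (r * r * (r * r)) \<le> r / 120 + C * r"
        using C(1) by (intro add_mono mult_left_mono) auto
      also have "\<dots> = r * (1 / 120 + C)" by (simp add: algebra_simps)
      also have "\<dots> \<le> 1 / (24 * (1 / 120 + C)) * (1 / 120 + C)"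
        using r r1 C(1) by (intro mult_right_mono) auto
      also have "\<dots> = 1 / 24" using C(1) by (simp add: field_simps)
      finally have "r ^ 3 * (r * r / 120 + C * (r * r * (r * r))) \<le> r ^ 3 * (1 / 24)"
        using r by (intro mult_left_mono) auto
      then show ?thesis by (simp add: algebra_simps power_numeral_reduce)
    qed
    ultimately show ?thesis by linarith
  qed
  have "\<exists>m>0. \<forall>r\<in>{r1..?R}. Re (saddle_phase (?w r)) \<le> - m"
  proof (cases "{r1..?R} = {}")
    case False
    have "continuous_on {r1..?R} (\<lambda>r. Re (saddle_phase (?w r)))"
      using r1 by (intro continuous_on_Re continuous_on_subset[OF saddle_phase_continuous]) auto
    from continuous_attains_sup[OF _ False this]
    obtain r0 where r0: "r0 \<in> {r1..?R}" "\<forall>r\<in>{r1..?R}. Re (saddle_phase (?w r)) \<le> Re (saddle_phase (?w r0))"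
      by auto
    have "Re (saddle_phase (?w r0)) < 0" using r0(1) r1 by (intro saddle_phase_negative) auto
    then show ?thesis using r0(2) by (intro exI[of _ "- Re (saddle_phase (?w r0))"]) auto
  qed (auto intro: exI[of _ 1])
  then obtain m where m: "m > 0" "\<And>r. r \<in> {r1..?R} \<Longrightarrow> Re (saddle_phase (?w r)) \<le> - m" by auto
  define \<kappa> where "\<kappa> = min (1 / 24) (m / ?R ^ 3)"
  have R: "?R ^ 3 > 0" using ray_length_pos by simp
  have "\<kappa> > 0" using m(1) R by (simp add: \<kappa>_def)
  have "\<kappa> \<le> 1 / 24" unfolding \<kappa>_def by (rule min.cobounded1)
  have "Re (saddle_phase (?w r)) \<le> - \<kappa> * r ^ 3" if r: "0 \<le> r" "r \<le> ?R" for r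
  proof (cases "r \<le> r1")
    case True
    have "\<kappa> * r ^ 3 \<le> (1 / 24) * r ^ 3" using r \<open>\<kappa> \<le> 1 / 24\<close> by (intro mult_right_mono) auto
    then show ?thesis using small[OF r True] by simp
  next
    case False
    have "\<kappa> * r ^ 3 \<le> (m / ?R ^ 3) * ?R ^ 3"
      using r m(1) R \<open>\<kappa> > 0\<close> by (intro mult_mono power_mono) (auto simp: \<kappa>_def)
    then show ?thesis using m(2)[of r] False r R by simp
  qed
  then show ?thesis using that \<open>\<kappa> > 0\<close> \<open>\<kappa> \<le> 1 / 24\<close> by blast
qed

text \<open>The logarithm of the amplitude, stripped of its quadratic Taylor polynomial, has
  derivative proportional to the phase. The cubic bound for the phase thus yields a quartic bound
  for the amplitude.\<close>

lemma saddle_phase_derivative_amp: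
  assumes "Re w < 0 \<or> w = 0"
  shows "((\<lambda>w. Ln (1 + exp w) - w / 2 - of_real (ln 2) - w ^ 2 / 8) has_field_derivative saddle_phase w / 4) (at w)"
proof -
  note nz = one_plus_exp_nonzero[OF assms]
  have "((\<lambda>w. Ln (1 + exp w) - w / 2 - of_real (ln 2) - w ^ 2 / 8) has_field_derivative
      exp w / (1 + exp w) - 1 / 2 - w / 4) (at w)"
  proof -
    have "((\<lambda>w. 1 + exp w) has_field_derivative exp w) (at w)"
      by (auto intro!: derivative_eq_intros)
    from DERIV_chain2[OF has_field_derivative_Ln[OF nz(3)] this]
    have 1: "((\<lambda>w. Ln (1 + exp w)) has_field_derivative exp w / (1 + exp w)) (at w)"
      by (simp add: field_simps)
    have "((\<lambda>w. w / 2 + of_real (ln 2) + w ^ 2 / 8) has_field_derivative 1 / 2 + w / 4) (at w)"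
      by (auto intro!: derivative_eq_intros)
    from DERIV_diff[OF 1 this] show ?thesis by (simp add: diff_diff_eq)
  qed
  moreover have "exp w / (1 + exp w) - 1 / 2 - w / 4 = saddle_phase w / 4"
  proof -
    define s where "s = 1 + exp w"
    have e: "exp w = s - 1" "exp w + 1 = s" and s: "s \<noteq> 0" using nz(1) by (auto simp: s_def)
    show ?thesis unfolding saddle_phase_def e(2) s_def[symmetric] unfolding e(1)
      using s by (simp add: diff_divide_distrib add_divide_distrib)
  qed
  ultimately show ?thesis by simp
qed

lemma saddle_phase_cubic_bound:
  obtains C where "C \<ge> 0"
    "\<And>r. 0 \<le> r \<Longrightarrow> r \<le> ray_length \<Longrightarrow> cmod (saddle_phase (of_real r * \<zeta>)) \<le> C * r ^ 3"
proof -
  let ?w = "\<lambda>r. of_real r * \<zeta>" and ?R = ray_length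
  obtain C where C: "C \<ge> 0"
    "\<And>r. 0 \<le> r \<Longrightarrow> r \<le> ?R \<Longrightarrow> cmod (saddle_phase (?w r) - (- (?w r ^ 3) / 12 + ?w r ^ 5 / 120)) \<le> C * r ^ 7"
    by (rule saddle_phase_expansion) (rule that)
  have "cmod (saddle_phase (?w r)) \<le> (1 / 12 + ?R\<^sup>2 / 120 + C * ?R ^ 4) * r ^ 3" if r: "0 \<le> r" "r \<le> ?R" for r
  proof -
    let ?e = "saddle_phase (?w r) - (- (?w r ^ 3) / 12 + ?w r ^ 5 / 120)"
    have "cmod (saddle_phase (?w r)) = cmod (?e + (- (?w r ^ 3) / 12 + ?w r ^ 5 / 120))" by simp
    also have "\<dots> \<le> cmod ?e + (cmod (- (?w r ^ 3) / 12) + cmod (?w r ^ 5 / 120))"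
      by (intro order_trans[OF norm_triangle_ineq] add_left_mono norm_triangle_ineq)
    also have "cmod (- (?w r ^ 3) / 12) = r ^ 3 / 12"
      by (simp only: norm_divide norm_minus_cancel norm_power norm_ray[OF r(1)] norm_numeral)
    also have "cmod (?w r ^ 5 / 120) = r ^ 5 / 120"
      by (simp only: norm_divide norm_power norm_ray[OF r(1)] norm_numeral)
    also have "cmod ?e + (r ^ 3 / 12 + r ^ 5 / 120) \<le> C * r ^ 7 + (r ^ 3 / 12 + r ^ 5 / 120)"
      using C(2)[OF r] by simp
    also have "\<dots> = (1 / 12 + r\<^sup>2 / 120 + C * r ^ 4) * r ^ 3"
      by (simp add: algebra_simps power_numeral_reduce)
    also have "\<dots> \<le> (1 / 12 + ?R\<^sup>2 / 120 + C * ?R ^ 4) * r ^ 3"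
      using r C(1) by (intro mult_right_mono add_mono mult_left_mono divide_right_mono power_mono) auto
    finally show ?thesis .
  qed
  moreover have "1 / 12 + ?R\<^sup>2 / 120 + C * ?R ^ 4 \<ge> 0" using C(1) ray_length_pos by simp
  ultimately show ?thesis using that by blast
qed

text \<open>The amplitude is 2^(-\<beta>) exp(-\<beta> (\<psi> + w^2/8)) with \<psi> of order w^4 by
  the mean value inequality along the ray; then exp is expanded to first order.\<close>

lemma saddle_amp_expansion:
  obtains C where "C \<ge> 0"
    "\<And>r. 0 \<le> r \<Longrightarrow> r \<le> ray_length \<Longrightarrow>
      cmod (saddle_amp \<beta> (of_real r * \<zeta>) - of_real (2 powr - \<beta>) * (1 - of_real (\<beta> / 8) * (of_real r * \<zeta>) ^ 2)) \<le> C * r ^ 4"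
proof -
  let ?w = "\<lambda>r. of_real r * \<zeta>" and ?R = ray_length
  let ?\<psi> = "\<lambda>w. Ln (1 + exp w) - w / 2 - of_real (ln 2) - w ^ 2 / 8"
  obtain C where C: "C \<ge> 0"
    "\<And>r. 0 \<le> r \<Longrightarrow> r \<le> ?R \<Longrightarrow> cmod (saddle_phase (?w r)) \<le> C * r ^ 3"
    by (rule saddle_phase_cubic_bound) (rule that)
  have psi: "cmod (?\<psi> (?w r)) \<le> C * r ^ 4" if r: "0 \<le> r" "r \<le> ?R" for r
  proof -
    have seg: "\<exists>t. z = ?w t \<and> 0 \<le> t \<and> t \<le> r" if z: "z \<in> closed_segment 0 (?w r)" for z
    proof -
      obtain u where u: "0 \<le> u" "u \<le> 1" "z = u *\<^sub>R ?w r" using z by (auto simp: in_segment)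
      then have "z = ?w (u * r)" by (simp add: scaleR_conv_of_real)
      moreover have "u * r \<le> r" using u r by (simp add: mult_left_le_one_le)
      ultimately show ?thesis using u r by (intro exI[of _ "u * r"]) auto
    qed
    have b: "cmod (?\<psi> (?w r) - ?\<psi> 0) \<le> C * r ^ 3 * cmod (?w r - 0)"
    proof (rule field_differentiable_bound[where f' = "\<lambda>w. saddle_phase w / 4"])
      fix z assume z: "z \<in> closed_segment 0 (?w r)"
      obtain t where t: "z = ?w t" "0 \<le> t" "t \<le> r" using seg[OF z] by blast
      show "(?\<psi> has_field_derivative saddle_phase z / 4) (at z within closed_segment 0 (?w r))"
        unfolding t(1) by (rule has_field_derivative_at_within[OF saddle_phase_derivative_amp[OF ray_left[OF t(2)]]])
      have "cmod (saddle_phase z / 4) \<le> cmod (saddle_phase z)" by (simp add: norm_divide)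
      also have "\<dots> \<le> C * t ^ 3" unfolding t(1) using t r by (intro C) auto
      also have "\<dots> \<le> C * r ^ 3" using t C(1) by (intro mult_left_mono power_mono) auto
      finally show "cmod (saddle_phase z / 4) \<le> C * r ^ 3" .
    qed auto
    have z0: "?\<psi> 0 = 0" using Ln_of_real[of 2] by simp
    have "C * r ^ 3 * r = C * r ^ 4" by (simp add: power_numeral_reduce)
    then show ?thesis using b unfolding z0 diff_zero norm_ray[OF r(1)] by (simp only:)
  qed
  define K where "K = \<bar>\<beta>\<bar> * (C * ?R\<^sup>2 + 1 / 8)"
  have K: "K \<ge> 0" using C(1) by (simp add: K_def)
  let ?C = "2 powr - \<beta> * (K\<^sup>2 * exp (K * ?R\<^sup>2) + \<bar>\<beta>\<bar> * C)"
  have "cmod (saddle_amp \<beta> (?w r) - of_real (2 powr - \<beta>) * (1 - of_real (\<beta> / 8) * ?w r ^ 2)) \<le> ?C * r ^ 4"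
    if r: "0 \<le> r" "r \<le> ?R" for r
  proof -
    let ?W = "?w r"
    define z where "z = - of_real \<beta> * (?\<psi> ?W + ?W ^ 2 / 8)"
    have amp: "saddle_amp \<beta> ?W = of_real (2 powr - \<beta>) * exp z"
    proof -
      have "of_real (\<beta> / 2) * ?W - of_real \<beta> * Ln (1 + exp ?W) = of_real (- \<beta> * ln 2) + z"
        by (simp add: z_def algebra_simps)
      then have "saddle_amp \<beta> ?W = exp (of_real (- \<beta> * ln 2)) * exp z"
        unfolding saddle_amp_def by (simp only: exp_add)
      also have "exp (complex_of_real (- \<beta> * ln 2)) = of_real (2 powr - \<beta>)"
        unfolding exp_of_real by (simp add: powr_def)
      finally show ?thesis .
    qed
    have nz: "cmod z \<le> K * r\<^sup>2"
    proof -
      have "cmod (?\<psi> ?W + ?W ^ 2 / 8) \<le> C * r ^ 4 + r\<^sup>2 / 8"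
        by (rule order_trans[OF norm_triangle_ineq add_mono[OF psi[OF r]]])
          (simp add: norm_divide norm_power norm_mult norm_\<zeta>)
      also have "C * r ^ 4 \<le> C * (?R\<^sup>2 * r\<^sup>2)"
      proof (intro mult_left_mono C(1))
        have "r\<^sup>2 * r\<^sup>2 \<le> ?R\<^sup>2 * r\<^sup>2" using r by (intro mult_right_mono power_mono) auto
        then show "r ^ 4 \<le> ?R\<^sup>2 * r\<^sup>2" by (simp flip: power_add)
      qed
      finally have "cmod (?\<psi> ?W + ?W ^ 2 / 8) \<le> (C * ?R\<^sup>2 + 1 / 8) * r\<^sup>2" by (simp add: algebra_simps)
      then have "\<bar>\<beta>\<bar> * cmod (?\<psi> ?W + ?W ^ 2 / 8) \<le> \<bar>\<beta>\<bar> * ((C * ?R\<^sup>2 + 1 / 8) * r\<^sup>2)"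
        by (rule mult_left_mono) simp
      then show ?thesis unfolding z_def norm_mult norm_minus_cancel norm_of_real K_def by (simp only: mult.assoc)
    qed
    have "cmod (exp z - 1 - z) \<le> (cmod z)\<^sup>2 * exp (cmod z)" by (rule cmod_exp_le_quadratic)
    also have "\<dots> \<le> (K * r\<^sup>2)\<^sup>2 * exp (K * ?R\<^sup>2)"
    proof (intro mult_mono power_mono nz)
      have "K * r\<^sup>2 \<le> K * ?R\<^sup>2" using r K by (intro mult_left_mono power_mono) auto
      then show "exp (cmod z) \<le> exp (K * ?R\<^sup>2)" using nz by simp
    qed auto
    also have "\<dots> = K\<^sup>2 * exp (K * ?R\<^sup>2) * r ^ 4" by (simp add: power_mult_distrib flip: power_mult)
    finally have 1: "cmod (exp z - 1 - z) \<le> K\<^sup>2 * exp (K * ?R\<^sup>2) * r ^ 4" .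
    have "exp z - (1 - of_real (\<beta> / 8) * ?W ^ 2) = (exp z - 1 - z) + - of_real \<beta> * ?\<psi> ?W"
      by (simp add: z_def algebra_simps)
    then have "cmod (exp z - (1 - of_real (\<beta> / 8) * ?W ^ 2)) \<le> cmod (exp z - 1 - z) + cmod (- of_real \<beta> * ?\<psi> ?W)"
      by (simp only: norm_triangle_ineq)
    also have "\<dots> \<le> K\<^sup>2 * exp (K * ?R\<^sup>2) * r ^ 4 + \<bar>\<beta>\<bar> * (C * r ^ 4)"
      unfolding norm_mult norm_minus_cancel norm_of_real using psi[OF r]
      by (intro add_mono 1 mult_left_mono) auto
    finally have 2: "cmod (exp z - (1 - of_real (\<beta> / 8) * ?W ^ 2)) \<le> (K\<^sup>2 * exp (K * ?R\<^sup>2) + \<bar>\<beta>\<bar> * C) * r ^ 4"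
      by (simp add: algebra_simps)
    have "cmod (saddle_amp \<beta> ?W - of_real (2 powr - \<beta>) * (1 - of_real (\<beta> / 8) * ?W ^ 2))
        = 2 powr - \<beta> * cmod (exp z - (1 - of_real (\<beta> / 8) * ?W ^ 2))"
      unfolding amp right_diff_distrib[symmetric] norm_mult norm_of_real by simp
    also have "\<dots> \<le> 2 powr - \<beta> * ((K\<^sup>2 * exp (K * ?R\<^sup>2) + \<bar>\<beta>\<bar> * C) * r ^ 4)"
      by (intro mult_left_mono 2) simp
    finally show ?thesis by (simp only: mult.assoc)
  qed
  moreover have "?C \<ge> 0" using C(1) by simp
  ultimately show ?thesis using that by blast
qed

text \<open>The factor (phase + w)/4 is tanh(w/2)/2 and arises from the derivative of the weighted
  polynomial. Multiplying (1 - \<beta> w^2/8) by (w/4 - w^3/48) gives the stated cubic; its w^5 term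
  goes into the error.\<close>

lemma saddle_amp_phase_expansion:
  obtains C where "C \<ge> 0"
    "\<And>r. 0 \<le> r \<Longrightarrow> r \<le> ray_length \<Longrightarrow>
      cmod (saddle_amp \<beta> (of_real r * \<zeta>) * ((saddle_phase (of_real r * \<zeta>) + of_real r * \<zeta>) / 4)
        - of_real (2 powr - \<beta>) * ((of_real r * \<zeta>) / 4 - of_real (1 / 48 + \<beta> / 32) * (of_real r * \<zeta>) ^ 3)) \<le> C * r ^ 4"
proof -
  let ?w = "\<lambda>r. of_real r * \<zeta>" and ?R = ray_length and ?g = "complex_of_real (2 powr - \<beta>)"
  obtain C where C: "C \<ge> 0"
    "\<And>r. 0 \<le> r \<Longrightarrow> r \<le> ?R \<Longrightarrow> cmod (saddle_phase (?w r) - (- (?w r ^ 3) / 12 + ?w r ^ 5 / 120)) \<le> C * r ^ 7"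
    by (rule saddle_phase_expansion) (rule that)
  obtain A where A: "A \<ge> 0"
    "\<And>r. 0 \<le> r \<Longrightarrow> r \<le> ?R \<Longrightarrow> cmod (saddle_amp \<beta> (?w r) - ?g * (1 - of_real (\<beta> / 8) * ?w r ^ 2)) \<le> A * r ^ 4"
    by (rule saddle_amp_expansion) (rule that)
  obtain B where B: "B \<ge> 0" "\<And>r. 0 \<le> r \<Longrightarrow> r \<le> ?R \<Longrightarrow> cmod ((saddle_phase (?w r) + ?w r) / 4) \<le> B"
    by (rule bounded_on_ray[of "\<lambda>r. (saddle_phase (?w r) + ?w r) / 4"])
      (intro continuous_intros saddle_phase_continuous, auto intro: that)
  obtain E where E: "E \<ge> 0" "\<And>r. 0 \<le> r \<Longrightarrow> r \<le> ?R \<Longrightarrow> cmod (?g * (1 - of_real (\<beta> / 8) * ?w r ^ 2)) \<le> E"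
    by (rule bounded_on_ray[of "\<lambda>r. ?g * (1 - of_real (\<beta> / 8) * ?w r ^ 2)"])
      (intro continuous_intros, auto intro: that)
  let ?D = "\<bar>\<beta>\<bar> / 384 * 2 powr - \<beta>"
  let ?C = "A * B + E * (?R / 480 + C * ?R ^ 3 / 4) + ?D * ?R"
  have "cmod (saddle_amp \<beta> (?w r) * ((saddle_phase (?w r) + ?w r) / 4)
        - ?g * (?w r / 4 - of_real (1 / 48 + \<beta> / 32) * ?w r ^ 3)) \<le> ?C * r ^ 4" if r: "0 \<le> r" "r \<le> ?R" for r
  proof -
    let ?W = "?w r"
    let ?a = "saddle_amp \<beta> ?W" and ?p = "(saddle_phase ?W + ?W) / 4" and ?q = "?g * (1 - of_real (\<beta> / 8) * ?W ^ 2)"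
    let ?e = "saddle_phase ?W - (- (?W ^ 3) / 12 + ?W ^ 5 / 120)"
    have split: "?a * ?p - ?g * (?W / 4 - of_real (1 / 48 + \<beta> / 32) * ?W ^ 3)
       = (?a - ?q) * ?p + ?q * (?W ^ 5 / 480 + ?e / 4) + ?g * of_real (\<beta> / 384) * ?W ^ 5"
      by (simp add: field_simps power_numeral_reduce)
    have n5: "cmod (?W ^ 5) = r ^ 5" by (simp only: norm_power norm_ray[OF r(1)])
    have 1: "cmod ((?a - ?q) * ?p) \<le> A * r ^ 4 * B"
      unfolding norm_mult using r A(1) by (intro mult_mono A B) auto
    have "cmod (?W ^ 5 / 480 + ?e / 4) \<le> r ^ 5 / 480 + C * r ^ 7 / 4"
      by (rule order_trans[OF norm_triangle_ineq]) (use C(2)[OF r] n5 in \<open>simp add: norm_divide\<close>)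
    also have "\<dots> = (r / 480 + C * r ^ 3 / 4) * r ^ 4" by (simp add: algebra_simps power_numeral_reduce)
    also have "\<dots> \<le> (?R / 480 + C * ?R ^ 3 / 4) * r ^ 4"
      using r C(1) by (intro mult_right_mono add_mono divide_right_mono mult_left_mono power_mono) auto
    finally have 2: "cmod (?q * (?W ^ 5 / 480 + ?e / 4)) \<le> E * ((?R / 480 + C * ?R ^ 3 / 4) * r ^ 4)"
      unfolding norm_mult[of ?q] using r E(1) by (intro mult_mono E) auto
    have "cmod (?g * of_real (\<beta> / 384) * ?W ^ 5) = ?D * r * r ^ 4"
      unfolding norm_mult[of _ "?W ^ 5"] n5 by (simp add: norm_mult abs_mult power_numeral_reduce mult_ac)
    also have "\<dots> \<le> ?D * ?R * r ^ 4" using r by (intro mult_right_mono mult_left_mono) auto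
    finally have 3: "cmod (?g * of_real (\<beta> / 384) * ?W ^ 5) \<le> ?D * ?R * r ^ 4" .
    have "cmod (?a * ?p - ?g * (?W / 4 - of_real (1 / 48 + \<beta> / 32) * ?W ^ 3))
       \<le> cmod ((?a - ?q) * ?p) + cmod (?q * (?W ^ 5 / 480 + ?e / 4)) + cmod (?g * of_real (\<beta> / 384) * ?W ^ 5)"
      unfolding split by (intro order_trans[OF norm_triangle_ineq] add_right_mono norm_triangle_ineq)
    also have "\<dots> \<le> A * r ^ 4 * B + E * ((?R / 480 + C * ?R ^ 3 / 4) * r ^ 4) + ?D * ?R * r ^ 4"
      by (intro add_mono 1 2 3)
    also have "\<dots> = ?C * r ^ 4" by (simp add: algebra_simps)
    finally show ?thesis .
  qed
  moreover have "?C \<ge> 0" using A(1) B(1) C(1) E(1) ray_length_pos by simp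
  ultimately show ?thesis using that by blast
qed

text \<open>Keeping exp(Re b) rather than exp |b| is essential below: together with the leading
  exponential it is controlled by the true decay of the phase.\<close>

lemma cmod_exp_minus_linear:
  fixes b :: complex
  shows "cmod (exp b - 1 - b) \<le> max 1 (exp (Re b)) * (cmod b)\<^sup>2"
proof -
  have "cmod (exp b - (\<Sum>i\<le>1. exp 0 * (b - 0) ^ i / fact i)) \<le> max 1 (exp (Re b)) * cmod (b - 0) ^ Suc 1 / fact 1"
  proof (rule complex_Taylor[of "closed_segment 0 b" 1 "\<lambda>_. exp" "max 1 (exp (Re b))" 0 b])
    fix x assume x: "x \<in> closed_segment 0 b"
    obtain u where u: "0 \<le> u" "u \<le> 1" "x = u *\<^sub>R b" using x by (auto simp: in_segment)
    have "u * Re b \<le> max 0 (Re b)"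
    proof (cases "Re b \<ge> 0")
      case True
      then show ?thesis using u by (simp add: mult_left_le_one_le)
    next
      case False
      then show ?thesis using u by (simp add: mult_nonneg_nonpos le_max_iff_disj)
    qed
    then have "exp (u * Re b) \<le> max 1 (exp (Re b))"
      by (cases "Re b \<ge> 0") auto
    then show "cmod (exp x) \<le> max 1 (exp (Re b))" unfolding u(3) by simp
  qed (auto intro: DERIV_subset[OF DERIV_exp])
  then show ?thesis by (simp add: power2_eq_square diff_diff_eq)
qed

lemma set_integral_cubic_complex:
  assumes "\<delta> > 0"
  shows "set_integrable lborel {0..} (\<lambda>r. c * complex_of_real (r ^ k * exp (- ((r / \<delta>) ^ 3) / 3)))"
    and "(LINT r:{0..}|lborel. c * complex_of_real (r ^ k * exp (- ((r / \<delta>) ^ 3) / 3)))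
      = c * of_real (\<delta> ^ Suc k * cubic_moment k)"
proof -
  have s: "set_integrable lborel {0..} (\<lambda>r. complex_of_real (r ^ k * exp (- ((r / \<delta>) ^ 3) / 3)))"
    using integrable_of_real[OF cubic_moment_scale(2)[OF assms, of k, unfolded set_integrable_def], where 'a = complex]
    unfolding set_integrable_def by (simp add: scaleR_conv_of_real)
  then show "set_integrable lborel {0..} (\<lambda>r. c * complex_of_real (r ^ k * exp (- ((r / \<delta>) ^ 3) / 3)))"
    by (intro set_integrable_mult_right) simp
  show "(LINT r:{0..}|lborel. c * complex_of_real (r ^ k * exp (- ((r / \<delta>) ^ 3) / 3)))
      = c * of_real (\<delta> ^ Suc k * cubic_moment k)"
    unfolding set_integral_mult_right set_integral_complex_of_real cubic_moment_scale(1)[OF assms] ..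
qed

text \<open>
  With \<open>\<nu> = 4 / \<delta>\<^sup>3\<close> the phase is \<open>\<nu> \<Phi>(w) = - (r / \<delta>)\<^sup>3 / 3 + \<nu> w\<^sup>5 / 120 + O(\<nu> r\<^sup>7)\<close> on the ray
  \<open>w = r \<zeta>\<close>, because \<open>\<zeta>\<^sup>3 = 1\<close>.
\<close>
lemma laplace_expansion:
  fixes H :: "complex \<Rightarrow> complex" and a0 a1 a2 a3 :: complex
  assumes cont: "continuous_on {0..ray_length} (\<lambda>r. H (of_real r * \<zeta>))"
    and H: "\<And>r. 0 \<le> r \<Longrightarrow> r \<le> ray_length \<Longrightarrow>
      cmod (H (of_real r * \<zeta>) - (a0 + a1 * (of_real r * \<zeta>) + a2 * (of_real r * \<zeta>) ^ 2 + a3 * (of_real r * \<zeta>) ^ 3)) \<le> C * r ^ 4"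
  obtains E where "E \<ge> 0" "\<And>\<delta>. \<delta> > 0 \<Longrightarrow>
    cmod ((LINT r:{0..ray_length}|lborel. exp (of_real (4 / \<delta> ^ 3) * saddle_phase (of_real r * \<zeta>)) * H (of_real r * \<zeta>))
      - (a0 * of_real (\<delta> * cubic_moment 0) + a1 * \<zeta> * of_real (\<delta> ^ 2 * cubic_moment 1)
         + a2 * \<zeta> ^ 2 * of_real (\<delta> ^ 3 * cubic_moment 2) + a0 * \<zeta> ^ 5 * of_real (\<delta> ^ 3 * cubic_moment 5 / 30)
         + a3 * \<zeta> ^ 3 * of_real (\<delta> ^ 4 * cubic_moment 3) + a1 * \<zeta> ^ 6 * of_real (\<delta> ^ 4 * cubic_moment 6 / 30)))
    \<le> E * \<delta> ^ 5"
proof -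
  let ?w = "\<lambda>r::real. of_real r * \<zeta>" and ?R = ray_length
  have R: "?R > 0" by (rule ray_length_pos)
  obtain C1 where C1: "C1 \<ge> 0"
    "\<And>r. 0 \<le> r \<Longrightarrow> r \<le> ?R \<Longrightarrow> cmod (saddle_phase (?w r) - (- (?w r ^ 3) / 12 + ?w r ^ 5 / 120)) \<le> C1 * r ^ 7"
    by (rule saddle_phase_expansion) (rule that)
  obtain \<kappa> where \<kappa>: "\<kappa> > 0" "\<kappa> \<le> 1 / 24"
    "\<And>r. 0 \<le> r \<Longrightarrow> r \<le> ?R \<Longrightarrow> Re (saddle_phase (?w r)) \<le> - \<kappa> * r ^ 3"
    by (rule saddle_phase_decay) (rule that)
  obtain HB where HB: "HB \<ge> 0" "\<And>r. 0 \<le> r \<Longrightarrow> r \<le> ?R \<Longrightarrow> cmod (H (?w r)) \<le> HB"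
    by (rule bounded_on_ray[OF cont]) (rule that)
  have C: "C \<ge> 0" using order_trans[OF norm_ge_zero H[of ?R]] R by (simp add: zero_le_mult_iff)
  define C2 where "C2 = 1 / 120 + C1 * ?R\<^sup>2"
  define D1 where "D1 = C2\<^sup>2 * HB + C1 * HB + C + C * ?R\<^sup>2 / 120 + (cmod a2 + cmod a3 * ?R) / 120"
  define D2 where "D2 = cmod a0 / ?R ^ 4 + cmod a1 / ?R ^ 3 + cmod a2 / ?R ^ 2 + cmod a3 / ?R
     + (cmod a0 / ?R ^ 2 + cmod a1 / ?R) / 120"
  define D where "D = D1 + D2"
  have D12: "D1 \<ge> 0" "D2 \<ge> 0"
    using C C1(1) HB(1) R by (auto simp: D1_def D2_def)
  then have D: "D \<ge> 0" "D1 \<le> D" "D2 \<le> D" by (auto simp: D_def)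
  \<comment> \<open>With this \<open>c\<close>, exp(-(r/(c\<delta>))^3/3) is exp(-\<kappa> \<nu>
    r^3), the decay provided by \<open>saddle_phase_decay\<close>.\<close>
  define c where "c = root 3 (1 / (12 * \<kappa>))"
  have c: "c > 0" "c ^ 3 = 1 / (12 * \<kappa>)" using \<kappa>(1) by (auto simp: c_def)
  \<comment> \<open>The moments of r^4, \<nu> r^7 and \<nu>^2 r^10 against this exponential all
    scale like \<delta>^5, because \<nu> = 4/\<delta>^3.\<close>
  define E where "E = D * (c ^ 5 * cubic_moment 4 + 4 * c ^ 8 * cubic_moment 7 + 16 * c ^ 11 * cubic_moment 10)"
  let ?M = "\<lambda>\<delta>. a0 * of_real (\<delta> * cubic_moment 0) + a1 * \<zeta> * of_real (\<delta> ^ 2 * cubic_moment 1)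
         + a2 * \<zeta> ^ 2 * of_real (\<delta> ^ 3 * cubic_moment 2) + a0 * \<zeta> ^ 5 * of_real (\<delta> ^ 3 * cubic_moment 5 / 30)
         + a3 * \<zeta> ^ 3 * of_real (\<delta> ^ 4 * cubic_moment 3) + a1 * \<zeta> ^ 6 * of_real (\<delta> ^ 4 * cubic_moment 6 / 30)"
  have main: "cmod ((LINT r:{0..?R}|lborel. exp (of_real (4 / \<delta> ^ 3) * saddle_phase (?w r)) * H (?w r)) - ?M \<delta>)
      \<le> E * \<delta> ^ 5" if \<delta>: "\<delta> > 0" for \<delta>
  proof -
    define \<nu> where "\<nu> = 4 / \<delta> ^ 3"
    have \<nu>: "\<nu> > 0" using \<delta> by (simp add: \<nu>_def)
    define g where "g r = exp (- ((r / \<delta>) ^ 3) / 3)" for r :: real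
    define f where "f r = exp (of_real \<nu> * saddle_phase (?w r)) * H (?w r)" for r
    \<comment> \<open>The integrand is extended by 0, the model \<open>m\<close> is integrated over
      the whole half-line, and \<open>B\<close> dominates their difference both on the ray and
      beyond its end.\<close>
    define F where "F r = (if r \<le> ?R then f r else 0)" for r
    define m where "m r = of_real (g r) * (a0 + a1 * ?w r + a2 * ?w r ^ 2 + a3 * ?w r ^ 3
        + of_real (\<nu> / 120) * (a0 * ?w r ^ 5 + a1 * ?w r ^ 6))" for r
    define k where "k r = exp (- ((r / (c * \<delta>)) ^ 3) / 3)" for r :: real
    define B where "B r = D * (r ^ 4 + \<nu> * r ^ 7 + \<nu>\<^sup>2 * r ^ 10) * k r" for r
    have g: "g r = exp (- (\<nu> * r ^ 3) / 12)" for r by (simp add: g_def \<nu>_def power_divide)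
    have kk: "k r = exp (- (\<kappa> * \<nu> * r ^ 3))" for r
      unfolding k_def power_divide power_mult_distrib c(2) using \<kappa>(1) by (simp add: \<nu>_def)
    have gk: "g r \<le> k r" if "r \<ge> 0" for r
    proof -
      have "\<kappa> * (\<nu> * r ^ 3) \<le> (1 / 24) * (\<nu> * r ^ 3)" using \<kappa>(2) \<nu> that by (intro mult_right_mono) auto
      moreover have "0 \<le> \<nu> * r ^ 3" using \<nu> that by simp
      ultimately show ?thesis unfolding g kk by (simp add: mult.assoc)
    qed
    have fint: "set_integrable lborel {0..?R} f"
      unfolding f_def
      by (intro borel_integrable_atLeastAtMost' continuous_intros saddle_phase_continuous cont)
    have Fint: "set_integrable lborel {0..} F" and Feq: "(LINT r:{0..?R}|lborel. f r) = (LINT r:{0..}|lborel. F r)"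
    proof -
      have eq: "(\<lambda>r. indicator {0..} r *\<^sub>R F r) = (\<lambda>r. indicator {0..?R} r *\<^sub>R f r)"
        by (auto simp: fun_eq_iff indicator_def F_def)
      show "set_integrable lborel {0..} F" using fint unfolding set_integrable_def eq .
      show "(LINT r:{0..?R}|lborel. f r) = (LINT r:{0..}|lborel. F r)"
        unfolding set_lebesgue_integral_def eq ..
    qed
    have m_sum: "m r = a0 * of_real (r ^ 0 * g r) + a1 * \<zeta> * of_real (r ^ 1 * g r) + a2 * \<zeta> ^ 2 * of_real (r ^ 2 * g r)
        + a3 * \<zeta> ^ 3 * of_real (r ^ 3 * g r) + a0 * \<zeta> ^ 5 * of_real (\<nu> / 120) * of_real (r ^ 5 * g r)
        + a1 * \<zeta> ^ 6 * of_real (\<nu> / 120) * of_real (r ^ 6 * g r)" for r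
      by (simp add: m_def power_mult_distrib algebra_simps)
    note sc = set_integral_cubic_complex[OF \<delta>, folded g_def]
    have mint: "set_integrable lborel {0..} m" and meq: "(LINT r:{0..}|lborel. m r) = ?M \<delta>"
    proof -
      show "set_integrable lborel {0..} m"
        unfolding m_sum[abs_def] by (intro set_integral_add(1) sc(1))
      have "(LINT r:{0..}|lborel. m r) = a0 * of_real (\<delta> ^ Suc 0 * cubic_moment 0)
        + a1 * \<zeta> * of_real (\<delta> ^ Suc 1 * cubic_moment 1) + a2 * \<zeta> ^ 2 * of_real (\<delta> ^ Suc 2 * cubic_moment 2)
        + a3 * \<zeta> ^ 3 * of_real (\<delta> ^ Suc 3 * cubic_moment 3)
        + a0 * \<zeta> ^ 5 * of_real (\<nu> / 120) * of_real (\<delta> ^ Suc 5 * cubic_moment 5)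
        + a1 * \<zeta> ^ 6 * of_real (\<nu> / 120) * of_real (\<delta> ^ Suc 6 * cubic_moment 6)"
        unfolding m_sum by (simp only: set_integral_add set_integral_add(1) sc)
      also have "\<dots> = ?M \<delta>"
      proof -
        have "\<nu> / 120 * (\<delta> ^ Suc 5 * y) = \<delta> ^ 3 * y / 30" "\<nu> / 120 * (\<delta> ^ Suc 6 * y) = \<delta> ^ 4 * y / 30" for y
          using \<delta> by (simp_all add: \<nu>_def field_simps power_numeral_reduce)
        then have e: "of_real (\<nu> / 120) * of_real (\<delta> ^ Suc 5 * y) = complex_of_real (\<delta> ^ 3 * y / 30)"
          "of_real (\<nu> / 120) * of_real (\<delta> ^ Suc 6 * y) = complex_of_real (\<delta> ^ 4 * y / 30)" for y
          by (metis of_real_mult)+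
        show ?thesis unfolding mult.assoc e by (simp add: eval_nat_numeral algebra_simps)
      qed
      finally show "(LINT r:{0..}|lborel. m r) = ?M \<delta>" .
    qed
    have B_sum: "B r = D * (r ^ 4 * k r) + D * \<nu> * (r ^ 7 * k r) + D * \<nu>\<^sup>2 * (r ^ 10 * k r)" for r
      by (simp add: B_def algebra_simps)
    have c\<delta>: "c * \<delta> > 0" using c \<delta> by simp
    note kc = cubic_moment_scale[OF c\<delta>, folded k_def]
    have kc': "set_integrable lborel {0..} (\<lambda>r. y * (r ^ j * k r))" for y j
      using kc(2)[of j] by (intro set_integrable_mult_right) simp
    have Bint: "set_integrable lborel {0..} B" and Beq: "(LINT r:{0..}|lborel. B r) = E * \<delta> ^ 5"
    proof -
      show "set_integrable lborel {0..} B"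
        unfolding B_sum[abs_def] by (intro set_integral_add(1) kc')
      have "(LINT r:{0..}|lborel. B r) = D * ((c * \<delta>) ^ Suc 4 * cubic_moment 4)
          + D * \<nu> * ((c * \<delta>) ^ Suc 7 * cubic_moment 7) + D * \<nu>\<^sup>2 * ((c * \<delta>) ^ Suc 10 * cubic_moment 10)"
        unfolding B_sum by (simp only: set_integral_add set_integral_add(1) kc' set_integral_mult_right kc(1))
      also have "\<dots> = E * \<delta> ^ 5"
      proof -
        have e: "\<nu> * (c * \<delta>) ^ Suc 7 = 4 * c ^ 8 * \<delta> ^ 5" "\<nu>\<^sup>2 * (c * \<delta>) ^ Suc 10 = 16 * c ^ 11 * \<delta> ^ 5"
          using \<delta> by (simp_all add: \<nu>_def power_mult_distrib field_simps power_numeral_reduce)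
        have a: "D * \<nu> * (X * y) = D * (\<nu> * X) * y" "D * \<nu>\<^sup>2 * (X * y) = D * (\<nu>\<^sup>2 * X) * y" for X y
          by simp_all
        have "D * ((c * \<delta>) ^ Suc 4 * cubic_moment 4)
          + D * \<nu> * ((c * \<delta>) ^ Suc 7 * cubic_moment 7) + D * \<nu>\<^sup>2 * ((c * \<delta>) ^ Suc 10 * cubic_moment 10)
          = D * (c ^ 5 * \<delta> ^ 5 * cubic_moment 4) + D * (4 * c ^ 8 * \<delta> ^ 5) * cubic_moment 7
            + D * (16 * c ^ 11 * \<delta> ^ 5) * cubic_moment 10"
          unfolding a e by (simp add: power_mult_distrib power_numeral_reduce)
        then show ?thesis by (simp add: E_def algebra_simps)
      qed
      finally show "(LINT r:{0..}|lborel. B r) = E * \<delta> ^ 5" .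
    qed
    have inside: "cmod (f r - m r) \<le> B r" if r: "0 \<le> r" "r \<le> ?R" for r
    proof -
      let ?W = "?w r"
      define p where "p = saddle_phase ?W - (- (?W ^ 3) / 12 + ?W ^ 5 / 120)"
      define b where "b = of_real \<nu> * (?W ^ 5 / 120 + p)"
      define q where "q = a0 + a1 * ?W + a2 * ?W ^ 2 + a3 * ?W ^ 3"
      have nW: "cmod (?W ^ j) = r ^ j" for j unfolding norm_power norm_ray[OF r(1)] ..
      have p: "cmod p \<le> C1 * r ^ 7" unfolding p_def by (rule C1(2)[OF r])
      have "of_real \<nu> * saddle_phase ?W = of_real (- (\<nu> * r ^ 3) / 12) + b"
      proof -
        have sp: "saddle_phase ?W = - of_real (r ^ 3) / 12 + ?W ^ 5 / 120 + p"
          unfolding p_def ray_cubed by simp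
        show ?thesis unfolding sp b_def by (simp add: algebra_simps)
      qed
      then have ef: "exp (of_real \<nu> * saddle_phase ?W) = of_real (g r) * exp b"
        unfolding g by (simp only: exp_add exp_of_real)
      \<comment> \<open>g exp(Re b) is the modulus of exp(\<nu> phase), so the decay of the full
        phase applies; \<open>g\<close> alone is even smaller.\<close>
      have gb: "g r * max 1 (exp (Re b)) \<le> k r"
      proof -
        have "g r * exp (Re b) = cmod (of_real (g r) * exp b)" by (simp add: norm_mult g)
        also have "\<dots> = exp (\<nu> * Re (saddle_phase ?W))" unfolding ef[symmetric] by simp
        also have "\<nu> * Re (saddle_phase ?W) \<le> \<nu> * (- \<kappa> * r ^ 3)" using \<kappa>(3)[OF r] \<nu> by (intro mult_left_mono) auto
        finally have "g r * exp (Re b) \<le> k r" unfolding kk by (simp add: mult_ac)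
        then show ?thesis using gk[OF r(1)] by (simp add: max_def)
      qed
      have g0: "g r > 0" and k0: "k r > 0" by (simp_all add: g_def k_def)
      have nb: "cmod b \<le> \<nu> * (C2 * r ^ 5)"
      proof -
        have "cmod (?W ^ 5 / 120 + p) \<le> r ^ 5 / 120 + C1 * r ^ 7"
          by (rule order_trans[OF norm_triangle_ineq]) (use p nW in \<open>simp add: norm_divide\<close>)
        also have "\<dots> = (1 / 120 + C1 * r\<^sup>2) * r ^ 5" by (simp add: algebra_simps power_numeral_reduce)
        also have "\<dots> \<le> C2 * r ^ 5"
          unfolding C2_def using r C1(1) by (intro mult_right_mono add_left_mono mult_left_mono power_mono) auto
        finally have "\<nu> * cmod (?W ^ 5 / 120 + p) \<le> \<nu> * (C2 * r ^ 5)" using \<nu> by (intro mult_left_mono) auto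
        then show ?thesis using \<nu> by (simp only: b_def norm_mult norm_of_real abs_of_pos)
      qed
      \<comment> \<open>Four errors: the second order remainder of exp b, the tail \<open>p\<close>
        of the phase, the remainder of \<open>H\<close>, and the products of the phase correction
        with \<open>a2\<close> and \<open>a3\<close>, which \<open>m\<close> omits.\<close>
      have split: "f r - m r = of_real (g r) * (exp b - 1 - b) * H ?W + of_real (g r) * (of_real \<nu> * p) * H ?W
         + of_real (g r) * (1 + of_real \<nu> * ?W ^ 5 / 120) * (H ?W - q)
         + of_real (g r) * (of_real \<nu> / 120 * (a2 * ?W ^ 7 + a3 * ?W ^ 8))"
      proof -
        have "f r = of_real (g r) * exp b * H ?W" by (simp only: f_def ef)
        moreover have "m r = of_real (g r) * (q + of_real \<nu> / 120 * (a0 * ?W ^ 5 + a1 * ?W ^ 6))"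
          by (simp add: m_def q_def)
        moreover have "b = of_real \<nu> * ?W ^ 5 / 120 + of_real \<nu> * p" by (simp add: b_def algebra_simps)
        moreover have "of_real \<nu> * ?W ^ 5 / 120 * q = of_real \<nu> / 120 * (a0 * ?W ^ 5 + a1 * ?W ^ 6)
            + of_real \<nu> / 120 * (a2 * ?W ^ 7 + a3 * ?W ^ 8)"
          by (simp add: q_def algebra_simps power_numeral_reduce)
        moreover have "f - m = g * (e - 1 - b) * h + g * v * h + g * (1 + u) * (h - q) + g * Z"
          if "f = g * e * h" "m = g * (q + A)" "b = u + v" "u * q = A + Z" for f m g e h q A b u v Z :: complex
          using that by algebra
        ultimately show ?thesis by blast
      qed
      have t1: "cmod (of_real (g r) * (exp b - 1 - b) * H ?W) \<le> C2\<^sup>2 * HB * (\<nu>\<^sup>2 * r ^ 10 * k r)"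
      proof -
        have "g r * cmod (exp b - 1 - b) \<le> g r * (max 1 (exp (Re b)) * (cmod b)\<^sup>2)"
          using g0 by (intro mult_left_mono cmod_exp_minus_linear) auto
        also have "\<dots> = g r * max 1 (exp (Re b)) * (cmod b)\<^sup>2" by simp
        also have "\<dots> \<le> k r * (\<nu> * (C2 * r ^ 5))\<^sup>2"
          using k0 g0 nb by (intro mult_mono gb power_mono) auto
        finally have "g r * cmod (exp b - 1 - b) * cmod (H ?W) \<le> k r * (\<nu> * (C2 * r ^ 5))\<^sup>2 * HB"
          by (rule mult_mono[OF _ HB(2)[OF r]]) (use k0 in auto)
        also have "\<dots> = C2\<^sup>2 * HB * (\<nu>\<^sup>2 * r ^ 10 * k r)"
          by (simp add: power_mult_distrib flip: power_mult)
        finally show ?thesis using g0 by (simp add: norm_mult)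
      qed
      have t2: "cmod (of_real (g r) * (of_real \<nu> * p) * H ?W) \<le> C1 * HB * (\<nu> * r ^ 7 * k r)"
      proof -
        have "g r * (\<nu> * cmod p) * cmod (H ?W) \<le> k r * (\<nu> * (C1 * r ^ 7)) * HB"
          using HB r p gk[OF r(1)] g0 k0 \<nu> C1(1) by (intro mult_mono mult_nonneg_nonneg) auto
        then show ?thesis using g0 \<nu> by (simp add: norm_mult mult_ac)
      qed
      have t3: "cmod (of_real (g r) * (1 + of_real \<nu> * ?W ^ 5 / 120) * (H ?W - q))
          \<le> C * (r ^ 4 * k r) + C * ?R\<^sup>2 / 120 * (\<nu> * r ^ 7 * k r)"
      proof -
        have "cmod (1 + of_real \<nu> * ?W ^ 5 / 120) \<le> 1 + \<nu> * r ^ 5 / 120"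
          by (rule order_trans[OF norm_triangle_ineq]) (use nW \<nu> in \<open>simp add: norm_divide norm_mult\<close>)
        then have "g r * cmod (1 + of_real \<nu> * ?W ^ 5 / 120) * cmod (H ?W - q)
            \<le> k r * (1 + \<nu> * r ^ 5 / 120) * (C * r ^ 4)"
          using H[OF r] gk[OF r(1)] g0 k0 \<nu> r C unfolding q_def[symmetric]
          by (intro mult_mono mult_nonneg_nonneg) auto
        also have "\<dots> = C * (r ^ 4 * k r) + C * r\<^sup>2 / 120 * (\<nu> * r ^ 7 * k r)"
          by (simp add: algebra_simps power_numeral_reduce)
        also have "\<dots> \<le> C * (r ^ 4 * k r) + C * ?R\<^sup>2 / 120 * (\<nu> * r ^ 7 * k r)"
          using r C \<nu> k0 by (intro add_left_mono mult_right_mono divide_right_mono mult_left_mono power_mono) auto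
        finally show ?thesis using g0 by (simp add: norm_mult)
      qed
      have t4: "cmod (of_real (g r) * (of_real \<nu> / 120 * (a2 * ?W ^ 7 + a3 * ?W ^ 8)))
          \<le> (cmod a2 + cmod a3 * ?R) / 120 * (\<nu> * r ^ 7 * k r)"
      proof -
        have "cmod (a2 * ?W ^ 7 + a3 * ?W ^ 8) \<le> cmod a2 * r ^ 7 + cmod a3 * r ^ 8"
          by (rule order_trans[OF norm_triangle_ineq]) (use nW in \<open>simp add: norm_mult\<close>)
        also have "\<dots> = (cmod a2 + cmod a3 * r) * r ^ 7" by (simp add: algebra_simps power_numeral_reduce)
        also have "\<dots> \<le> (cmod a2 + cmod a3 * ?R) * r ^ 7"
          using r by (intro mult_right_mono add_left_mono mult_left_mono) auto
        finally have "g r * (\<nu> / 120 * cmod (a2 * ?W ^ 7 + a3 * ?W ^ 8))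
            \<le> k r * (\<nu> / 120 * ((cmod a2 + cmod a3 * ?R) * r ^ 7))"
          using gk[OF r(1)] g0 k0 \<nu> by (intro mult_mono mult_left_mono mult_nonneg_nonneg) auto
        then show ?thesis using g0 \<nu> by (simp add: norm_mult norm_divide mult_ac)
      qed
      have "cmod (f r - m r) \<le> C2\<^sup>2 * HB * (\<nu>\<^sup>2 * r ^ 10 * k r) + C1 * HB * (\<nu> * r ^ 7 * k r)
          + (C * (r ^ 4 * k r) + C * ?R\<^sup>2 / 120 * (\<nu> * r ^ 7 * k r))
          + (cmod a2 + cmod a3 * ?R) / 120 * (\<nu> * r ^ 7 * k r)"
        unfolding split by (intro order_trans[OF norm_triangle_ineq] add_mono t1 t2 t3 t4)
      also have "\<dots> \<le> D1 * (\<nu>\<^sup>2 * r ^ 10 * k r) + D1 * (\<nu> * r ^ 7 * k r) + D1 * (r ^ 4 * k r)"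
      proof -
        let ?s = "r ^ 4 * k r" and ?t = "\<nu> * r ^ 7 * k r" and ?u = "\<nu>\<^sup>2 * r ^ 10 * k r"
        have nn: "0 \<le> ?s" "0 \<le> ?t" "0 \<le> ?u" using r k0 \<nu> by auto
        have parts: "0 \<le> C2\<^sup>2 * HB" "0 \<le> C1 * HB" "0 \<le> C" "0 \<le> C * ?R\<^sup>2 / 120" "0 \<le> (cmod a2 + cmod a3 * ?R) / 120"
          using C C1(1) HB(1) R by auto
        have "C2\<^sup>2 * HB * ?u \<le> D1 * ?u" "C * ?s \<le> D1 * ?s"
          "(C1 * HB + C * ?R\<^sup>2 / 120 + (cmod a2 + cmod a3 * ?R) / 120) * ?t \<le> D1 * ?t"
          using parts nn by (intro mult_right_mono; simp add: D1_def)+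
        then show ?thesis by (simp only: distrib_right)
      qed
      also have "\<dots> \<le> B r"
      proof -
        have n: "0 \<le> \<nu>\<^sup>2 * r ^ 10 * k r" "0 \<le> \<nu> * r ^ 7 * k r" "0 \<le> r ^ 4 * k r" using r k0 \<nu> by auto
        show ?thesis
          using mult_right_mono[OF D(2) n(1)] mult_right_mono[OF D(2) n(2)] mult_right_mono[OF D(2) n(3)]
          unfolding B_sum mult.assoc by linarith
      qed
      finally show ?thesis .
    qed
    \<comment> \<open>Beyond the end of the ray only the model is present; as r > R, its lower
      powers of r may be raised to r^4 and r^7.\<close>
    have outside: "cmod (m r) \<le> B r" if r: "r > ?R" for r
    proof -
      have r0: "r > 0" using r R by simp
      let ?W = "?w r"
      have nW: "cmod (?W ^ j) = r ^ j" for j unfolding norm_power norm_ray[OF less_imp_le[OF r0]] ..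
      have nW1: "cmod ?W = r" by (rule norm_ray[OF less_imp_le[OF r0]])
      have k0: "k r > 0" by (simp add: k_def)
      have up: "r ^ j \<le> r ^ (j + i) / ?R ^ i" for i j
      proof -
        have "?R ^ i \<le> r ^ i" using r R by (intro power_mono) auto
        then have "r ^ j * ?R ^ i \<le> r ^ j * r ^ i" using r0 by (intro mult_left_mono) auto
        then show ?thesis using R by (simp add: pos_le_divide_eq power_add)
      qed
      have "cmod (a0 + a1 * ?W + a2 * ?W ^ 2 + a3 * ?W ^ 3 + of_real (\<nu> / 120) * (a0 * ?W ^ 5 + a1 * ?W ^ 6))
          \<le> cmod a0 + cmod a1 * r + cmod a2 * r ^ 2 + cmod a3 * r ^ 3 + \<nu> / 120 * (cmod a0 * r ^ 5 + cmod a1 * r ^ 6)"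
      proof -
        have "cmod (of_real (\<nu> / 120) * (a0 * ?W ^ 5 + a1 * ?W ^ 6)) \<le> \<nu> / 120 * (cmod a0 * r ^ 5 + cmod a1 * r ^ 6)"
          unfolding norm_mult[of "of_real (\<nu> / 120)"] norm_of_real using \<nu>
          by (intro mult_mono order_trans[OF norm_triangle_ineq]) (auto simp: norm_mult nW simp del: norm_power)
        moreover have "cmod (a0 + a1 * ?W + a2 * ?W ^ 2 + a3 * ?W ^ 3) \<le> cmod a0 + cmod (a1 * ?W) + cmod (a2 * ?W ^ 2) + cmod (a3 * ?W ^ 3)"
          by (intro order_trans[OF norm_triangle_ineq] add_right_mono norm_triangle_ineq)
        ultimately show ?thesis
          unfolding norm_mult[of a1] norm_mult[of a2] norm_mult[of a3] nW nW1
          by - (rule order_trans[OF norm_triangle_ineq], rule add_mono; linarith)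
      qed
      also have "\<dots> \<le> cmod a0 * (r ^ 4 / ?R ^ 4) + cmod a1 * (r ^ 4 / ?R ^ 3) + cmod a2 * (r ^ 4 / ?R ^ 2) + cmod a3 * (r ^ 4 / ?R ^ 1)
          + \<nu> / 120 * (cmod a0 * (r ^ 7 / ?R ^ 2) + cmod a1 * (r ^ 7 / ?R ^ 1))"
        using mult_left_mono[OF up[of 0 4], of "cmod a0"] up[of 1 3] up[of 2 2] up[of 3 1] up[of 5 2] up[of 6 1] \<nu>
        by (intro add_mono mult_left_mono) auto
      also have "\<dots> = (cmod a0 / ?R ^ 4 + cmod a1 / ?R ^ 3 + cmod a2 / ?R ^ 2 + cmod a3 / ?R) * r ^ 4
          + (cmod a0 / ?R ^ 2 + cmod a1 / ?R) / 120 * (\<nu> * r ^ 7)"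
        by (simp add: algebra_simps)
      also have "\<dots> \<le> D2 * r ^ 4 + D2 * (\<nu> * r ^ 7)"
        using r0 R \<nu> by (intro add_mono mult_right_mono) (auto simp: D2_def)
      also have "\<dots> \<le> D * r ^ 4 + D * (\<nu> * r ^ 7)"
        using D r0 \<nu> by (intro add_mono mult_right_mono) auto
      also have "\<dots> \<le> D * (r ^ 4 + \<nu> * r ^ 7 + \<nu>\<^sup>2 * r ^ 10)"
        using D(1) r0 by (simp add: distrib_left)
      finally have "g r * cmod (a0 + a1 * ?W + a2 * ?W ^ 2 + a3 * ?W ^ 3 + of_real (\<nu> / 120) * (a0 * ?W ^ 5 + a1 * ?W ^ 6))
          \<le> k r * (D * (r ^ 4 + \<nu> * r ^ 7 + \<nu>\<^sup>2 * r ^ 10))"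
        using gk[of r] r0 k0 by (intro mult_mono) (auto simp: g_def)
      then show ?thesis by (simp add: m_def B_def norm_mult g_def mult_ac)
    qed
    have "cmod ((LINT r:{0..}|lborel. F r) - (LINT r:{0..}|lborel. m r)) = cmod (LINT r:{0..}|lborel. F r - m r)"
      using Fint mint by (simp add: set_integral_diff)
    also have "\<dots> \<le> (LINT r:{0..}|lborel. B r)"
    proof (rule norm_set_integral_Ici_le[OF Bint set_integral_diff(1)[OF Fint mint]])
      fix r :: real assume "r \<ge> 0"
      then show "norm (F r - m r) \<le> B r"
        using inside[of r] outside[of r] by (cases "r \<le> ?R") (auto simp: F_def)
    qed
    finally show ?thesis unfolding Feq[symmetric] meq Beq f_def \<nu>_def .
  qed
  have "E \<ge> 0"
    using order_trans[OF norm_ge_zero main[of 1]] by simp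
  then show ?thesis using that main by blast
qed

text \<open>The width \<delta> of the cubic saddle, determined by 4/\<delta>^3 = \<nu>.\<close>

definition turning_scale :: "real \<Rightarrow> nat \<Rightarrow> real" where
  "turning_scale \<alpha> n = root 3 (4 / (real n + (\<alpha> + 1) / 2))"

lemma turning_scale:
  assumes "\<alpha> > -1"
  shows "turning_scale \<alpha> n > 0" "4 / turning_scale \<alpha> n ^ 3 = real n + (\<alpha> + 1) / 2"
proof -
  have \<nu>: "real n + (\<alpha> + 1) / 2 > 0" using assms by (simp add: add_nonneg_pos)
  then show "turning_scale \<alpha> n > 0" by (simp add: turning_scale_def)
  have "turning_scale \<alpha> n ^ 3 = 4 / (real n + (\<alpha> + 1) / 2)"
    unfolding turning_scale_def using \<nu> by (intro real_root_pow_pos2) auto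
  then show "4 / turning_scale \<alpha> n ^ 3 = real n + (\<alpha> + 1) / 2" by simp
qed

text \<open>At x = 0 the rotated Airy integrals are the real cubic moments, which lets the saddle
  point terms be recognised as Airy values.\<close>

lemma airy_moment_0: "airy_moment k 0 = of_real (cubic_moment k)"
proof -
  have "airy_integrand 0 k = (\<lambda>t. complex_of_real (t ^ k * exp (- (t ^ 3) / 3)))"
    unfolding airy_integrand_def
    by (simp only: mult_zero_left of_real_0 add_0_right exp_of_real of_real_mult)
  then show ?thesis
    unfolding airy_moment_def cubic_moment_def set_integral_complex_of_real[symmetric] by simp
qed

lemma Ai_0_0: "Ai 0 0 = Im \<zeta> * cubic_moment 0 / pi"
  by (simp add: Ai_def airy_moment_0 Re_\<omega> Im_\<zeta>)

lemma Ai_1_0: "Ai 1 0 = Im (\<zeta>\<^sup>2) * cubic_moment 1 / pi"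
  by (simp add: Ai_def airy_moment_0 Re_\<omega> Im_\<omega> Re_\<zeta> Im_\<zeta> power2_eq_square)

lemma cubic_moment_3: "cubic_moment 3 = cubic_moment 0" and cubic_moment_6: "cubic_moment 6 = 4 * cubic_moment 0"
  using cubic_moment_rec[of 0] cubic_moment_rec[of 3] by simp_all

lemma \<zeta>_powers: "\<zeta> * \<zeta> ^ 2 = 1" "\<zeta> * \<zeta> ^ 5 = 1" "\<zeta> ^ 6 = 1"
proof -
  have "\<zeta> * \<zeta> ^ 2 = \<zeta> ^ 3" "\<zeta> * \<zeta> ^ 5 = \<zeta> ^ 3 * \<zeta> ^ 3" "\<zeta> ^ 6 = \<zeta> ^ 3 * \<zeta> ^ 3"
    by (simp_all add: power_numeral_reduce mult_ac)
  then show "\<zeta> * \<zeta> ^ 2 = 1" "\<zeta> * \<zeta> ^ 5 = 1" "\<zeta> ^ 6 = 1" by (simp_all add: \<zeta>_cubed)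
qed

lemma Im_ray_le:
  assumes "cmod (I - M) \<le> e"
  shows "\<bar>Im (\<zeta> * I) / pi - Im (\<zeta> * M) / pi\<bar> \<le> e"
proof -
  have "\<bar>Im (\<zeta> * I) / pi - Im (\<zeta> * M) / pi\<bar> = \<bar>Im (\<zeta> * (I - M))\<bar> / pi"
    by (simp add: right_diff_distrib flip: diff_divide_distrib)
  also have "\<dots> \<le> cmod (\<zeta> * (I - M)) / 1"
    using pi_ge_two by (intro frac_le abs_Im_le_cmod) auto
  also have "\<dots> \<le> e" using assms by (simp add: norm_mult norm_\<zeta>)
  finally show ?thesis .
qed

text \<open>The amplitude is even, so there are no terms in \<delta>^2 and \<delta>^4. The terms in
  \<delta>^3 carry powers of \<open>\<zeta>\<close> equal to 1, hence are real and drop out of the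
  imaginary part; the leading term is accurate to order \<delta>^5.\<close>

lemma laguerre_turning_value:
  assumes \<alpha>: "\<alpha> > -1"
  obtains E where "\<And>n. \<bar>(- 1) ^ n * exp (- (4 * (real n + (\<alpha> + 1) / 2)) / 2) * laguerre n \<alpha> (4 * (real n + (\<alpha> + 1) / 2))
    - 2 powr - (\<alpha> + 1) * (turning_scale \<alpha> n * Ai 0 0)\<bar> \<le> E * turning_scale \<alpha> n ^ 5"
proof -
  let ?w = "\<lambda>r::real. of_real r * \<zeta>" and ?\<beta> = "\<alpha> + 1" and ?g = "complex_of_real (2 powr - (\<alpha> + 1))"
  obtain C where C: "C \<ge> 0"
    "\<And>r. 0 \<le> r \<Longrightarrow> r \<le> ray_length \<Longrightarrow> cmod (saddle_amp ?\<beta> (?w r) - ?g * (1 - of_real (?\<beta> / 8) * ?w r ^ 2)) \<le> C * r ^ 4"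
    by (rule saddle_amp_expansion) (rule that)
  let ?a2 = "- ?g * of_real (?\<beta> / 8)"
  obtain E where E: "E \<ge> 0" "\<And>\<delta>. \<delta> > 0 \<Longrightarrow>
    cmod ((LINT r:{0..ray_length}|lborel. exp (of_real (4 / \<delta> ^ 3) * saddle_phase (?w r)) * saddle_amp ?\<beta> (?w r))
      - (?g * of_real (\<delta> * cubic_moment 0) + 0 * \<zeta> * of_real (\<delta> ^ 2 * cubic_moment 1)
         + ?a2 * \<zeta> ^ 2 * of_real (\<delta> ^ 3 * cubic_moment 2) + ?g * \<zeta> ^ 5 * of_real (\<delta> ^ 3 * cubic_moment 5 / 30)
         + 0 * \<zeta> ^ 3 * of_real (\<delta> ^ 4 * cubic_moment 3) + 0 * \<zeta> ^ 6 * of_real (\<delta> ^ 4 * cubic_moment 6 / 30)))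
    \<le> E * \<delta> ^ 5"
  proof (rule laplace_expansion[of "saddle_amp ?\<beta>" ?g 0 ?a2 0 C])
    show "continuous_on {0..ray_length} (\<lambda>r. saddle_amp ?\<beta> (?w r))" by (rule saddle_amp_continuous)
    show "cmod (saddle_amp ?\<beta> (?w r) - (?g + 0 * ?w r + ?a2 * ?w r ^ 2 + 0 * ?w r ^ 3)) \<le> C * r ^ 4"
      if "0 \<le> r" "r \<le> ray_length" for r
    proof -
      have "g + 0 * W + - g * c * W ^ 2 + 0 * W ^ 3 = g * (1 - c * W ^ 2)" for g c W :: complex
        by (simp add: algebra_simps)
      then show ?thesis using C(2)[OF that] by presburger
    qed
  qed (rule that)
  show ?thesis
  proof (rule that)
    fix n
    let ?\<delta> = "turning_scale \<alpha> n" and ?x = "4 * (real n + (\<alpha> + 1) / 2)"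
    note \<delta> = turning_scale[OF \<alpha>, of n]
    let ?I = "LINT r:{0..ray_length}|lborel. exp (of_real (4 / ?\<delta> ^ 3) * saddle_phase (?w r)) * saddle_amp ?\<beta> (?w r)"
    let ?M = "?g * of_real (?\<delta> * cubic_moment 0) + 0 * \<zeta> * of_real (?\<delta> ^ 2 * cubic_moment 1)
         + ?a2 * \<zeta> ^ 2 * of_real (?\<delta> ^ 3 * cubic_moment 2) + ?g * \<zeta> ^ 5 * of_real (?\<delta> ^ 3 * cubic_moment 5 / 30)
         + 0 * \<zeta> ^ 3 * of_real (?\<delta> ^ 4 * cubic_moment 3) + 0 * \<zeta> ^ 6 * of_real (?\<delta> ^ 4 * cubic_moment 6 / 30)"
    have "(- 1) ^ n * exp (- ?x / 2) * laguerre n \<alpha> ?x = Im (\<zeta> * ?I) / pi"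
      unfolding laguerre_contour_integral laguerre_integrand_saddle \<delta>(2) ..
    moreover have "Im (\<zeta> * ?M) / pi = 2 powr - ?\<beta> * (?\<delta> * Ai 0 0)"
    proof -
      have "\<zeta> * ?M = \<zeta> * of_real (2 powr - ?\<beta> * (?\<delta> * cubic_moment 0))
          + (\<zeta> * \<zeta> ^ 2) * (?a2 * of_real (?\<delta> ^ 3 * cubic_moment 2))
          + (\<zeta> * \<zeta> ^ 5) * (?g * of_real (?\<delta> ^ 3 * cubic_moment 5 / 30))"
        by (simp add: algebra_simps)
      then show ?thesis unfolding \<zeta>_powers Ai_0_0 by simp
    qed
    ultimately show "\<bar>(- 1) ^ n * exp (- ?x / 2) * laguerre n \<alpha> ?x - 2 powr - ?\<beta> * (?\<delta> * Ai 0 0)\<bar> \<le> E * ?\<delta> ^ 5"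
      using Im_ray_le[OF E(2)[OF \<delta>(1)]] by simp
  qed
qed

text \<open>The combination L' - L/2 comes from differentiating e^(-x/2) L. Its amplitude is odd,
  which leaves the orders \<delta>^2, giving Ai'(0), and \<delta>^4, giving a multiple of
  Ai(0).\<close>

lemma laguerre_turning_derivative:
  assumes \<alpha>: "\<alpha> > -1"
  obtains E where "\<And>n. n \<ge> 1 \<Longrightarrow> \<bar>(- 1) ^ n * exp (- (4 * (real n + (\<alpha> + 1) / 2)) / 2) *
      (laguerre_deriv n \<alpha> (4 * (real n + (\<alpha> + 1) / 2)) - laguerre n \<alpha> (4 * (real n + (\<alpha> + 1) / 2)) / 2)
    - 2 powr - (\<alpha> + 1) * (turning_scale \<alpha> n ^ 2 / 4 * Ai 1 0
         + turning_scale \<alpha> n ^ 4 * (1 / 80 - (\<alpha> + 1) / 32) * Ai 0 0)\<bar> \<le> E * turning_scale \<alpha> n ^ 5"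
proof -
  let ?w = "\<lambda>r::real. of_real r * \<zeta>" and ?\<beta> = "\<alpha> + 1" and ?g = "complex_of_real (2 powr - (\<alpha> + 1))"
  let ?H = "\<lambda>w. saddle_amp ?\<beta> w * ((saddle_phase w + w) / 4)"
  obtain C where C: "C \<ge> 0"
    "\<And>r. 0 \<le> r \<Longrightarrow> r \<le> ray_length \<Longrightarrow> cmod (?H (?w r) - ?g * (?w r / 4 - of_real (1 / 48 + ?\<beta> / 32) * ?w r ^ 3)) \<le> C * r ^ 4"
    by (rule saddle_amp_phase_expansion) (rule that)
  let ?a1 = "?g / 4" and ?a3 = "- ?g * of_real (1 / 48 + ?\<beta> / 32)"
  obtain E where E: "E \<ge> 0" "\<And>\<delta>. \<delta> > 0 \<Longrightarrow>
    cmod ((LINT r:{0..ray_length}|lborel. exp (of_real (4 / \<delta> ^ 3) * saddle_phase (?w r)) * ?H (?w r))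
      - (0 * of_real (\<delta> * cubic_moment 0) + ?a1 * \<zeta> * of_real (\<delta> ^ 2 * cubic_moment 1)
         + 0 * \<zeta> ^ 2 * of_real (\<delta> ^ 3 * cubic_moment 2) + 0 * \<zeta> ^ 5 * of_real (\<delta> ^ 3 * cubic_moment 5 / 30)
         + ?a3 * \<zeta> ^ 3 * of_real (\<delta> ^ 4 * cubic_moment 3) + ?a1 * \<zeta> ^ 6 * of_real (\<delta> ^ 4 * cubic_moment 6 / 30)))
    \<le> E * \<delta> ^ 5"
  proof (rule laplace_expansion[of ?H 0 ?a1 0 ?a3 C])
    show "continuous_on {0..ray_length} (\<lambda>r. ?H (?w r))"
      by (intro continuous_intros saddle_amp_continuous saddle_phase_continuous) simp
    show "cmod (?H (?w r) - (0 + ?a1 * ?w r + 0 * ?w r ^ 2 + ?a3 * ?w r ^ 3)) \<le> C * r ^ 4"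
      if "0 \<le> r" "r \<le> ray_length" for r
    proof -
      have "0 + g / 4 * W + 0 * W ^ 2 + - g * c * W ^ 3 = g * (W / 4 - c * W ^ 3)" for g c W :: complex
        by (simp add: algebra_simps)
      then show ?thesis using C(2)[OF that] by presburger
    qed
  qed (rule that)
  show ?thesis
  proof (rule that)
    fix n :: nat assume "n \<ge> 1"
    then obtain m where m: "n = Suc m" by (cases n) auto
    let ?\<delta> = "turning_scale \<alpha> n" and ?x = "4 * (real n + (\<alpha> + 1) / 2)"
    note \<delta> = turning_scale[OF \<alpha>, of n]
    let ?I = "LINT r:{0..ray_length}|lborel. exp (of_real (4 / ?\<delta> ^ 3) * saddle_phase (?w r)) * ?H (?w r)"
    let ?M = "0 * of_real (?\<delta> * cubic_moment 0) + ?a1 * \<zeta> * of_real (?\<delta> ^ 2 * cubic_moment 1)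
         + 0 * \<zeta> ^ 2 * of_real (?\<delta> ^ 3 * cubic_moment 2) + 0 * \<zeta> ^ 5 * of_real (?\<delta> ^ 3 * cubic_moment 5 / 30)
         + ?a3 * \<zeta> ^ 3 * of_real (?\<delta> ^ 4 * cubic_moment 3) + ?a1 * \<zeta> ^ 6 * of_real (?\<delta> ^ 4 * cubic_moment 6 / 30)"
    let ?G0 = "\<lambda>r. laguerre_integrand n \<alpha> ?x (?w r)" and ?G1 = "\<lambda>r. laguerre_integrand m (\<alpha> + 1) ?x (?w r)"
    have cont: "continuous_on {0..ray_length} (\<lambda>r. laguerre_integrand k a y (?w r))" for k a y
      by (rule continuous_on_compose2[OF holomorphic_on_imp_continuous_on[OF laguerre_integrand_holomorphic]])
        (auto intro!: continuous_intros simp: Re_\<zeta>)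
    have int: "set_integrable lborel {0..ray_length} ?G0" "set_integrable lborel {0..ray_length} ?G1"
      by (intro borel_integrable_atLeastAtMost' cont)+
    \<comment> \<open>Raising \<alpha> and lowering n by one multiplies the integrand by exp w / (1
      + exp w); subtracting 1/2 leaves tanh(w/2)/2.\<close>
    have G: "?G1 r - (1 / 2) * ?G0 r = exp (of_real (4 / ?\<delta> ^ 3) * saddle_phase (?w r)) * ?H (?w r)" if "r \<ge> 0" for r
    proof -
      let ?W = "?w r"
      note nz = one_plus_exp_nonzero[OF ray_left[OF that]]
      define Q where "Q = of_real (?x / 2) * ((exp ?W - 1) / (exp ?W + 1))"
      define l where "l = Ln (1 + exp ?W)"
      have l: "exp l = 1 + exp ?W" unfolding l_def using nz(1) by simp
      have "?G1 r = exp (Q - of_nat m * ?W) * exp (- of_real (\<alpha> + 1 + 1) * l)"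
        by (simp only: laguerre_integrand_def Q_def l_def)
      also have "Q - of_nat m * ?W = (Q - of_nat n * ?W) + ?W" by (simp add: m algebra_simps)
      also have "- of_real (\<alpha> + 1 + 1) * l = - of_real (\<alpha> + 1) * l + - l" by (simp add: algebra_simps)
      also have "exp (Q - of_nat n * ?W + ?W) * exp (- of_real (\<alpha> + 1) * l + - l)
          = ?G0 r * (exp ?W * exp (- l))"
        by (simp only: exp_add laguerre_integrand_def Q_def l_def mult_ac)
      also have "exp (- l) = 1 / (1 + exp ?W)" by (simp add: exp_minus l divide_inverse)
      finally have "?G1 r - (1 / 2) * ?G0 r = ?G0 r * (exp ?W * (1 / (1 + exp ?W)) - 1 / 2)"
        by (simp add: algebra_simps)
      also have "exp ?W * (1 / (1 + exp ?W)) - 1 / 2 = (saddle_phase ?W + ?W) / 4"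
      proof -
        define s where "s = 1 + exp ?W"
        have e: "exp ?W = s - 1" "exp ?W + 1 = s" and s: "s \<noteq> 0" using nz(1) by (auto simp: s_def)
        show ?thesis unfolding saddle_phase_def e(2) s_def[symmetric] unfolding e(1)
          using s by (simp add: diff_divide_distrib add_divide_distrib)
      qed
      finally have X: "?G1 r - (1 / 2) * ?G0 r = ?G0 r * ((saddle_phase ?W + ?W) / 4)" .
      have "?G0 r = exp (of_real (4 / ?\<delta> ^ 3) * saddle_phase ?W) * saddle_amp ?\<beta> ?W"
        unfolding laguerre_integrand_saddle \<delta>(2) ..
      then show ?thesis by (intro trans[OF X]) (simp only: mult.assoc)
    qed
    have "(LINT r:{0..ray_length}|lborel. ?G1 r) - (1 / 2) * (LINT r:{0..ray_length}|lborel. ?G0 r)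
        = (LINT r:{0..ray_length}|lborel. ?G1 r - (1 / 2) * ?G0 r)"
      using int by (simp add: set_integral_diff set_integral_mult_right)
    also have "\<dots> = ?I"
      by (rule set_lebesgue_integral_cong) (use G in auto)
    finally have I: "?I = (LINT r:{0..ray_length}|lborel. ?G1 r) - (1 / 2) * (LINT r:{0..ray_length}|lborel. ?G0 r)" ..
    have "(- 1) ^ n * exp (- ?x / 2) * (laguerre_deriv n \<alpha> ?x - laguerre n \<alpha> ?x / 2)
       = (- 1) ^ m * exp (- ?x / 2) * laguerre m (\<alpha> + 1) ?x - (1 / 2) * ((- 1) ^ n * exp (- ?x / 2) * laguerre n \<alpha> ?x)"
      unfolding m laguerre_deriv_eq by (simp add: algebra_simps)
    also have "\<dots> = Im (\<zeta> * ?I) / pi"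
    proof -
      have "Im (z * A) / pi - (1 / 2) * (Im (z * B) / pi) = Im (z * (A - (1 / 2) * B)) / pi" for z A B
        by (simp add: field_simps)
      then show ?thesis unfolding laguerre_contour_integral I .
    qed
    finally have "(- 1) ^ n * exp (- ?x / 2) * (laguerre_deriv n \<alpha> ?x - laguerre n \<alpha> ?x / 2) = Im (\<zeta> * ?I) / pi" .
    \<comment> \<open>1/80 = 1/30 - 1/48: the first fraction stems from the w^5 term of the phase
      through the sixth moment, the second from the cubic term of the amplitude.\<close>
    moreover have "Im (\<zeta> * ?M) / pi = 2 powr - ?\<beta> * (?\<delta> ^ 2 / 4 * Ai 1 0 + ?\<delta> ^ 4 * (1 / 80 - ?\<beta> / 32) * Ai 0 0)"
    proof -
      have gen: "z * (0 * p + a1 * z * of_real (d2 * m1) + 0 * q * q' + 0 * r * r' + a3 * 1 * of_real (d4 * m0) + a1 * 1 * of_real (d4 * (4 * m0) / 30))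
          = z\<^sup>2 * of_real (g / 4 * (d2 * m1)) + z * of_real (g * (d4 * m0) * (1 / 30 - (1 / 48 + c)))"
        if "a1 = of_real (g / 4)" "a3 = of_real (- g * (1 / 48 + c))" for z p q q' r r' a1 a3 :: complex and d2 d4 m0 m1 g c :: real
        unfolding that by (simp add: field_simps power2_eq_square)
      have e: "\<zeta> * ?M = \<zeta>\<^sup>2 * of_real (2 powr - ?\<beta> / 4 * (?\<delta> ^ 2 * cubic_moment 1))
          + \<zeta> * of_real (2 powr - ?\<beta> * (?\<delta> ^ 4 * cubic_moment 0) * (1 / 30 - (1 / 48 + ?\<beta> / 32)))"
        unfolding \<zeta>_powers(3) \<zeta>_cubed cubic_moment_3 cubic_moment_6
        by (rule gen) simp_all
      have im: "Im (z * of_real p + y * of_real q) = Im z * p + Im y * q" for z y p q by simp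
      have "(u * (g / 4 * (d2 * m1)) + v * (g * (d4 * m0) * (1 / 30 - (1 / 48 + c / 32)))) / pi
          = g * (d2 / 4 * (u * m1 / pi) + d4 * (1 / 80 - c / 32) * (v * m0 / pi))" for u v g d2 d4 m0 m1 c :: real
        by (simp add: field_simps)
      then show ?thesis unfolding e im Ai_0_0 Ai_1_0 .
    qed
    ultimately show "\<bar>(- 1) ^ n * exp (- ?x / 2) * (laguerre_deriv n \<alpha> ?x - laguerre n \<alpha> ?x / 2)
       - 2 powr - ?\<beta> * (?\<delta> ^ 2 / 4 * Ai 1 0 + ?\<delta> ^ 4 * (1 / 80 - ?\<beta> / 32) * Ai 0 0)\<bar> \<le> E * ?\<delta> ^ 5"
      using Im_ray_le[OF E(2)[OF \<delta>(1)]] by simp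
  qed
qed

section \<open>Gamma quotients, scaling and the initial data at the turning point\<close>

section \<open>Normalisation\<close>

text \<open>The sequence a n + 2C/n decreases to 0, since 2C/n - 2C/(n+1) >= C/n^2; hence it is
  nonnegative.\<close>

lemma tendsto_0_summable_increments:
  fixes a :: "nat \<Rightarrow> real"
  assumes "a \<longlonglongrightarrow> 0" "\<And>n. n \<ge> N \<Longrightarrow> a (Suc n) - a n \<le> C / (real n)\<^sup>2" "N \<ge> 1" "n \<ge> N" "C \<ge> 0"
  shows "- a n \<le> 2 * C / real n"
proof -
  define c where "c k = a (k + N) + 2 * C / real (k + N)" for k
  have "decseq c"
  proof (rule decseq_SucI)
    fix k
    let ?m = "k + N"
    have m: "real ?m \<ge> 1" using assms(3) by simp
    have "C / (real ?m)\<^sup>2 \<le> 2 * C / real ?m - 2 * C / real (Suc ?m)"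
    proof -
      have "2 * C / real ?m - 2 * C / real (Suc ?m) = 2 * C / (real ?m * real (Suc ?m))"
        using m by (simp add: field_simps)
      moreover have "C / z\<^sup>2 = 2 * C / (z * (2 * z))" for z :: real by (simp add: power2_eq_square)
      then have "C / (real ?m)\<^sup>2 = 2 * C / (real ?m * (2 * real ?m))" .
      moreover have "2 * C / (real ?m * (2 * real ?m)) \<le> 2 * C / (real ?m * real (Suc ?m))"
        using m assms(5) by (intro divide_left_mono mult_left_mono mult_pos_pos) auto
      ultimately show ?thesis by simp
    qed
    then show "c (Suc k) \<le> c k"
      using assms(2)[of ?m] by (simp add: c_def)
  qed
  moreover have "c \<longlonglongrightarrow> 0"
  proof -
    have "(\<lambda>k. a (k + N)) \<longlonglongrightarrow> 0" using assms(1) by (rule LIMSEQ_ignore_initial_segment)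
    moreover have "(\<lambda>k. 2 * C / real (k + N)) \<longlonglongrightarrow> 0" by real_asymp
    ultimately show ?thesis unfolding c_def using tendsto_add by fastforce
  qed
  ultimately have "0 \<le> c (n - N)" by (rule decseq_ge)
  then show ?thesis using assms(4) by (simp add: c_def)
qed

text \<open>The increments of the logarithm are O(1/n^2). Summed from infinity, where the logarithm
  vanishes, they give O(1/n); the previous lemma is used for the logarithm and its negative.\<close>

lemma Gamma_ratio_asymptotics:
  assumes "\<alpha> > -1"
  obtains C where "\<forall>\<^sub>F n in sequentially.
    \<bar>Gamma (real n + 1) * real n powr \<alpha> / Gamma (\<alpha> + real n + 1) - 1\<bar> \<le> C / real n"
proof -
  define r where "r n = Gamma (real n + 1) * real n powr \<alpha> / Gamma (\<alpha> + real n + 1)" for n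
  have pos: "\<alpha> + real n + 1 > 0" for n using assms by (simp add: add_pos_nonneg)
  have Gp: "Gamma (\<alpha> + real n + 1) > 0" for n using pos by (rule Gamma_real_pos)
  have rpos: "r n > 0" if "n \<ge> 1" for n
    using that Gp[of n] Gamma_real_pos[of "real n + 1"] by (simp add: r_def)
  have G1: "Gamma (\<alpha> + real (Suc n) + 1) = (\<alpha> + real n + 1) * Gamma (\<alpha> + real n + 1)" for n
    using Gamma_plus1[of "\<alpha> + real n + 1"] pos[of n] nonpos_Ints_nonpos[of "\<alpha> + real n + 1"]
    by (simp add: algebra_simps) (metis add.assoc add.commute not_le)
  have G2: "Gamma (real (Suc n) + 1) = (real n + 1) * Gamma (real n + 1)" for n
    using Gamma_fact[of n, where 'a = real] Gamma_fact[of "Suc n", where 'a = real] by (simp add: algebra_simps)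
  have rat: "r (Suc n) = r n * ((real n + 1) / (\<alpha> + real n + 1) * ((real n + 1) / real n) powr \<alpha>)" if "n \<ge> 1" for n
  proof -
    have gen: "(m * G) * X / (q * H) = G * x / H * (m / q * (X / x))" if "x \<noteq> 0" for m G X q H x :: real
      using that by (simp add: mult_ac)
    have S: "real (Suc n) = real n + 1" by simp
    have P: "((real n + 1) / real n) powr \<alpha> = (real n + 1) powr \<alpha> / real n powr \<alpha>"
      by (simp add: powr_divide)
    show ?thesis
      unfolding r_def G1 G2 unfolding S P using that by (intro gen) simp
  qed
  define a where "a n = ln (r n)" for n
  have inc: "a (Suc n) - a n = ln ((real n + 1) / (\<alpha> + real n + 1)) + \<alpha> * ln ((real n + 1) / real n)" if "n \<ge> 1" for n
  proof -
    have "ln (r (Suc n)) = ln (r n) + ln ((real n + 1) / (\<alpha> + real n + 1) * ((real n + 1) / real n) powr \<alpha>)"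
      unfolding rat[OF that] using rpos[OF that] pos[of n] that by (intro ln_mult_pos) auto
    also have "ln ((real n + 1) / (\<alpha> + real n + 1) * ((real n + 1) / real n) powr \<alpha>)
        = ln ((real n + 1) / (\<alpha> + real n + 1)) + \<alpha> * ln ((real n + 1) / real n)"
      using pos[of n] that by (subst ln_mult_pos) (auto simp: ln_powr)
    finally show ?thesis by (simp add: a_def)
  qed
  have lnb: "\<bar>ln (1 + t) - t\<bar> \<le> 2 * t\<^sup>2" if "\<bar>t\<bar> \<le> 1 / 2" for t :: real
    using abs_ln_one_plus_x_minus_x_bound[OF that] .
  define D where "D = 4 * (\<alpha>\<^sup>2 + 2 * \<bar>\<alpha>\<bar> + 1)"
  define N where "N = nat \<lceil>2 * (\<bar>\<alpha>\<bar> + 1)\<rceil>"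
  have "real N \<ge> 2 * (\<bar>\<alpha>\<bar> + 1)" unfolding N_def by linarith
  moreover from this have "real N > 0" using abs_ge_zero[of \<alpha>] by argo
  then have "N \<ge> 1" by linarith
  ultimately have N: "N \<ge> 1" "real N \<ge> 2 * (\<bar>\<alpha>\<bar> + 1)" by auto
  have incb: "\<bar>a (Suc n) - a n\<bar> \<le> D / (real n)\<^sup>2" if "n \<ge> N" for n
  proof -
    have n: "n \<ge> 1" "real n \<ge> 2 * (\<bar>\<alpha>\<bar> + 1)" using that N by auto
    have e: "ln ((real n + 1) / (\<alpha> + real n + 1)) = ln (1 + 1 / real n) - ln (1 + (\<alpha> + 1) / real n)"
    proof -
      have "1 + 1 / real n = (real n + 1) / real n" "1 + (\<alpha> + 1) / real n = (\<alpha> + real n + 1) / real n"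
        using n by (simp_all add: field_simps)
      then have "(real n + 1) / (\<alpha> + real n + 1) = (1 + 1 / real n) / (1 + (\<alpha> + 1) / real n)"
        using n by simp
      moreover have "1 + (\<alpha> + 1) / real n > 0" using n assms by (simp add: add_pos_nonneg)
      moreover have "1 + 1 / real n > 0" by (simp add: add_pos_nonneg)
      ultimately show ?thesis by (simp add: ln_div)
    qed
    have e2: "(real n + 1) / real n = 1 + 1 / real n" using n by (simp add: field_simps)
    have s1: "\<bar>1 / real n\<bar> \<le> 1 / 2" using n by (simp add: field_simps)
    have s2: "\<bar>(\<alpha> + 1) / real n\<bar> \<le> 1 / 2"
    proof -
      have "\<bar>\<alpha> + 1\<bar> * 2 \<le> real n" using n(2) abs_triangle_ineq[of \<alpha> 1] by simp
      then show ?thesis using n by (simp add: abs_divide field_simps)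
    qed
    let ?t = "1 / real n" and ?u = "(\<alpha> + 1) / real n"
    \<comment> \<open>The first order terms cancel because (1+\<alpha>)/n is exactly the second
      argument \<open>?u\<close>.\<close>
    have "a (Suc n) - a n = (1 + \<alpha>) * (ln (1 + ?t) - ?t) - (ln (1 + ?u) - ?u)"
      unfolding inc[OF n(1)] e e2 by (simp add: algebra_simps add_divide_distrib)
    then have "\<bar>a (Suc n) - a n\<bar> \<le> \<bar>1 + \<alpha>\<bar> * \<bar>ln (1 + ?t) - ?t\<bar> + \<bar>ln (1 + ?u) - ?u\<bar>"
      using abs_triangle_ineq4[of "(1 + \<alpha>) * (ln (1 + ?t) - ?t)" "ln (1 + ?u) - ?u"] by (simp only: abs_mult)
    also have "\<dots> \<le> \<bar>1 + \<alpha>\<bar> * (2 * ?t\<^sup>2) + 2 * ?u\<^sup>2"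
      by (intro add_mono mult_left_mono lnb s1 s2) auto
    also have "\<dots> = (2 * \<bar>1 + \<alpha>\<bar> + 2 * (\<alpha> + 1)\<^sup>2) / (real n)\<^sup>2"
      by (simp only: power_divide add_divide_distrib[of "2 * _"] power_one) simp
    also have "\<dots> \<le> D / (real n)\<^sup>2"
    proof (intro divide_right_mono)
      have "2 * (\<alpha> + 1)\<^sup>2 = 2 * \<alpha>\<^sup>2 + 4 * \<alpha> + 2" by (simp add: power2_eq_square algebra_simps)
      moreover have "0 \<le> (\<bar>\<alpha>\<bar> - 1)\<^sup>2" by simp
      then have "2 * \<bar>\<alpha>\<bar> \<le> \<alpha>\<^sup>2 + 1" by (simp add: power2_eq_square algebra_simps)
      moreover have "\<bar>1 + \<alpha>\<bar> \<le> 1 + \<bar>\<alpha>\<bar>" "\<alpha> \<le> \<bar>\<alpha>\<bar>" "0 \<le> \<alpha>\<^sup>2" using abs_triangle_ineq[of 1 \<alpha>] by auto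
      ultimately show "2 * \<bar>1 + \<alpha>\<bar> + 2 * (\<alpha> + 1)\<^sup>2 \<le> D" unfolding D_def by argo
    qed simp
    finally show ?thesis .
  qed
  \<comment> \<open>The limit comes from the product formula for Gamma(\<alpha>+1) contained in
    \<open>Gamma_series\<close>.\<close>
  have r1: "r \<longlonglongrightarrow> 1"
  proof -
    have "Gamma_series (\<alpha> + 1) \<longlonglongrightarrow> Gamma (\<alpha> + 1)" by (rule Gamma_series_LIMSEQ)
    then have "(\<lambda>n. Gamma_series (\<alpha> + 1) n / Gamma (\<alpha> + 1) * ((\<alpha> + real n + 1) / real n)) \<longlonglongrightarrow> Gamma (\<alpha> + 1) / Gamma (\<alpha> + 1) * 1"
      using Gp[of 0] by (intro tendsto_intros) (simp, real_asymp)
    moreover have "\<forall>\<^sub>F n in sequentially. Gamma_series (\<alpha> + 1) n / Gamma (\<alpha> + 1) * ((\<alpha> + real n + 1) / real n) = r n"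
      using eventually_ge_at_top[of 1]
    proof eventually_elim
      case (elim n)
      have "\<alpha> + 1 \<notin> \<int>\<^sub>\<le>\<^sub>0" using assms nonpos_Ints_nonpos[of "\<alpha> + 1"] by auto
      then have "pochhammer (\<alpha> + 1) (n + 1) = Gamma (\<alpha> + real (Suc n) + 1) / Gamma (\<alpha> + 1)"
        using pochhammer_Gamma[of "\<alpha> + 1" "n + 1"] by (simp add: algebra_simps)
      then have "Gamma_series (\<alpha> + 1) n = fact n * (real n powr \<alpha> * real n) * Gamma (\<alpha> + 1) / ((\<alpha> + real n + 1) * Gamma (\<alpha> + real n + 1))"
        unfolding Gamma_series_def G1 using elim by (simp add: powr_def exp_add algebra_simps)
      moreover have "Gamma (real n + 1) = fact n" using Gamma_fact[of n, where 'a = real] by (simp add: add.commute)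
      moreover have "fact n * (x * m) * g / (q * G) / g * (q / m) = fact n * x / G" if "g \<noteq> 0" "q \<noteq> 0" "m \<noteq> 0" for x m g q G :: real
        using that by simp
      ultimately show ?case unfolding r_def using Gp[of 0] pos[of n] elim by simp
    qed
    ultimately show ?thesis using Gp[of 0] by (simp add: Lim_transform_eventually)
  qed
  have a0: "a \<longlonglongrightarrow> 0" unfolding a_def using tendsto_ln[OF r1] by simp
  have D: "D \<ge> 0" by (simp add: D_def)
  have ab: "\<bar>a n\<bar> \<le> 2 * D / real n" if "n \<ge> N" for n
  proof -
    have "- a n \<le> 2 * D / real n"
      using incb by (intro tendsto_0_summable_increments[OF a0 _ N(1) that D]) (meson abs_le_D1)
    moreover have "- (- a n) \<le> 2 * D / real n"
    proof (rule tendsto_0_summable_increments[OF _ _ N(1) that D])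
      show "(\<lambda>n. - a n) \<longlonglongrightarrow> 0" using tendsto_minus[OF a0] by simp
      show "- a (Suc n) - - a n \<le> D / (real n)\<^sup>2" if "n \<ge> N" for n using incb[OF that] by linarith
    qed
    ultimately show ?thesis by linarith
  qed
  have "\<forall>\<^sub>F n in sequentially. \<bar>r n - 1\<bar> \<le> 4 * D / real n"
  proof -
    have "\<forall>\<^sub>F n in sequentially. \<bar>a n\<bar> < 1 / 2"
      using tendstoD[OF a0, of "1 / 2"] by simp
    then show ?thesis
      using eventually_ge_at_top[of N]
    proof eventually_elim
      case (elim n)
      have "r n = exp (a n)" using rpos[of n] elim N(1) by (simp add: a_def)
      moreover have "\<bar>exp (a n) - 1\<bar> \<le> 2 * \<bar>a n\<bar>"
        using exp_bound_lemma[of "a n"] elim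
        by (smt (verit) exp_ge_add_one_self exp_le_cancel_iff exp_zero real_norm_def)
      ultimately show ?case using ab[of n] elim by simp
    qed
  qed
  then show ?thesis unfolding r_def by (rule that)
qed

definition edge_scale :: "nat \<Rightarrow> real" where
  "edge_scale n = (2 * real n) powr (1 / 3)"

definition turning_point :: "real \<Rightarrow> nat \<Rightarrow> real" where
  "turning_point \<alpha> n = 4 * (real n + (\<alpha> + 1) / 2)"

text \<open>The square root distributes the Christoffel-Darboux constant evenly over the two factors
  of the kernel, and the sign removes the oscillation in n, so that \<open>wave\<close> approximates
  Ai.\<close>

definition wave_factor :: "real \<Rightarrow> nat \<Rightarrow> real" where
  "wave_factor \<alpha> n = (- 1) ^ n * sqrt (Gamma (real n + 1) / (Gamma (\<alpha> + real n + 1) * (2 * edge_scale n)))"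

definition wave :: "real \<Rightarrow> nat \<Rightarrow> real \<Rightarrow> real" where
  "wave \<alpha> n \<xi> = wave_factor \<alpha> n * laguerre_u n \<alpha> (turning_point \<alpha> n + 2 * edge_scale n * \<xi>)"

definition wave' :: "real \<Rightarrow> nat \<Rightarrow> real \<Rightarrow> real" where
  "wave' \<alpha> n \<xi> = wave_factor \<alpha> n * (2 * edge_scale n) * laguerre_u' n \<alpha> (turning_point \<alpha> n + 2 * edge_scale n * \<xi>)"

lemma edge_scale_pos: "n \<ge> 1 \<Longrightarrow> edge_scale n > 0" by (simp add: edge_scale_def)

lemma edge_scale_cube: "edge_scale n ^ 3 = 2 * real n"
  by (cases "n = 0") (simp_all add: edge_scale_def powr_realpow[symmetric] powr_powr)

lemma turning_scale_powr: "\<alpha> > -1 \<Longrightarrow> turning_scale \<alpha> n = (4 / (real n + (\<alpha> + 1) / 2)) powr (1 / 3)"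
  by (simp add: turning_scale_def root_powr_inverse)

lemma turning_scale_cube: "\<alpha> > -1 \<Longrightarrow> turning_scale \<alpha> n ^ 3 = 4 / (real n + (\<alpha> + 1) / 2)"
  using turning_scale[of \<alpha> n] by (metis divide_divide_eq_right mult.commute nonzero_mult_div_cancel_left zero_neq_numeral)

lemma bigo_eq_ge_1:
  fixes f g h :: "nat \<Rightarrow> real"
  assumes "f \<in> O(h)" "\<And>n. n \<ge> 1 \<Longrightarrow> g n = f n"
  shows "g \<in> O(h)"
proof -
  have "\<forall>\<^sub>F n in sequentially. g n = f n"
    using eventually_ge_at_top[of "1::nat"] by eventually_elim (rule assms(2))
  from landau_o.big.in_cong[OF this] show ?thesis using assms(1) by blast
qed

lemma bigo_inverseI:
  fixes f :: "nat \<Rightarrow> real"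
  assumes "\<And>n. n \<ge> 1 \<Longrightarrow> \<bar>f n\<bar> \<le> C * (1 / real n)"
  shows "f \<in> O(\<lambda>n. 1 / real n)"
proof (rule bigoI[of _ C])
  show "\<forall>\<^sub>F n in sequentially. norm (f n) \<le> C * norm (1 / real n)"
    using eventually_ge_at_top[of "1::nat"] by eventually_elim (use assms in simp)
qed

text \<open>Translates the saddle width \<delta> into the edge scale b: b\<delta>/2 = (1 +
  c/n)^(-1/3) with c = (\<alpha>+1)/2, and b\<delta>^3/40 = b/(10\<nu>), whereas b/(10n) =
  1/(5b^2).\<close>

lemma edge_scale_turning_scale:
  assumes "\<alpha> > -1"
  shows "(\<lambda>n. edge_scale n * turning_scale \<alpha> n / 2 - 1) \<in> O(\<lambda>n. 1 / real n)"
    "(\<lambda>n. edge_scale n * turning_scale \<alpha> n ^ 3 / 40 - 1 / (5 * (edge_scale n)\<^sup>2)) \<in> O(\<lambda>n. 1 / real n)"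
proof -
  define c where "c = (\<alpha> + 1) / 2"
  have c: "c > 0" using assms by (simp add: c_def)
  have lim: "(\<lambda>n. (1 + c / real n) powr (- 1 / 3) - 1) \<in> O(\<lambda>n. 1 / real n)" by real_asymp
  have eq: "edge_scale n * turning_scale \<alpha> n / 2 = (1 + c / real n) powr (- 1 / 3)" if "n \<ge> 1" for n
  proof -
    have e: "(1 + c / real n) = (real n + c) / real n" using that by (simp add: field_simps)
    have "edge_scale n * turning_scale \<alpha> n = (2 ^ 3 * (real n / (real n + c))) powr (1 / 3)"
      unfolding edge_scale_def turning_scale_powr[OF assms] c_def[symmetric]
      using c by (subst powr_mult[symmetric]) (auto simp: field_simps)
    also have "\<dots> = 2 * (real n / (real n + c)) powr (1 / 3)"
      using c by (subst powr_mult) (auto simp: powr_powr simp flip: powr_realpow)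
    also have "(real n / (real n + c)) powr (1 / 3) = (1 + c / real n) powr (- 1 / 3)"
      unfolding e using c by (simp add: powr_divide powr_minus_divide)
    finally show ?thesis by simp
  qed
  show "(\<lambda>n. edge_scale n * turning_scale \<alpha> n / 2 - 1) \<in> O(\<lambda>n. 1 / real n)"
    by (rule bigo_eq_ge_1[OF lim]) (simp only: eq)
  have "(\<lambda>n. (2 * real n) powr (1/3) / (10 * (real n+c)) - (2 * real n) powr (1/3) / (10 * real n)) \<in> O(\<lambda>n. 1 / real n)"
    using c by real_asymp
  moreover have "edge_scale n * turning_scale \<alpha> n ^ 3 / 40 - 1 / (5 * (edge_scale n)\<^sup>2)
      = (2 * real n) powr (1/3) / (10 * (real n+c)) - (2 * real n) powr (1/3) / (10 * real n)" if "n \<ge> 1" for n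
  proof -
    have "1 / (5 * b\<^sup>2) = b / (10 * m)" if "b ^ 3 = 2 * m" "b > 0" for b m :: real
    proof -
      have "b / (10 * m) = b / (5 * (2 * m))" by simp
      also have "\<dots> = 1 / (5 * b\<^sup>2)" unfolding that(1)[symmetric] using that(2) by (simp add: power3_eq_cube power2_eq_square)
      finally show ?thesis ..
    qed
    from this[OF edge_scale_cube edge_scale_pos[OF that]]
    have e: "1 / (5 * (edge_scale n)\<^sup>2) = edge_scale n / (10 * real n)" .
    have "b * (4 / m) / 40 = b / (10 * m)" for b m :: real by simp
    then show ?thesis
      unfolding turning_scale_cube[OF assms] c_def[symmetric] e unfolding edge_scale_def by presburger
  qed
  ultimately show "(\<lambda>n. edge_scale n * turning_scale \<alpha> n ^ 3 / 40 - 1 / (5 * (edge_scale n)\<^sup>2)) \<in> O(\<lambda>n. 1 / real n)"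
    by (rule bigo_eq_ge_1)
qed

lemma bigo_mult_limits:
  fixes f g h :: "'a \<Rightarrow> real"
  assumes "(\<lambda>x. f x - a) \<in> O[F](h)" "(\<lambda>x. g x - b) \<in> O[F](h)" "h \<in> O[F](\<lambda>_. 1)"
  shows "(\<lambda>x. f x * g x - a * b) \<in> O[F](h)"
proof -
  have "(\<lambda>x. (f x - a) * (g x - b)) \<in> O[F](\<lambda>x. h x * 1)"
    by (intro landau_o.big.mult assms(1) landau_o.big_trans[OF assms(2,3)])
  then have "(\<lambda>x. (f x - a) * (g x - b) + a * (g x - b) + b * (f x - a)) \<in> O[F](h)"
    using assms by (intro sum_in_bigo) auto
  then show ?thesis by (simp add: algebra_simps)
qed

lemma inverse_in_bigo_1: "(\<lambda>n. 1 / real n) \<in> O(\<lambda>_. 1)" by real_asymp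

text \<open>The square of this prefactor is exactly the Gamma quotient times (1 +
  c/n)^(\<alpha>+1/3).\<close>

lemma wave_factor_asymptotics:
  assumes \<alpha>: "\<alpha> > -1"
  shows "(\<lambda>n. \<bar>wave_factor \<alpha> n\<bar> * turning_point \<alpha> n powr ((\<alpha> + 1) / 2) * 2 powr - (\<alpha> + 1) * turning_scale \<alpha> n - 1)
     \<in> O(\<lambda>n. 1 / real n)"
proof -
  define p where "p n = \<bar>wave_factor \<alpha> n\<bar> * turning_point \<alpha> n powr ((\<alpha> + 1) / 2) * 2 powr - (\<alpha> + 1) * turning_scale \<alpha> n" for n
  define g where "g n = Gamma (real n + 1) * real n powr \<alpha> / Gamma (\<alpha> + real n + 1)" for n
  define c where "c = (\<alpha> + 1) / 2"
  have c: "c > 0" using assms by (simp add: c_def)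
  have gO: "(\<lambda>n. g n - 1) \<in> O(\<lambda>n. 1 / real n)"
  proof -
    obtain C where "\<forall>\<^sub>F n in sequentially. \<bar>g n - 1\<bar> \<le> C / real n"
      unfolding g_def by (rule Gamma_ratio_asymptotics[OF \<alpha>])
    then show ?thesis by (intro bigoI[of _ C]) simp
  qed
  have "(\<lambda>n. (1 + c / real n) powr (\<alpha> + 1 / 3) - 1) \<in> O(\<lambda>n. 1 / real n)"
    by real_asymp
  from bigo_mult_limits[OF gO this inverse_in_bigo_1]
  have *: "(\<lambda>n. g n * (1 + c / real n) powr (\<alpha> + 1 / 3) - 1) \<in> O(\<lambda>n. 1 / real n)" by simp
  have sq: "(p n)\<^sup>2 = g n * (1 + c / real n) powr (\<alpha> + 1 / 3)" if "n \<ge> 1" for n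
  proof -
    define \<nu> where "\<nu> = real n + c"
    have \<nu>: "\<nu> > 0" "1 + c / real n = \<nu> / real n" "real n > 0" using c that by (auto simp: \<nu>_def field_simps)
    define R where "R = Gamma (real n + 1) / Gamma (\<alpha> + real n + 1)"
    have R: "R \<ge> 0" using \<alpha> by (auto simp: R_def intro!: divide_nonneg_nonneg Gamma_real_nonneg)
    have "\<bar>wave_factor \<alpha> n\<bar>\<^sup>2 = R / (2 * edge_scale n)"
    proof -
      have "wave_factor \<alpha> n = (- 1) ^ n * sqrt (R / (2 * edge_scale n))" by (simp add: wave_factor_def R_def)
      then show ?thesis using R edge_scale_pos[OF that] by (simp add: abs_mult power_mult_distrib)
    qed
    then have "(p n)\<^sup>2 = R / (2 * edge_scale n) * (turning_point \<alpha> n powr ((\<alpha> + 1) / 2))\<^sup>2 * (2 powr - (\<alpha> + 1))\<^sup>2 * (turning_scale \<alpha> n)\<^sup>2"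
      by (simp add: p_def power_mult_distrib)
    also have "\<dots> = R * real n powr \<alpha> * (\<nu> / real n) powr (\<alpha> + 1 / 3)"
    proof -
      let ?A = "(turning_point \<alpha> n powr ((\<alpha> + 1) / 2))\<^sup>2 * (2 powr - (\<alpha> + 1))\<^sup>2 * (turning_scale \<alpha> n)\<^sup>2 / (2 * edge_scale n)"
      let ?B = "real n powr \<alpha> * (\<nu> / real n) powr (\<alpha> + 1 / 3)"
      have l4: "ln 4 = 2 * ln (2::real)" using ln_realpow[of 2 2] by simp
      have A: "?A = ((4 * \<nu>) powr ((\<alpha> + 1) / 2))\<^sup>2 * (2 powr - (\<alpha> + 1))\<^sup>2 * ((4 / \<nu>) powr (1 / 3))\<^sup>2 / (2 * (2 * real n) powr (1 / 3))"
        by (simp add: turning_scale_powr[OF \<alpha>] turning_point_def edge_scale_def \<nu>_def c_def)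
      have "ln ?A = ln ?B"
        unfolding A using \<nu> by (simp add: ln_mult ln_div ln_realpow l4 algebra_simps add_divide_distrib)
      moreover have "?A > 0" unfolding A using \<nu> by simp
      moreover have "?B > 0" using \<nu> by simp
      ultimately have "?A = ?B" by simp
      have "R / b * x * y * z = R * (x * y * z / b)" for b x y z :: real by simp
      then show ?thesis using \<open>?A = ?B\<close> by (simp only: mult.assoc)
    qed
    finally show ?thesis unfolding \<nu>(2) by (simp add: g_def R_def)
  qed
  have "(\<lambda>n. (p n)\<^sup>2 - 1) \<in> O(\<lambda>n. 1 / real n)"
    by (rule bigo_eq_ge_1[OF *]) (simp add: sq)
  moreover have "(\<lambda>n. p n - 1) \<in> O(\<lambda>n. (p n)\<^sup>2 - 1)"
  \<comment> \<open>As p is nonnegative, |p - 1| <= |p + 1| |p - 1| = |p^2 - 1|.\<close>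
  proof (intro bigoI[of _ 1] always_eventually allI)
    fix n
    have "p n \<ge> 0" using turning_scale[OF \<alpha>, of n] by (simp add: p_def)
    then have "1 * \<bar>p n - 1\<bar> \<le> \<bar>p n + 1\<bar> * \<bar>p n - 1\<bar>" by (intro mult_right_mono) auto
    also have "\<dots> = \<bar>(p n)\<^sup>2 - 1\<bar>" by (simp add: abs_mult[symmetric] power2_eq_square algebra_simps)
    finally show "norm (p n - 1) \<le> 1 * norm ((p n)\<^sup>2 - 1)" by simp
  qed
  ultimately show ?thesis unfolding p_def by (rule landau_o.big_trans[rotated])
qed

text \<open>The two saddle point expansions multiplied by the normalised prefactor. The relative
  error of the prefactor is O(1/n), while b\<delta> stays bounded, so the absolute errors \<delta>^5
  become O(1/n) as well.\<close>

lemma wave_initial: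
  assumes \<alpha>: "\<alpha> > -1"
  shows "(\<lambda>n. wave \<alpha> n 0 - Ai 0 0) \<in> O(\<lambda>n. 1 / real n)"
    "(\<lambda>n. wave' \<alpha> n 0 - (Ai 1 0 + 1 / (5 * (edge_scale n)\<^sup>2) * Ai 0 0)) \<in> O(\<lambda>n. 1 / real n)"
proof -
  let ?\<beta> = "\<alpha> + 1" and ?\<delta> = "\<lambda>n. turning_scale \<alpha> n" and ?x = "turning_point \<alpha>"
  define V where "V n = (- 1) ^ n * exp (- ?x n / 2) * laguerre n \<alpha> (?x n)" for n
  define W where "W n = (- 1) ^ n * exp (- ?x n / 2) * (laguerre_deriv n \<alpha> (?x n) - laguerre n \<alpha> (?x n) / 2)" for n
  define q where "q n = \<bar>wave_factor \<alpha> n\<bar> * ?x n powr (?\<beta> / 2)" for n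
  define p where "p n = q n * 2 powr - ?\<beta> * ?\<delta> n" for n
  note \<delta> = turning_scale[OF \<alpha>]
  have p1: "(\<lambda>n. p n - 1) \<in> O(\<lambda>n. 1 / real n)"
    unfolding p_def q_def by (rule wave_factor_asymptotics[OF \<alpha>])
  have sgn: "wave_factor \<alpha> n = (- 1) ^ n * \<bar>wave_factor \<alpha> n\<bar>" for n
  proof -
    have "Gamma (real n + 1) / (Gamma (\<alpha> + real n + 1) * (2 * edge_scale n)) \<ge> 0"
      using \<alpha> by (auto intro!: divide_nonneg_nonneg mult_nonneg_nonneg Gamma_real_nonneg simp: edge_scale_def)
    then show ?thesis by (simp add: wave_factor_def abs_mult)
  qed
  obtain E1 where "\<And>n. \<bar>(- 1) ^ n * exp (- (4 * (real n + (\<alpha> + 1) / 2)) / 2) * laguerre n \<alpha> (4 * (real n + (\<alpha> + 1) / 2))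
      - 2 powr - ?\<beta> * (?\<delta> n * Ai 0 0)\<bar> \<le> E1 * ?\<delta> n ^ 5"
    by (rule laguerre_turning_value[OF \<alpha>]) (rule that)
  note E1 = this[folded turning_point_def, folded V_def]
  obtain E2 where "\<And>n. n \<ge> 1 \<Longrightarrow> \<bar>(- 1) ^ n * exp (- (4 * (real n + (\<alpha> + 1) / 2)) / 2) *
      (laguerre_deriv n \<alpha> (4 * (real n + (\<alpha> + 1) / 2)) - laguerre n \<alpha> (4 * (real n + (\<alpha> + 1) / 2)) / 2)
      - 2 powr - ?\<beta> * (?\<delta> n ^ 2 / 4 * Ai 1 0 + ?\<delta> n ^ 4 * (1 / 80 - ?\<beta> / 32) * Ai 0 0)\<bar> \<le> E2 * ?\<delta> n ^ 5"
    by (rule laguerre_turning_derivative[OF \<alpha>]) (rule that)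
  note E2 = this[folded turning_point_def, folded W_def]
  define k where "k = (2::real) powr ?\<beta>"
  have k: "k > 0" "2 powr - ?\<beta> = 1 / k" unfolding k_def by (simp, rule powr_minus_divide)
  define s where "s n = V n * k / ?\<delta> n - Ai 0 0" for n
  define t where "t n = 2 * edge_scale n * (?\<beta> / (2 * ?x n) * V n + W n) * k / ?\<delta> n
     - (edge_scale n * ?\<delta> n / 2 * Ai 1 0 + edge_scale n * ?\<delta> n ^ 3 / 40 * Ai 0 0)" for n
  have d3: "?\<delta> n ^ 3 \<le> 4 / real n" if "n \<ge> 1" for n
    unfolding turning_scale_cube[OF \<alpha>] using \<alpha> that by (intro divide_left_mono mult_pos_pos) (auto simp: add_nonneg_pos)
  have bd: "edge_scale n * ?\<delta> n \<le> 2" if "n \<ge> 1" for n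
  proof (rule power_le_imp_le_base[of _ 2])
    have "(edge_scale n * ?\<delta> n) ^ 3 = 2 * real n * ?\<delta> n ^ 3" by (simp add: power_mult_distrib edge_scale_cube)
    also have "\<dots> \<le> 2 * real n * (4 / real n)" using d3[OF that] by (intro mult_left_mono) auto
    also have "\<dots> = 2 ^ 3" using that by simp
    finally show "(edge_scale n * ?\<delta> n) ^ Suc 2 \<le> 2 ^ Suc 2" by (simp add: numeral_3_eq_3[symmetric])
  qed simp
  have b1: "edge_scale n \<ge> 1" if "n \<ge> 1" for n
    unfolding edge_scale_def using that by (intro ge_one_powr_ge_zero) auto
  have d1: "?\<delta> n \<le> 2" if "n \<ge> 1" for n
    using mult_right_mono[OF b1[OF that], of "?\<delta> n"] \<delta>(1)[of n] bd[OF that] by linarith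
  have s_bound: "\<bar>s n\<bar> \<le> (2 * k * \<bar>E1\<bar> * 4) * (1 / real n)" if "n \<ge> 1" for n
  proof -
    have "s n = (V n - 2 powr - ?\<beta> * (?\<delta> n * Ai 0 0)) * (k / ?\<delta> n)"
      unfolding s_def k(2) using \<delta>(1)[of n] k(1) by (simp add: field_simps)
    then have "\<bar>s n\<bar> = \<bar>V n - 2 powr - ?\<beta> * (?\<delta> n * Ai 0 0)\<bar> * (k / ?\<delta> n)"
      using \<delta>(1)[of n] k(1) by (simp add: abs_mult)
    also have "\<dots> \<le> (\<bar>E1\<bar> * ?\<delta> n ^ 5) * (k / ?\<delta> n)"
    proof (rule mult_right_mono)
      have "E1 * ?\<delta> n ^ 5 \<le> \<bar>E1\<bar> * ?\<delta> n ^ 5" using \<delta>(1)[of n] by (intro mult_right_mono) auto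
      then show "\<bar>V n - 2 powr - ?\<beta> * (?\<delta> n * Ai 0 0)\<bar> \<le> \<bar>E1\<bar> * ?\<delta> n ^ 5" using E1[of n] by linarith
    qed (use \<delta>(1)[of n] k(1) in auto)
    also have "\<dots> = k * \<bar>E1\<bar> * (?\<delta> n * ?\<delta> n ^ 3)"
      using \<delta>(1)[of n] by (simp add: eval_nat_numeral)
    also have "\<dots> \<le> k * \<bar>E1\<bar> * (2 * (4 / real n))"
      using d1[OF that] d3[OF that] \<delta>(1)[of n] k(1) by (intro mult_left_mono mult_mono) auto
    finally show ?thesis by (simp add: mult_ac)
  qed
  have sO: "s \<in> O(\<lambda>n. 1 / real n)"
    using s_bound by (rule bigo_inverseI)
  have t_bound: "\<bar>t n\<bar> \<le> (16 * k * (\<bar>?\<beta>\<bar> * \<bar>E1\<bar> + \<bar>E2\<bar>)) * (1 / real n)" if "n \<ge> 1" for n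
  proof -
    define v where "v = V n - 2 powr - ?\<beta> * (?\<delta> n * Ai 0 0)"
    define w where "w = W n - 2 powr - ?\<beta> * (?\<delta> n ^ 2 / 4 * Ai 1 0 + ?\<delta> n ^ 4 * (1 / 80 - ?\<beta> / 32) * Ai 0 0)"
    have V: "V n = v + 1 / k * (?\<delta> n * Ai 0 0)"
      and W: "W n = w + 1 / k * (?\<delta> n ^ 2 / 4 * Ai 1 0 + ?\<delta> n ^ 4 * (1 / 80 - ?\<beta> / 32) * Ai 0 0)"
      by (simp_all only: v_def w_def k(2) diff_add_cancel)
    have x: "?\<beta> / (2 * ?x n) = ?\<beta> * ?\<delta> n ^ 3 / 32"
      unfolding turning_point_def \<delta>(2)[of n, symmetric] using \<delta>(1)[of n] by simp
    \<comment> \<open>The term \<beta>/(2x) V from differentiating the power of x equals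
      \<beta>\<delta>^3 V/32 and cancels the part -\<beta>/32 of the saddle coefficient; only 1/80
      remains, independent of \<alpha>.\<close>
    have gen: "2 * b * (\<beta> * d ^ 3 / 32 * (v + 1 / k * (d * A)) + (w + 1 / k * (d ^ 2 / 4 * B + d ^ 4 * (1 / 80 - \<beta> / 32) * A))) * k / d
       - (b * d / 2 * B + b * d ^ 3 / 40 * A) = (2 * b * k / d) * (\<beta> * d ^ 3 / 32 * v + w)"
      if "d \<noteq> 0" "k \<noteq> 0" for b \<beta> d v w A B k :: real
      using that by (simp add: divide_simps) (simp add: algebra_simps eval_nat_numeral)
    have t: "t n = (2 * edge_scale n * k / ?\<delta> n) * (?\<beta> * ?\<delta> n ^ 3 / 32 * v + w)"
      unfolding t_def x V W using \<delta>(1)[of n] k(1) by (intro gen) auto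
    let ?d = "?\<delta> n"
    have d0: "0 < ?d" by (rule \<delta>(1))
    have "?d ^ 3 \<le> 2 ^ 3" using d1[OF that] d0 by (intro power_mono) auto
    then have d8: "?d ^ 3 / 32 \<le> 1" by simp
    have E: "E * ?d ^ 5 \<le> \<bar>E\<bar> * ?d ^ 5" for E using d0 by (intro mult_right_mono) auto
    have v: "\<bar>v\<bar> \<le> \<bar>E1\<bar> * ?d ^ 5" unfolding v_def by (rule order_trans[OF E1 E])
    have w: "\<bar>w\<bar> \<le> \<bar>E2\<bar> * ?d ^ 5" unfolding w_def by (rule order_trans[OF E2[OF that] E])
    have "\<bar>?\<beta> * ?d ^ 3 / 32 * v\<bar> = (\<bar>?\<beta>\<bar> * (?d ^ 3 / 32)) * \<bar>v\<bar>" using d0 by (simp add: abs_mult)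
    also have "\<dots> \<le> (\<bar>?\<beta>\<bar> * 1) * (\<bar>E1\<bar> * ?d ^ 5)"
      using d0 by (intro mult_mono v mult_left_mono d8) auto
    finally have "\<bar>?\<beta> * ?d ^ 3 / 32 * v + w\<bar> \<le> \<bar>?\<beta>\<bar> * (\<bar>E1\<bar> * ?d ^ 5) + \<bar>E2\<bar> * ?d ^ 5"
      using w by linarith
    then have "\<bar>t n\<bar> \<le> (2 * edge_scale n * k / ?d) * (\<bar>?\<beta>\<bar> * (\<bar>E1\<bar> * ?d ^ 5) + \<bar>E2\<bar> * ?d ^ 5)"
      unfolding t abs_mult using b1[OF that] k(1) d0 by (intro mult_mono) auto
    also have "\<dots> = 2 * k * (\<bar>?\<beta>\<bar> * \<bar>E1\<bar> + \<bar>E2\<bar>) * ((edge_scale n * ?d) * ?d ^ 3)"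
    proof -
      have "(2 * b * k / d) * (\<beta> * (e * d ^ 5) + f * d ^ 5) = 2 * k * (\<beta> * e + f) * ((b * d) * d ^ 3)" if "d > 0"
        for b \<beta> d e f :: real
        using that by (simp add: divide_simps) (simp add: algebra_simps eval_nat_numeral)
      from this[OF d0] show ?thesis .
    qed
    also have "\<dots> \<le> 2 * k * (\<bar>?\<beta>\<bar> * \<bar>E1\<bar> + \<bar>E2\<bar>) * (2 * (4 / real n))"
      using bd[OF that] d3[OF that] d0 k(1) by (intro mult_left_mono mult_mono) auto
    finally show ?thesis by (simp add: mult_ac)
  qed
  have tO: "t \<in> O(\<lambda>n. 1 / real n)"
    using t_bound by (rule bigo_inverseI)
  have w0: "wave \<alpha> n 0 = q n * V n" for n
    unfolding wave_def laguerre_u_def q_def V_def by (subst sgn) simp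
  have w1: "wave' \<alpha> n 0 = q n * (2 * edge_scale n) * (?\<beta> / (2 * ?x n) * V n + W n)" for n
    unfolding wave'_def laguerre_u'_def q_def V_def W_def by (subst sgn) (simp add: algebra_simps)
  have w0': "wave \<alpha> n 0 = p n * (Ai 0 0 + s n)" for n
    unfolding w0 p_def s_def k(2) using k(1) \<delta>(1)[of n] by simp
  have w1': "wave' \<alpha> n 0 = p n * (edge_scale n * ?\<delta> n / 2 * Ai 1 0 + edge_scale n * ?\<delta> n ^ 3 / 40 * Ai 0 0 + t n)" for n
    unfolding w1 p_def t_def k(2) using k(1) \<delta>(1)[of n] by simp
  have "(\<lambda>n. (Ai 0 0 + s n) - Ai 0 0) \<in> O(\<lambda>n. 1 / real n)" using sO by simp
  from bigo_mult_limits[OF p1 this inverse_in_bigo_1]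
  show "(\<lambda>n. wave \<alpha> n 0 - Ai 0 0) \<in> O(\<lambda>n. 1 / real n)" by (simp add: w0')
  define r where "r n = (edge_scale n * ?\<delta> n / 2 - 1) * Ai 1 0
     + (edge_scale n * ?\<delta> n ^ 3 / 40 - 1 / (5 * (edge_scale n)\<^sup>2)) * Ai 0 0 + t n" for n
  have rO: "r \<in> O(\<lambda>n. 1 / real n)"
    unfolding r_def by (intro sum_in_bigo tO landau_o.big.mult_in_1) (use edge_scale_turning_scale[OF \<alpha>] in auto)
  have e0: "(\<lambda>n. 1 / (5 * (edge_scale n)\<^sup>2)) \<in> O(\<lambda>_. 1)" unfolding edge_scale_def by real_asymp
  have "P * (q * B + u * A + T) - (B + c * A) = (P - 1) * (B + c * A) + P * ((q - 1) * B + (u - c) * A + T)" for P q B u A T c :: real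
    by (simp add: algebra_simps)
  then have "wave' \<alpha> n 0 - (Ai 1 0 + 1 / (5 * (edge_scale n)\<^sup>2) * Ai 0 0)
     = (p n - 1) * (Ai 1 0 + 1 / (5 * (edge_scale n)\<^sup>2) * Ai 0 0) + p n * r n" for n
    unfolding w1' r_def .
  moreover have "(\<lambda>n. (p n - 1) * (Ai 1 0 + 1 / (5 * (edge_scale n)\<^sup>2) * Ai 0 0)) \<in> O(\<lambda>n. 1 / real n)"
  proof -
    have "(\<lambda>n. Ai 1 0 + 1 / (5 * (edge_scale n)\<^sup>2) * Ai 0 0) \<in> O(\<lambda>_. 1)"
      using e0 by (intro sum_in_bigo landau_o.big.mult_in_1) auto
    from landau_o.big.mult[OF p1 this] show ?thesis by simp
  qed
  moreover have "(\<lambda>n. p n * r n - 1 * 0) \<in> O(\<lambda>n. 1 / real n)"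
    by (intro bigo_mult_limits p1 inverse_in_bigo_1) (simp add: rO)
  ultimately show "(\<lambda>n. wave' \<alpha> n 0 - (Ai 1 0 + 1 / (5 * (edge_scale n)\<^sup>2) * Ai 0 0)) \<in> O(\<lambda>n. 1 / real n)"
    by (auto intro: sum_in_bigo)
qed

section \<open>Comparison of the rescaled equation with the Airy equation\<close>

section \<open>The Airy expansion of the wave function\<close>

text \<open>The energy d^2 + e^2 + s^2 grows at rate at most K + 2; including s^2 treats the forcing
  term and the initial data on the same footing.\<close>

lemma second_order_Gronwall_right:
  fixes d e Q R :: "real \<Rightarrow> real"
  assumes d: "\<And>\<xi>. 0 \<le> \<xi> \<Longrightarrow> \<xi> \<le> M \<Longrightarrow> (d has_real_derivative e \<xi>) (at \<xi>)"
    and e: "\<And>\<xi>. 0 \<le> \<xi> \<Longrightarrow> \<xi> \<le> M \<Longrightarrow> (e has_real_derivative Q \<xi> * d \<xi> + R \<xi>) (at \<xi>)"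
    and Q: "\<And>\<xi>. 0 \<le> \<xi> \<Longrightarrow> \<xi> \<le> M \<Longrightarrow> \<bar>Q \<xi>\<bar> \<le> K" and R: "\<And>\<xi>. 0 \<le> \<xi> \<Longrightarrow> \<xi> \<le> M \<Longrightarrow> \<bar>R \<xi>\<bar> \<le> s"
    and init: "\<bar>d 0\<bar> \<le> s" "\<bar>e 0\<bar> \<le> s" and \<xi>: "0 \<le> \<xi>" "\<xi> \<le> M"
  shows "\<bar>d \<xi>\<bar> \<le> 2 * exp ((K + 2) * M) * s" "\<bar>e \<xi>\<bar> \<le> 2 * exp ((K + 2) * M) * s"
proof -
  have K: "K \<ge> 0" and s: "s \<ge> 0" using Q[OF \<xi>] init by linarith+
  define L where "L = K + 2"
  have L: "L \<ge> 2" using K by (simp add: L_def)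
  define E where "E x = (d x)\<^sup>2 + (e x)\<^sup>2 + s\<^sup>2" for x
  define F where "F x = exp (- L * x) * E x" for x
  have mono: "F \<xi> \<le> F 0"
  proof (rule DERIV_nonpos_imp_nonincreasing[OF \<xi>(1)])
    fix x assume x: "0 \<le> x" "x \<le> \<xi>"
    then have xM: "x \<le> M" using \<xi> by simp
    define D where "D = 2 * d x * e x + 2 * e x * (Q x * d x + R x)"
    have "(F has_real_derivative exp (- L * x) * D + (- L * exp (- L * x)) * E x) (at x)"
      unfolding F_def E_def D_def
      by (rule derivative_eq_intros d[OF x(1) xM] e[OF x(1) xM] refl | simp)+
    moreover have "exp (- L * x) * D + (- L * exp (- L * x)) * E x = exp (- L * x) * (D - L * E x)"
      by (simp add: algebra_simps)
    moreover have "D \<le> L * E x"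
    proof -
      have sq: "2 * \<bar>u * v\<bar> \<le> u\<^sup>2 + v\<^sup>2" for u v :: real
        using sum_squares_bound[of "\<bar>u\<bar>" "\<bar>v\<bar>"] by (simp add: abs_mult)
      have 1: "2 * d x * e x \<le> (d x)\<^sup>2 + (e x)\<^sup>2" using sq[of "d x" "e x"] by linarith
      have "2 * e x * (Q x * d x) = Q x * (2 * (d x * e x))" by simp
      also have "\<dots> \<le> \<bar>Q x\<bar> * \<bar>2 * (d x * e x)\<bar>" by (metis abs_ge_self abs_mult)
      also have "\<dots> \<le> K * ((d x)\<^sup>2 + (e x)\<^sup>2)"
        using sq[of "d x" "e x"] Q[OF x(1) xM] by (intro mult_mono) (auto simp: abs_mult)
      finally have 2: "2 * e x * (Q x * d x) \<le> K * ((d x)\<^sup>2 + (e x)\<^sup>2)" .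
      have "2 * \<bar>e x * R x\<bar> \<le> 2 * (\<bar>e x\<bar> * s)" unfolding abs_mult using R[OF x(1) xM] by (intro mult_left_mono) auto
      also have "\<dots> \<le> (e x)\<^sup>2 + s\<^sup>2" using sq[of "e x" s] s by (simp add: abs_mult)
      finally have 3: "2 * e x * R x \<le> (e x)\<^sup>2 + s\<^sup>2" by linarith
      have "D = 2 * d x * e x + 2 * e x * (Q x * d x) + 2 * e x * R x" by (simp add: D_def algebra_simps)
      also have "\<dots> \<le> ((d x)\<^sup>2 + (e x)\<^sup>2) + K * ((d x)\<^sup>2 + (e x)\<^sup>2) + ((e x)\<^sup>2 + s\<^sup>2)" using 1 2 3 by linarith
      also have "\<dots> \<le> L * E x"
      proof -
        have "a + b + k * (a + b) + (b + c) \<le> (k + 2) * (a + b + c)" if "a \<ge> 0" "b \<ge> 0" "c \<ge> 0" "k \<ge> 0" for a b c k :: real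
        proof -
          have "(k + 2) * (a + b + c) - (a + b + k * (a + b) + (b + c)) = a + c + k * c" by (simp add: algebra_simps)
          moreover have "a + c + k * c \<ge> 0" using that by simp
          ultimately show ?thesis by linarith
        qed
        from this[of "(d x)\<^sup>2" "(e x)\<^sup>2" "s\<^sup>2" K] show ?thesis unfolding L_def E_def using K by simp
      qed
      finally show ?thesis .
    qed
    ultimately show "\<exists>y. (F has_real_derivative y) (at x) \<and> y \<le> 0"
      by (metis diff_le_0_iff_le exp_ge_zero mult_nonneg_nonpos)
  qed
  have E0: "E 0 \<le> 3 * s\<^sup>2"
    using power_mono[OF init(1), of 2] power_mono[OF init(2), of 2] by (simp add: E_def)
  have "E \<xi> = exp (L * \<xi>) * F \<xi>" by (simp add: F_def exp_minus)
  also have "\<dots> \<le> exp (L * \<xi>) * (3 * s\<^sup>2)"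
    using mono E0 by (intro mult_left_mono) (auto simp: F_def)
  also have "\<dots> \<le> exp (L * M) * (3 * s\<^sup>2)"
    using \<xi> L by (intro mult_right_mono) auto
  also have "\<dots> \<le> (exp (L * M))\<^sup>2 * (4 * s\<^sup>2)"
  proof (intro mult_mono)
    have "1 \<le> exp (L * M)" using \<xi> L by simp
    then show "exp (L * M) \<le> (exp (L * M))\<^sup>2" by (simp add: power2_eq_square)
  qed auto
  also have "\<dots> = (2 * exp (L * M) * s)\<^sup>2" by (simp add: power_mult_distrib)
  finally have *: "(d \<xi>)\<^sup>2 + (e \<xi>)\<^sup>2 \<le> (2 * exp (L * M) * s)\<^sup>2" using zero_le_power2[of s] unfolding E_def by linarith
  have p: "0 \<le> 2 * exp (L * M) * s" using s by simp
  have "(d \<xi>)\<^sup>2 \<le> (2 * exp (L * M) * s)\<^sup>2" "(e \<xi>)\<^sup>2 \<le> (2 * exp (L * M) * s)\<^sup>2"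
    using * zero_le_power2[of "d \<xi>"] zero_le_power2[of "e \<xi>"] by linarith+
  then show "\<bar>d \<xi>\<bar> \<le> 2 * exp ((K + 2) * M) * s" "\<bar>e \<xi>\<bar> \<le> 2 * exp ((K + 2) * M) * s"
    using p unfolding L_def by (simp_all only: abs_le_square_iff[symmetric] abs_of_nonneg)
qed

lemma second_order_Gronwall:
  fixes d e Q R :: "real \<Rightarrow> real"
  assumes d: "\<And>\<xi>. \<bar>\<xi>\<bar> \<le> M \<Longrightarrow> (d has_real_derivative e \<xi>) (at \<xi>)"
    and e: "\<And>\<xi>. \<bar>\<xi>\<bar> \<le> M \<Longrightarrow> (e has_real_derivative Q \<xi> * d \<xi> + R \<xi>) (at \<xi>)"
    and Q: "\<And>\<xi>. \<bar>\<xi>\<bar> \<le> M \<Longrightarrow> \<bar>Q \<xi>\<bar> \<le> K" and R: "\<And>\<xi>. \<bar>\<xi>\<bar> \<le> M \<Longrightarrow> \<bar>R \<xi>\<bar> \<le> s"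
    and init: "\<bar>d 0\<bar> \<le> s" "\<bar>e 0\<bar> \<le> s" and \<xi>: "\<bar>\<xi>\<bar> \<le> M"
  shows "\<bar>d \<xi>\<bar> \<le> 2 * exp ((K + 2) * M) * s \<and> \<bar>e \<xi>\<bar> \<le> 2 * exp ((K + 2) * M) * s"
proof (cases "\<xi> \<ge> 0")
  case True
  show ?thesis
    using second_order_Gronwall_right[of M d e Q R K s \<xi>] assms True by auto
next
  case False
  define d' where "d' x = d (- x)" for x
  define e' where "e' x = - e (- x)" for x
  have D: "(d' has_real_derivative e' x) (at x)"
    "(e' has_real_derivative Q (- x) * d' x + R (- x)) (at x)" "\<bar>Q (- x)\<bar> \<le> K" "\<bar>R (- x)\<bar> \<le> s"
    if "0 \<le> x" "x \<le> M" for x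
  proof -
    from that have x: "\<bar>- x\<bar> \<le> M" by simp
    show "(d' has_real_derivative e' x) (at x)"
      unfolding d'_def e'_def using DERIV_chain2[where f = d and g = "\<lambda>x. - x" and x = x and s = UNIV and Db = "-1", OF d[OF x]] by (simp add: DERIV_minus)
    show "(e' has_real_derivative Q (- x) * d' x + R (- x)) (at x)"
      unfolding d'_def e'_def using DERIV_minus[OF DERIV_chain2[where f = e and g = "\<lambda>x. - x" and x = x and s = UNIV and Db = "-1", OF e[OF x]]] by (simp add: DERIV_minus add.commute)
    show "\<bar>Q (- x)\<bar> \<le> K" "\<bar>R (- x)\<bar> \<le> s" using Q[OF x] R[OF x] by auto
  qed
  have "\<bar>d' (- \<xi>)\<bar> \<le> 2 * exp ((K + 2) * M) * s \<and> \<bar>e' (- \<xi>)\<bar> \<le> 2 * exp ((K + 2) * M) * s"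
    using second_order_Gronwall_right[where \<xi> = "- \<xi>", OF D] init False \<xi> by (simp add: d'_def e'_def)
  then show ?thesis by (simp add: d'_def e'_def)
qed

text \<open>Error terms must remain small after division by \<xi> - \<eta>, so smallness is measured
  in values and Lipschitz constant at once.\<close>

definition bounded_Lipschitz :: "real \<Rightarrow> real \<Rightarrow> (real \<Rightarrow> real) \<Rightarrow> bool" where
  "bounded_Lipschitz M C f \<longleftrightarrow> (\<forall>\<xi>. \<bar>\<xi>\<bar> \<le> M \<longrightarrow> \<bar>f \<xi>\<bar> \<le> C) \<and>
     (\<forall>\<xi> \<eta>. \<bar>\<xi>\<bar> \<le> M \<longrightarrow> \<bar>\<eta>\<bar> \<le> M \<longrightarrow> \<bar>f \<xi> - f \<eta>\<bar> \<le> C * \<bar>\<xi> - \<eta>\<bar>)"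

lemma bounded_LipschitzI:
  fixes f f' :: "real \<Rightarrow> real"
  assumes "\<And>\<xi>. \<bar>\<xi>\<bar> \<le> M \<Longrightarrow> (f has_real_derivative f' \<xi>) (at \<xi>)" "\<And>\<xi>. \<bar>\<xi>\<bar> \<le> M \<Longrightarrow> \<bar>f \<xi>\<bar> \<le> C" "\<And>\<xi>. \<bar>\<xi>\<bar> \<le> M \<Longrightarrow> \<bar>f' \<xi>\<bar> \<le> C"
  shows "bounded_Lipschitz M C f"
  unfolding bounded_Lipschitz_def
proof (intro conjI allI impI)
  fix \<xi> \<eta> :: real assume "\<bar>\<xi>\<bar> \<le> M" "\<bar>\<eta>\<bar> \<le> M"
  then have "\<xi> \<in> {-M..M}" "\<eta> \<in> {-M..M}" by (auto simp: abs_le_iff)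
  then have "norm (f \<xi> - f \<eta>) \<le> C * norm (\<xi> - \<eta>)"
    using assms by (intro field_differentiable_bound[of "{-M..M}" f f'] DERIV_subset[OF assms(1)]) auto
  then show "\<bar>f \<xi> - f \<eta>\<bar> \<le> C * \<bar>\<xi> - \<eta>\<bar>" by simp
qed (use assms in auto)

lemma smooth_bounded_Lipschitz:
  fixes f f' :: "real \<Rightarrow> real"
  assumes "\<And>\<xi>. (f has_real_derivative f' \<xi>) (at \<xi>)" "continuous_on UNIV f'"
  obtains C where "C \<ge> 0" "bounded_Lipschitz M C f"
proof -
  have c: "continuous_on {-M..M} f" "continuous_on {-M..M} f'"
    using continuous_on_subset[OF assms(2)] DERIV_continuous_on[of "{-M..M}" f f'] assms(1)[THEN DERIV_subset] by auto
  have "\<exists>B. \<forall>x. \<bar>x\<bar> \<le> M \<longrightarrow> \<bar>g x\<bar> \<le> B" if g: "continuous_on {-M..M} g" for g :: "real \<Rightarrow> real"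
  proof -
    have "bounded (g ` {-M..M})" using g by (intro compact_imp_bounded compact_continuous_image) auto
    then obtain B where "\<forall>y\<in>g ` {-M..M}. norm y \<le> B" unfolding bounded_iff by blast
    then show ?thesis by (intro exI[of _ B]) (auto simp: abs_le_iff)
  qed
  from this[OF c(1)] this[OF c(2)] obtain B1 B2 where B: "\<forall>x. \<bar>x\<bar> \<le> M \<longrightarrow> \<bar>f x\<bar> \<le> B1" "\<forall>x. \<bar>x\<bar> \<le> M \<longrightarrow> \<bar>f' x\<bar> \<le> B2" by auto
  show ?thesis
  proof (rule that[of "max 0 (max B1 B2)"])
    show "bounded_Lipschitz M (max 0 (max B1 B2)) f"
      by (rule bounded_LipschitzI[OF assms(1)]) (use B in \<open>fastforce simp: max_def\<close>)+
  qed simp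
qed

text \<open>The solution of w'' = \<xi> w - \<xi>^2 Ai with w(0) = 0 and w'(0) = Ai(0)/5: the
  equation is the b^(-2) part of the perturbed Airy equation, the initial values are those found in
  \<open>wave_initial\<close>.\<close>

definition airy_corr :: "real \<Rightarrow> real" where "airy_corr \<xi> = (\<xi> * Ai 0 \<xi> - \<xi>\<^sup>2 * Ai 1 \<xi>) / 5"
definition airy_corr' :: "real \<Rightarrow> real" where "airy_corr' \<xi> = ((1 - \<xi> ^ 3) * Ai 0 \<xi> - \<xi> * Ai 1 \<xi>) / 5"

lemma airy_corr_derivative: "(airy_corr has_real_derivative airy_corr' \<xi>) (at \<xi>)"
  unfolding airy_corr_def airy_corr'_def
  by (rule derivative_eq_intros Ai_0_derivative Ai_1_derivative refl | simp)+ (simp add: field_simps power2_eq_square power3_eq_cube)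

lemma airy_corr'_derivative: "(airy_corr' has_real_derivative \<xi> * airy_corr \<xi> - \<xi>\<^sup>2 * Ai 0 \<xi>) (at \<xi>)"
  unfolding airy_corr_def airy_corr'_def
  by (rule derivative_eq_intros Ai_0_derivative Ai_1_derivative refl | simp)+ (simp add: field_simps power2_eq_square power3_eq_cube)

text \<open>Write x = 2b^3 (1+y) with y of order b^(-2). The potential is then \<xi>/(1+y) up to
  lower order, and the geometric series to first order gives \<xi> - \<xi>^2/b^2.\<close>

lemma edge_position_bounds:
  fixes b \<beta> \<xi> M s :: real
  defines "y \<equiv> \<xi> / b\<^sup>2 + \<beta> / b ^ 3" and "x \<equiv> 2 * b ^ 3 + 2 * \<beta> + 2 * b * \<xi>"
  assumes b: "b \<ge> 1" and \<beta>: "\<beta> \<ge> 0" and \<xi>: "\<bar>\<xi>\<bar> \<le> M" and small: "(M + \<beta>) / b\<^sup>2 \<le> 1 / 2"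
  shows "x = 2 * b ^ 3 * (1 + y)" "\<bar>y\<bar> \<le> (M + \<beta>) / b\<^sup>2" "x \<ge> b ^ 3"
    "\<bar>b\<^sup>2 * (2 * b * \<xi> / x + s / x\<^sup>2) - (\<xi> - \<xi>\<^sup>2 / b\<^sup>2)\<bar> \<le> (M * \<beta> + 2 * M * (M + \<beta>)\<^sup>2 + \<bar>s\<bar>) / b ^ 3"
proof -
  show x: "x = 2 * b ^ 3 * (1 + y)"
    using b by (simp add: x_def y_def field_simps power2_eq_square power3_eq_cube)
  have "\<beta> / b ^ 3 \<le> \<beta> / b\<^sup>2" using b \<beta> by (intro divide_left_mono) (auto intro: power_increasing)
  moreover have "\<bar>\<xi> / b\<^sup>2\<bar> \<le> M / b\<^sup>2" using \<xi> by (simp add: abs_divide divide_right_mono)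
  moreover have "\<beta> / b ^ 3 \<ge> 0" using b \<beta> by simp
  ultimately show y: "\<bar>y\<bar> \<le> (M + \<beta>) / b\<^sup>2" unfolding y_def add_divide_distrib by linarith
  then have y2: "\<bar>y\<bar> \<le> 1 / 2" using small by linarith
  have b3: "b ^ 3 \<ge> 1" using b by simp
  have "b ^ 3 * 1 \<le> b ^ 3 * (2 * (1 + y))" using y2 b by (intro mult_left_mono) auto
  then show xb: "x \<ge> b ^ 3" unfolding x by (simp add: algebra_simps)
  have M: "M \<ge> 0" using \<xi> by linarith
  have "b\<^sup>2 * (2 * b * \<xi> / x) = \<xi> / (1 + y)"
    unfolding x using b by (simp add: power2_eq_square power3_eq_cube)
  moreover have "\<xi> / (1 + y) - (\<xi> - \<xi>\<^sup>2 / b\<^sup>2) = - (\<xi> * \<beta> / b ^ 3) + \<xi> * y\<^sup>2 / (1 + y)"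
  proof -
    have "\<xi> / (1 + y) = \<xi> - \<xi> * y + \<xi> * y\<^sup>2 / (1 + y)" using y2 by (simp add: field_simps power2_eq_square)
    moreover have "\<xi> * y = \<xi>\<^sup>2 / b\<^sup>2 + \<xi> * \<beta> / b ^ 3" by (simp add: y_def distrib_left power2_eq_square)
    ultimately show ?thesis by simp
  qed
  ultimately have e: "b\<^sup>2 * (2 * b * \<xi> / x + s / x\<^sup>2) - (\<xi> - \<xi>\<^sup>2 / b\<^sup>2) = - (\<xi> * \<beta> / b ^ 3) + \<xi> * y\<^sup>2 / (1 + y) + b\<^sup>2 * s / x\<^sup>2"
    by (simp add: distrib_left)
  have b43: "c / b ^ 4 \<le> c / b ^ 3" if "c \<ge> 0" for c
    using b that by (intro divide_left_mono) (auto intro: power_increasing)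
  have 1: "\<bar>\<xi> * \<beta> / b ^ 3\<bar> \<le> M * \<beta> / b ^ 3"
    using \<xi> \<beta> b by (simp add: abs_mult divide_right_mono mult_right_mono)
  have 2: "\<bar>\<xi> * y\<^sup>2 / (1 + y)\<bar> \<le> 2 * M * (M + \<beta>)\<^sup>2 / b ^ 3"
  proof -
    have "\<bar>\<xi> * y\<^sup>2 / (1 + y)\<bar> = \<bar>\<xi>\<bar> * \<bar>y\<bar>\<^sup>2 * (1 / (1 + y))" using y2 by (simp add: abs_mult)
    also have "\<dots> \<le> M * ((M + \<beta>) / b\<^sup>2)\<^sup>2 * 2"
      using y y2 \<xi> M \<beta> by (intro mult_mono power_mono) (auto simp: field_simps)
    also have "\<dots> = 2 * M * (M + \<beta>)\<^sup>2 / b ^ 4" by (simp add: power_divide power_mult[symmetric])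
    also have "\<dots> \<le> 2 * M * (M + \<beta>)\<^sup>2 / b ^ 3" using M by (intro b43) auto
    finally show ?thesis .
  qed
  have 3: "\<bar>b\<^sup>2 * s / x\<^sup>2\<bar> \<le> \<bar>s\<bar> / b ^ 3"
  proof -
    have "\<bar>b\<^sup>2 * s / x\<^sup>2\<bar> = b\<^sup>2 * \<bar>s\<bar> / x\<^sup>2" by (simp add: abs_mult)
    also have "\<dots> \<le> b\<^sup>2 * \<bar>s\<bar> / (b ^ 3)\<^sup>2"
      using xb b b3 less_le_trans[OF zero_less_power[of b 3] xb] by (intro divide_left_mono power_mono mult_pos_pos zero_less_power) auto
    also have "\<dots> = \<bar>s\<bar> / b ^ 4" using b by (simp add: eval_nat_numeral)
    also have "\<dots> \<le> \<bar>s\<bar> / b ^ 3" by (intro b43) auto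
    finally show ?thesis .
  qed
  show "\<bar>b\<^sup>2 * (2 * b * \<xi> / x + s / x\<^sup>2) - (\<xi> - \<xi>\<^sup>2 / b\<^sup>2)\<bar> \<le> (M * \<beta> + 2 * M * (M + \<beta>)\<^sup>2 + \<bar>s\<bar>) / b ^ 3"
    unfolding e add_divide_distrib using 1 2 3 by linarith
qed

lemma wave_derivative:
  assumes "turning_point \<alpha> n + 2 * edge_scale n * \<xi> > 0"
  shows "(wave \<alpha> n has_real_derivative wave' \<alpha> n \<xi>) (at \<xi>)"
proof -
  have "((\<lambda>\<xi>. laguerre_u n \<alpha> (turning_point \<alpha> n + 2 * edge_scale n * \<xi>)) has_real_derivative
     laguerre_u' n \<alpha> (turning_point \<alpha> n + 2 * edge_scale n * \<xi>) * (2 * edge_scale n)) (at \<xi>)"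
    by (rule DERIV_chain2[where f = "laguerre_u n \<alpha>" and x = \<xi> and g = "\<lambda>\<xi>. turning_point \<alpha> n + 2 * edge_scale n * \<xi>", OF laguerre_u_derivative[OF assms]])
      (auto intro!: derivative_eq_intros)
  from DERIV_cmult[OF this, of "wave_factor \<alpha> n"] show ?thesis
    unfolding wave_def[abs_def] wave'_def by (simp add: mult_ac)
qed

text \<open>The chain rule multiplies the normal form coefficient by (2b)^2, and x - 4\<nu> =
  2b\<xi> turns 1/4 - \<nu>/x into b\<xi>/(2x).\<close>

lemma wave'_derivative:
  fixes \<alpha> \<xi> :: real
  defines "x n \<equiv> turning_point \<alpha> n + 2 * edge_scale n * \<xi>"
  assumes "x n > 0"
  shows "(wave' \<alpha> n has_real_derivative
     (edge_scale n)\<^sup>2 * (2 * edge_scale n * \<xi> / x n + (\<alpha>\<^sup>2 - 1) / (x n)\<^sup>2) * wave \<alpha> n \<xi>) (at \<xi>)"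
proof -
  have "((\<lambda>\<xi>. laguerre_u' n \<alpha> (turning_point \<alpha> n + 2 * edge_scale n * \<xi>)) has_real_derivative
     (1 / 4 - (real n + (\<alpha> + 1) / 2) / x n + (\<alpha>\<^sup>2 - 1) / (4 * (x n)\<^sup>2)) * laguerre_u n \<alpha> (x n) * (2 * edge_scale n)) (at \<xi>)"
    unfolding x_def
    by (rule DERIV_chain2[where f = "laguerre_u' n \<alpha>" and x = \<xi> and g = "\<lambda>\<xi>. turning_point \<alpha> n + 2 * edge_scale n * \<xi>",
        OF laguerre_u'_derivative[OF assms(2)[unfolded x_def]]]) (auto intro!: derivative_eq_intros)
  from DERIV_cmult[OF this, of "wave_factor \<alpha> n * (2 * edge_scale n)"]
  have D: "(wave' \<alpha> n has_real_derivative wave_factor \<alpha> n * (2 * edge_scale n) *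
     ((1 / 4 - (real n + (\<alpha> + 1) / 2) / x n + (\<alpha>\<^sup>2 - 1) / (4 * (x n)\<^sup>2)) * laguerre_u n \<alpha> (x n) * (2 * edge_scale n))) (at \<xi>)"
    unfolding wave'_def[abs_def] .
  have "k * (2 * b) * ((1 / 4 - \<nu> / z + s / (4 * z\<^sup>2)) * u * (2 * b)) = b\<^sup>2 * (2 * b * \<xi> / z + s / z\<^sup>2) * (k * u)"
    if "2 * b * \<xi> = z - 4 * \<nu>" "z \<noteq> 0" for k b \<nu> z s u
    unfolding that(1) using that(2) by (simp add: field_simps power2_eq_square)
  from this[of "edge_scale n" "x n" "real n + (\<alpha> + 1) / 2" "wave_factor \<alpha> n" "\<alpha>\<^sup>2 - 1" "laguerre_u n \<alpha> (x n)"]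
  have e: "wave_factor \<alpha> n * (2 * edge_scale n) *
     ((1 / 4 - (real n + (\<alpha> + 1) / 2) / x n + (\<alpha>\<^sup>2 - 1) / (4 * (x n)\<^sup>2)) * laguerre_u n \<alpha> (x n) * (2 * edge_scale n))
     = (edge_scale n)\<^sup>2 * (2 * edge_scale n * \<xi> / x n + (\<alpha>\<^sup>2 - 1) / (x n)\<^sup>2) * (wave_factor \<alpha> n * laguerre_u n \<alpha> (x n))"
    using assms(2) by (simp add: x_def turning_point_def)
  show ?thesis using D unfolding e unfolding wave_def x_def .
qed

lemma turning_point_edge_scale: "turning_point \<alpha> n + 2 * edge_scale n * \<xi> = 2 * edge_scale n ^ 3 + 2 * (\<alpha> + 1) + 2 * edge_scale n * \<xi>"
  by (simp add: turning_point_def edge_scale_cube)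

lemma edge_scale_ge_1: "n \<ge> 1 \<Longrightarrow> edge_scale n \<ge> 1"
  unfolding edge_scale_def by (intro ge_one_powr_ge_zero) auto

lemma eventually_edge_scale_large: "\<forall>\<^sub>F n in sequentially. c / (edge_scale n)\<^sup>2 \<le> 1 / 2" for c :: real
proof -
  have "(\<lambda>n. c / (edge_scale n)\<^sup>2) \<longlonglongrightarrow> 0" unfolding edge_scale_def by real_asymp
  from order_tendstoD(2)[OF this, of "1 / 2"] show ?thesis by (auto elim: eventually_mono)
qed

lemma bigo_inverse_edge_scale:
  assumes "f \<in> O(\<lambda>n. 1 / real n)"
  obtains C where "C \<ge> 0" "\<forall>\<^sub>F n in sequentially. \<bar>f n\<bar> \<le> C / edge_scale n ^ 3"
proof -
  obtain C where C: "C > 0" "\<forall>\<^sub>F n in sequentially. norm (f n) \<le> C * norm (1 / real n)"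
    using landau_o.bigE[OF assms] by blast
  have "\<forall>\<^sub>F n in sequentially. \<bar>f n\<bar> \<le> (2 * C) / edge_scale n ^ 3"
    using C(2) by eventually_elim (simp add: edge_scale_cube)
  then show ?thesis using C(1) by (intro that[of "2 * C"]) auto
qed

text \<open>The error of the Airy ansatz solves the same linear equation with forcing and initial
  data of order b^(-3); Gronwall bounds it and its derivative.\<close>

lemma wave_expansion:
  assumes \<alpha>: "\<alpha> > -1" and M: "M \<ge> 0"
  obtains C where "C \<ge> 0" "\<forall>\<^sub>F n in sequentially.
      bounded_Lipschitz M (C / edge_scale n ^ 3) (\<lambda>\<xi>. wave \<alpha> n \<xi> - (Ai 0 \<xi> + airy_corr \<xi> / (edge_scale n)\<^sup>2)) \<and>
      bounded_Lipschitz M (C / edge_scale n ^ 3) (\<lambda>\<xi>. wave' \<alpha> n \<xi> - (Ai 1 \<xi> + airy_corr' \<xi> / (edge_scale n)\<^sup>2))"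
proof -
  define \<beta> where "\<beta> = \<alpha> + 1"
  have \<beta>: "\<beta> \<ge> 0" using \<alpha> by (simp add: \<beta>_def)
  obtain A0 where A0: "A0 \<ge> 0" "\<forall>\<^sub>F n in sequentially. \<bar>wave \<alpha> n 0 - Ai 0 0\<bar> \<le> A0 / edge_scale n ^ 3"
    by (rule bigo_inverse_edge_scale[OF wave_initial(1)[OF \<alpha>]]) (rule that)
  obtain A1 where A1: "A1 \<ge> 0" "\<forall>\<^sub>F n in sequentially. \<bar>wave' \<alpha> n 0 - (Ai 1 0 + 1 / (5 * (edge_scale n)\<^sup>2) * Ai 0 0)\<bar> \<le> A1 / edge_scale n ^ 3"
    by (rule bigo_inverse_edge_scale[OF wave_initial(2)[OF \<alpha>]]) (rule that)
  have c: "continuous_on UNIV (Ai 1)" "continuous_on UNIV airy_corr'" "continuous_on UNIV (Ai 0)"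
    using Ai_0_derivative Ai_1_derivative airy_corr'_derivative
    by (auto intro!: continuous_at_imp_continuous_on DERIV_isCont)
  obtain K1 where K1: "K1 \<ge> 0" "bounded_Lipschitz M K1 (Ai 0)"
    by (rule smooth_bounded_Lipschitz[OF Ai_0_derivative c(1)]) (rule that)
  obtain K2 where K2: "K2 \<ge> 0" "bounded_Lipschitz M K2 airy_corr"
    by (rule smooth_bounded_Lipschitz[OF airy_corr_derivative c(2)]) (rule that)
  define Kq where "Kq = M * \<beta> + 2 * M * (M + \<beta>)\<^sup>2 + \<bar>\<alpha>\<^sup>2 - 1\<bar>"
  have Kq: "Kq \<ge> 0" using M \<beta> by (simp add: Kq_def)
  define K where "K = M + M\<^sup>2 + Kq"
  have K: "K \<ge> 0" using M Kq by (simp add: K_def)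
  define S where "S = A0 + A1 + Kq * (K1 + K2) + M\<^sup>2 * K2"
  have S: "S \<ge> 0" using A0 A1 Kq K1 K2 by (simp add: S_def)
  define G where "G = 2 * exp ((K + 2) * M)"
  have G: "G \<ge> 1" 
  proof -
    have "1 \<le> exp ((K + 2) * M)" using K M by simp
    then show ?thesis unfolding G_def by linarith
  qed
  define C where "C = (K + 1) * (G * S)"
  have GS: "S \<le> G * S" "G * S \<ge> 0" using G S by (auto simp: mult_le_cancel_right1)
  have C: "G * S \<le> C" "K * (G * S) + S \<le> C" "C \<ge> 0"
    using GS K mult_nonneg_nonneg[OF K GS(2)] by (auto simp: C_def distrib_right)
  have "\<forall>\<^sub>F n in sequentially.
      bounded_Lipschitz M (C / edge_scale n ^ 3) (\<lambda>\<xi>. wave \<alpha> n \<xi> - (Ai 0 \<xi> + airy_corr \<xi> / (edge_scale n)\<^sup>2)) \<and>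
      bounded_Lipschitz M (C / edge_scale n ^ 3) (\<lambda>\<xi>. wave' \<alpha> n \<xi> - (Ai 1 \<xi> + airy_corr' \<xi> / (edge_scale n)\<^sup>2))"
    using A0(2) A1(2) eventually_edge_scale_large[of "M + \<beta>"] eventually_ge_at_top[of 1]
  proof eventually_elim
    case (elim n)
    define b where "b = edge_scale n"
    have b: "b \<ge> 1" unfolding b_def by (rule edge_scale_ge_1[OF elim(4)])
    define x where "x \<xi> = turning_point \<alpha> n + 2 * b * \<xi>" for \<xi>
    have xe: "x \<xi> = 2 * b ^ 3 + 2 * \<beta> + 2 * b * \<xi>" for \<xi>
      unfolding x_def b_def \<beta>_def by (rule turning_point_edge_scale)
    note pos = edge_position_bounds(3,4)[OF b \<beta> _ elim(3)[folded b_def], folded xe]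
    have x0: "x \<xi> > 0" if "\<bar>\<xi>\<bar> \<le> M" for \<xi>
      using pos(1)[OF that] b zero_less_power[of b 3] by linarith
    define Q where "Q \<xi> = b\<^sup>2 * (2 * b * \<xi> / x \<xi> + (\<alpha>\<^sup>2 - 1) / (x \<xi>)\<^sup>2)" for \<xi>
    have Q: "\<bar>Q \<xi> - (\<xi> - \<xi>\<^sup>2 / b\<^sup>2)\<bar> \<le> Kq / b ^ 3" if "\<bar>\<xi>\<bar> \<le> M" for \<xi>
      unfolding Q_def Kq_def by (rule pos(2)[OF that])
    have b2: "b\<^sup>2 \<ge> 1" "b ^ 3 \<ge> 1" using b by auto
    have b34: "1 / b ^ 4 \<le> 1 / b ^ 3" "1 / b\<^sup>2 \<le> 1" "1 / b ^ 3 \<le> 1"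
      using b b2 by (auto intro!: divide_left_mono power_increasing mult_pos_pos simp: divide_le_eq_1)
    have QK: "\<bar>Q \<xi>\<bar> \<le> K" if \<xi>: "\<bar>\<xi>\<bar> \<le> M" for \<xi>
    proof -
      have "\<xi>\<^sup>2 \<le> M\<^sup>2" using power_mono[OF \<xi>, of 2] by simp
      then have "\<xi>\<^sup>2 * (1 / b\<^sup>2) \<le> M\<^sup>2 * 1" using b34 by (intro mult_mono) auto
      moreover have "Kq * (1 / b ^ 3) \<le> Kq * 1" using b34 Kq by (intro mult_left_mono) auto
      moreover have "\<bar>\<xi>\<^sup>2 / b\<^sup>2\<bar> = \<xi>\<^sup>2 * (1 / b\<^sup>2)" by simp
      moreover have "Kq / b ^ 3 = Kq * (1 / b ^ 3)" by simp
      moreover have "\<bar>q\<bar> \<le> \<bar>q - (u - v)\<bar> + \<bar>u\<bar> + \<bar>v\<bar>" for q u v :: real by linarith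
      ultimately show ?thesis using Q[OF \<xi>] \<xi> unfolding K_def by (smt (verit))
    qed
    define A where "A \<xi> = Ai 0 \<xi> + airy_corr \<xi> / b\<^sup>2" for \<xi>
    define B where "B \<xi> = Ai 1 \<xi> + airy_corr' \<xi> / b\<^sup>2" for \<xi>
    \<comment> \<open>The forcing: the error of the potential acting on the ansatz, and the b^(-4)
      term by which the ansatz misses the truncated equation.\<close>
    define R where "R \<xi> = (Q \<xi> - (\<xi> - \<xi>\<^sup>2 / b\<^sup>2)) * A \<xi> - \<xi>\<^sup>2 * airy_corr \<xi> / b ^ 4" for \<xi>
    define d where "d \<xi> = wave \<alpha> n \<xi> - A \<xi>" for \<xi>
    define e where "e \<xi> = wave' \<alpha> n \<xi> - B \<xi>" for \<xi>
    have dd: "(d has_real_derivative e \<xi>) (at \<xi>)" if "\<bar>\<xi>\<bar> \<le> M" for \<xi>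
      unfolding d_def e_def A_def B_def
      by (intro DERIV_diff DERIV_add DERIV_cdivide Ai_0_derivative airy_corr_derivative
          wave_derivative x0[OF that, unfolded x_def b_def])
    have ed: "(e has_real_derivative Q \<xi> * d \<xi> + R \<xi>) (at \<xi>)" if "\<bar>\<xi>\<bar> \<le> M" for \<xi>
    proof -
      have "(e has_real_derivative Q \<xi> * wave \<alpha> n \<xi> - (\<xi> * Ai 0 \<xi> + (\<xi> * airy_corr \<xi> - \<xi>\<^sup>2 * Ai 0 \<xi>) / b\<^sup>2)) (at \<xi>)"
        unfolding e_def B_def Q_def x_def b_def
        by (intro DERIV_diff DERIV_add DERIV_cdivide Ai_1_derivative airy_corr'_derivative
          wave'_derivative x0[OF that, unfolded x_def b_def])
      moreover have "q * u - (\<xi> * a + (\<xi> * w - \<xi>\<^sup>2 * a) / b\<^sup>2)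
         = q * (u - (a + w / b\<^sup>2)) + ((q - (\<xi> - \<xi>\<^sup>2 / b\<^sup>2)) * (a + w / b\<^sup>2) - \<xi>\<^sup>2 * w / b ^ 4)" for q u a w
        using b by (simp add: field_simps eval_nat_numeral)
      ultimately show ?thesis unfolding d_def R_def A_def by (simp only:)
    qed
    have Rb: "\<bar>R \<xi>\<bar> \<le> S / b ^ 3" if \<xi>: "\<bar>\<xi>\<bar> \<le> M" for \<xi>
    proof -
      have w: "\<bar>airy_corr \<xi>\<bar> \<le> K2" and a: "\<bar>Ai 0 \<xi>\<bar> \<le> K1"
        using K1(2) K2(2) \<xi> by (auto simp: bounded_Lipschitz_def)
      have "\<bar>airy_corr \<xi>\<bar> * (1 / b\<^sup>2) \<le> K2 * 1" using w b34 by (intro mult_mono) auto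
      then have "\<bar>A \<xi>\<bar> \<le> K1 + K2" unfolding A_def using a abs_triangle_ineq[of "Ai 0 \<xi>" "airy_corr \<xi> / b\<^sup>2"] by simp
      then have 1: "\<bar>(Q \<xi> - (\<xi> - \<xi>\<^sup>2 / b\<^sup>2)) * A \<xi>\<bar> \<le> Kq / b ^ 3 * (K1 + K2)"
        unfolding abs_mult using Q[OF \<xi>] by (intro mult_mono) auto
      have "\<xi>\<^sup>2 \<le> M\<^sup>2" using power_mono[OF \<xi>, of 2] by simp
      then have "(\<xi>\<^sup>2 * \<bar>airy_corr \<xi>\<bar>) * (1 / b ^ 4) \<le> (M\<^sup>2 * K2) * (1 / b ^ 3)"
        using w b34 b2 K2 by (intro mult_mono) auto
      then have 2: "\<bar>\<xi>\<^sup>2 * airy_corr \<xi> / b ^ 4\<bar> \<le> M\<^sup>2 * K2 / b ^ 3" by (simp add: abs_mult)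
      have "\<bar>R \<xi>\<bar> \<le> Kq / b ^ 3 * (K1 + K2) + M\<^sup>2 * K2 / b ^ 3" unfolding R_def using 1 2 by linarith
      also have "\<dots> = (Kq * (K1 + K2) + M\<^sup>2 * K2) / b ^ 3" by (simp add: add_divide_distrib)
      also have "\<dots> \<le> S / b ^ 3" using b b2 A0(1) A1(1) unfolding S_def by (intro divide_right_mono) auto
      finally show ?thesis .
    qed
    have d0: "\<bar>d 0\<bar> \<le> S / b ^ 3" "\<bar>e 0\<bar> \<le> S / b ^ 3"
    proof -
      have m: "A0 / b ^ 3 \<le> S / b ^ 3" "A1 / b ^ 3 \<le> S / b ^ 3"
        using b b2 A0(1) A1(1) Kq K1(1) K2(1) unfolding S_def by (auto intro!: divide_right_mono)
      show "\<bar>d 0\<bar> \<le> S / b ^ 3" using elim(1) m(1) by (simp add: d_def A_def airy_corr_def b_def)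
      show "\<bar>e 0\<bar> \<le> S / b ^ 3" using elim(2) m(2) by (simp add: e_def B_def airy_corr'_def b_def)
    qed
    have main: "\<bar>d \<xi>\<bar> \<le> G * S / b ^ 3 \<and> \<bar>e \<xi>\<bar> \<le> G * S / b ^ 3" if "\<bar>\<xi>\<bar> \<le> M" for \<xi>
      using second_order_Gronwall[of M d e Q R K "S / b ^ 3" \<xi>, OF dd ed QK Rb d0 that] unfolding G_def by simp
    have CC: "G * S / b ^ 3 \<le> C / b ^ 3" "K * (G * S / b ^ 3) + S / b ^ 3 \<le> C / b ^ 3"
      using C b b2 divide_right_mono[of "G * S" C "b ^ 3"] divide_right_mono[of "K * (G * S) + S" C "b ^ 3"] by (auto simp: add_divide_distrib)
    have "bounded_Lipschitz M (C / b ^ 3) d"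
      by (rule bounded_LipschitzI[OF dd]) (use main CC in fastforce)+
    moreover have "bounded_Lipschitz M (C / b ^ 3) e"
    \<comment> \<open>The Lipschitz constant of the derivative error is read off from the
      differential equation.\<close>
    proof (rule bounded_LipschitzI[OF ed])
      fix \<xi> assume \<xi>: "\<bar>\<xi>\<bar> \<le> M"
      have "\<bar>Q \<xi> * d \<xi>\<bar> \<le> K * (G * S / b ^ 3)"
        unfolding abs_mult using QK[OF \<xi>] main[OF \<xi>] K by (intro mult_mono) auto
      then show "\<bar>Q \<xi> * d \<xi> + R \<xi>\<bar> \<le> C / b ^ 3" using Rb[OF \<xi>] CC(2) by linarith
    qed (use main CC in fastforce)+
    ultimately show ?case unfolding d_def e_def A_def B_def b_def by blast
  qed
  then show ?thesis using C(3) that by blast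
qed

section \<open>From the wave function to the kernel, centred at the turning point\<close>

section \<open>Expansion of the Laguerre kernel in the turning point variable\<close>

lemma airy_kernel_commute: "airy_kernel X Y = airy_kernel Y X"
  by (simp add: airy_kernel_def mult.commute)

text \<open>The off-diagonal form is, up to sign, a difference quotient of \<open>N\<close>, which
  vanishes at X.\<close>

lemma airy_kernel_tendsto_diagonal: "((\<lambda>Y. airy_kernel X Y) \<longlongrightarrow> airy_kernel X X) (at X)"
proof -
  define N where "N Y = Ai 0 X * Ai 1 Y - Ai 1 X * Ai 0 Y" for Y
  have "(N has_real_derivative Ai 0 X * (X * Ai 0 X) - Ai 1 X * Ai 1 X) (at X)"
    unfolding N_def by (intro DERIV_diff DERIV_cmult Ai_0_derivative Ai_1_derivative)
  then have "((\<lambda>Y. (N Y - N X) / (Y - X)) \<longlongrightarrow> Ai 0 X * (X * Ai 0 X) - Ai 1 X * Ai 1 X) (at X)"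
    by (simp add: has_field_derivative_iff)
  from tendsto_minus[OF this] have "((\<lambda>Y. - ((N Y - N X) / (Y - X))) \<longlongrightarrow> airy_kernel X X) (at X)"
    by (simp add: airy_kernel_diagonal power2_eq_square algebra_simps)
  moreover have "\<forall>\<^sub>F Y in at X. - ((N Y - N X) / (Y - X)) = airy_kernel X Y"
  proof -
    have "- ((N Y - N X) / (Y - X)) = airy_kernel X Y" if "Y \<noteq> X" for Y
      using that airy_kernel_off_diagonal[of X Y] by (simp add: N_def minus_divide_right)
    then show ?thesis by (simp add: eventually_at_filter)
  qed
  ultimately show ?thesis by (rule Lim_transform_eventually)
qed

lemma bounded_Lipschitz_add:
  assumes "bounded_Lipschitz M C f" "bounded_Lipschitz M D g"
  shows "bounded_Lipschitz M (C + D) (\<lambda>\<xi>. f \<xi> + g \<xi>)"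
  unfolding bounded_Lipschitz_def
proof (intro conjI allI impI)
  fix \<xi> \<eta> :: real assume *: "\<bar>\<xi>\<bar> \<le> M"
  then have "\<bar>f \<xi>\<bar> \<le> C" "\<bar>g \<xi>\<bar> \<le> D" using assms by (auto simp: bounded_Lipschitz_def)
  then show "\<bar>f \<xi> + g \<xi>\<bar> \<le> C + D" by linarith
  assume "\<bar>\<eta>\<bar> \<le> M"
  with * have "\<bar>f \<xi> - f \<eta>\<bar> \<le> C * \<bar>\<xi> - \<eta>\<bar>" "\<bar>g \<xi> - g \<eta>\<bar> \<le> D * \<bar>\<xi> - \<eta>\<bar>" using assms by (auto simp: bounded_Lipschitz_def)
  then show "\<bar>f \<xi> + g \<xi> - (f \<eta> + g \<eta>)\<bar> \<le> (C + D) * \<bar>\<xi> - \<eta>\<bar>" unfolding distrib_right by linarith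
qed

lemma bounded_Lipschitz_divide:
  assumes "bounded_Lipschitz M C f" "c \<ge> 1"
  shows "bounded_Lipschitz M C (\<lambda>\<xi>. f \<xi> / c)"
  unfolding bounded_Lipschitz_def
proof (intro conjI allI impI)
  have d: "\<bar>u / c\<bar> \<le> \<bar>u\<bar>" for u using assms(2) divide_left_mono[of 1 c "\<bar>u\<bar>"] by (simp add: abs_divide)
  fix \<xi> \<eta> :: real assume *: "\<bar>\<xi>\<bar> \<le> M"
  then show "\<bar>f \<xi> / c\<bar> \<le> C" using d[of "f \<xi>"] assms by (force simp: bounded_Lipschitz_def)
  assume "\<bar>\<eta>\<bar> \<le> M"
  with * show "\<bar>f \<xi> / c - f \<eta> / c\<bar> \<le> C * \<bar>\<xi> - \<eta>\<bar>"
    using d[of "f \<xi> - f \<eta>"] assms unfolding diff_divide_distrib[symmetric] by (force simp: bounded_Lipschitz_def)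
qed

text \<open>The expression vanishes for \<xi> = \<eta>, so it is controlled by the distance and can
  be divided by \<xi> - \<eta>.\<close>

lemma bounded_Lipschitz_commutator:
  assumes "bounded_Lipschitz M C f" "bounded_Lipschitz M D g" "\<bar>\<xi>\<bar> \<le> M" "\<bar>\<eta>\<bar> \<le> M"
  shows "\<bar>f \<xi> * g \<eta> - g \<xi> * f \<eta>\<bar> \<le> 2 * (C * D) * \<bar>\<xi> - \<eta>\<bar>"
proof -
  have b: "\<bar>f \<xi> - f \<eta>\<bar> \<le> C * \<bar>\<xi> - \<eta>\<bar>" "\<bar>g \<xi> - g \<eta>\<bar> \<le> D * \<bar>\<xi> - \<eta>\<bar>" "\<bar>f \<eta>\<bar> \<le> C" "\<bar>g \<eta>\<bar> \<le> D"
    using assms by (auto simp: bounded_Lipschitz_def)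
  have "f \<xi> * g \<eta> - g \<xi> * f \<eta> = (f \<xi> - f \<eta>) * g \<eta> - (g \<xi> - g \<eta>) * f \<eta>" by (simp add: algebra_simps)
  then have "\<bar>f \<xi> * g \<eta> - g \<xi> * f \<eta>\<bar> \<le> \<bar>f \<xi> - f \<eta>\<bar> * \<bar>g \<eta>\<bar> + \<bar>g \<xi> - g \<eta>\<bar> * \<bar>f \<eta>\<bar>"
    using abs_triangle_ineq4[of "(f \<xi> - f \<eta>) * g \<eta>" "(g \<xi> - g \<eta>) * f \<eta>"] by (simp only: abs_mult)
  also have "\<dots> \<le> (C * \<bar>\<xi> - \<eta>\<bar>) * D + (D * \<bar>\<xi> - \<eta>\<bar>) * C"
  proof -
    have "C * \<bar>\<xi> - \<eta>\<bar> \<ge> 0" "D * \<bar>\<xi> - \<eta>\<bar> \<ge> 0" using b(1,2) abs_ge_zero order_trans by blast+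
    then show ?thesis using b by (intro add_mono mult_mono) auto
  qed
  finally show ?thesis by (simp add: algebra_simps)
qed

lemma triple_product_close:
  fixes s t u v u' v' :: real
  assumes "\<bar>s - t\<bar> \<le> \<sigma>" "\<bar>u - u'\<bar> \<le> \<delta>" "\<bar>v - v'\<bar> \<le> \<delta>" "\<bar>u\<bar> \<le> Z" "\<bar>v\<bar> \<le> Z" "\<bar>u'\<bar> \<le> Z" "\<bar>t\<bar> \<le> \<tau>"
  shows "\<bar>s * u * v - t * u' * v'\<bar> \<le> \<sigma> * Z\<^sup>2 + \<tau> * (2 * (Z * \<delta>))"
proof -
  have nn: "Z \<ge> 0" "\<delta> \<ge> 0" "\<sigma> \<ge> 0" "\<tau> \<ge> 0" using assms by linarith+
  have "s * u * v - t * u' * v' = (s - t) * (u * v) + t * ((u - u') * v + u' * (v - v'))" by (simp add: algebra_simps)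
  moreover have "\<bar>(s - t) * (u * v)\<bar> \<le> \<sigma> * (Z * Z)"
    unfolding abs_mult by (intro mult_mono assms nn abs_ge_zero mult_nonneg_nonneg)
  moreover have "\<bar>t * ((u - u') * v + u' * (v - v'))\<bar> \<le> \<tau> * (2 * (Z * \<delta>))"
  proof -
    have "\<bar>(u - u') * v\<bar> \<le> \<delta> * Z" "\<bar>u' * (v - v')\<bar> \<le> Z * \<delta>"
      unfolding abs_mult by (intro mult_mono assms nn abs_ge_zero)+
    then have "\<bar>(u - u') * v + u' * (v - v')\<bar> \<le> 2 * (Z * \<delta>)" by (simp add: mult.commute)
    then show ?thesis unfolding abs_mult by (intro mult_mono assms nn abs_ge_zero)
  qed
  ultimately show ?thesis unfolding power2_eq_square by linarith
qed

lemma inverse_one_plus_close: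
  fixes t :: real
  assumes "\<bar>t\<bar> \<le> q" "q \<le> 1 / 2"
  shows "\<bar>1 / (1 + t) - 1\<bar> \<le> 2 * q"
proof -
  have "\<bar>1 / (1 + t) - 1\<bar> = \<bar>t\<bar> * (1 / (1 + t))"
  proof -
    have "1 / (1 + t) - 1 = - (t / (1 + t))" using assms by (simp add: field_simps)
    then show ?thesis using assms by (simp add: abs_divide)
  qed
  also have "\<dots> \<le> q * 2" using assms by (intro mult_mono) (auto simp: field_simps)
  finally show ?thesis by simp
qed

lemma geometric_mean_close:
  fixes y z q :: real
  assumes "\<bar>y\<bar> \<le> q" "\<bar>z\<bar> \<le> q" "q \<le> 1 / 2"
  shows "\<bar>sqrt ((1 + y) * (1 + z)) - 1\<bar> \<le> q"
proof -
  have "(1 - q) * (1 - q) \<le> (1 + y) * (1 + z)" "(1 + y) * (1 + z) \<le> (1 + q) * (1 + q)"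
    using assms by (intro mult_mono; linarith)+
  then have "sqrt ((1 - q)\<^sup>2) \<le> sqrt ((1 + y) * (1 + z))" "sqrt ((1 + y) * (1 + z)) \<le> sqrt ((1 + q)\<^sup>2)"
    unfolding power2_eq_square by (intro real_sqrt_le_mono; simp)+
  then have "1 - q \<le> sqrt ((1 + y) * (1 + z))" "sqrt ((1 + y) * (1 + z)) \<le> 1 + q" using assms by simp_all
  then show ?thesis by (simp only: abs_le_iff) linarith
qed

text \<open>Both positions are close to 2b^3, hence so is their geometric mean; the limits are
  2b/(4b^3) and 2b^2/(2b^3).\<close>

lemma kernel_coefficient_bounds:
  fixes b x y u v q :: real
  assumes b: "b \<ge> 1" and x: "x = 2 * b ^ 3 * (1 + u)" and y: "y = 2 * b ^ 3 * (1 + v)"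
    and uv: "\<bar>u\<bar> \<le> q" "\<bar>v\<bar> \<le> q" "q \<le> 1 / 2" and q: "q \<le> k / b\<^sup>2"
  shows "\<bar>2 * b / (x + sqrt (x * y)) - 1 / (2 * b\<^sup>2)\<bar> \<le> 2 * k / b ^ 3"
    "\<bar>2 * b\<^sup>2 / sqrt (x * y) - 1 / b\<bar> \<le> 2 * k / b ^ 3"
proof -
  define g where "g = sqrt ((1 + u) * (1 + v)) - 1"
  have g: "\<bar>g\<bar> \<le> q" unfolding g_def by (rule geometric_mean_close[OF uv])
  have "x * y = (2 * b ^ 3)\<^sup>2 * ((1 + u) * (1 + v))" unfolding x y by (simp add: power2_eq_square)
  then have w: "sqrt (x * y) = 2 * b ^ 3 * (1 + g)"
  proof -
    have "2 * b ^ 3 \<ge> 0" using b by simp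
    then show ?thesis unfolding g_def \<open>x * y = _\<close> real_sqrt_mult real_sqrt_abs by simp
  qed
  have q0: "q \<ge> 0" and b2: "b\<^sup>2 \<ge> 1" "b > 0" using uv b by auto
  have k: "k / b\<^sup>2 \<ge> 0" using q q0 by linarith
  have gen: "2 * b\<^sup>2 / (2 * b ^ 3 * G) - 1 / b = (1 / G - 1) / b" "2 * b / (4 * b ^ 3 * G) - 1 / (2 * b\<^sup>2) = (1 / G - 1) / (2 * b\<^sup>2)"
    if "G \<noteq> 0" for G
    using that b2 by (simp_all add: field_simps eval_nat_numeral)
  have "2 * b\<^sup>2 / sqrt (x * y) - 1 / b = (1 / (1 + g) - 1) / b"
    unfolding w using g uv by (intro gen) auto
  then have "\<bar>2 * b\<^sup>2 / sqrt (x * y) - 1 / b\<bar> \<le> 2 * q / b"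
    using inverse_one_plus_close[OF g uv(3)] b by (simp add: abs_divide divide_right_mono)
  also have "\<dots> \<le> 2 * (k / b\<^sup>2) / b" using q b by (intro divide_right_mono mult_left_mono) auto
  also have "\<dots> = 2 * k / b ^ 3" by (simp add: eval_nat_numeral)
  finally show "\<bar>2 * b\<^sup>2 / sqrt (x * y) - 1 / b\<bar> \<le> 2 * k / b ^ 3" .
  define t where "t = (u + g) / 2"
  have t: "\<bar>t\<bar> \<le> q" using g uv(1) abs_triangle_ineq[of u g] unfolding t_def abs_divide by simp
  have xw: "x + sqrt (x * y) = 4 * b ^ 3 * (1 + t)" unfolding w t_def unfolding x by (simp add: field_simps)
  have "2 * b / (x + sqrt (x * y)) - 1 / (2 * b\<^sup>2) = (1 / (1 + t) - 1) / (2 * b\<^sup>2)"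
    unfolding xw using t uv by (intro gen) auto
  then have "\<bar>2 * b / (x + sqrt (x * y)) - 1 / (2 * b\<^sup>2)\<bar> = \<bar>1 / (1 + t) - 1\<bar> / (2 * b\<^sup>2)"
    by (simp only: abs_divide) simp
  also have "\<dots> \<le> 2 * q / (2 * b\<^sup>2)"
    by (intro divide_right_mono inverse_one_plus_close[OF t uv(3)]) auto
  also have "\<dots> \<le> 2 * (k / b\<^sup>2) / b"
  proof -
    have "b * 1 \<le> b * b" using b by (intro mult_left_mono) auto
    then have "b \<le> 2 * b\<^sup>2" using b unfolding power2_eq_square by linarith
    then show ?thesis using q q0 b k by (intro frac_le) auto
  qed
  also have "\<dots> = 2 * k / b ^ 3" by (simp add: eval_nat_numeral)
  finally show "\<bar>2 * b / (x + sqrt (x * y)) - 1 / (2 * b\<^sup>2)\<bar> \<le> 2 * k / b ^ 3" .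
qed

text \<open>sqrt(y/x) = 1 - (x-y)/(x + sqrt(xy)), and similarly for the inverse. The deviations from
  1 carry a factor x - y that cancels the denominator, leaving a pure Wronskian quotient and three
  regular products.\<close>

lemma wave_kernel:
  fixes \<alpha> \<xi> \<eta> :: real
  defines "X \<equiv> \<lambda>\<xi> n. turning_point \<alpha> n + 2 * edge_scale n * \<xi>"
  assumes \<alpha>: "\<alpha> > -1" and n: "n \<ge> 1" and pos: "X \<xi> n > 0" "X \<eta> n > 0" and ne: "\<xi> \<noteq> \<eta>"
  shows "2 * edge_scale n * laguerre_kernel \<alpha> n (X \<xi> n) (X \<eta> n)
    = (wave \<alpha> n \<xi> * wave' \<alpha> n \<eta> - wave' \<alpha> n \<xi> * wave \<alpha> n \<eta>) / (\<xi> - \<eta>)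
      - 2 * edge_scale n / (X \<xi> n + sqrt (X \<xi> n * X \<eta> n)) * wave \<alpha> n \<xi> * wave' \<alpha> n \<eta>
      - 2 * edge_scale n / (X \<eta> n + sqrt (X \<xi> n * X \<eta> n)) * wave' \<alpha> n \<xi> * wave \<alpha> n \<eta>
      - 2 * (edge_scale n)\<^sup>2 / sqrt (X \<xi> n * X \<eta> n) * wave \<alpha> n \<xi> * wave \<alpha> n \<eta>"
proof -
  define b where "b = edge_scale n"
  define \<gamma> where "\<gamma> = Gamma (real n + 1) / Gamma (\<alpha> + real n + 1)"
  define k where "k = wave_factor \<alpha> n"
  define x y where "x = X \<xi> n" and "y = X \<eta> n"
  define w where "w = sqrt (x * y)"
  define u u' v v' where "u = laguerre_u n \<alpha> x" and "u' = laguerre_u' n \<alpha> x" and "v = laguerre_u n \<alpha> y" and "v' = laguerre_u' n \<alpha> y"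
  have b: "b > 0" unfolding b_def using n by (rule edge_scale_pos)
  have xy: "x > 0" "y > 0" using pos by (auto simp: x_def y_def)
  have w: "w > 0" using xy by (simp add: w_def)
  have kk: "k * k * (2 * b) = \<gamma>"
  proof -
    have "\<gamma> \<ge> 0" using \<alpha> by (auto simp: \<gamma>_def intro!: divide_nonneg_nonneg Gamma_real_nonneg)
    moreover have "k = (- 1) ^ n * sqrt (\<gamma> / (2 * b))" by (simp add: k_def wave_factor_def \<gamma>_def b_def)
    moreover have "s * r * (s * r) * c = (s * s) * ((r * r) * c)" for s r c :: real by (simp only: mult_ac)
    moreover have "((- 1) ^ n * (- 1) ^ n :: real) = 1" by (simp flip: power_mult_distrib)
    ultimately show ?thesis using b by (simp only:) simp
  qed
  have sq: "sqrt (y / x) = 1 - (x - y) / (x + w)" "sqrt (x / y) = 1 + (x - y) / (y + w)"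
  proof -
    define p r where "p = sqrt x" and "r = sqrt y"
    have pr: "p > 0" "r > 0" "x = p * p" "y = r * r" "w = p * r"
      using xy by (auto simp: p_def r_def w_def real_sqrt_mult)
    have "sqrt (y / x) = r / p" "sqrt (x / y) = p / r" by (simp_all add: p_def r_def real_sqrt_divide)
    moreover have "p * p + p * r = p * (p + r)" "r * r + p * r = r * (p + r)" "p * p - r * r = (p - r) * (p + r)"
      by (simp_all add: algebra_simps)
    moreover have "r / p = 1 - (p - r) * (p + r) / (p * (p + r))" "p / r = 1 + (p - r) * (p + r) / (r * (p + r))"
      using pr(1,2) by (simp_all add: diff_divide_distrib)
    ultimately show "sqrt (y / x) = 1 - (x - y) / (x + w)" "sqrt (x / y) = 1 + (x - y) / (y + w)"
      unfolding pr(3-5) by (simp_all only:)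
  qed
  have xy': "x - y = 2 * b * (\<xi> - \<eta>)" by (simp add: x_def y_def X_def b_def algebra_simps)
  have waves: "wave \<alpha> n \<xi> = k * u" "wave \<alpha> n \<eta> = k * v" "wave' \<alpha> n \<xi> = k * (2 * b) * u'" "wave' \<alpha> n \<eta> = k * (2 * b) * v'"
    by (simp_all add: wave_def wave'_def k_def u_def v_def u'_def v'_def x_def y_def X_def b_def)
  have CD: "(x - y) * laguerre_kernel \<alpha> n x y = \<gamma> * (sqrt (y / x) * u * v' - sqrt (x / y) * u' * v - (x - y) / 2 * u * v / w)"
    using laguerre_kernel_off_diagonal[OF \<alpha> n xy] unfolding \<gamma>_def u_def v_def u'_def v'_def w_def .
  have gen: "2 * b * K = (k * u * (k * (2 * b) * v') - k * (2 * b) * u' * (k * v)) / h - 2 * b / p * (k * u) * (k * (2 * b) * v')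
     - 2 * b / r * (k * (2 * b) * u') * (k * v) - 2 * b\<^sup>2 / w * (k * u) * (k * v)"
    if "2 * b * h * K = k * k * (2 * b) * ((1 - 2 * b * h / p) * u * v' - (1 + 2 * b * h / r) * u' * v - 2 * b * h / 2 * u * v / w)" "h \<noteq> 0"
    for K h p r k u u' v v' :: real
  proof -
    have "2 * b * K = (2 * b * h * K) / h" using that(2) by simp
    also have "\<dots> = (k * u * (k * (2 * b) * v') - k * (2 * b) * u' * (k * v)) / h - 2 * b / p * (k * u) * (k * (2 * b) * v')
     - 2 * b / r * (k * (2 * b) * u') * (k * v) - 2 * b\<^sup>2 / w * (k * u) * (k * v)"
    proof -
      define P R W where "P = 1 / p" "R = 1 / r" "W = 1 / w"
      have pe: "c / p = c * P" "c / r = c * R" "c / w = c * W" for c by (simp_all add: P_R_W_def)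
      show ?thesis unfolding that(1) pe using that(2) by (simp add: field_simps power2_eq_square)
    qed
    finally show ?thesis .
  qed
  have "2 * b * laguerre_kernel \<alpha> n x y
    = (k * u * (k * (2 * b) * v') - k * (2 * b) * u' * (k * v)) / (\<xi> - \<eta>) - 2 * b / (x + w) * (k * u) * (k * (2 * b) * v')
     - 2 * b / (y + w) * (k * (2 * b) * u') * (k * v) - 2 * b\<^sup>2 / w * (k * u) * (k * v)"
    using CD ne unfolding sq kk[symmetric] xy' by (intro gen) auto
  then show ?thesis unfolding waves x_def[symmetric] y_def[symmetric] w_def[symmetric] b_def[symmetric] .
qed

text \<open>The coefficient of b^(-2) for the centring c = 1/2, which places \<xi> = 0 at the
  turning point.\<close>

definition second_coeff :: "real \<Rightarrow> real \<Rightarrow> real" where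
  "second_coeff \<xi> \<eta> = ((\<xi>\<^sup>2 + \<xi> * \<eta> + \<eta>\<^sup>2) * Ai 0 \<xi> * Ai 0 \<eta> - (\<xi> + \<eta>) * Ai 1 \<xi> * Ai 1 \<eta>) / 5
     - 3 / 10 * (Ai 0 \<xi> * Ai 1 \<eta> + Ai 1 \<xi> * Ai 0 \<eta>)"

definition kernel_approx :: "real \<Rightarrow> real \<Rightarrow> real \<Rightarrow> real" where
  "kernel_approx b \<xi> \<eta> = airy_kernel \<xi> \<eta> - Ai 0 \<xi> * Ai 0 \<eta> / b + second_coeff \<xi> \<eta> / b\<^sup>2"

text \<open>The numerator is divisible by \<xi> - \<eta>. The extra half of Ai Ai' + Ai' Ai will be
  cancelled by the two products with coefficient 1/(2b^2) in \<open>wave_kernel\<close>.\<close>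

lemma airy_corr_Wronskian:
  assumes "\<xi> \<noteq> \<eta>"
  shows "(Ai 0 \<xi> * airy_corr' \<eta> - airy_corr' \<xi> * Ai 0 \<eta> + (airy_corr \<xi> * Ai 1 \<eta> - Ai 1 \<xi> * airy_corr \<eta>)) / (\<xi> - \<eta>)
     = second_coeff \<xi> \<eta> + (Ai 0 \<xi> * Ai 1 \<eta> + Ai 1 \<xi> * Ai 0 \<eta>) / 2"
proof -
  have "Ai 0 \<xi> * airy_corr' \<eta> - airy_corr' \<xi> * Ai 0 \<eta> + (airy_corr \<xi> * Ai 1 \<eta> - Ai 1 \<xi> * airy_corr \<eta>)
     = (\<xi> - \<eta>) * (second_coeff \<xi> \<eta> + (Ai 0 \<xi> * Ai 1 \<eta> + Ai 1 \<xi> * Ai 0 \<eta>) / 2)"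
    unfolding airy_corr_def airy_corr'_def second_coeff_def
    by (simp add: field_simps power2_eq_square power3_eq_cube)
  then show ?thesis using assms by simp
qed

text \<open>Insert the wave expansion into \<open>wave_kernel\<close>. The Wronskian contributes the
  Airy kernel and its b^(-2) correction, the regular products contribute -Ai Ai/b and terms of order
  b^(-2).\<close>

lemma kernel_expansion_off_diagonal:
  assumes \<alpha>: "\<alpha> > -1" and M: "M \<ge> 0"
  obtains C where "\<forall>\<^sub>F n in sequentially. \<forall>\<xi> \<eta>. \<bar>\<xi>\<bar> \<le> M \<longrightarrow> \<bar>\<eta>\<bar> \<le> M \<longrightarrow>
     turning_point \<alpha> n + 2 * edge_scale n * \<xi> > 0 \<and> (\<xi> \<noteq> \<eta> \<longrightarrow>
     \<bar>2 * edge_scale n * laguerre_kernel \<alpha> n (turning_point \<alpha> n + 2 * edge_scale n * \<xi>) (turning_point \<alpha> n + 2 * edge_scale n * \<eta>)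
       - kernel_approx (edge_scale n) \<xi> \<eta>\<bar> \<le> C / edge_scale n ^ 3)"
proof -
  define \<beta> where "\<beta> = \<alpha> + 1"
  have \<beta>: "\<beta> \<ge> 0" using \<alpha> by (simp add: \<beta>_def)
  have base: "continuous_on UNIV (Ai 0)" "continuous_on UNIV (Ai 1)" "continuous_on UNIV airy_corr" "continuous_on UNIV airy_corr'"
    using Ai_0_derivative Ai_1_derivative airy_corr_derivative airy_corr'_derivative
    by (blast intro: continuous_at_imp_continuous_on DERIV_isCont)+
  have cont: "continuous_on UNIV (Ai 1)" "continuous_on UNIV airy_corr'" "continuous_on UNIV (\<lambda>\<xi>. \<xi> * Ai 0 \<xi>)"
      "continuous_on UNIV (\<lambda>\<xi>. \<xi> * airy_corr \<xi> - \<xi>\<^sup>2 * Ai 0 \<xi>)"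
    by (intro continuous_intros base)+
  obtain K0 where K0: "K0 \<ge> 0" "bounded_Lipschitz M K0 (Ai 0)"
    by (rule smooth_bounded_Lipschitz[OF Ai_0_derivative cont(1)]) (rule that)
  obtain K1 where K1: "K1 \<ge> 0" "bounded_Lipschitz M K1 (Ai 1)"
    by (rule smooth_bounded_Lipschitz[OF Ai_1_derivative cont(3)]) (rule that)
  obtain K2 where K2: "K2 \<ge> 0" "bounded_Lipschitz M K2 airy_corr"
    by (rule smooth_bounded_Lipschitz[OF airy_corr_derivative cont(2)]) (rule that)
  obtain K3 where K3: "K3 \<ge> 0" "bounded_Lipschitz M K3 airy_corr'"
    by (rule smooth_bounded_Lipschitz[OF airy_corr'_derivative cont(4)]) (rule that)
  obtain C where C: "C \<ge> 0" "\<forall>\<^sub>F n in sequentially.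
      bounded_Lipschitz M (C / edge_scale n ^ 3) (\<lambda>\<xi>. wave \<alpha> n \<xi> - (Ai 0 \<xi> + airy_corr \<xi> / (edge_scale n)\<^sup>2)) \<and>
      bounded_Lipschitz M (C / edge_scale n ^ 3) (\<lambda>\<xi>. wave' \<alpha> n \<xi> - (Ai 1 \<xi> + airy_corr' \<xi> / (edge_scale n)\<^sup>2))"
    by (rule wave_expansion[OF \<alpha> M]) (rule that)
  define KA KB Z where "KA = K0 + K2" and "KB = K1 + K3" and "Z = KA + KB + C"
  have nn: "KA \<ge> 0" "KB \<ge> 0" "Z \<ge> 0" using K0 K1 K2 K3 C by (auto simp: KA_def KB_def Z_def)
  define H where "H = 2 * (M + \<beta>) * Z\<^sup>2 + 2 * (Z * Z)"
  define W where "W = 2 * (K2 * K3) + 2 * (KA * C) + 2 * (C * KB) + 2 * (C * C)"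
  have "\<forall>\<^sub>F n in sequentially. \<forall>\<xi> \<eta>. \<bar>\<xi>\<bar> \<le> M \<longrightarrow> \<bar>\<eta>\<bar> \<le> M \<longrightarrow>
     turning_point \<alpha> n + 2 * edge_scale n * \<xi> > 0 \<and> (\<xi> \<noteq> \<eta> \<longrightarrow>
     \<bar>2 * edge_scale n * laguerre_kernel \<alpha> n (turning_point \<alpha> n + 2 * edge_scale n * \<xi>) (turning_point \<alpha> n + 2 * edge_scale n * \<eta>)
       - kernel_approx (edge_scale n) \<xi> \<eta>\<bar> \<le> (W + 3 * H) / edge_scale n ^ 3)"
    using C(2) eventually_edge_scale_large[of "M + \<beta>"] eventually_ge_at_top[of 1]
  proof eventually_elim
    case (elim n)
    define b where "b = edge_scale n"
    have b: "b \<ge> 1" unfolding b_def by (rule edge_scale_ge_1[OF elim(3)])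
    then have b1: "b > 0" "b\<^sup>2 \<ge> 1" "b ^ 3 \<ge> 1" by auto
    define X where "X = (\<lambda>\<xi> n. turning_point \<alpha> n + 2 * edge_scale n * \<xi>)"
    have xe: "X \<xi> n = 2 * b ^ 3 + 2 * \<beta> + 2 * b * \<xi>" for \<xi>
      unfolding X_def b_def \<beta>_def by (rule turning_point_edge_scale)
    note pos = edge_position_bounds(1-3)[OF b \<beta> _ elim(2)[folded b_def], folded xe]
    have x0: "X \<xi> n > 0" if "\<bar>\<xi>\<bar> \<le> M" for \<xi>
      using pos(3)[OF that] b1 by linarith
    define d where "d \<xi> = wave \<alpha> n \<xi> - (Ai 0 \<xi> + airy_corr \<xi> / b\<^sup>2)" for \<xi>
    define e where "e \<xi> = wave' \<alpha> n \<xi> - (Ai 1 \<xi> + airy_corr' \<xi> / b\<^sup>2)" for \<xi>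
    define A where "A \<xi> = Ai 0 \<xi> + airy_corr \<xi> / b\<^sup>2" for \<xi>
    define B where "B \<xi> = Ai 1 \<xi> + airy_corr' \<xi> / b\<^sup>2" for \<xi>
    have Ld: "bounded_Lipschitz M (C / b ^ 3) d" and Le: "bounded_Lipschitz M (C / b ^ 3) e"
      using elim(1) unfolding d_def[abs_def] e_def[abs_def] b_def by auto
    have LA: "bounded_Lipschitz M KA A" and LB: "bounded_Lipschitz M KB B"
      unfolding A_def B_def KA_def KB_def
      by (intro bounded_Lipschitz_add bounded_Lipschitz_divide K0 K1 K2 K3 b1)+
    have wv: "wave \<alpha> n \<xi> = A \<xi> + d \<xi>" "wave' \<alpha> n \<xi> = B \<xi> + e \<xi>" for \<xi>
      by (simp_all add: A_def B_def d_def e_def)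
    have b32: "c / b ^ 3 \<le> c / b\<^sup>2" "c / b ^ 3 \<le> c" "c / b ^ 4 \<le> c / b ^ 3" "c / b\<^sup>2 \<le> c" "c / b ^ 6 \<le> c / b ^ 3" if "c \<ge> 0" for c
    proof -
      have "c / b ^ j \<le> c / b ^ i" if "i \<le> j" for i j
        using b b1 \<open>c \<ge> 0\<close> that by (intro divide_left_mono power_increasing mult_pos_pos zero_less_power) auto
      from this[of 2 3] this[of 0 3] this[of 3 4] this[of 0 2] this[of 3 6]
      show "c / b ^ 3 \<le> c / b\<^sup>2" "c / b ^ 3 \<le> c" "c / b ^ 4 \<le> c / b ^ 3" "c / b\<^sup>2 \<le> c" "c / b ^ 6 \<le> c / b ^ 3" by simp_all
    qed
    have size: "\<bar>wave \<alpha> n \<xi>\<bar> \<le> Z" "\<bar>wave' \<alpha> n \<xi>\<bar> \<le> Z" "\<bar>Ai 0 \<xi>\<bar> \<le> Z" "\<bar>Ai 1 \<xi>\<bar> \<le> Z"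
      "\<bar>wave \<alpha> n \<xi> - Ai 0 \<xi>\<bar> \<le> Z / b\<^sup>2" "\<bar>wave' \<alpha> n \<xi> - Ai 1 \<xi>\<bar> \<le> Z / b\<^sup>2" if \<xi>: "\<bar>\<xi>\<bar> \<le> M" for \<xi>
    proof -
      have v: "\<bar>Ai 0 \<xi>\<bar> \<le> K0" "\<bar>Ai 1 \<xi>\<bar> \<le> K1" "\<bar>airy_corr \<xi>\<bar> \<le> K2" "\<bar>airy_corr' \<xi>\<bar> \<le> K3" "\<bar>d \<xi>\<bar> \<le> C / b ^ 3" "\<bar>e \<xi>\<bar> \<le> C / b ^ 3"
        using \<xi> K0 K1 K2 K3 Ld Le by (auto simp: bounded_Lipschitz_def)
      have w: "\<bar>airy_corr \<xi> / b\<^sup>2\<bar> \<le> K2 / b\<^sup>2" "\<bar>airy_corr' \<xi> / b\<^sup>2\<bar> \<le> K3 / b\<^sup>2"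
        using v by (auto simp: abs_divide intro!: divide_right_mono)
      note k = b32(4)[OF K2(1)] b32(4)[OF K3(1)] b32(1,2)[OF C(1)]
      have Zs: "K2 / b\<^sup>2 + C / b\<^sup>2 \<le> Z / b\<^sup>2" "K3 / b\<^sup>2 + C / b\<^sup>2 \<le> Z / b\<^sup>2"
        unfolding add_divide_distrib[symmetric] using K0 K1 K2 K3
        by (auto simp: Z_def KA_def KB_def intro!: divide_right_mono)
      have wd: "wave \<alpha> n \<xi> - Ai 0 \<xi> = airy_corr \<xi> / b\<^sup>2 + d \<xi>" "wave' \<alpha> n \<xi> - Ai 1 \<xi> = airy_corr' \<xi> / b\<^sup>2 + e \<xi>"
        by (simp_all add: d_def e_def)
      show p: "\<bar>wave \<alpha> n \<xi> - Ai 0 \<xi>\<bar> \<le> Z / b\<^sup>2" "\<bar>wave' \<alpha> n \<xi> - Ai 1 \<xi>\<bar> \<le> Z / b\<^sup>2"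
        unfolding wd using v(5,6) w k Zs abs_triangle_ineq[of "airy_corr \<xi> / b\<^sup>2" "d \<xi>"] abs_triangle_ineq[of "airy_corr' \<xi> / b\<^sup>2" "e \<xi>"]
        by (meson add_mono order_trans)+
      show "\<bar>Ai 0 \<xi>\<bar> \<le> Z" "\<bar>Ai 1 \<xi>\<bar> \<le> Z" using v K0 K1 K2 K3 C(1) unfolding Z_def KA_def KB_def by linarith+
      have "wave \<alpha> n \<xi> = Ai 0 \<xi> + airy_corr \<xi> / b\<^sup>2 + d \<xi>" "wave' \<alpha> n \<xi> = Ai 1 \<xi> + airy_corr' \<xi> / b\<^sup>2 + e \<xi>"
        using wd by linarith+
      then show "\<bar>wave \<alpha> n \<xi>\<bar> \<le> Z" "\<bar>wave' \<alpha> n \<xi>\<bar> \<le> Z"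
        using v(1,2,5,6) w k K0(1) K1(1) K2(1) K3(1) abs_triangle_ineq[of "Ai 0 \<xi> + airy_corr \<xi> / b\<^sup>2" "d \<xi>"] abs_triangle_ineq[of "Ai 0 \<xi>" "airy_corr \<xi> / b\<^sup>2"]
          abs_triangle_ineq[of "Ai 1 \<xi> + airy_corr' \<xi> / b\<^sup>2" "e \<xi>"] abs_triangle_ineq[of "Ai 1 \<xi>" "airy_corr' \<xi> / b\<^sup>2"]
        unfolding Z_def KA_def KB_def by argo+
    qed
    show ?case
    proof (intro allI impI conjI)
      fix \<xi> \<eta> assume \<xi>: "\<bar>\<xi>\<bar> \<le> M" and \<eta>: "\<bar>\<eta>\<bar> \<le> M"
      show "turning_point \<alpha> n + 2 * edge_scale n * \<xi> > 0" using x0[OF \<xi>] by (simp add: X_def)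
      assume ne: "\<xi> \<noteq> \<eta>"
      define s1 where "s1 = 2 * b / (X \<xi> n + sqrt (X \<xi> n * X \<eta> n))"
      define s2 where "s2 = 2 * b / (X \<eta> n + sqrt (X \<xi> n * X \<eta> n))"
      define s3 where "s3 = 2 * b\<^sup>2 / sqrt (X \<xi> n * X \<eta> n)"
      have s: "\<bar>s1 - 1 / (2 * b\<^sup>2)\<bar> \<le> 2 * (M + \<beta>) / b ^ 3" "\<bar>s2 - 1 / (2 * b\<^sup>2)\<bar> \<le> 2 * (M + \<beta>) / b ^ 3"
          "\<bar>s3 - 1 / b\<bar> \<le> 2 * (M + \<beta>) / b ^ 3"
        using kernel_coefficient_bounds[OF b pos(1)[OF \<xi>] pos(1)[OF \<eta>] pos(2)[OF \<xi>] pos(2)[OF \<eta>] elim(2)[folded b_def] order_refl]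
          kernel_coefficient_bounds(1)[OF b pos(1)[OF \<eta>] pos(1)[OF \<xi>] pos(2)[OF \<eta>] pos(2)[OF \<xi>] elim(2)[folded b_def] order_refl]
        unfolding s1_def s2_def s3_def by (auto simp: mult.commute)
      have \<tau>: "\<bar>1 / (2 * b\<^sup>2)\<bar> \<le> 1 / b" "\<bar>1 / b\<bar> \<le> 1 / b"
        using b by (auto simp: field_simps power2_eq_square)
      have Hb: "2 * (M + \<beta>) / b ^ 3 * Z\<^sup>2 + 1 / b * (2 * (Z * (Z / b\<^sup>2))) = H / b ^ 3"
        using b1 by (simp add: H_def field_simps eval_nat_numeral)
      note tp = triple_product_close[where Z = Z and \<delta> = "Z / b\<^sup>2" and \<sigma> = "2 * (M + \<beta>) / b ^ 3" and \<tau> = "1 / b", unfolded Hb]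
      have 1: "\<bar>s1 * wave \<alpha> n \<xi> * wave' \<alpha> n \<eta> - 1 / (2 * b\<^sup>2) * Ai 0 \<xi> * Ai 1 \<eta>\<bar> \<le> H / b ^ 3"
        by (rule tp[OF s(1) size(5)[OF \<xi>] size(6)[OF \<eta>] size(1)[OF \<xi>] size(2)[OF \<eta>] size(3)[OF \<xi>] \<tau>(1)])
      have 2: "\<bar>s2 * wave' \<alpha> n \<xi> * wave \<alpha> n \<eta> - 1 / (2 * b\<^sup>2) * Ai 1 \<xi> * Ai 0 \<eta>\<bar> \<le> H / b ^ 3"
        by (rule tp[OF s(2) size(6)[OF \<xi>] size(5)[OF \<eta>] size(2)[OF \<xi>] size(1)[OF \<eta>] size(4)[OF \<xi>] \<tau>(1)])
      have 3: "\<bar>s3 * wave \<alpha> n \<xi> * wave \<alpha> n \<eta> - 1 / b * Ai 0 \<xi> * Ai 0 \<eta>\<bar> \<le> H / b ^ 3"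
        by (rule tp[OF s(3) size(5)[OF \<xi>] size(5)[OF \<eta>] size(1)[OF \<xi>] size(1)[OF \<eta>] size(3)[OF \<xi>] \<tau>(2)])
      \<comment> \<open>The part of the Wronskian beyond order b^(-2). Each bracket is a commutator
        of bounded Lipschitz functions, hence O(b^(-3)) times |\<xi> - \<eta>|.\<close>
      define E where "E = (airy_corr \<xi> * airy_corr' \<eta> - airy_corr' \<xi> * airy_corr \<eta>) / b ^ 4 + (A \<xi> * e \<eta> - e \<xi> * A \<eta>)
         + (d \<xi> * B \<eta> - B \<xi> * d \<eta>) + (d \<xi> * e \<eta> - e \<xi> * d \<eta>)"
      have Eb: "\<bar>E\<bar> \<le> W / b ^ 3 * \<bar>\<xi> - \<eta>\<bar>"
      proof -
        have "\<bar>airy_corr \<xi> * airy_corr' \<eta> - airy_corr' \<xi> * airy_corr \<eta>\<bar> / b ^ 4 \<le> (2 * (K2 * K3) * \<bar>\<xi> - \<eta>\<bar>) / b ^ 4"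
          by (intro divide_right_mono bounded_Lipschitz_commutator[OF K2(2) K3(2) \<xi> \<eta>]) auto
        also have "\<dots> \<le> (2 * (K2 * K3) * \<bar>\<xi> - \<eta>\<bar>) / b ^ 3"
          using K2 K3 by (intro b32) auto
        finally have 1: "\<bar>(airy_corr \<xi> * airy_corr' \<eta> - airy_corr' \<xi> * airy_corr \<eta>) / b ^ 4\<bar> \<le> 2 * (K2 * K3) / b ^ 3 * \<bar>\<xi> - \<eta>\<bar>"
          by (simp add: abs_divide)
        have 2: "\<bar>A \<xi> * e \<eta> - e \<xi> * A \<eta>\<bar> \<le> 2 * (KA * C) / b ^ 3 * \<bar>\<xi> - \<eta>\<bar>"
          using bounded_Lipschitz_commutator[OF LA Le \<xi> \<eta>] by simp
        have 3: "\<bar>d \<xi> * B \<eta> - B \<xi> * d \<eta>\<bar> \<le> 2 * (C * KB) / b ^ 3 * \<bar>\<xi> - \<eta>\<bar>"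
          using bounded_Lipschitz_commutator[OF Ld LB \<xi> \<eta>] by simp
        have "2 * (C / b ^ 3 * (C / b ^ 3)) = 2 * (C * C) / b ^ 6" by (simp add: eval_nat_numeral)
        also have "\<dots> \<le> 2 * (C * C) / b ^ 3" using C by (intro b32) auto
        finally have "2 * (C / b ^ 3 * (C / b ^ 3)) * \<bar>\<xi> - \<eta>\<bar> \<le> 2 * (C * C) / b ^ 3 * \<bar>\<xi> - \<eta>\<bar>" by (intro mult_right_mono) auto
        from order_trans[OF bounded_Lipschitz_commutator[OF Ld Le \<xi> \<eta>] this]
        have 4: "\<bar>d \<xi> * e \<eta> - e \<xi> * d \<eta>\<bar> \<le> 2 * (C * C) / b ^ 3 * \<bar>\<xi> - \<eta>\<bar>" .
        have "\<bar>p + q + r + s\<bar> \<le> p' + q' + r' + s'" if "\<bar>p\<bar> \<le> p'" "\<bar>q\<bar> \<le> q'" "\<bar>r\<bar> \<le> r'" "\<bar>s\<bar> \<le> s'" for p q r s p' q' r' s' :: real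
          using that by linarith
        from this[OF 1 2 3 4] show ?thesis unfolding E_def W_def add_divide_distrib distrib_right .
      qed
      have Eq: "\<bar>E / (\<xi> - \<eta>)\<bar> \<le> W / b ^ 3"
        using Eb ne by (simp add: abs_divide pos_divide_le_eq)
      have ident: "(wave \<alpha> n \<xi> * wave' \<alpha> n \<eta> - wave' \<alpha> n \<xi> * wave \<alpha> n \<eta>) / (\<xi> - \<eta>)
         = airy_kernel \<xi> \<eta> + (second_coeff \<xi> \<eta> + (Ai 0 \<xi> * Ai 1 \<eta> + Ai 1 \<xi> * Ai 0 \<eta>) / 2) / b\<^sup>2 + E / (\<xi> - \<eta>)"
      proof -
        have "(a + w / b\<^sup>2 + d) * (B' + w' / b\<^sup>2 + e') - (B + W / b\<^sup>2 + e) * (a' + V / b\<^sup>2 + d')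
          = (a * B' - B * a') + (a * w' - W * a' + (w * B' - B * V)) / b\<^sup>2
            + ((w * w' - W * V) / b ^ 4 + ((a + w / b\<^sup>2) * e' - e * (a' + V / b\<^sup>2)) + (d * (B' + w' / b\<^sup>2) - (B + W / b\<^sup>2) * d') + (d * e' - e * d'))"
          for a w d B' w' e' B W e a' V d' :: real
        proof -
          define r where "r = 1 / b\<^sup>2"
          have r: "z / b\<^sup>2 = z * r" "z / b ^ 4 = z * (r * r)" for z by (simp_all add: r_def eval_nat_numeral)
          show ?thesis unfolding r by (simp add: algebra_simps)
        qed
        then have "wave \<alpha> n \<xi> * wave' \<alpha> n \<eta> - wave' \<alpha> n \<xi> * wave \<alpha> n \<eta>
           = (Ai 0 \<xi> * Ai 1 \<eta> - Ai 1 \<xi> * Ai 0 \<eta>)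
           + (Ai 0 \<xi> * airy_corr' \<eta> - airy_corr' \<xi> * Ai 0 \<eta> + (airy_corr \<xi> * Ai 1 \<eta> - Ai 1 \<xi> * airy_corr \<eta>)) / b\<^sup>2 + E"
          unfolding wv E_def A_def B_def .
        then have "(wave \<alpha> n \<xi> * wave' \<alpha> n \<eta> - wave' \<alpha> n \<xi> * wave \<alpha> n \<eta>) / (\<xi> - \<eta>)
           = (Ai 0 \<xi> * Ai 1 \<eta> - Ai 1 \<xi> * Ai 0 \<eta>) / (\<xi> - \<eta>)
           + ((Ai 0 \<xi> * airy_corr' \<eta> - airy_corr' \<xi> * Ai 0 \<eta> + (airy_corr \<xi> * Ai 1 \<eta> - Ai 1 \<xi> * airy_corr \<eta>)) / (\<xi> - \<eta>)) / b\<^sup>2 + E / (\<xi> - \<eta>)"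
          by (simp only: add_divide_distrib divide_divide_eq_left mult.commute)
        then show ?thesis unfolding airy_corr_Wronskian[OF ne] airy_kernel_off_diagonal[OF ne] .
      qed
      have K: "2 * edge_scale n * laguerre_kernel \<alpha> n (X \<xi> n) (X \<eta> n)
        = airy_kernel \<xi> \<eta> + (second_coeff \<xi> \<eta> + (Ai 0 \<xi> * Ai 1 \<eta> + Ai 1 \<xi> * Ai 0 \<eta>) / 2) / b\<^sup>2 + E / (\<xi> - \<eta>)
          - s1 * wave \<alpha> n \<xi> * wave' \<alpha> n \<eta> - s2 * wave' \<alpha> n \<xi> * wave \<alpha> n \<eta> - s3 * wave \<alpha> n \<xi> * wave \<alpha> n \<eta>"
        using wave_kernel[OF \<alpha> elim(3) x0[OF \<xi>, unfolded X_def] x0[OF \<eta>, unfolded X_def] ne]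
        unfolding ident s1_def s2_def s3_def b_def X_def .
      have "(P + (t + u) / 2) / b\<^sup>2 = P / b\<^sup>2 + 1 / (2 * b\<^sup>2) * t + 1 / (2 * b\<^sup>2) * u" for P t u :: real
        by (simp add: add_divide_distrib)
      note split = this[of "second_coeff \<xi> \<eta>" "Ai 0 \<xi> * Ai 1 \<eta>" "Ai 1 \<xi> * Ai 0 \<eta>", folded mult.assoc]
      have sum: "(W + 3 * H) / b ^ 3 = W / b ^ 3 + H / b ^ 3 + H / b ^ 3 + H / b ^ 3" by (simp add: add_divide_distrib)
      have bb: "Ai 0 \<xi> * Ai 0 \<eta> / b = 1 / b * Ai 0 \<xi> * Ai 0 \<eta>" by simp
      have "\<bar>2 * edge_scale n * laguerre_kernel \<alpha> n (X \<xi> n) (X \<eta> n) - kernel_approx b \<xi> \<eta>\<bar> \<le> (W + 3 * H) / b ^ 3"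
      proof -
        have "\<bar>k + (P + t + u) + q - S1 - S2 - S3 - (k - c + P)\<bar> \<le> w + h + h + h"
          if "\<bar>S1 - t\<bar> \<le> h" "\<bar>S2 - u\<bar> \<le> h" "\<bar>S3 - c\<bar> \<le> h" "\<bar>q\<bar> \<le> w" for k P t u q S1 S2 S3 c w h :: real
          using that by linarith
        from this[OF 1 2 3 Eq] show ?thesis unfolding K kernel_approx_def split sum bb .
      qed
      then show "\<bar>2 * edge_scale n * laguerre_kernel \<alpha> n (turning_point \<alpha> n + 2 * edge_scale n * \<xi>) (turning_point \<alpha> n + 2 * edge_scale n * \<eta>)
         - kernel_approx (edge_scale n) \<xi> \<eta>\<bar> \<le> (W + 3 * H) / edge_scale n ^ 3"
        unfolding X_def b_def .
    qed
  qed
  then show ?thesis by (rule that)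
qed

lemma laguerre_fun_isCont: "y > 0 \<Longrightarrow> isCont (laguerre_fun k \<alpha>) y"
  unfolding laguerre_fun_def[abs_def]
  by (intro continuous_intros DERIV_isCont[OF laguerre_has_derivative]) auto

text \<open>For fixed n both sides are continuous, so the off-diagonal bound passes to the diagonal.
  The radius M + 1 leaves room for neighbours of points with modulus M.\<close>

lemma kernel_expansion:
  assumes \<alpha>: "\<alpha> > -1" and M: "M \<ge> 0"
  obtains C where "\<forall>\<^sub>F n in sequentially. \<forall>\<xi> \<eta>. \<bar>\<xi>\<bar> \<le> M \<longrightarrow> \<bar>\<eta>\<bar> \<le> M \<longrightarrow>
     turning_point \<alpha> n + 2 * edge_scale n * \<xi> > 0 \<and>
     \<bar>2 * edge_scale n * laguerre_kernel \<alpha> n (turning_point \<alpha> n + 2 * edge_scale n * \<xi>) (turning_point \<alpha> n + 2 * edge_scale n * \<eta>)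
       - kernel_approx (edge_scale n) \<xi> \<eta>\<bar> \<le> C / edge_scale n ^ 3"
proof -
  have M1: "M + 1 \<ge> 0" using M by simp
  obtain C where C: "\<forall>\<^sub>F n in sequentially. \<forall>\<xi> \<eta>. \<bar>\<xi>\<bar> \<le> M + 1 \<longrightarrow> \<bar>\<eta>\<bar> \<le> M + 1 \<longrightarrow>
     turning_point \<alpha> n + 2 * edge_scale n * \<xi> > 0 \<and> (\<xi> \<noteq> \<eta> \<longrightarrow>
     \<bar>2 * edge_scale n * laguerre_kernel \<alpha> n (turning_point \<alpha> n + 2 * edge_scale n * \<xi>) (turning_point \<alpha> n + 2 * edge_scale n * \<eta>)
       - kernel_approx (edge_scale n) \<xi> \<eta>\<bar> \<le> C / edge_scale n ^ 3)"
    by (rule kernel_expansion_off_diagonal[OF \<alpha> M1]) (rule that)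
  show ?thesis
  proof (rule that, use C in eventually_elim, intro allI impI)
    fix n \<xi> \<eta> assume *: "\<forall>\<xi> \<eta>. \<bar>\<xi>\<bar> \<le> M + 1 \<longrightarrow> \<bar>\<eta>\<bar> \<le> M + 1 \<longrightarrow>
     turning_point \<alpha> n + 2 * edge_scale n * \<xi> > 0 \<and> (\<xi> \<noteq> \<eta> \<longrightarrow>
     \<bar>2 * edge_scale n * laguerre_kernel \<alpha> n (turning_point \<alpha> n + 2 * edge_scale n * \<xi>) (turning_point \<alpha> n + 2 * edge_scale n * \<eta>)
       - kernel_approx (edge_scale n) \<xi> \<eta>\<bar> \<le> C / edge_scale n ^ 3)" and \<xi>: "\<bar>\<xi>\<bar> \<le> M" and \<eta>: "\<bar>\<eta>\<bar> \<le> M"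
    define x where "x \<eta> = turning_point \<alpha> n + 2 * edge_scale n * \<eta>" for \<eta>
    have \<xi>\<eta>: "\<bar>\<xi>\<bar> \<le> M + 1" "\<bar>\<eta>\<bar> \<le> M + 1" using \<xi> \<eta> by auto
    have x0: "x \<xi> > 0" using * \<xi>\<eta> unfolding x_def by blast
    have "\<bar>2 * edge_scale n * laguerre_kernel \<alpha> n (x \<xi>) (x \<eta>) - kernel_approx (edge_scale n) \<xi> \<eta>\<bar> \<le> C / edge_scale n ^ 3"
    proof (cases "\<xi> = \<eta>")
      case True
      have "((\<lambda>\<eta>. laguerre_kernel \<alpha> n (x \<xi>) (x \<eta>)) \<longlongrightarrow> laguerre_kernel \<alpha> n (x \<xi>) (x \<xi>)) (at \<xi>)"
      proof -
        have "isCont (\<lambda>y. laguerre_kernel \<alpha> n (x \<xi>) y) (x \<xi>)"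
          unfolding laguerre_kernel_def by (intro continuous_intros laguerre_fun_isCont x0)
        moreover have "(x \<longlongrightarrow> x \<xi>) (at \<xi>)" unfolding x_def[abs_def] by (intro tendsto_intros)
        ultimately show ?thesis by (rule isCont_tendsto_compose)
      qed
      moreover have "((\<lambda>\<eta>. kernel_approx (edge_scale n) \<xi> \<eta>) \<longlongrightarrow> kernel_approx (edge_scale n) \<xi> \<xi>) (at \<xi>)"
        unfolding kernel_approx_def second_coeff_def divide_inverse
        using DERIV_isCont[OF Ai_0_derivative, of \<xi>] DERIV_isCont[OF Ai_1_derivative, of \<xi>]
        unfolding isCont_def by (intro tendsto_intros airy_kernel_tendsto_diagonal)
      ultimately have "((\<lambda>\<eta>. \<bar>2 * edge_scale n * laguerre_kernel \<alpha> n (x \<xi>) (x \<eta>) - kernel_approx (edge_scale n) \<xi> \<eta>\<bar>)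
        \<longlongrightarrow> \<bar>2 * edge_scale n * laguerre_kernel \<alpha> n (x \<xi>) (x \<xi>) - kernel_approx (edge_scale n) \<xi> \<xi>\<bar>) (at \<xi>)"
        by (intro tendsto_intros)
      moreover have "\<forall>\<^sub>F \<eta> in at \<xi>. \<bar>2 * edge_scale n * laguerre_kernel \<alpha> n (x \<xi>) (x \<eta>) - kernel_approx (edge_scale n) \<xi> \<eta>\<bar> \<le> C / edge_scale n ^ 3"
      proof -
        have "\<forall>\<^sub>F \<eta> in at \<xi>. \<bar>\<eta> - \<xi>\<bar> < 1 \<and> \<eta> \<noteq> \<xi>"
          unfolding eventually_at by (intro exI[of _ 1]) (auto simp: dist_real_def)
        then show ?thesis
        proof eventually_elim
          case (elim \<eta>)
          then have "\<bar>\<eta>\<bar> \<le> M + 1" "\<bar>\<xi>\<bar> \<le> M + 1" "\<xi> \<noteq> \<eta>" using \<xi> by auto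
          then show ?case using * unfolding x_def by blast
        qed
      qed
      ultimately have "\<bar>2 * edge_scale n * laguerre_kernel \<alpha> n (x \<xi>) (x \<xi>) - kernel_approx (edge_scale n) \<xi> \<xi>\<bar> \<le> C / edge_scale n ^ 3"
        by (rule tendsto_upperbound) simp
      then show ?thesis using True by simp
    next
      case False
      then show ?thesis using * \<xi>\<eta> unfolding x_def by blast
    qed
    then show "turning_point \<alpha> n + 2 * edge_scale n * \<xi> > 0 \<and>
     \<bar>2 * edge_scale n * laguerre_kernel \<alpha> n (turning_point \<alpha> n + 2 * edge_scale n * \<xi>) (turning_point \<alpha> n + 2 * edge_scale n * \<eta>)
       - kernel_approx (edge_scale n) \<xi> \<eta>\<bar> \<le> C / edge_scale n ^ 3"
      using x0 unfolding x_def by simp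
  qed
qed

section \<open>Translation of both variables by (2c-1)/b\<close>

section \<open>Change of the centring parameter\<close>

lemma power_bound_from_derivative:
  fixes f f' :: "real \<Rightarrow> real"
  assumes "\<And>s. \<bar>s\<bar> \<le> \<bar>t\<bar> \<Longrightarrow> (f has_real_derivative f' s) (at s)" "\<And>s. \<bar>s\<bar> \<le> \<bar>t\<bar> \<Longrightarrow> \<bar>f' s\<bar> \<le> C * \<bar>s\<bar> ^ k" "C \<ge> 0"
  shows "\<bar>f t - f 0\<bar> \<le> C * \<bar>t\<bar> ^ Suc k"
proof -
  have "norm (f t - f 0) \<le> (C * \<bar>t\<bar> ^ k) * norm (t - 0)"
  proof (rule field_differentiable_bound[of "{-\<bar>t\<bar>..\<bar>t\<bar>}" f f'])
    fix s assume "s \<in> {-\<bar>t\<bar>..\<bar>t\<bar>}"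
    then have s: "\<bar>s\<bar> \<le> \<bar>t\<bar>" by auto
    show "(f has_field_derivative f' s) (at s within {-\<bar>t\<bar>..\<bar>t\<bar>})" by (rule DERIV_subset[OF assms(1)[OF s]]) simp
    have "C * \<bar>s\<bar> ^ k \<le> C * \<bar>t\<bar> ^ k" using s assms(3) by (intro mult_left_mono power_mono) auto
    then show "norm (f' s) \<le> C * \<bar>t\<bar> ^ k" using assms(2)[OF s] by simp
  qed auto
  then show ?thesis by (simp add: mult_ac)
qed

text \<open>Only simultaneous shifts of both variables matter, because a change of c moves X and Y
  by the same amount.\<close>

definition diagonal_Lipschitz :: "real \<Rightarrow> (real \<Rightarrow> real \<Rightarrow> real) \<Rightarrow> bool" where
  "diagonal_Lipschitz R f \<longleftrightarrow> (\<exists>C\<ge>0. \<forall>X Y t. \<bar>X\<bar> \<le> R \<longrightarrow> \<bar>Y\<bar> \<le> R \<longrightarrow> \<bar>X + t\<bar> \<le> R \<longrightarrow> \<bar>Y + t\<bar> \<le> R \<longrightarrow>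
     \<bar>f X Y\<bar> \<le> C \<and> \<bar>f (X + t) (Y + t) - f X Y\<bar> \<le> C * \<bar>t\<bar>)"

lemma diagonal_Lipschitz_fst_snd:
  assumes "bounded_Lipschitz R C f" "C \<ge> 0"
  shows "diagonal_Lipschitz R (\<lambda>X Y. f X)" "diagonal_Lipschitz R (\<lambda>X Y. f Y)"
proof -
  have "\<bar>f X\<bar> \<le> C \<and> \<bar>f (X + t) - f X\<bar> \<le> C * \<bar>t\<bar>" if "\<bar>X\<bar> \<le> R" "\<bar>X + t\<bar> \<le> R" for X t
    using assms(1) that unfolding bounded_Lipschitz_def by (metis add_diff_cancel_left')
  then show "diagonal_Lipschitz R (\<lambda>X Y. f X)" "diagonal_Lipschitz R (\<lambda>X Y. f Y)"
    unfolding diagonal_Lipschitz_def using assms(2) by blast+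
qed

lemma diagonal_Lipschitz_const: "diagonal_Lipschitz R (\<lambda>X Y. c)"
  unfolding diagonal_Lipschitz_def by (intro exI[of _ "\<bar>c\<bar>"]) auto

lemma diagonal_Lipschitz_add:
  assumes "diagonal_Lipschitz R f" "diagonal_Lipschitz R g"
  shows "diagonal_Lipschitz R (\<lambda>X Y. f X Y + g X Y)"
proof -
  obtain C where C: "C \<ge> 0" "\<And>X Y t. \<bar>X\<bar> \<le> R \<Longrightarrow> \<bar>Y\<bar> \<le> R \<Longrightarrow> \<bar>X + t\<bar> \<le> R \<Longrightarrow> \<bar>Y + t\<bar> \<le> R \<Longrightarrow>
     \<bar>f X Y\<bar> \<le> C \<and> \<bar>f (X + t) (Y + t) - f X Y\<bar> \<le> C * \<bar>t\<bar>" using assms(1) unfolding diagonal_Lipschitz_def by blast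
  obtain D where D: "D \<ge> 0" "\<And>X Y t. \<bar>X\<bar> \<le> R \<Longrightarrow> \<bar>Y\<bar> \<le> R \<Longrightarrow> \<bar>X + t\<bar> \<le> R \<Longrightarrow> \<bar>Y + t\<bar> \<le> R \<Longrightarrow>
     \<bar>g X Y\<bar> \<le> D \<and> \<bar>g (X + t) (Y + t) - g X Y\<bar> \<le> D * \<bar>t\<bar>" using assms(2) unfolding diagonal_Lipschitz_def by blast
  show ?thesis
    unfolding diagonal_Lipschitz_def
  proof (intro exI[of _ "C + D"] conjI allI impI)
    show "0 \<le> C + D" using C D by simp
    fix X Y t :: real assume r: "\<bar>X\<bar> \<le> R" "\<bar>Y\<bar> \<le> R" "\<bar>X + t\<bar> \<le> R" "\<bar>Y + t\<bar> \<le> R"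
    note Cr = C(2)[OF r, THEN conjunct1] C(2)[OF r, THEN conjunct2] and Dr = D(2)[OF r, THEN conjunct1] D(2)[OF r, THEN conjunct2]
    show "\<bar>f X Y + g X Y\<bar> \<le> C + D" by (rule order_trans[OF abs_triangle_ineq add_mono[OF Cr(1) Dr(1)]])
    have "f (X + t) (Y + t) + g (X + t) (Y + t) - (f X Y + g X Y) = (f (X + t) (Y + t) - f X Y) + (g (X + t) (Y + t) - g X Y)" by simp
    then show "\<bar>f (X + t) (Y + t) + g (X + t) (Y + t) - (f X Y + g X Y)\<bar> \<le> (C + D) * \<bar>t\<bar>"
      unfolding distrib_right using order_trans[OF abs_triangle_ineq add_mono[OF Cr(2) Dr(2)]] by simp
  qed
qed

lemma diagonal_Lipschitz_mult:
  assumes "diagonal_Lipschitz R f" "diagonal_Lipschitz R g"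
  shows "diagonal_Lipschitz R (\<lambda>X Y. f X Y * g X Y)"
proof -
  obtain C where C: "C \<ge> 0" "\<And>X Y t. \<bar>X\<bar> \<le> R \<Longrightarrow> \<bar>Y\<bar> \<le> R \<Longrightarrow> \<bar>X + t\<bar> \<le> R \<Longrightarrow> \<bar>Y + t\<bar> \<le> R \<Longrightarrow>
     \<bar>f X Y\<bar> \<le> C \<and> \<bar>f (X + t) (Y + t) - f X Y\<bar> \<le> C * \<bar>t\<bar>" using assms(1) unfolding diagonal_Lipschitz_def by blast
  obtain D where D: "D \<ge> 0" "\<And>X Y t. \<bar>X\<bar> \<le> R \<Longrightarrow> \<bar>Y\<bar> \<le> R \<Longrightarrow> \<bar>X + t\<bar> \<le> R \<Longrightarrow> \<bar>Y + t\<bar> \<le> R \<Longrightarrow>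
     \<bar>g X Y\<bar> \<le> D \<and> \<bar>g (X + t) (Y + t) - g X Y\<bar> \<le> D * \<bar>t\<bar>" using assms(2) unfolding diagonal_Lipschitz_def by blast
  show ?thesis
    unfolding diagonal_Lipschitz_def
  proof (intro exI[of _ "2 * (C * D)"] conjI allI impI)
    show "0 \<le> 2 * (C * D)" using C D by simp
    fix X Y t :: real assume r: "\<bar>X\<bar> \<le> R" "\<bar>Y\<bar> \<le> R" "\<bar>X + t\<bar> \<le> R" "\<bar>Y + t\<bar> \<le> R"
    note Cr = C(2)[OF r, THEN conjunct1] C(2)[OF r, THEN conjunct2] and Dr = D(2)[OF r, THEN conjunct1] D(2)[OF r, THEN conjunct2]
    have g: "\<bar>g (X + t) (Y + t)\<bar> \<le> D"
      using D(2)[of "X + t" "Y + t" "- t", THEN conjunct1] r by simp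
    have "\<bar>f X Y * g X Y\<bar> \<le> C * D" unfolding abs_mult by (intro mult_mono Cr Dr C(1) abs_ge_zero)
    moreover have "C * D \<ge> 0" using C D by simp
    ultimately show "\<bar>f X Y * g X Y\<bar> \<le> 2 * (C * D)" by linarith
    have e: "f (X + t) (Y + t) * g (X + t) (Y + t) - f X Y * g X Y
       = (f (X + t) (Y + t) - f X Y) * g (X + t) (Y + t) + f X Y * (g (X + t) (Y + t) - g X Y)" by (simp add: algebra_simps)
    have "\<bar>(f (X + t) (Y + t) - f X Y) * g (X + t) (Y + t)\<bar> \<le> (C * \<bar>t\<bar>) * D"
      unfolding abs_mult by (intro mult_mono Cr g mult_nonneg_nonneg C(1) abs_ge_zero)
    moreover have "\<bar>f X Y * (g (X + t) (Y + t) - g X Y)\<bar> \<le> C * (D * \<bar>t\<bar>)"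
      unfolding abs_mult by (intro mult_mono Cr Dr C(1) abs_ge_zero)
    ultimately show "\<bar>f (X + t) (Y + t) * g (X + t) (Y + t) - f X Y * g X Y\<bar> \<le> 2 * (C * D) * \<bar>t\<bar>"
      unfolding e by (simp add: mult_ac)
  qed
qed

lemma Ai_translate_derivative:
  "((\<lambda>t. Ai 0 (Z + t)) has_real_derivative Ai 1 (Z + t)) (at t)"
  "((\<lambda>t. Ai 1 (Z + t)) has_real_derivative (Z + t) * Ai 0 (Z + t)) (at t)"
proof -
  have lin: "((\<lambda>t. Z + t) has_real_derivative 1) (at t)" by (auto intro!: derivative_eq_intros)
  show "((\<lambda>t. Ai 0 (Z + t)) has_real_derivative Ai 1 (Z + t)) (at t)"
    using DERIV_chain2[where f = "Ai 0" and g = "\<lambda>t. Z + t", OF Ai_0_derivative lin] by simp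
  show "((\<lambda>t. Ai 1 (Z + t)) has_real_derivative (Z + t) * Ai 0 (Z + t)) (at t)"
    using DERIV_chain2[where f = "Ai 1" and g = "\<lambda>t. Z + t", OF Ai_1_derivative lin] by simp
qed

text \<open>The shifted kernel is the integral of Ai(X+z) Ai(Y+z) over z >= t; the derivative is
  verified on the closed forms.\<close>

lemma airy_kernel_shift_derivative:
  "((\<lambda>t. airy_kernel (X + t) (Y + t)) has_real_derivative - (Ai 0 (X + t) * Ai 0 (Y + t))) (at t)"
proof -
  note D0 = Ai_translate_derivative(1) and D1 = Ai_translate_derivative(2)
  show ?thesis
  proof (cases "X = Y")
    case True
    have "((\<lambda>t. (Ai 1 (X + t))\<^sup>2 - (X + t) * (Ai 0 (X + t))\<^sup>2) has_real_derivative - (Ai 0 (X + t) * Ai 0 (X + t))) (at t)"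
      by (rule derivative_eq_intros D0 D1 refl | simp)+ (simp add: algebra_simps power2_eq_square)
    then show ?thesis unfolding True[symmetric] airy_kernel_diagonal .
  next
    case False
    then have ne: "X + t \<noteq> Y + t" for t by simp
    have "((\<lambda>t. (Ai 0 (X + t) * Ai 1 (Y + t) - Ai 1 (X + t) * Ai 0 (Y + t)) / (X - Y)) has_real_derivative
       (Ai 1 (X + t) * Ai 1 (Y + t) + (Y + t) * Ai 0 (Y + t) * Ai 0 (X + t)
         - ((X + t) * Ai 0 (X + t) * Ai 0 (Y + t) + Ai 1 (Y + t) * Ai 1 (X + t))) / (X - Y)) (at t)"
      by (rule derivative_eq_intros D0 D1 refl | use False in simp)+
    moreover have "(p * r + (y + t) * b * a - ((x + t) * a * b + r * p)) / (x - y) = - (a * b)" if "x \<noteq> y" for p r a b x y :: real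
      using that by (simp add: divide_eq_eq) (simp add: algebra_simps)
    ultimately show ?thesis
      unfolding airy_kernel_off_diagonal[OF ne] using False by simp
  qed
qed

text \<open>Taylor expansion in d = (2c-1)/b: second order for the Airy kernel, first order for the
  1/b term, zeroth order for the last one. Each remainder is O(b^(-3)).\<close>

lemma kernel_approx_shift:
  assumes M: "M \<ge> 0"
  obtains C where "\<And>b c X Y. b \<ge> 1 \<Longrightarrow> \<bar>c\<bar> \<le> M \<Longrightarrow> \<bar>X\<bar> \<le> M \<Longrightarrow> \<bar>Y\<bar> \<le> M \<Longrightarrow>
    \<bar>kernel_approx b (X + (2 * c - 1) / b) (Y + (2 * c - 1) / b) -
      (airy_kernel X Y - 2 / b * (c * Ai 0 X * Ai 0 Y)
       + 1 / (5 * b\<^sup>2) * ((X\<^sup>2 + X * Y + Y\<^sup>2) * Ai 0 X * Ai 0 Y - (X + Y) * Ai 1 X * Ai 1 Y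
          - (10 * c\<^sup>2 - 1) * (Ai 0 X * Ai 1 Y + Ai 1 X * Ai 0 Y)))\<bar> \<le> C / b ^ 3"
proof -
  define R where "R = 3 * M + 1"
  define D where "D = 2 * M + 1"
  have D: "D \<ge> 0" using M by (simp add: D_def)
  have base: "continuous_on UNIV (Ai 0)" "continuous_on UNIV (Ai 1)"
    using Ai_0_derivative Ai_1_derivative by (blast intro: continuous_at_imp_continuous_on DERIV_isCont)+
  have cont: "continuous_on UNIV (\<lambda>\<xi>. \<xi> * Ai 0 \<xi>)" "continuous_on UNIV (\<lambda>x::real. 1::real)" by (intro continuous_intros base)+
  obtain K0 where K0: "K0 \<ge> 0" "bounded_Lipschitz R K0 (Ai 0)"
    by (rule smooth_bounded_Lipschitz[OF Ai_0_derivative base(2)]) (rule that)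
  obtain K1 where K1: "K1 \<ge> 0" "bounded_Lipschitz R K1 (Ai 1)"
    by (rule smooth_bounded_Lipschitz[OF Ai_1_derivative cont(1)]) (rule that)
  obtain K2 where K2: "K2 \<ge> 0" "bounded_Lipschitz R K2 (\<lambda>x. x)"
    by (rule smooth_bounded_Lipschitz[OF DERIV_ident cont(2)]) (rule that)
  note dl = diagonal_Lipschitz_fst_snd[OF K0(2,1)] diagonal_Lipschitz_fst_snd[OF K1(2,1)] diagonal_Lipschitz_fst_snd[OF K2(2,1)]
  define S where "S X Y = Ai 0 X * Ai 1 Y + Ai 1 X * Ai 0 Y" for X Y
  define P where "P X Y = Ai 0 X * Ai 0 Y" for X Y
  have "diagonal_Lipschitz R S" unfolding S_def
    by (intro diagonal_Lipschitz_add diagonal_Lipschitz_mult dl)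
  then obtain CS where CS: "CS \<ge> 0" "\<And>X Y t. \<bar>X\<bar> \<le> R \<Longrightarrow> \<bar>Y\<bar> \<le> R \<Longrightarrow> \<bar>X + t\<bar> \<le> R \<Longrightarrow> \<bar>Y + t\<bar> \<le> R \<Longrightarrow> \<bar>S (X + t) (Y + t) - S X Y\<bar> \<le> CS * \<bar>t\<bar>"
    unfolding diagonal_Lipschitz_def by blast
  have sc: "second_coeff = (\<lambda>X Y. (1 / 5) * ((X * X + X * Y + Y * Y) * (Ai 0 X * Ai 0 Y) + (-1) * ((X + Y) * (Ai 1 X * Ai 1 Y))) + (- 3 / 10) * S X Y)"
    by (intro ext) (simp add: second_coeff_def S_def power2_eq_square field_simps)
  have "diagonal_Lipschitz R second_coeff"
    unfolding sc S_def by (intro diagonal_Lipschitz_add diagonal_Lipschitz_mult diagonal_Lipschitz_const dl)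
  then obtain CB where CB: "CB \<ge> 0" "\<And>X Y t. \<bar>X\<bar> \<le> R \<Longrightarrow> \<bar>Y\<bar> \<le> R \<Longrightarrow> \<bar>X + t\<bar> \<le> R \<Longrightarrow> \<bar>Y + t\<bar> \<le> R \<Longrightarrow> \<bar>second_coeff (X + t) (Y + t) - second_coeff X Y\<bar> \<le> CB * \<bar>t\<bar>"
    unfolding diagonal_Lipschitz_def by blast
  show ?thesis
  proof (rule that[of "CS * D ^ 3 + CS * D\<^sup>2 + CB * D"])
    fix b c X Y :: real assume b: "b \<ge> 1" and c: "\<bar>c\<bar> \<le> M" and XY: "\<bar>X\<bar> \<le> M" "\<bar>Y\<bar> \<le> M"
    define d where "d = (2 * c - 1) / b"
    have "\<bar>2 * c - 1\<bar> \<le> D" using c by (simp add: D_def abs_le_iff)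
    then have db: "\<bar>d\<bar> \<le> D / b" using b by (simp add: d_def abs_divide divide_right_mono)
    have "D / b \<le> D / 1" using b D by (intro divide_left_mono) auto
    then have dD: "\<bar>d\<bar> \<le> D" using db by simp
    have R: "\<bar>X\<bar> \<le> R" "\<bar>Y\<bar> \<le> R" using XY M by (auto simp: R_def)
    have Rs: "\<bar>X + s\<bar> \<le> R" "\<bar>Y + s\<bar> \<le> R" if "\<bar>s\<bar> \<le> \<bar>d\<bar>" for s
      using XY dD that abs_triangle_ineq[of X s] abs_triangle_ineq[of Y s] by (auto simp: R_def D_def)
    \<comment> \<open>\<open>p\<close> is the first order Taylor remainder of Ai Ai along the
      diagonal direction, and q' = -p for the second order remainder \<open>q\<close> of the kernel,
      so each bound integrates to the next.\<close>
    define p where "p s = P (X + s) (Y + s) - P X Y - s * S X Y" for s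
    have p': "(p has_real_derivative S (X + s) (Y + s) - S X Y) (at s)" for s
      unfolding p_def P_def S_def by (rule derivative_eq_intros Ai_translate_derivative refl | simp)+
    have pb: "\<bar>p s\<bar> \<le> CS * \<bar>s\<bar> ^ 2" if "\<bar>s\<bar> \<le> \<bar>d\<bar>" for s
    proof -
      have "\<bar>p s - p 0\<bar> \<le> CS * \<bar>s\<bar> ^ Suc 1"
        using CS(2)[OF R Rs] that CS(1) by (intro power_bound_from_derivative[OF p']) auto
      then show ?thesis by (simp add: p_def numeral_2_eq_2)
    qed
    define q where "q s = airy_kernel (X + s) (Y + s) + s * P X Y + s\<^sup>2 / 2 * S X Y" for s
    have q': "(q has_real_derivative - p s) (at s)" for s
      unfolding q_def p_def P_def by (rule derivative_eq_intros airy_kernel_shift_derivative refl | simp)+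
    have "\<bar>q d - q 0\<bar> \<le> CS * \<bar>d\<bar> ^ Suc 2"
      by (rule power_bound_from_derivative[OF q']) (use pb CS(1) in auto)
    then have e2: "\<bar>q d - airy_kernel X Y\<bar> \<le> CS * \<bar>d\<bar> ^ 3" by (simp add: q_def numeral_3_eq_3)
    have e1: "\<bar>p d\<bar> \<le> CS * \<bar>d\<bar> ^ 2" by (rule pb) simp
    have e3: "\<bar>second_coeff (X + d) (Y + d) - second_coeff X Y\<bar> \<le> CB * \<bar>d\<bar>" by (rule CB(2)[OF R Rs]) auto
    let ?B = "second_coeff X Y" and ?T = "airy_kernel X Y - 2 / b * (c * Ai 0 X * Ai 0 Y)
       + 1 / (5 * b\<^sup>2) * ((X\<^sup>2 + X * Y + Y\<^sup>2) * Ai 0 X * Ai 0 Y - (X + Y) * Ai 1 X * Ai 1 Y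
          - (10 * c\<^sup>2 - 1) * (Ai 0 X * Ai 1 Y + Ai 1 X * Ai 0 Y))"
    \<comment> \<open>Here the coefficients combine: d + 1/b = 2c/b, and d^2/2 + d/b + 3/(10 b^2) =
      (10 c^2 - 1)/(5 b^2).\<close>
    have T: "?T = airy_kernel X Y - d * P X Y - d\<^sup>2 / 2 * S X Y - (P X Y + d * S X Y) / b + ?B / b\<^sup>2"
    proof -
      define r where "r = 1 / b"
      have rr: "z / b = z * r" "z / (5 * b\<^sup>2) = z / 5 * (r * r)" "z / b\<^sup>2 = z * (r * r)" for z
        by (simp_all add: r_def power2_eq_square)
      show ?thesis unfolding d_def P_def S_def second_coeff_def rr by (simp add: field_simps power2_eq_square)
    qed
    have K: "kernel_approx b (X + d) (Y + d) - ?T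
       = (q d - airy_kernel X Y) - p d / b + (second_coeff (X + d) (Y + d) - ?B) / b\<^sup>2"
      unfolding T kernel_approx_def q_def p_def P_def by (simp add: add_divide_distrib diff_divide_distrib)
    have b1: "b > 0" "b\<^sup>2 > 0" using b by auto
    have 2: "\<bar>q d - airy_kernel X Y\<bar> \<le> CS * D ^ 3 / b ^ 3"
    proof -
      have "CS * \<bar>d\<bar> ^ 3 \<le> CS * (D / b) ^ 3" using db CS(1) by (intro mult_left_mono power_mono) auto
      then show ?thesis using e2 by (simp add: power_divide)
    qed
    have 1: "\<bar>p d / b\<bar> \<le> CS * D\<^sup>2 / b ^ 3"
    proof -
      have "CS * \<bar>d\<bar> ^ 2 \<le> CS * (D / b) ^ 2" using db CS(1) by (intro mult_left_mono power_mono) auto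
      then have "\<bar>p d\<bar> / b \<le> CS * (D / b)\<^sup>2 / b" using e1 b1 by (intro divide_right_mono) linarith+
      also have "\<dots> = CS * D\<^sup>2 / b ^ 3" by (simp add: power_divide eval_nat_numeral)
      finally show ?thesis using b1 by (simp add: abs_divide)
    qed
    have 3: "\<bar>(second_coeff (X + d) (Y + d) - ?B) / b\<^sup>2\<bar> \<le> CB * D / b ^ 3"
    proof -
      have "CB * \<bar>d\<bar> \<le> CB * (D / b)" using db CB(1) by (intro mult_left_mono) auto
      then have "\<bar>second_coeff (X + d) (Y + d) - ?B\<bar> / b\<^sup>2 \<le> CB * (D / b) / b\<^sup>2" using e3 b1 by (intro divide_right_mono) linarith+
      also have "\<dots> = CB * D / b ^ 3" by (simp add: eval_nat_numeral)
      finally show ?thesis using b1 by (simp add: abs_divide)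
    qed
    have "\<bar>u - v + w\<bar> \<le> u' + v' + w'" if "\<bar>u\<bar> \<le> u'" "\<bar>v\<bar> \<le> v'" "\<bar>w\<bar> \<le> w'" for u v w u' v' w' :: real
      using that by linarith
    from this[OF 2 1 3] show "\<bar>kernel_approx b (X + (2 * c - 1) / b) (Y + (2 * c - 1) / b) - ?T\<bar>
       \<le> (CS * D ^ 3 + CS * D\<^sup>2 + CB * D) / b ^ 3"
      unfolding K[unfolded d_def] d_def add_divide_distrib .
  qed
qed

section \<open>Trace class property of the combined kernel\<close>

section \<open>The error kernel\<close>

lemma power_le_fact_exp: "x \<ge> 0 \<Longrightarrow> x ^ m \<le> fact m * exp x" for x :: real
proof -
  assume x: "x \<ge> 0"
  have "(\<Sum>k\<in>{m}. x ^ k /\<^sub>R fact k) \<le> (\<Sum>k. x ^ k /\<^sub>R fact k)"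
    using x by (intro sum_le_suminf summable_exp_generic) auto
  then have "x ^ m / fact m \<le> exp x" by (simp add: exp_def divide_inverse mult.commute)
  then show ?thesis by (simp add: field_simps)
qed

text \<open>The exponential beats every power. For x >= 1 the real power x^(\<alpha>/2) is below an
  integral one, and x^2 x^m x^j e^(-x/2) is bounded through factorials.\<close>

lemma laguerre_fun_decay:
  obtains C where "C \<ge> 0" "\<And>x. x \<ge> 1 \<Longrightarrow> \<bar>laguerre_fun k \<alpha> x\<bar> \<le> C / x\<^sup>2"
proof -
  define m where "m = nat \<lceil>\<bar>\<alpha>\<bar>\<rceil>"
  have m: "real m \<ge> \<alpha> / 2"
  proof -
    have "real m \<ge> \<bar>\<alpha>\<bar>" unfolding m_def by linarith
    then show ?thesis by linarith
  qed
  define c where "c j = (- 1) ^ j * ((real k + \<alpha>) gchoose (k - j)) / fact j" for j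
  define C where "C = (\<Sum>j\<le>k. \<bar>c j\<bar> * (2 ^ (m + 2 + j) * fact (m + 2 + j)))"
  have "\<bar>laguerre_fun k \<alpha> x\<bar> \<le> C / x\<^sup>2" if x: "x \<ge> 1" for x
  proof -
    have "x powr (\<alpha> / 2) \<le> x powr real m" using x m by (intro powr_mono) auto
    then have p: "x powr (\<alpha> / 2) \<le> x ^ m" using x by (simp add: powr_realpow)
    have t: "x\<^sup>2 * (x powr (\<alpha> / 2) * exp (- x / 2) * x ^ j) \<le> 2 ^ (m + 2 + j) * fact (m + 2 + j)" for j
    proof -
      have "x\<^sup>2 * (x powr (\<alpha> / 2) * exp (- x / 2) * x ^ j) \<le> x\<^sup>2 * (x ^ m * exp (- x / 2) * x ^ j)"
        using p x by (intro mult_left_mono mult_right_mono) auto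
      also have "\<dots> = 2 ^ (m + 2 + j) * (x / 2) ^ (m + 2 + j) * exp (- x / 2)"
        by (simp add: power_add power_divide power2_eq_square)
      also have "\<dots> \<le> 2 ^ (m + 2 + j) * (fact (m + 2 + j) * exp (x / 2)) * exp (- x / 2)"
        using x by (intro mult_left_mono mult_right_mono power_le_fact_exp) auto
      also have "\<dots> = 2 ^ (m + 2 + j) * fact (m + 2 + j)" by (simp add: exp_minus)
      finally show ?thesis .
    qed
    have e: "x\<^sup>2 * laguerre_fun k \<alpha> x = (\<Sum>j\<le>k. c j * (x\<^sup>2 * (x powr (\<alpha> / 2) * exp (- x / 2) * x ^ j)))"
      unfolding laguerre_fun_def laguerre_def c_def sum_distrib_left by (intro sum.cong) auto
    have "\<bar>x\<^sup>2 * laguerre_fun k \<alpha> x\<bar> \<le> C" unfolding e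
      unfolding C_def using t x by (intro order_trans[OF sum_abs] sum_mono) (simp add: abs_mult mult_left_mono)
    then show ?thesis using x by (simp add: abs_mult field_simps)
  qed
  moreover have "C \<ge> 0" unfolding C_def by (intro sum_nonneg) auto
  ultimately show ?thesis by (intro that)
qed

text \<open>Every part is nuclear: the Laguerre and Airy products have admissible factors thanks to
  their decay, and the Airy kernel was treated in \<open>edge_kernels\<close>. The symmetric sum is
  then covered by \<open>nuclear_trace_class\<close>.\<close>

lemma edge_kernels_combination:
  assumes J: "J \<in> sets borel" "\<And>X. X \<in> J \<Longrightarrow> B \<le> X" and s: "s > 0" and edge: "\<And>X. X \<in> J \<Longrightarrow> a + s * X \<ge> 1"
  shows "trace_class_kernel (restrict_space lborel J) (\<lambda>X Y. complex_of_real
     (N * (s * laguerre_kernel \<alpha> n (a + s * X) (a + s * Y) - (airy_kernel X Y - u * (Ai 0 X * Ai 0 Y)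
       + v * ((X\<^sup>2 + X * Y + Y\<^sup>2) * Ai 0 X * Ai 0 Y - (X + Y) * Ai 1 X * Ai 1 Y
          - r * (Ai 0 X * Ai 1 Y + Ai 1 X * Ai 0 Y))))))"
proof -
  obtain q D where dk: "dominated_kernels (restrict_space lborel J) (edge_weight B) q D 1"
    and adm: "\<And>f c. continuous_on J f \<Longrightarrow> (\<And>x. x \<in> J \<Longrightarrow> \<bar>f x\<bar> \<le> c * edge_weight B x) \<Longrightarrow>
       dominated_kernels.admissible (restrict_space lborel J) (edge_weight B) q f"
    and nuc: "dominated_kernels.nuclear (restrict_space lborel J) (edge_weight B) q airy_kernel"
  proof (rule edge_kernels[OF J(1), of B])
    show "\<And>x. x \<in> J \<Longrightarrow> B \<le> x" by (rule J(2))
    fix q D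
    assume a: "dominated_kernels (restrict_space lborel J) (edge_weight B) q D 1"
      "\<And>f c. continuous_on J f \<Longrightarrow> (\<And>x. x \<in> J \<Longrightarrow> \<bar>f x\<bar> \<le> c * edge_weight B x) \<Longrightarrow>
         dominated_kernels.admissible (restrict_space lborel J) (edge_weight B) q f"
      "dominated_kernels.nuclear (restrict_space lborel J) (edge_weight B) q airy_kernel"
    show thesis by (rule that[OF a])
  qed
  interpret dominated_kernels "restrict_space lborel J" "edge_weight B" q D 1 by (rule dk)
  have w: "edge_weight B X = 1 / (1 + X - B)\<^sup>2" if "X \<in> J" for X using J(2)[OF that] by (simp add: edge_weight_def)
  have airy_adm: "admissible (\<lambda>X. X ^ i * f X)"
    if f: "continuous_on UNIV f" "\<And>x. x \<ge> 1 \<Longrightarrow> \<bar>f x\<bar> \<le> C / x ^ 4" and i: "i \<le> 2" for f C i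
  proof -
    obtain E where E: "E \<ge> 0" "\<And>x. x \<ge> B \<Longrightarrow> \<bar>f x\<bar> \<le> E / (1 + x - B) ^ 4"
      by (rule decay_bound_half_line[OF f(1), of C B], erule f(2), rule that)
    show ?thesis
    proof (rule adm[of _ "(1 + \<bar>B\<bar>)\<^sup>2 * E"])
      show "continuous_on J (\<lambda>X. X ^ i * f X)"
        by (intro continuous_intros continuous_on_subset[OF f(1)]) simp
      fix X assume X: "X \<in> J"
      define z where "z = 1 + X - B"
      have z: "z \<ge> 1" using J(2)[OF X] by (simp add: z_def)
      define g where "g = (1 + \<bar>B\<bar>) * z"
      have "\<bar>B\<bar> * 1 \<le> \<bar>B\<bar> * z" using z by (intro mult_left_mono) auto
      then have Xz: "\<bar>X\<bar> \<le> g" "1 \<le> g" using z unfolding g_def z_def by (auto simp: distrib_right)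
      have "\<bar>X\<bar> ^ i \<le> g ^ i" using Xz by (intro power_mono) auto
      also have "\<dots> \<le> g\<^sup>2" using Xz i by (intro power_increasing) auto
      finally have "\<bar>X ^ i * f X\<bar> \<le> g\<^sup>2 * (E / z ^ 4)"
        unfolding abs_mult power_abs using E(2)[OF J(2)[OF X]] unfolding z_def[symmetric] by (intro mult_mono) auto
      also have "\<dots> = (1 + \<bar>B\<bar>)\<^sup>2 * E * (1 / z\<^sup>2)"
        using z by (simp add: g_def power_mult_distrib eval_nat_numeral)
      finally show "\<bar>X ^ i * f X\<bar> \<le> (1 + \<bar>B\<bar>)\<^sup>2 * E * edge_weight B X"
        unfolding w[OF X] z_def .
    qed
  qed
  have base: "continuous_on UNIV (Ai 0)" "continuous_on UNIV (Ai 1)"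
    using Ai_0_derivative Ai_1_derivative by (blast intro: continuous_at_imp_continuous_on DERIV_isCont)+
  note A = airy_adm[OF base(1) Ai_0_decay4] and A' = airy_adm[OF base(2) Ai_1_decay4]
  have a: "admissible (\<lambda>X. Ai 0 X)" "admissible (\<lambda>X. X * Ai 0 X)" "admissible (\<lambda>X. X\<^sup>2 * Ai 0 X)"
      "admissible (\<lambda>X. Ai 1 X)" "admissible (\<lambda>X. X * Ai 1 X)"
    using A[of 0] A[of 1] A[of 2] A'[of 0] A'[of 1] by simp_all
  have l: "admissible (\<lambda>X. laguerre_fun k \<alpha> (a + s * X))" for k
  proof -
    obtain C where C: "C \<ge> 0" "\<And>x. x \<ge> 1 \<Longrightarrow> \<bar>laguerre_fun k \<alpha> x\<bar> \<le> C / x\<^sup>2"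
      by (rule laguerre_fun_decay[of k \<alpha>]) (rule that)
    \<comment> \<open>With this \<open>L\<close>, 1 + X - B <= L (a + s X) on J, so decay in the
      Laguerre variable becomes decay in X.\<close>
    define L where "L = 1 / s + \<bar>1 - B - a / s\<bar>"
    have L: "L > 0" using s by (simp add: L_def add_pos_nonneg)
    show ?thesis
    proof (rule adm[of _ "L\<^sup>2 * C"])
      show "continuous_on J (\<lambda>X. laguerre_fun k \<alpha> (a + s * X))"
      proof (intro continuous_at_imp_continuous_on ballI)
        fix X assume "X \<in> J"
        then have "a + s * X > 0" using edge by force
        then show "isCont (\<lambda>X. laguerre_fun k \<alpha> (a + s * X)) X"
          by (intro isCont_o2[where g = "laguerre_fun k \<alpha>" and f = "\<lambda>X. a + s * X"] continuous_intros laguerre_fun_isCont)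
      qed
      fix X assume X: "X \<in> J"
      define x where "x = a + s * X"
      have x: "x \<ge> 1" unfolding x_def by (rule edge[OF X])
      define z where "z = 1 + X - B"
      have z: "z \<ge> 1" using J(2)[OF X] by (simp add: z_def)
      have "z = x / s + (1 - B - a / s)" using s by (simp add: z_def x_def field_simps)
      also have "\<dots> \<le> x / s + \<bar>1 - B - a / s\<bar> * x"
      proof -
        have "u \<le> \<bar>u\<bar> * x" for u :: real
          using mult_left_mono[OF x, of "\<bar>u\<bar>"] abs_ge_self[of u] abs_ge_zero[of u] by argo
        then show ?thesis by (rule add_left_mono)
      qed
      also have "\<dots> = L * x" by (simp add: L_def distrib_right)
      finally have "z\<^sup>2 \<le> (L * x)\<^sup>2" using z by (intro power_mono) auto
      then have "C * z\<^sup>2 \<le> C * (L\<^sup>2 * x\<^sup>2)" using C(1) by (intro mult_left_mono) (auto simp: power_mult_distrib)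
      then have "C / x\<^sup>2 \<le> L\<^sup>2 * C / z\<^sup>2" using x z by (simp add: field_simps)
      then show "\<bar>laguerre_fun k \<alpha> (a + s * X)\<bar> \<le> L\<^sup>2 * C * edge_weight B X"
        using C(2)[OF x] unfolding w[OF X] z_def x_def by simp
    qed
  qed
  \<comment> \<open>The same kernel arranged as a combination of products of a function of X and a
    function of Y, the shape to which the closure rules apply.\<close>
  define K where "K X Y = N * (s * (\<Sum>k<n. Gamma (real k + 1) / Gamma (\<alpha> + real k + 1) * (laguerre_fun k \<alpha> (a + s * X) * laguerre_fun k \<alpha> (a + s * Y)))
     + ((-1) * airy_kernel X Y + (u * (Ai 0 X * Ai 0 Y)
       + (- v) * ((((X\<^sup>2 * Ai 0 X) * Ai 0 Y + (X * Ai 0 X) * (Y * Ai 0 Y)) + Ai 0 X * (Y\<^sup>2 * Ai 0 Y))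
          + ((-1) * ((X * Ai 1 X) * Ai 1 Y + Ai 1 X * (Y * Ai 1 Y))
          + (- r) * (Ai 0 X * Ai 1 Y + Ai 1 X * Ai 0 Y))))))" for X Y
  have "nuclear K"
    unfolding K_def[abs_def]
    by (intro nuclear_scale nuclear_add nuclear_sum nuclear_tensor nuc l a finite_lessThan)
  moreover have "symmetric K"
    unfolding symmetric_def K_def
    by (intro ballI) (simp add: airy_kernel_commute mult_ac add_ac)
  ultimately have "trace_class_kernel (restrict_space lborel J) (\<lambda>X Y. complex_of_real (K X Y))"
    by (rule nuclear_trace_class)
  moreover have "K X Y = N * (s * laguerre_kernel \<alpha> n (a + s * X) (a + s * Y) - (airy_kernel X Y - u * (Ai 0 X * Ai 0 Y)
       + v * ((X\<^sup>2 + X * Y + Y\<^sup>2) * Ai 0 X * Ai 0 Y - (X + Y) * Ai 1 X * Ai 1 Y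
          - r * (Ai 0 X * Ai 1 Y + Ai 1 X * Ai 0 Y))))" for X Y
    unfolding K_def laguerre_kernel_def by (simp only: mult.assoc) (simp add: algebra_simps)
  ultimately show ?thesis by (simp only:)
qed

section \<open>Assembly of the expansion and of the error kernel\<close>

definition edge_expansion :: "real \<Rightarrow> real \<Rightarrow> real \<Rightarrow> real \<Rightarrow> real" where
  "edge_expansion b c X Y = airy_kernel X Y - 2 / b * (c * Ai 0 X * Ai 0 Y)
     + 1 / (5 * b\<^sup>2) * ((X\<^sup>2 + X * Y + Y\<^sup>2) * Ai 0 X * Ai 0 Y - (X + Y) * Ai 1 X * Ai 1 Y
        - (10 * c\<^sup>2 - 1) * (Ai 0 X * Ai 1 Y + Ai 1 X * Ai 0 Y))"

lemma laguerre_edge_alt: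
  "laguerre_edge \<alpha> c n X = (4 * (real n + c) + 2 * \<alpha>) + 2 * edge_scale n * X"
  by (simp add: laguerre_edge_def edge_scale_def)

lemma laguerre_edge_turning_point:
  assumes "n \<ge> 1"
  shows "laguerre_edge \<alpha> c n X = turning_point \<alpha> n + 2 * edge_scale n * (X + (2 * c - 1) / edge_scale n)"
  using edge_scale_pos[OF assms] by (simp add: laguerre_edge_alt turning_point_def field_simps)

text \<open>The fractional powers of 2 and n in the theorem are 2/b and 1/(5 b^2), by means of
  (2^(1/3))^3 = 2.\<close>

lemma edge_scale_powers:
  assumes "n \<ge> 1"
  shows "2 powr (2 / 3) * real n powr (- 1 / 3) = 2 / edge_scale n"
    "2 powr (1 / 3) / 10 * real n powr (- 2 / 3) = 1 / (5 * (edge_scale n)\<^sup>2)"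
proof -
  define p q where "p = (2::real) powr (1 / 3)" and "q = real n powr (1 / 3)"
  have pq: "p > 0" "q > 0" "edge_scale n = p * q" using assms by (auto simp: p_def q_def edge_scale_def powr_mult)
  have p3: "p ^ 3 = 2" by (simp add: p_def powr_realpow[symmetric] powr_powr)
  have e: "2 powr (2 / 3) = p\<^sup>2" "real n powr (- 1 / 3) = 1 / q" "real n powr (- 2 / 3) = 1 / q\<^sup>2"
    using assms by (simp_all add: p_def q_def powr_realpow[symmetric] powr_powr powr_minus_divide[symmetric])
  have "p\<^sup>2 * (1 / q) = p ^ 3 / (p * q)" using pq by (simp add: power2_eq_square power3_eq_cube)
  then show "2 powr (2 / 3) * real n powr (- 1 / 3) = 2 / edge_scale n" unfolding e pq(3) p3 .
  have "p / 10 * (1 / q\<^sup>2) = p ^ 3 / (10 * (p * q)\<^sup>2)" using pq by (simp add: power2_eq_square power3_eq_cube)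
  then show "2 powr (1 / 3) / 10 * real n powr (- 2 / 3) = 1 / (5 * (edge_scale n)\<^sup>2)"
    unfolding e pq(3) p3 p_def[symmetric] by simp
qed

text \<open>The kernel expansion at shifted arguments followed by the Taylor expansion in the shift.
  For b >= 1 the shift is at most 2M + 1, which explains the radius 3M + 1.\<close>

lemma edge_expansion_bound:
  assumes \<alpha>: "\<alpha> > -1" and M: "M \<ge> 0"
  obtains C where "\<forall>\<^sub>F n in sequentially. \<forall>c X Y. \<bar>c\<bar> \<le> M \<longrightarrow> \<bar>X\<bar> \<le> M \<longrightarrow> \<bar>Y\<bar> \<le> M \<longrightarrow>
     laguerre_edge \<alpha> c n X > 0 \<and>
     \<bar>real n * (2 * edge_scale n * laguerre_kernel \<alpha> n (laguerre_edge \<alpha> c n X) (laguerre_edge \<alpha> c n Y)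
       - edge_expansion (edge_scale n) c X Y)\<bar> \<le> C"
proof -
  define R where "R = 3 * M + 1"
  have R: "R \<ge> 0" using M by (simp add: R_def)
  obtain C1 where C1: "\<forall>\<^sub>F n in sequentially. \<forall>\<xi> \<eta>. \<bar>\<xi>\<bar> \<le> R \<longrightarrow> \<bar>\<eta>\<bar> \<le> R \<longrightarrow>
     turning_point \<alpha> n + 2 * edge_scale n * \<xi> > 0 \<and>
     \<bar>2 * edge_scale n * laguerre_kernel \<alpha> n (turning_point \<alpha> n + 2 * edge_scale n * \<xi>) (turning_point \<alpha> n + 2 * edge_scale n * \<eta>)
       - kernel_approx (edge_scale n) \<xi> \<eta>\<bar> \<le> C1 / edge_scale n ^ 3"
    by (rule kernel_expansion[OF \<alpha> R]) (rule that)
  obtain C2 where "\<And>b c X Y. b \<ge> 1 \<Longrightarrow> \<bar>c\<bar> \<le> M \<Longrightarrow> \<bar>X\<bar> \<le> M \<Longrightarrow> \<bar>Y\<bar> \<le> M \<Longrightarrow>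
    \<bar>kernel_approx b (X + (2 * c - 1) / b) (Y + (2 * c - 1) / b) -
      (airy_kernel X Y - 2 / b * (c * Ai 0 X * Ai 0 Y)
       + 1 / (5 * b\<^sup>2) * ((X\<^sup>2 + X * Y + Y\<^sup>2) * Ai 0 X * Ai 0 Y - (X + Y) * Ai 1 X * Ai 1 Y
          - (10 * c\<^sup>2 - 1) * (Ai 0 X * Ai 1 Y + Ai 1 X * Ai 0 Y)))\<bar> \<le> C2 / b ^ 3"
    by (rule kernel_approx_shift[OF M]) (rule that)
  note C2 = this[folded edge_expansion_def]
  have "\<forall>\<^sub>F n in sequentially. \<forall>c X Y. \<bar>c\<bar> \<le> M \<longrightarrow> \<bar>X\<bar> \<le> M \<longrightarrow> \<bar>Y\<bar> \<le> M \<longrightarrow>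
     laguerre_edge \<alpha> c n X > 0 \<and>
     \<bar>real n * (2 * edge_scale n * laguerre_kernel \<alpha> n (laguerre_edge \<alpha> c n X) (laguerre_edge \<alpha> c n Y)
       - edge_expansion (edge_scale n) c X Y)\<bar> \<le> (C1 + C2) / 2"
    using C1 eventually_ge_at_top[of 1]
  proof eventually_elim
    case (elim n)
    have b: "edge_scale n \<ge> 1" using elim(2) by (rule edge_scale_ge_1)
    show ?case
    proof (intro allI impI)
      fix c X Y :: real assume c: "\<bar>c\<bar> \<le> M" and X: "\<bar>X\<bar> \<le> M" and Y: "\<bar>Y\<bar> \<le> M"
      define d where "d = (2 * c - 1) / edge_scale n"
      have "\<bar>2 * c - 1\<bar> \<le> 2 * M + 1" using c by (simp add: abs_le_iff)
      moreover have "\<bar>d\<bar> \<le> \<bar>2 * c - 1\<bar> / 1" unfolding d_def abs_divide using b by (intro divide_left_mono) auto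
      ultimately have d: "\<bar>d\<bar> \<le> 2 * M + 1" by simp
      have XY: "\<bar>X + d\<bar> \<le> R" "\<bar>Y + d\<bar> \<le> R"
        using d X Y abs_triangle_ineq[of X d] abs_triangle_ineq[of Y d] by (auto simp: R_def)
      note edge = laguerre_edge_turning_point[OF elim(2), of \<alpha> c, folded d_def]
      define K where "K = 2 * edge_scale n * laguerre_kernel \<alpha> n (laguerre_edge \<alpha> c n X) (laguerre_edge \<alpha> c n Y)"
      have K: "laguerre_edge \<alpha> c n X > 0" "\<bar>K - kernel_approx (edge_scale n) (X + d) (Y + d)\<bar> \<le> C1 / edge_scale n ^ 3"
        using elim(1) XY unfolding K_def edge by blast+
      have "\<bar>kernel_approx (edge_scale n) (X + d) (Y + d) - edge_expansion (edge_scale n) c X Y\<bar> \<le> C2 / edge_scale n ^ 3"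
        unfolding d_def by (rule C2[OF b c X Y])
      with K(2) have "\<bar>K - edge_expansion (edge_scale n) c X Y\<bar> \<le> C1 / edge_scale n ^ 3 + C2 / edge_scale n ^ 3" by linarith
      then have "real n * \<bar>K - edge_expansion (edge_scale n) c X Y\<bar> \<le> real n * (C1 / edge_scale n ^ 3 + C2 / edge_scale n ^ 3)"
        by (intro mult_left_mono) auto
      \<comment> \<open>n / b^3 = 1/2.\<close>
      also have "\<dots> = (C1 + C2) / 2" using elim(2) by (simp add: edge_scale_cube field_simps)
      finally show "laguerre_edge \<alpha> c n X > 0 \<and> \<bar>real n * (2 * edge_scale n * laguerre_kernel \<alpha> n (laguerre_edge \<alpha> c n X) (laguerre_edge \<alpha> c n Y)
         - edge_expansion (edge_scale n) c X Y)\<bar> \<le> (C1 + C2) / 2"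
        using K(1) unfolding K_def by (simp add: abs_mult)
    qed
  qed
  then show ?thesis by (rule that)
qed

theorem theorem1p3:
  fixes \<alpha> :: real
  assumes "\<alpha> > -1"
  shows "\<exists>F :: real \<Rightarrow> nat \<Rightarrow> real \<Rightarrow> real \<Rightarrow> real.
    (\<forall>c n X Y. n \<ge> 1 \<and> laguerre_edge \<alpha> c n X > 0 \<and> laguerre_edge \<alpha> c n Y > 0 \<longrightarrow>
       2 * (2 * real n) powr (1 / 3) *
         laguerre_kernel \<alpha> n (laguerre_edge \<alpha> c n X) (laguerre_edge \<alpha> c n Y)
       = airy_kernel X Y
         - 2 powr (2 / 3) * c * airy X * airy Y * real n powr (- 1 / 3)
         + 2 powr (1 / 3) / 10 *
           ((X\<^sup>2 + X * Y + Y\<^sup>2) * airy X * airy Y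
            - (X + Y) * airy_deriv X * airy_deriv Y
            - (10 * c\<^sup>2 - 1) * (airy X * airy_deriv Y + airy_deriv X * airy Y))
           * real n powr (- 2 / 3)
         + real n powr (- 1) * F c n X Y) \<and>
    (\<forall>M. \<exists>C. \<forall>\<^sub>F n in sequentially. \<forall>c X Y.
       \<bar>c\<bar> \<le> M \<and> \<bar>X\<bar> \<le> M \<and> \<bar>Y\<bar> \<le> M \<longrightarrow>
         laguerre_edge \<alpha> c n X > 0 \<and> laguerre_edge \<alpha> c n Y > 0 \<and> \<bar>F c n X Y\<bar> \<le> C) \<and>
    (\<forall>J \<in> sets borel. bdd_below J \<longrightarrow>
       (\<forall>M. \<forall>\<^sub>F n in sequentially. \<forall>c. \<bar>c\<bar> \<le> M \<longrightarrow>
          (\<forall>X\<in>J. laguerre_edge \<alpha> c n X > 0) \<and>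
          trace_class_kernel (restrict_space lborel J) (\<lambda>X Y. complex_of_real (F c n X Y))))"
proof -
  \<comment> \<open>n times the exact remainder; the asserted identity holds by construction and all
    content lies in the other two clauses.\<close>
  define F where "F c n X Y = real n * (2 * edge_scale n *
      laguerre_kernel \<alpha> n (laguerre_edge \<alpha> c n X) (laguerre_edge \<alpha> c n Y) - edge_expansion (edge_scale n) c X Y)" for c n X Y
  show ?thesis
  proof (intro exI[of _ F] conjI allI impI ballI)
    fix c n X Y assume "n \<ge> 1 \<and> laguerre_edge \<alpha> c n X > 0 \<and> laguerre_edge \<alpha> c n Y > 0"
    then have n: "n \<ge> 1" by blast
    have "k * c * x * y * e = k * e * (c * x * y)" "l / 10 * z * f = l / 10 * f * z" for k c x y e l z f :: real
      by simp_all
    note re = this(1)[of "2 powr (2 / 3)" c "Ai 0 X" "Ai 0 Y" "real n powr (- 1 / 3)"] this(2)[of "2 powr (1 / 3)" _ "real n powr (- 2 / 3)"]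
    have inv: "real n powr (- 1) * F c n X Y = 2 * edge_scale n *
      laguerre_kernel \<alpha> n (laguerre_edge \<alpha> c n X) (laguerre_edge \<alpha> c n Y) - edge_expansion (edge_scale n) c X Y"
      using n by (simp add: F_def powr_minus_divide)
    show "2 * (2 * real n) powr (1 / 3) *
         laguerre_kernel \<alpha> n (laguerre_edge \<alpha> c n X) (laguerre_edge \<alpha> c n Y)
       = airy_kernel X Y
         - 2 powr (2 / 3) * c * airy X * airy Y * real n powr (- 1 / 3)
         + 2 powr (1 / 3) / 10 *
           ((X\<^sup>2 + X * Y + Y\<^sup>2) * airy X * airy Y
            - (X + Y) * airy_deriv X * airy_deriv Y
            - (10 * c\<^sup>2 - 1) * (airy X * airy_deriv Y + airy_deriv X * airy Y))
           * real n powr (- 2 / 3)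
         + real n powr (- 1) * F c n X Y"
      unfolding inv airy_eq_Ai airy_deriv_eq_Ai unfolding re unfolding edge_scale_powers[OF n]
      by (simp only: edge_expansion_def edge_scale_def add_diff_cancel_left' diff_add_cancel)
  next
    fix M :: real
    \<comment> \<open>\<open>M\<close> is an arbitrary real here, whereas the bound is available for
      nonnegative radii.\<close>
    note bound = edge_expansion_bound[OF assms, of "max M 0", folded F_def]
    obtain C where C: "\<forall>\<^sub>F n in sequentially. \<forall>c X Y. \<bar>c\<bar> \<le> max M 0 \<longrightarrow> \<bar>X\<bar> \<le> max M 0 \<longrightarrow> \<bar>Y\<bar> \<le> max M 0 \<longrightarrow>
        laguerre_edge \<alpha> c n X > 0 \<and> \<bar>F c n X Y\<bar> \<le> C"
      by (rule bound, simp, rule that)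
    show "\<exists>C. \<forall>\<^sub>F n in sequentially. \<forall>c X Y. \<bar>c\<bar> \<le> M \<and> \<bar>X\<bar> \<le> M \<and> \<bar>Y\<bar> \<le> M \<longrightarrow>
         laguerre_edge \<alpha> c n X > 0 \<and> laguerre_edge \<alpha> c n Y > 0 \<and> \<bar>F c n X Y\<bar> \<le> C"
    proof (rule exI[of _ C], use C in eventually_elim)
      case (elim n)
      show ?case
      proof (intro allI impI)
        fix c X Y assume "\<bar>c\<bar> \<le> M \<and> \<bar>X\<bar> \<le> M \<and> \<bar>Y\<bar> \<le> M"
        then have "\<bar>c\<bar> \<le> max M 0" "\<bar>X\<bar> \<le> max M 0" "\<bar>Y\<bar> \<le> max M 0" by (simp_all add: le_max_iff_disj)
        then show "laguerre_edge \<alpha> c n X > 0 \<and> laguerre_edge \<alpha> c n Y > 0 \<and> \<bar>F c n X Y\<bar> \<le> C" using elim by blast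
      qed
    qed
  next
    fix J :: "real set" and M :: real assume J: "J \<in> sets borel" and "bdd_below J"
    then obtain B where B: "\<And>X. X \<in> J \<Longrightarrow> B \<le> X" unfolding bdd_below_def by blast
    \<comment> \<open>The worst case is X = B and c = -M. Once this position exceeds 1, all of J is
      mapped into the region where the Laguerre functions decay, uniformly in c.\<close>
    have "filterlim (\<lambda>n. (4 * (real n - M) + 2 * \<alpha>) + 2 * edge_scale n * B) at_top sequentially"
      unfolding edge_scale_def by real_asymp
    then have "\<forall>\<^sub>F n in sequentially. (4 * (real n - M) + 2 * \<alpha>) + 2 * edge_scale n * B \<ge> 1"
      by (simp add: filterlim_at_top)
    then show "\<forall>\<^sub>F n in sequentially. \<forall>c. \<bar>c\<bar> \<le> M \<longrightarrow> (\<forall>X\<in>J. laguerre_edge \<alpha> c n X > 0) \<and>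
          trace_class_kernel (restrict_space lborel J) (\<lambda>X Y. complex_of_real (F c n X Y))"
      using eventually_ge_at_top[of 1]
    proof eventually_elim
      case (elim n)
      have b: "edge_scale n > 0" using elim(2) by (rule edge_scale_pos)
      show ?case
      proof (intro allI impI)
        fix c assume c: "\<bar>c\<bar> \<le> M"
        have edge: "(4 * (real n + c) + 2 * \<alpha>) + 2 * edge_scale n * X \<ge> 1" if "X \<in> J" for X
        proof -
          have "2 * edge_scale n * B \<le> 2 * edge_scale n * X" using B[OF that] b by (intro mult_left_mono) auto
          moreover have "- M \<le> c" using c by (simp add: abs_le_iff)
          ultimately show ?thesis using elim(1) unfolding right_diff_distrib distrib_left by argo
        qed
        have "trace_class_kernel (restrict_space lborel J) (\<lambda>X Y. complex_of_real (F c n X Y))"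
          using edge_kernels_combination[OF J B _ edge, where N = "real n" and \<alpha> = \<alpha> and n = n and u = "2 / edge_scale n * c" and v = "1 / (5 * (edge_scale n)\<^sup>2)" and r = "10 * c\<^sup>2 - 1"] b
          unfolding F_def laguerre_edge_alt edge_expansion_def by (simp only: mult.assoc)
        then show "(\<forall>X\<in>J. laguerre_edge \<alpha> c n X > 0) \<and>
          trace_class_kernel (restrict_space lborel J) (\<lambda>X Y. complex_of_real (F c n X Y))"
          unfolding laguerre_edge_alt using edge by (auto intro: less_le_trans[OF zero_less_one])
      qed
    qed
  qed
qed

end
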